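(* Let $h\in L^1(\mathbb{P}_\eta\otimes\lambda)\cap L^2(\mathbb{P}_\eta\otimes\lambda)$ and assume that $$\sum_{n=0}^\infty(n+1)!\int\tilde h_n^2\,d\lambda^{n+1}<\infty .$$ Then $\delta(h)=\delta'(h)$ $\mathbb{P}$-a.s.
   Context: Let $(\mathbb{Y},\mathcal{Y})$ be an arbitrary measurable space and $\lambda$ an arbitrary $\sigma$-finite measure on it. Let $\mathbf{N}$ be the space of all $\sigma$-finite measures $\mu$ on $\mathbb{Y}$ with values in $\{0,1,2,\ldots\}\cup\{\infty\}$, equipped with the smallest $\sigma$-field making $\mu\mapsto\mu(B)$ measurable for every $B\in\mathcal{Y}$. On a probability space $(\Omega,\mathcal{F},\mathbb{P})$, $\eta$ is a Poisson process on $\mathbb{Y}$ with intensity measure $\lambda$: a random element of $\mathbf{N}$ such that $\eta(B)$ is Poisson distributed with parameter $\lambda(B)$ for each $B\in\mathcal{Y}$, and $\eta(B_1),\ldots,\eta(B_k)$ are independent for pairwise disjoint $B_1,\ldots,B_k\in\mathcal{Y}$. $\eta$ is taken in a version of the form $\eta=\sum_{i=1}^{\eta(\mathbb{Y})}\delta_{X_i}$ with random elements $X_i$ of $\mathbb{Y}$ (such a version always exists). $\mathbb{P}_\eta$ is the distribution of $\eta$. Difference operators: for measurable $f:\mathbf{N}\to\mathbb{R}$ and $y\in\mathbb{Y}$, $D_yf(\mu):=f(\mu+\delta_y)-f(\mu)$; $D^1:=D$, $D^0f:=f$, and $D^n_{y_1,\ldots,y_n}f:=D^1_{y_1}D^{n-1}_{y_2,\ldots,y_n}f$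 for $n\ge2$. Multiple Wiener-Itô integral $I_n$: $I_0(c):=c$ for $c\in\mathbb{R}$. For $\mu=\sum_i\delta_{x_i}$ and $m\ge1$, $\mu^{(m)}$ is the measure on $\mathbb{Y}^m$ such that $\mu^{(m)}(B)$ is the number of $m$-tuples of pairwise distinct indices $(i_1,\ldots,i_m)$ with $(x_{i_1},\ldots,x_{i_m})\in B$; $\mu^{(m)}(g)$ denotes the integral of $g$ with respect to it. Let $\mathcal{Y}_0:=\{B\in\mathcal{Y}:\lambda(B)<\infty\}$. For $n\geq 1$, a function $g:\mathbb{Y}^n\to\mathbb{R}$ is of product form if $g(y_1,\ldots,y_n)=\prod_{i=1}^ng_i(y_i)$ (written $g=\otimes_{i=1}^ng_i$) with each $g_i$ bounded, measurable and vanishing outside some $B\in\mathcal{Y}_0$; then $$I_n(g):=\sum_{J\subset\{1,\ldots,n\}}(-1)^{n-|J|}\,\eta^{(|J|)}(\otimes_{j\in J}g_j)\,\lambda^{n-|J|}(\otimes_{j'\in\{1,\ldots,n\}\setminus J}\,g_{j'}),$$ where the factors corresponding to an empty index set are $1$. $I_n$ is extended by linearity to finite sums of functions of product form (functions of sum-product form), and then, using the isometry $\mathbb{E}I_m(g)I_n(g')=\mathbf{1}\{m=n\}\,m!\,\langle\mathrm{sym}\,g,\mathrm{sym}\,g'\rangle_n$ (where $\mathrm{sym}\,g(y_1,\ldots,y_n)=\frac1{n!}\sum_\pi g(y_{\pi(1)},\ldots,y_{\pi(n)})$ is the symmetrization and $\langle\cdot,\cdot\rangle_n$ the scalar product of $L^2(\lambda^n)$)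 and the density of functions of sum-product form, by continuity to a linear map $I_n:L^2(\lambda^n)\to L^2(\mathbb{P})$. Kabanov-Skorohod integral: for $h\in L^2(\mathbb{P}_\eta\otimes\lambda)$ (so $h(\cdot,y)\in L^2(\mathbb{P}_\eta)$ for $\lambda$-a.e. $y$) and $n\ge0$, let $$\tilde h_n(y_1,\ldots,y_{n+1}):=\frac1{(n+1)!}\sum_{i=1}^{n+1}\mathbb{E}\,D^n_{y_1,\ldots,y_{i-1},y_{i+1},\ldots,y_{n+1}}h(\eta,y_i),$$ where $D^n$ acts on the first argument of $h$; this is a symmetric function in $L^2(\lambda^{n+1})$. Under the summability condition in the claim, $$\delta(h):=\sum_{n=0}^\infty I_{n+1}(\tilde h_n),$$ the series converging in $L^2(\mathbb{P})$. Pathwise operator: for $h\in L^1(\mathbb{P}_\eta\otimes\lambda)$, $$\delta'(h):=\int h(\eta-\delta_y,y)\,\eta(dy)-\int h(\eta,y)\,\lambda(dy).$$ Here $\delta_y$ is the Dirac measure at $y$. *)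

theory Defs
  imports "HOL-Probability.Probability"
begin

text \<open>
  Throughout, \<open>lam\<close> is a measure whose underlying measurable space is the state space of the
  point process; it serves both as that measurable space and as the intensity measure.
  Tuples \<open>(y\<^sub>1, \<dots>, y\<^sub>n)\<close> are elements of \<open>PiM {..<n} (\<lambda>_. lam)\<close>, so indices start at 0.
\<close>

section \<open>Integer-valued measures and Poisson processes\<close>

definition counting_measures :: "'y measure \<Rightarrow> 'y measure set" where
  "counting_measures lam =
     {\<mu>. sets \<mu> = sets lam \<and> sigma_finite_measure \<mu> \<and>
         (\<forall>B\<in>sets lam. emeasure \<mu> B \<in> insert \<infinity> (range of_nat))}"

text \<open>The \<open>\<sigma>\<close>-field generated by the evaluations \<open>\<mu> \<mapsto> \<mu>(B)\<close>; same construction as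
  \<^const>\<open>subprob_algebra\<close>.\<close>

definition counting_space :: "'y measure \<Rightarrow> 'y measure measure" where
  "counting_space lam =
     (SUP B\<in>sets lam. vimage_algebra (counting_measures lam) (\<lambda>\<mu>. emeasure \<mu> B) borel)"

text \<open>The Poisson law on \<open>[0,\<infinity>]\<close> with parameter \<open>r \<in> [0,\<infinity>]\<close>; the boundary parameters, which
  \<^const>\<open>poisson_pmf\<close> does not cover, give the point masses at \<open>0\<close> and \<open>\<infinity>\<close>.\<close>

definition poisson_law :: "ennreal \<Rightarrow> ennreal measure" where
  "poisson_law r =
     (if r = 0 then return borel 0
      else if r = \<infinity> then return borel \<infinity>
      else distr (measure_pmf (poisson_pmf (enn2real r))) borel of_nat)"

definition poisson_process :: "'w measure \<Rightarrow> 'y measure \<Rightarrow> ('w \<Rightarrow> 'y measure) \<Rightarrow> bool" where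
  "poisson_process M lam \<eta> \<longleftrightarrow>
     \<eta> \<in> M \<rightarrow>\<^sub>M counting_space lam \<and>
     (\<forall>B\<in>sets lam. distr M borel (\<lambda>\<omega>. emeasure (\<eta> \<omega>) B) = poisson_law (emeasure lam B)) \<and>
     (\<forall>(k::nat) B. (\<forall>i<k. B i \<in> sets lam) \<longrightarrow> disjoint_family_on B {..<k} \<longrightarrow>
        prob_space.indep_vars M (\<lambda>_. borel) (\<lambda>i \<omega>. emeasure (\<eta> \<omega>) (B i)) {..<k})"

definition point_indices :: "'y measure \<Rightarrow> nat set" where
  "point_indices \<mu> = {i. of_nat i < emeasure \<mu> (space \<mu>)}"

text \<open>\<open>\<eta> = \<Sum>i<\<eta>(Y). \<delta>\<^bsub>X i\<^esub>\<close>. Random elements of an empty state space do not exist, but then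
  there are no points to represent; hence the guard.\<close>

definition point_representation ::
  "'w measure \<Rightarrow> 'y measure \<Rightarrow> ('w \<Rightarrow> 'y measure) \<Rightarrow> (nat \<Rightarrow> 'w \<Rightarrow> 'y) \<Rightarrow> bool" where
  "point_representation M lam \<eta> X \<longleftrightarrow>
     (space lam \<noteq> {} \<longrightarrow> (\<forall>i. X i \<in> M \<rightarrow>\<^sub>M lam)) \<and>
     (\<forall>\<omega>\<in>space M. \<forall>B\<in>sets lam. emeasure (\<eta> \<omega>) B =
        (\<Sum>i. if i \<in> point_indices (\<eta> \<omega>) then indicator B (X i \<omega>) else 0))"

section \<open>Difference operators\<close>

definition add_dirac :: "'y measure \<Rightarrow> 'y \<Rightarrow> 'y measure" where
  "add_dirac \<mu> y = measure_of (space \<mu>) (sets \<mu>) (\<lambda>A. emeasure \<mu> A + indicator A y)"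

text \<open>Only used when \<open>y\<close> is a point of \<open>\<mu>\<close>, in which case \<open>\<mu> - \<delta>\<^sub>y\<close> is a measure; see
  \<open>emeasure_remove_dirac\<close> below.\<close>

definition remove_dirac :: "'y measure \<Rightarrow> 'y \<Rightarrow> 'y measure" where
  "remove_dirac \<mu> y = measure_of (space \<mu>) (sets \<mu>) (\<lambda>A. emeasure \<mu> A - indicator A y)"

definition diff_op :: "'y \<Rightarrow> ('y measure \<Rightarrow> real) \<Rightarrow> 'y measure \<Rightarrow> real" where
  "diff_op y f \<mu> = f (add_dirac \<mu> y) - f \<mu>"

primrec diff_ops :: "'y list \<Rightarrow> ('y measure \<Rightarrow> real) \<Rightarrow> 'y measure \<Rightarrow> real" where
  "diff_ops [] f = f"
| "diff_ops (y # ys) f = diff_op y (diff_ops ys f)"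

section \<open>Square integrable functions\<close>

definition square_integrable :: "'a measure \<Rightarrow> ('a \<Rightarrow> real) \<Rightarrow> bool" where
  "square_integrable M f \<longleftrightarrow> f \<in> borel_measurable M \<and> integrable M (\<lambda>x. (f x)\<^sup>2)"

definition tendsto_L2 :: "'a measure \<Rightarrow> (nat \<Rightarrow> 'a \<Rightarrow> real) \<Rightarrow> ('a \<Rightarrow> real) \<Rightarrow> bool" where
  "tendsto_L2 M F f \<longleftrightarrow>
     (\<forall>k. square_integrable M (F k)) \<and> square_integrable M f \<and>
     (\<lambda>k. \<integral>x. (F k x - f x)\<^sup>2 \<partial>M) \<longlonglongrightarrow> 0"

section \<open>Multiple Wiener-Ito integrals\<close>

text \<open>The factorial measure of \<open>\<mu> = \<Sum>i\<in>I. \<delta>\<^bsub>x i\<^esub>\<close> as the image of counting measure on the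
  injective index tuples. Coordinates are labelled by a finite set \<open>J\<close>; \<open>\<mu>\<^sup>(\<^sup>m\<^sup>)\<close> is the case
  \<open>J = {..<m}\<close>.\<close>

definition factorial_measure ::
  "'y measure \<Rightarrow> nat set \<Rightarrow> (nat \<Rightarrow> 'y) \<Rightarrow> nat set \<Rightarrow> (nat \<Rightarrow> 'y) measure" where
  "factorial_measure lam I x J =
     distr (count_space {i \<in> J \<rightarrow>\<^sub>E I. inj_on i J}) (PiM J (\<lambda>_. lam)) (\<lambda>i. \<lambda>j\<in>J. x (i j))"

definition admissible_factor :: "'y measure \<Rightarrow> ('y \<Rightarrow> real) \<Rightarrow> bool" where
  "admissible_factor lam f \<longleftrightarrow>
     f \<in> borel_measurable lam \<and> (\<exists>c. \<forall>y\<in>space lam. \<bar>f y\<bar> \<le> c) \<and>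
     (\<exists>B\<in>sets lam. emeasure lam B < \<infinity> \<and> (\<forall>y\<in>space lam - B. f y = 0))"

text \<open>\<open>I\<^sub>n(\<Otimes>i<n. g i)\<close>\<close>

definition wiener_ito_product ::
  "'y measure \<Rightarrow> ('w \<Rightarrow> 'y measure) \<Rightarrow> (nat \<Rightarrow> 'w \<Rightarrow> 'y) \<Rightarrow> nat \<Rightarrow> (nat \<Rightarrow> 'y \<Rightarrow> real) \<Rightarrow> 'w \<Rightarrow> real"
where
  "wiener_ito_product lam \<eta> X n g \<omega> =
     (\<Sum>J\<in>Pow {..<n}. (-1) ^ (n - card J) *
        (\<integral>x. (\<Prod>j\<in>J. g j (x j)) \<partial>factorial_measure lam (point_indices (\<eta> \<omega>)) (\<lambda>i. X i \<omega>) J) *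
        (\<integral>x. (\<Prod>j\<in>{..<n} - J. g j (x j)) \<partial>PiM ({..<n} - J) (\<lambda>_. lam)))"

text \<open>A function of sum-product form is given by the list of its summands, each a family of
  factors.\<close>

definition sum_product_form :: "'y measure \<Rightarrow> nat \<Rightarrow> (nat \<Rightarrow> 'y \<Rightarrow> real) list \<Rightarrow> bool" where
  "sum_product_form lam n gs \<longleftrightarrow> (\<forall>g\<in>set gs. \<forall>i<n. admissible_factor lam (g i))"

definition sum_product :: "nat \<Rightarrow> (nat \<Rightarrow> 'y \<Rightarrow> real) list \<Rightarrow> (nat \<Rightarrow> 'y) \<Rightarrow> real" where
  "sum_product n gs y = (\<Sum>g\<leftarrow>gs. \<Prod>i<n. g i (y i))"

definition wiener_ito_sum_product ::
  "'y measure \<Rightarrow> ('w \<Rightarrow> 'y measure) \<Rightarrow> (nat \<Rightarrow> 'w \<Rightarrow> 'y) \<Rightarrow> nat \<Rightarrow> (nat \<Rightarrow> 'y \<Rightarrow> real) list \<Rightarrow> 'w \<Rightarrow> real"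
where
  "wiener_ito_sum_product lam \<eta> X n gs \<omega> = (\<Sum>g\<leftarrow>gs. wiener_ito_product lam \<eta> X n g \<omega>)"

text \<open>Extension by continuity. The value is a version of an element of \<open>L\<^sup>2(P)\<close>, hence determined
  only almost surely. For \<open>n = 0\<close> the only tuple is the empty one.\<close>

definition wiener_ito ::
  "'w measure \<Rightarrow> 'y measure \<Rightarrow> ('w \<Rightarrow> 'y measure) \<Rightarrow> (nat \<Rightarrow> 'w \<Rightarrow> 'y) \<Rightarrow> nat \<Rightarrow>
   ((nat \<Rightarrow> 'y) \<Rightarrow> real) \<Rightarrow> 'w \<Rightarrow> real" where
  "wiener_ito M lam \<eta> X n g =
     (if n = 0 then (\<lambda>_. g (\<lambda>_. undefined))
      else SOME Z. \<exists>gs. (\<forall>k. sum_product_form lam n (gs k)) \<and>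
             tendsto_L2 (PiM {..<n} (\<lambda>_. lam)) (\<lambda>k. sum_product n (gs k)) g \<and>
             tendsto_L2 M (\<lambda>k. wiener_ito_sum_product lam \<eta> X n (gs k)) Z)"

section \<open>Kabanov-Skorohod integral and pathwise operator\<close>

definition kernel_tilde ::
  "'w measure \<Rightarrow> ('w \<Rightarrow> 'y measure) \<Rightarrow> ('y measure \<Rightarrow> 'y \<Rightarrow> real) \<Rightarrow> nat \<Rightarrow> (nat \<Rightarrow> 'y) \<Rightarrow> real" where
  "kernel_tilde M \<eta> h n y =
     1 / fact (n + 1) *
     (\<Sum>i<n + 1. \<integral>\<omega>. diff_ops (map y ([0..<i] @ [i + 1..<n + 1])) (\<lambda>\<mu>. h \<mu> (y i)) (\<eta> \<omega>) \<partial>M)"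

definition kabanov_skorohod ::
  "'w measure \<Rightarrow> 'y measure \<Rightarrow> ('w \<Rightarrow> 'y measure) \<Rightarrow> (nat \<Rightarrow> 'w \<Rightarrow> 'y) \<Rightarrow>
   ('y measure \<Rightarrow> 'y \<Rightarrow> real) \<Rightarrow> 'w \<Rightarrow> real" where
  "kabanov_skorohod M lam \<eta> X h =
     (SOME Z. tendsto_L2 M (\<lambda>N \<omega>. \<Sum>n<N. wiener_ito M lam \<eta> X (n + 1) (kernel_tilde M \<eta> h n) \<omega>) Z)"

text \<open>Integration with respect to \<open>\<mu> = \<Sum>i. \<delta>\<^bsub>x i\<^esub>\<close>, each \<open>\<delta>\<^bsub>x i\<^esub>\<close> acting by evaluation. For
  measurable integrands this is the integral with respect to \<open>\<mu>\<close>, see \<open>integral_eq_points_integral\<close>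
  below. In the pathwise operator the integrand \<open>y \<mapsto> h(\<mu> - \<delta>\<^sub>y, y)\<close> makes sense only at the points
  of \<open>\<mu>\<close>; on an arbitrary measurable space these need not form a measurable set, and extending
  the integrand by junk values off the points could destroy measurability.\<close>

definition points_integral :: "'y measure \<Rightarrow> (nat \<Rightarrow> 'y) \<Rightarrow> ('y \<Rightarrow> real) \<Rightarrow> real" where
  "points_integral \<mu> x f = (\<integral>i. f (x i) \<partial>count_space (point_indices \<mu>))"

definition pathwise_skorohod ::
  "'y measure \<Rightarrow> ('w \<Rightarrow> 'y measure) \<Rightarrow> (nat \<Rightarrow> 'w \<Rightarrow> 'y) \<Rightarrow> ('y measure \<Rightarrow> 'y \<Rightarrow> real) \<Rightarrow> 'w \<Rightarrow> real"
where
  "pathwise_skorohod lam \<eta> X h \<omega> =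
     points_integral (\<eta> \<omega>) (\<lambda>i. X i \<omega>) (\<lambda>y. h (remove_dirac (\<eta> \<omega>) y) y) - (\<integral>y. h (\<eta> \<omega>) y \<partial>lam)"

section \<open>Consistency of the encodings\<close>

lemma space_counting_space: "space (counting_space lam) = counting_measures lam"
  by (auto simp add: counting_space_def space_Sup_eq_UN)

lemma emeasure_add_dirac:
  assumes "A \<in> sets \<mu>"
  shows "emeasure (add_dirac \<mu> y) A = emeasure \<mu> A + indicator A y"
proof (rule emeasure_measure_of[OF add_dirac_def])
  show "countably_additive (sets (add_dirac \<mu> y)) (\<lambda>A. emeasure \<mu> A + indicator A y)"
  proof (rule countably_additiveI)
    fix A :: "nat \<Rightarrow> 'a set"
    assume A: "range A \<subseteq> sets (add_dirac \<mu> y)" "disjoint_family A"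
    then have "range A \<subseteq> sets \<mu>"
      by (simp add: add_dirac_def)
    with A show "(\<Sum>i. emeasure \<mu> (A i) + indicator (A i) y)
        = emeasure \<mu> (\<Union>i. A i) + indicator (\<Union>i. A i) y"
      by (simp add: suminf_add[symmetric] suminf_emeasure suminf_indicator)
  qed
qed (use assms sets.space_closed in \<open>auto simp: positive_def add_dirac_def\<close>)

lemma point_measure_eq_distr:
  assumes "\<And>i. i \<in> point_indices \<mu> \<Longrightarrow> x i \<in> space \<mu>"
    and "\<And>B. B \<in> sets \<mu> \<Longrightarrow>
      emeasure \<mu> B = (\<Sum>i. if i \<in> point_indices \<mu> then indicator B (x i) else 0)"
  shows "\<mu> = distr (count_space (point_indices \<mu>)) \<mu> x"
proof (rule measure_eqI)
  fix B assume B: "B \<in> sets \<mu>"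
  have "emeasure \<mu> B = (\<integral>\<^sup>+i. (if i \<in> point_indices \<mu> then indicator B (x i) else 0) \<partial>count_space UNIV)"
    using assms(2)[OF B] by (simp add: nn_integral_count_space_nat)
  also have "\<dots> = (\<integral>\<^sup>+i. indicator B (x i) \<partial>count_space (point_indices \<mu>))"
    by (simp add: nn_integral_count_space_indicator)
       (intro nn_integral_cong, simp split: split_indicator)
  also have "\<dots> = (\<integral>\<^sup>+y. indicator B y \<partial>distr (count_space (point_indices \<mu>)) \<mu> x)"
    using assms(1) B by (subst nn_integral_distr) auto
  finally show "emeasure \<mu> B = emeasure (distr (count_space (point_indices \<mu>)) \<mu> x) B"
    using B by simp
qed simp

lemma integral_eq_points_integral:
  assumes "\<And>i. i \<in> point_indices \<mu> \<Longrightarrow> x i \<in> space \<mu>"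
    and "\<And>B. B \<in> sets \<mu> \<Longrightarrow>
      emeasure \<mu> B = (\<Sum>i. if i \<in> point_indices \<mu> then indicator B (x i) else 0)"
    and f: "f \<in> borel_measurable \<mu>"
  shows "(\<integral>y. f y \<partial>\<mu>) = points_integral \<mu> x f"
  unfolding points_integral_def
  by (subst point_measure_eq_distr[of \<mu> x, OF assms(1,2)], assumption, assumption)
     (use assms(1) f in \<open>auto intro!: integral_distr\<close>)

lemma emeasure_remove_dirac:
  assumes points: "\<And>i. i \<in> point_indices \<mu> \<Longrightarrow> x i \<in> space \<mu>"
    and rep: "\<And>B. B \<in> sets \<mu> \<Longrightarrow>
      emeasure \<mu> B = (\<Sum>i. if i \<in> point_indices \<mu> then indicator B (x i) else 0)"
    and i: "i \<in> point_indices \<mu>" and A: "A \<in> sets \<mu>"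
  shows "emeasure (remove_dirac \<mu> (x i)) A = emeasure \<mu> A - indicator A (x i)"
proof -
  define \<nu> where "\<nu> = distr (count_space (point_indices \<mu> - {i})) \<mu> x"
  have \<nu>: "emeasure \<mu> B - indicator B (x i) = emeasure \<nu> B" if B: "B \<in> sets \<mu>" for B
  proof -
    have split: "count_space (point_indices \<mu>) = count_space (insert i (point_indices \<mu> - {i}))"
      using i by (simp add: insert_absorb)
    have "emeasure \<mu> B = emeasure (count_space (point_indices \<mu>)) (x -` B \<inter> point_indices \<mu>)"
      by (subst point_measure_eq_distr[of \<mu> x, OF assms(1,2)], assumption, assumption)
         (use points B in \<open>auto simp: emeasure_distr\<close>)
    also have "\<dots> = emeasure (count_space UNIV) (x -` B \<inter> point_indices \<mu>)"
      by (cases "finite (x -` B \<inter> point_indices \<mu>)") auto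
    also have "x -` B \<inter> point_indices \<mu> =
        (x -` B \<inter> (point_indices \<mu> - {i})) \<union> (if x i \<in> B then {i} else {})"
      using i by auto
    also have "emeasure (count_space UNIV) \<dots> =
        emeasure (count_space UNIV) (x -` B \<inter> (point_indices \<mu> - {i})) + indicator B (x i)"
      by (subst plus_emeasure[symmetric]) (auto split: split_indicator)
    also have "emeasure (count_space UNIV) (x -` B \<inter> (point_indices \<mu> - {i})) = emeasure \<nu> B"
      using points B unfolding \<nu>_def
      by (cases "finite (x -` B \<inter> (point_indices \<mu> - {i}))") (auto simp: emeasure_distr)
    finally show ?thesis
      by (simp split: split_indicator)
  qed
  have "remove_dirac \<mu> (x i) = measure_of (space \<nu>) (sets \<nu>) (emeasure \<nu>)"
    unfolding remove_dirac_def using sets.space_closed[of \<mu>]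
    by (auto simp: \<nu>_def intro!: measure_of_eq \<nu>[unfolded \<nu>_def] simp: sets.sigma_sets_eq)
  also have "\<dots> = \<nu>"
    by (rule measure_of_of_measure)
  finally show ?thesis
    using \<nu>[OF A] by simp
qed

end

theory Submission
  imports Defs
begin

text \<open>
  Both integrals are tested against the random variables \<open>G(\<eta>) = \<Prod>k. s\<^sub>k ^ \<eta>(C\<^sub>k)\<close> with
  \<open>\<bar>s\<^sub>k\<bar> \<le> 1\<close> and \<open>\<lambda>(C\<^sub>k) < \<infinity>\<close>. These are eigenfunctions of the difference operators:
  \<open>D\<^sub>y G = w(y) G\<close> for a bounded function \<open>w\<close> supported by a set of finite measure. For the pathwise
  operator the Mecke equation gives \<open>E[\<delta>'(h) G] = E[\<integral>h(\<eta>,y) D\<^sub>y G(\<eta>) \<lambda>(dy)] = E[G H]\<close> with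
  \<open>H = \<integral>w(y) h(\<eta>,y) \<lambda>(dy)\<close>. For the chaos series, the duality between multiple integrals and
  difference operators gives \<open>E[I\<^sub>n(g) G] = E[G] \<integral>g w\<^sup>\<otimes>\<^sup>n d\<lambda>\<^sup>n\<close>, and the pairing of the kernel of order
  \<open>n\<close> with \<open>w\<^sup>\<otimes>\<^sup>(\<^sup>n\<^sup>+\<^sup>1\<^sup>)\<close> is \<open>E[I\<^sub>n(w\<^sup>\<otimes>\<^sup>n) H] / n!\<close>; since \<open>G = E[G] \<Sum>n. I\<^sub>n(w\<^sup>\<otimes>\<^sup>n) / n!\<close>, summation gives \<open>E[G H]\<close>
  again. Varying the \<open>s\<^sub>k\<close> and comparing coefficients of power series, an integrable function of \<open>\<eta>\<close>
  that is orthogonal to all \<open>G\<close> is orthogonal to all indicators of the events \<open>\<eta>(C\<^sub>k) = m\<^sub>k\<close>, hence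
  vanishes. The integrals over \<open>h\<close> exist because the number of points in a set of finite measure has
  exponential moments.
\<close>

text \<open>The pathwise operator is known in advance only to be integrable, so its chaos expansion
  cannot be compared with the series; it can only be paired with bounded variables, which is what
  \<bar>s_k\<bar> \<le> 1 provides. Two obstacles shape the rest. First, a difference operator
  shifts the configuration, and by the Mecke equation integrating a shift over a window B costs a
  factor \<eta>(B). Square integrability does not survive this; finiteness of
  E[c^\<eta>(B) \<bar>F\<bar>] for all c does, at the price of a larger c. Hence the analysis takes
  place in windows of finite intensity, and h enters it through c^n \<bar>z\<bar> \<le> c^(2n) +
  z^2. Second, the integrals are defined through the points X_i, which may carry information beyond
  \<eta>, whereas test variables only see \<eta>. For finite configurations a Newton type recursion
  turns the multiple integral of a product into a polynomial in linear statistics of \<eta>, hence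
  into a function of \<eta>; for limits, closeness in L1 to such functions is carried along.\<close>

section \<open>Square integrable functions\<close>

lemma square_integrable_measurable [measurable_dest]:
  "square_integrable M f \<Longrightarrow> f \<in> borel_measurable M"
  by (simp add: square_integrable_def)

lemma square_integrable_mult:
  assumes "square_integrable M f" "square_integrable M g"
  shows "integrable M (\<lambda>x. f x * g x)"
proof (rule Bochner_Integration.integrable_bound)
  show "integrable M (\<lambda>x. (f x)\<^sup>2 + (g x)\<^sup>2)"
    using assms by (auto simp: square_integrable_def)
  show "(\<lambda>x. f x * g x) \<in> borel_measurable M"
    using assms by (auto simp: square_integrable_def)
  have "norm (f x * g x) \<le> norm ((f x)\<^sup>2 + (g x)\<^sup>2)" for x
    using sum_squares_bound[of "f x" "g x"] sum_squares_bound[of "f x" "- g x"]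
      zero_le_power2[of "f x"] zero_le_power2[of "g x"]
    by (simp add: abs_if)
  then show "AE x in M. norm (f x * g x) \<le> norm ((f x)\<^sup>2 + (g x)\<^sup>2)"
    by simp
qed

lemma square_integrable_cmult:
  "square_integrable M f \<Longrightarrow> square_integrable M (\<lambda>x. c * f x)"
  by (auto simp: square_integrable_def power_mult_distrib)

lemma square_integrable_add:
  assumes "square_integrable M f" "square_integrable M g"
  shows "square_integrable M (\<lambda>x. f x + g x)"
proof -
  have "integrable M (\<lambda>x. (f x)\<^sup>2 + (g x)\<^sup>2 + 2 * (f x * g x))"
    using assms square_integrable_mult[OF assms] by (auto simp: square_integrable_def)
  moreover have "(f x + g x)\<^sup>2 = (f x)\<^sup>2 + (g x)\<^sup>2 + 2 * (f x * g x)" for x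
    by (simp add: power2_sum)
  ultimately show ?thesis
    using assms by (auto simp: square_integrable_def)
qed

lemma square_integrable_diff:
  assumes "square_integrable M f" "square_integrable M g"
  shows "square_integrable M (\<lambda>x. f x - g x)"
  using square_integrable_add[OF assms(1) square_integrable_cmult[OF assms(2), of "-1"]] by simp

lemma square_integrable_0: "square_integrable M (\<lambda>_. 0)"
  by (simp add: square_integrable_def)

lemma square_integrable_sum:
  "(\<And>i. i \<in> A \<Longrightarrow> square_integrable M (f i)) \<Longrightarrow> square_integrable M (\<lambda>x. \<Sum>i\<in>A. f i x)"
  by (induction A rule: infinite_finite_induct)
     (auto simp: square_integrable_0 intro: square_integrable_add)

text \<open>The integral of (t f + g)^2 is a polynomial of degree at most two in t that is never
  negative; evaluating it at its minimum gives the inequality.\<close>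

lemma integral_Cauchy_Schwarz:
  assumes "square_integrable M f" "square_integrable M g"
  shows "(\<integral>x. f x * g x \<partial>M)\<^sup>2 \<le> (\<integral>x. (f x)\<^sup>2 \<partial>M) * (\<integral>x. (g x)\<^sup>2 \<partial>M)"
proof -
  define a b c where "a = (\<integral>x. (f x)\<^sup>2 \<partial>M)" and "b = (\<integral>x. f x * g x \<partial>M)" and "c = (\<integral>x. (g x)\<^sup>2 \<partial>M)"
  have q: "0 \<le> a * t\<^sup>2 + 2 * b * t + c" for t
  proof -
    have "(t * f x + g x)\<^sup>2 = t\<^sup>2 * (f x)\<^sup>2 + 2 * t * (f x * g x) + (g x)\<^sup>2" for x
      by (simp add: power2_sum power_mult_distrib)
    then have "(\<integral>x. (t * f x + g x)\<^sup>2 \<partial>M) = a * t\<^sup>2 + 2 * b * t + c"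
      using assms square_integrable_mult[OF assms]
      by (simp add: a_def b_def c_def square_integrable_def)
    moreover have "0 \<le> (\<integral>x. (t * f x + g x)\<^sup>2 \<partial>M)"
      by simp
    ultimately show ?thesis by simp
  qed
  have "a \<ge> 0" by (simp add: a_def)
  have "b\<^sup>2 \<le> a * c"
  proof (cases "a = 0")
    case True
    have "b = 0"
    proof (rule ccontr)
      assume "b \<noteq> 0"
      \<comment> \<open>With a = 0 the polynomial is 2bt + c, and this t gives it the value
        -1.\<close>
      then show False
        using q[of "- (c + 1) / (2 * b)"] True by (simp add: field_simps)
    qed
    then show ?thesis using True by simp
  next
    case False
    then show ?thesis
      using q[of "- b / a"] \<open>a \<ge> 0\<close> by (simp add: field_simps power2_eq_square)
  qed
  then show ?thesis by (simp add: a_def b_def c_def)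
qed

text \<open>The product F H splits into (F - f)(H - h), (F - f) h, f (H - h) and f h; the first
  three have vanishing integrals by Cauchy-Schwarz.\<close>

lemma tendsto_L2_mult:
  assumes F: "tendsto_L2 M F f" and H: "tendsto_L2 M H h"
  shows "(\<lambda>k. \<integral>x. F k x * H k x \<partial>M) \<longlonglongrightarrow> (\<integral>x. f x * h x \<partial>M)"
proof -
  have sq: "square_integrable M (F k)" "square_integrable M f" "square_integrable M (H k)"
    "square_integrable M h" for k
    using F H by (auto simp: tendsto_L2_def)
  note sq' = sq square_integrable_diff[OF sq(1,2)] square_integrable_diff[OF sq(3,4)]
  have zero: "(\<lambda>k. \<integral>x. a k x * b k x \<partial>M) \<longlonglongrightarrow> 0"
    if "\<And>k. square_integrable M (a k)" "\<And>k. square_integrable M (b k)"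
      "(\<lambda>k. (\<integral>x. (a k x)\<^sup>2 \<partial>M) * (\<integral>x. (b k x)\<^sup>2 \<partial>M)) \<longlonglongrightarrow> 0" for a b
  proof -
    have "(\<lambda>k. (\<integral>x. a k x * b k x \<partial>M)\<^sup>2) \<longlonglongrightarrow> 0"
      by (rule tendsto_sandwich[OF _ _ tendsto_const that(3)])
         (auto intro!: always_eventually integral_Cauchy_Schwarz that)
    from tendsto_real_sqrt[OF this] show ?thesis
      by (simp add: tendsto_rabs_zero_iff)
  qed
  have Z: "(\<lambda>k. \<integral>x. (F k x - f x)\<^sup>2 \<partial>M) \<longlonglongrightarrow> 0" "(\<lambda>k. \<integral>x. (H k x - h x)\<^sup>2 \<partial>M) \<longlonglongrightarrow> 0"
    using F H by (auto simp: tendsto_L2_def)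
  have "(\<lambda>k. (\<integral>x. (F k x - f x) * (H k x - h x) \<partial>M) + (\<integral>x. (F k x - f x) * h x \<partial>M) +
      (\<integral>x. f x * (H k x - h x) \<partial>M) + (\<integral>x. f x * h x \<partial>M)) \<longlonglongrightarrow> 0 + 0 + 0 + (\<integral>x. f x * h x \<partial>M)"
    by (intro tendsto_add tendsto_const zero sq')
       (use tendsto_mult[OF Z] tendsto_mult[OF Z(1) tendsto_const] tendsto_mult[OF tendsto_const Z(2)]
        in auto)
  moreover have "(\<integral>x. (F k x - f x) * (H k x - h x) \<partial>M) + (\<integral>x. (F k x - f x) * h x \<partial>M) +
      (\<integral>x. f x * (H k x - h x) \<partial>M) + (\<integral>x. f x * h x \<partial>M) = (\<integral>x. F k x * H k x \<partial>M)" for k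
    using sq' by (simp add: square_integrable_mult flip: Bochner_Integration.integral_add)
       (simp add: algebra_simps)
  ultimately show ?thesis by simp
qed

lemma tendsto_L2_const: "square_integrable M f \<Longrightarrow> tendsto_L2 M (\<lambda>_. f) f"
  by (simp add: tendsto_L2_def)

text \<open>Completeness of L2, for functions rather than classes. A subsequence with geometrically
  small increments converges almost everywhere, and Fatou's lemma carries the Cauchy bound over to
  the limit.\<close>

lemma L2_Cauchy_limit:
  assumes F: "\<And>k. square_integrable M (F k)"
    and Cauchy: "\<And>e. e > 0 \<Longrightarrow> \<exists>N. \<forall>m\<ge>N. \<forall>n\<ge>N. (\<integral>x. (F m x - F n x)\<^sup>2 \<partial>M) < e"
  shows "\<exists>Z. tendsto_L2 M F Z"
proof -
  have [measurable]: "F k \<in> borel_measurable M" for k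
    using F by auto
  have sqd: "integrable M (\<lambda>x. (F m x - F n x)\<^sup>2)" for m n
    using square_integrable_diff[OF F F] by (simp add: square_integrable_def)
  have nn: "(\<integral>\<^sup>+x. ennreal ((F m x - F n x)\<^sup>2) \<partial>M) = ennreal (\<integral>x. (F m x - F n x)\<^sup>2 \<partial>M)" for m n
    by (rule nn_integral_eq_integral[OF sqd]) simp
  \<comment> \<open>The rate 1/4 leaves room for the weights \<open>2 ^ k\<close> below: the
    weighted squares still sum to a geometric series of ratio 1/2.\<close>
  obtain s where s: "\<And>k m n. m \<ge> s k \<Longrightarrow> n \<ge> s k \<Longrightarrow> (\<integral>x. (F m x - F n x)\<^sup>2 \<partial>M) < (1/4) ^ k"
    using Cauchy[of "(1/4) ^ k" for k] by simp metis
  \<comment> \<open>Partial sums make \<open>r k\<close> dominate every \<open>s j\<close> with j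
    \<le> k, not only \<open>s k\<close>.\<close>
  define r where "r k = (\<Sum>i\<le>k. s i)" for k
  have rs: "s k \<le> r k" "s k \<le> r (Suc k)" for k
    by (auto simp: r_def intro: member_le_sum trans_le_add1)
  have "(\<integral>\<^sup>+x. (\<Sum>k. ennreal (2 ^ k * (F (r (Suc k)) x - F (r k) x)\<^sup>2)) \<partial>M) =
      (\<Sum>k. \<integral>\<^sup>+x. ennreal (2 ^ k * (F (r (Suc k)) x - F (r k) x)\<^sup>2) \<partial>M)"
    by (rule nn_integral_suminf) measurable
  also have "\<dots> \<le> (\<Sum>k. ennreal ((1/2) ^ k))"
  proof (intro suminf_le ballI)
    fix k
    have "(\<integral>\<^sup>+x. ennreal (2 ^ k * (F (r (Suc k)) x - F (r k) x)\<^sup>2) \<partial>M) =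
        ennreal (2 ^ k) * ennreal (\<integral>x. (F (r (Suc k)) x - F (r k) x)\<^sup>2 \<partial>M)"
      by (simp add: ennreal_mult nn_integral_cmult nn)
    also have "\<dots> \<le> ennreal (2 ^ k) * ennreal ((1/4) ^ k)"
      using s[OF rs(2) rs(1), of k] by (intro mult_left_mono ennreal_leI) auto
    also have "\<dots> = ennreal ((1/2) ^ k)"
      by (simp add: ennreal_mult[symmetric] power_mult_distrib[symmetric])
    finally show "(\<integral>\<^sup>+x. ennreal (2 ^ k * (F (r (Suc k)) x - F (r k) x)\<^sup>2) \<partial>M) \<le> ennreal ((1/2) ^ k)" .
  qed auto
  also have "\<dots> < \<infinity>"
    by (subst suminf_ennreal2) (auto intro: summable_geometric)
  finally have "AE x in M. (\<Sum>k. ennreal (2 ^ k * (F (r (Suc k)) x - F (r k) x)\<^sup>2)) \<noteq> \<infinity>"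
    by (intro nn_integral_PInf_AE) auto
  then have AE: "AE x in M. convergent (\<lambda>k. F (r k) x)"
  proof eventually_elim
    case (elim x)
    have sm: "summable (\<lambda>k. 2 ^ k * (F (r (Suc k)) x - F (r k) x)\<^sup>2)"
      by (rule summable_suminf_not_top) (use elim in \<open>auto simp: infinity_ennreal_def\<close>)
    have "summable (\<lambda>k. F (r (Suc k)) x - F (r k) x)"
    proof (rule summable_comparison_test')
      show "summable (\<lambda>k. (1/2) ^ k + 2 ^ k * (F (r (Suc k)) x - F (r k) x)\<^sup>2)"
        by (intro summable_add sm summable_geometric) simp
      fix k
      let ?d = "F (r (Suc k)) x - F (r k) x"
      \<comment> \<open>Passage from squares to first powers: expand the square (1 - 2^k
        \<bar>d\<bar>)^2 \<ge> 0 and divide by 2^k.\<close>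
      have two: "2 * \<bar>?d\<bar> \<le> (1/2) ^ k + 2 ^ k * ?d\<^sup>2"
      proof -
        have "0 \<le> (1/2) ^ k * (1 - 2 ^ k * \<bar>?d\<bar>)\<^sup>2" by simp
        also have "\<dots> = (1/2) ^ k + 2 ^ k * ?d\<^sup>2 * ((1/2)^k * 2^k) - 2 * \<bar>?d\<bar> * ((1/2)^k * 2^k)"
          by (simp add: power2_diff power_mult_distrib algebra_simps) (simp add: power2_eq_square)
        also have "(1/2)^k * 2^k = (1::real)"
          by (simp add: power_mult_distrib[symmetric])
        finally show ?thesis by simp
      qed
      show "norm ?d \<le> (1/2) ^ k + 2 ^ k * ?d\<^sup>2"
        by (rule order_trans[OF _ two]) simp
    qed
    then have "convergent (\<lambda>n. \<Sum>k<n. F (r (Suc k)) x - F (r k) x)"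
      by (simp add: summable_iff_convergent)
    moreover have "(\<Sum>k<n. F (r (Suc k)) x - F (r k) x) = F (r n) x - F (r 0) x" for n
      by (rule sum_lessThan_telescope)
    ultimately show ?case
      by (simp add: convergent_diff_const_right_iff)
  qed
  define Z where "Z x = lim (\<lambda>k. F (r k) x)" for x
  have [measurable]: "Z \<in> borel_measurable M"
    unfolding Z_def by measurable
  have bound: "(\<integral>\<^sup>+x. ennreal ((F n x - Z x)\<^sup>2) \<partial>M) \<le> ennreal ((1/4) ^ j)" if n: "n \<ge> s j" for n j
  proof -
    have "(\<integral>\<^sup>+x. ennreal ((F n x - Z x)\<^sup>2) \<partial>M) = (\<integral>\<^sup>+x. liminf (\<lambda>k. ennreal ((F n x - F (r k) x)\<^sup>2)) \<partial>M)"
    proof (rule nn_integral_cong_AE)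
      show "AE x in M. ennreal ((F n x - Z x)\<^sup>2) = liminf (\<lambda>k. ennreal ((F n x - F (r k) x)\<^sup>2))"
        using AE
      proof eventually_elim
        case (elim x)
        then have "(\<lambda>k. F (r k) x) \<longlonglongrightarrow> Z x"
          by (simp add: Z_def convergent_LIMSEQ_iff)
        then have "(\<lambda>k. ennreal ((F n x - F (r k) x)\<^sup>2)) \<longlonglongrightarrow> ennreal ((F n x - Z x)\<^sup>2)"
          by (intro tendsto_intros)
        then show ?case
          by (rule lim_imp_Liminf[OF trivial_limit_sequentially, symmetric])
      qed
    qed
    also have "\<dots> \<le> liminf (\<lambda>k. \<integral>\<^sup>+x. ennreal ((F n x - F (r k) x)\<^sup>2) \<partial>M)"
      by (rule nn_integral_liminf) measurable
    also have "\<dots> \<le> ennreal ((1/4) ^ j)"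
    proof (rule Liminf_le)
      show "\<forall>\<^sub>F k in sequentially. (\<integral>\<^sup>+x. ennreal ((F n x - F (r k) x)\<^sup>2) \<partial>M) \<le> ennreal ((1/4) ^ j)"
      proof (rule eventually_sequentiallyI[of j])
        fix k assume "j \<le> k"
        then have "s j \<le> r k"
          by (auto simp: r_def intro: member_le_sum)
        then show "(\<integral>\<^sup>+x. ennreal ((F n x - F (r k) x)\<^sup>2) \<partial>M) \<le> ennreal ((1/4) ^ j)"
          using s[OF n, of "r k"] by (simp add: nn ennreal_leI less_imp_le)
      qed
    qed simp
    finally show ?thesis .
  qed
  have sqZ: "square_integrable M (\<lambda>x. F n x - Z x)" if "n \<ge> s j" for n j
    using le_less_trans[OF bound[OF that] ennreal_less_top]
    by (auto simp: square_integrable_def integrable_iff_bounded)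
  have Z: "square_integrable M Z"
    using square_integrable_diff[OF F[of "s 0"] sqZ[of 0 "s 0"]] by simp
  have sqD: "integrable M (\<lambda>x. (F n x - Z x)\<^sup>2)" for n
    using square_integrable_diff[OF F Z] by (simp add: square_integrable_def)
  have "(\<lambda>k. \<integral>x. (F k x - Z x)\<^sup>2 \<partial>M) \<longlonglongrightarrow> 0"
  proof (rule LIMSEQ_I)
    fix e :: real assume "e > 0"
    then obtain j where j: "(1/4) ^ j < e"
      using real_arch_pow_inv[of e "1/4"] by auto
    have "(\<integral>x. (F n x - Z x)\<^sup>2 \<partial>M) \<le> (1/4) ^ j" if "n \<ge> s j" for n
      using bound[OF that] by (subst (asm) nn_integral_eq_integral[OF sqD]) auto
    then show "\<exists>n0. \<forall>n\<ge>n0. norm ((\<integral>x. (F n x - Z x)\<^sup>2 \<partial>M) - 0) < e"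
      using j by (intro exI[of _ "s j"]) (auto intro: le_less_trans)
  qed
  then show ?thesis
    using F Z by (auto simp: tendsto_L2_def)
qed

section \<open>Density of functions of sum-product form\<close>

lemma admissible_factor_indicator:
  assumes "A \<in> sets lam" "emeasure lam A < \<infinity>"
  shows "admissible_factor lam (indicator A)"
  using assms unfolding admissible_factor_def
  by (auto intro!: exI[of _ 1] bexI[of _ A] simp: indicator_def)

lemma admissible_factor_bound:
  assumes "admissible_factor lam f"
  obtains c B where "c \<ge> 0" "B \<in> sets lam" "emeasure lam B < \<infinity>"
    "\<And>y. y \<in> space lam \<Longrightarrow> \<bar>f y\<bar> \<le> c * indicator B y"
proof -
  from assms obtain c B where *: "\<forall>y\<in>space lam. \<bar>f y\<bar> \<le> c" "B \<in> sets lam" "emeasure lam B < \<infinity>"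
    "\<forall>y\<in>space lam - B. f y = 0"
    unfolding admissible_factor_def by blast
  show thesis
    by (rule that[of "max c 0" B]) (use * in \<open>auto simp: indicator_def max_def dest: bspec\<close>)
qed

lemma admissible_factor_mult:
  assumes f: "admissible_factor lam f"
    and g: "g \<in> borel_measurable lam" "\<And>y. y \<in> space lam \<Longrightarrow> \<bar>g y\<bar> \<le> c"
  shows "admissible_factor lam (\<lambda>y. f y * g y)"
proof -
  from f obtain a B where *: "f \<in> borel_measurable lam" "\<forall>y\<in>space lam. \<bar>f y\<bar> \<le> a" "B \<in> sets lam"
    "emeasure lam B < \<infinity>" "\<forall>y\<in>space lam - B. f y = 0"
    unfolding admissible_factor_def by blast
  have "\<bar>f y * g y\<bar> \<le> a * c" if "y \<in> space lam" for y
    using *(2) g(2)[OF that] that by (auto simp: abs_mult intro!: mult_mono intro: order_trans[OF abs_ge_zero])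
  with * g(1) show ?thesis
    unfolding admissible_factor_def
    by (intro conjI exI[of _ "a * c"] bexI[of _ B]) auto
qed

lemma admissible_factor_integrable:
  assumes "admissible_factor lam f"
  shows "integrable lam f"
proof -
  obtain c B where *: "c \<ge> 0" "B \<in> sets lam" "emeasure lam B < \<infinity>"
    "\<And>y. y \<in> space lam \<Longrightarrow> \<bar>f y\<bar> \<le> c * indicator B y"
    using admissible_factor_bound[OF assms] by metis
  have "integrable lam (\<lambda>y. c * indicator B y :: real)"
    using * by auto
  then show ?thesis
    by (rule Bochner_Integration.integrable_bound)
       (use assms * in \<open>auto simp: admissible_factor_def intro!: AE_I2\<close>)
qed

lemma admissible_factor_mult_integrable:
  assumes "admissible_factor lam f" "admissible_factor lam g"
  shows "integrable lam (\<lambda>y. f y * g y)"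
proof -
  obtain c B where "c \<ge> 0" "\<And>y. y \<in> space lam \<Longrightarrow> \<bar>g y\<bar> \<le> c * indicator B y"
    using admissible_factor_bound[OF assms(2)] by metis
  from this(2) have "\<bar>g y\<bar> \<le> c" if "y \<in> space lam" for y
    by (rule order_trans) (use \<open>c \<ge> 0\<close> that in \<open>auto simp: indicator_def\<close>)
  then show ?thesis
    using assms by (intro admissible_factor_integrable admissible_factor_mult[of lam f g c])
      (auto simp: admissible_factor_def)
qed

text \<open>The L2 closure is expressed by \<epsilon>-approximation, so that iterated limits call
  for no diagonal sequence; a sequence is extracted only in
  \<open>sum_product_dense\<close>.\<close>

definition sum_product_closure :: "'a measure \<Rightarrow> nat \<Rightarrow> ((nat \<Rightarrow> 'a) \<Rightarrow> real) set" where
  "sum_product_closure M n = {g. square_integrable (PiM {..<n} (\<lambda>_. M)) g \<and>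
     (\<forall>e>0. \<exists>gs. sum_product_form M n gs \<and>
        (\<integral>y. (sum_product n gs y - g y)\<^sup>2 \<partial>PiM {..<n} (\<lambda>_. M)) < e)}"

context sigma_finite_measure
begin

lemma product_sigma_finite_const: "product_sigma_finite (\<lambda>_. M)"
  by unfold_locales

lemma square_integrable_product:
  assumes "finite J" "\<And>i. i \<in> J \<Longrightarrow> admissible_factor M (g i)"
  shows "square_integrable (PiM J (\<lambda>_. M)) (\<lambda>y. \<Prod>i\<in>J. g i (y i))"
proof -
  interpret product_sigma_finite "\<lambda>_. M" by (rule product_sigma_finite_const)
  have [measurable]: "g i \<in> borel_measurable M" if "i \<in> J" for i
    using assms(2)[OF that] by (simp add: admissible_factor_def)
  have "(\<Prod>i\<in>J. g i (y i))\<^sup>2 = (\<Prod>i\<in>J. g i (y i) * g i (y i))" for y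
    by (simp add: power2_eq_square prod.distrib)
  moreover have "integrable (PiM J (\<lambda>_. M)) (\<lambda>y. \<Prod>i\<in>J. (\<lambda>z. g i z * g i z) (y i))"
    using assms by (intro product_integrable_prod admissible_factor_mult_integrable) auto
  ultimately show ?thesis
    by (simp add: square_integrable_def)
qed

lemma square_integrable_sum_product:
  assumes "sum_product_form M n gs"
  shows "square_integrable (PiM {..<n} (\<lambda>_. M)) (sum_product n gs)"
  using assms
proof (induction gs)
  case Nil
  then show ?case by (simp add: sum_product_def[abs_def] square_integrable_0)
next
  case (Cons g gs)
  then have "square_integrable (PiM {..<n} (\<lambda>_. M)) (\<lambda>y. \<Prod>i<n. g i (y i))"
    by (intro square_integrable_product) (auto simp: sum_product_form_def)
  moreover have "square_integrable (PiM {..<n} (\<lambda>_. M)) (sum_product n gs)"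
    using Cons by (auto simp: sum_product_form_def)
  ultimately show ?case
    using square_integrable_add by (fastforce simp: sum_product_def[abs_def])
qed

text \<open>The form of closedness that the monotone class arguments below use: dominated pointwise
  limits. The domination (u - g)^2 \<le> 4 v^2 turns pointwise into L2 convergence.\<close>

lemma sum_product_closure_limit:
  assumes u: "\<And>k. u k \<in> sum_product_closure M n"
    and g: "g \<in> borel_measurable (PiM {..<n} (\<lambda>_. M))"
    and lim: "\<And>y. y \<in> space (PiM {..<n} (\<lambda>_. M)) \<Longrightarrow> (\<lambda>k. u k y) \<longlonglongrightarrow> g y"
    and v: "square_integrable (PiM {..<n} (\<lambda>_. M)) v"
    and bound: "\<And>k y. y \<in> space (PiM {..<n} (\<lambda>_. M)) \<Longrightarrow> \<bar>u k y\<bar> \<le> v y"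
  shows "g \<in> sum_product_closure M n"
proof -
  let ?P = "PiM {..<n} (\<lambda>_. M)"
  have gb: "\<bar>g y\<bar> \<le> v y" if "y \<in> space ?P" for y
    using lim[OF that, THEN tendsto_rabs] bound[OF that] by (intro tendsto_upperbound) auto
  have su: "square_integrable ?P (u k)" for k
    using u by (simp add: sum_product_closure_def)
  have v2: "integrable ?P (\<lambda>y. (v y)\<^sup>2)"
    using v by (simp add: square_integrable_def)
  have sg: "square_integrable ?P g"
    unfolding square_integrable_def
  proof (intro conjI g)
    show "integrable ?P (\<lambda>y. (g y)\<^sup>2)"
    proof (rule Bochner_Integration.integrable_bound[OF v2])
      show "AE y in ?P. norm ((g y)\<^sup>2) \<le> norm ((v y)\<^sup>2)"
      proof (rule AE_I2)
        fix y assume "y \<in> space ?P"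
        from power_mono[OF gb[OF this], of 2] show "norm ((g y)\<^sup>2) \<le> norm ((v y)\<^sup>2)"
          by simp
      qed
    qed (use g in measurable)
  qed
  have "(\<lambda>k. \<integral>y. (u k y - g y)\<^sup>2 \<partial>?P) \<longlonglongrightarrow> (\<integral>y. 0 \<partial>?P)"
  proof (rule integral_dominated_convergence)
    show "integrable ?P (\<lambda>y. 4 * (v y)\<^sup>2)"
      using v2 by simp
    show "AE y in ?P. (\<lambda>k. (u k y - g y)\<^sup>2) \<longlonglongrightarrow> 0"
    proof (rule AE_I2)
      fix y assume "y \<in> space ?P"
      from tendsto_power[OF tendsto_diff[OF lim[OF this] tendsto_const[of "g y"]], of 2]
      show "(\<lambda>k. (u k y - g y)\<^sup>2) \<longlonglongrightarrow> 0" by simp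
    qed
    show "AE y in ?P. norm ((u k y - g y)\<^sup>2) \<le> 4 * (v y)\<^sup>2" for k
    proof (rule AE_I2)
      fix y assume y: "y \<in> space ?P"
      have "\<bar>u k y - g y\<bar> \<le> 2 * v y"
        using gb[OF y] bound[OF y, of k] by linarith
      from power_mono[OF this, of 2] show "norm ((u k y - g y)\<^sup>2) \<le> 4 * (v y)\<^sup>2"
        by (simp add: power_mult_distrib)
    qed
  qed (use g su in \<open>auto dest: square_integrable_measurable\<close>)
  then have lim0: "(\<lambda>k. \<integral>y. (u k y - g y)\<^sup>2 \<partial>?P) \<longlonglongrightarrow> 0" by simp
  have "\<exists>gs. sum_product_form M n gs \<and> (\<integral>y. (sum_product n gs y - g y)\<^sup>2 \<partial>?P) < e" if "e > 0" for e
  proof -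
    \<comment> \<open>Two errors below e/4 suffice, since (a + b)^2 \<le> 2 a^2 + 2 b^2.\<close>
    from order_tendstoD(2)[OF lim0, of "e / 4"] that
    obtain k where k: "(\<integral>y. (u k y - g y)\<^sup>2 \<partial>?P) < e / 4"
      by (auto simp: eventually_sequentially)
    from u[of k] that obtain gs where gs: "sum_product_form M n gs"
      "(\<integral>y. (sum_product n gs y - u k y)\<^sup>2 \<partial>?P) < e / 4"
      unfolding sum_product_closure_def by (auto dest: spec[of _ "e / 4"])
    let ?s = "sum_product n gs"
    have s: "square_integrable ?P ?s"
      by (rule square_integrable_sum_product) fact
    have i: "integrable ?P (\<lambda>y. (?s y - u k y)\<^sup>2)" "integrable ?P (\<lambda>y. (u k y - g y)\<^sup>2)"
      "integrable ?P (\<lambda>y. (?s y - g y)\<^sup>2)"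
      using square_integrable_diff[OF s su[of k]] square_integrable_diff[OF su[of k] sg]
        square_integrable_diff[OF s sg] by (auto simp: square_integrable_def)
    have "(\<integral>y. (?s y - g y)\<^sup>2 \<partial>?P) \<le> (\<integral>y. 2 * (?s y - u k y)\<^sup>2 + 2 * (u k y - g y)\<^sup>2 \<partial>?P)"
    proof (rule integral_mono)
      fix y
      have "2 * ((?s y - u k y) * (u k y - g y)) \<le> (?s y - u k y)\<^sup>2 + (u k y - g y)\<^sup>2"
        using sum_squares_bound by (simp add: mult.assoc)
      moreover have "(?s y - g y)\<^sup>2 = (?s y - u k y)\<^sup>2 + (u k y - g y)\<^sup>2 + 2 * ((?s y - u k y) * (u k y - g y))"
        by (simp add: power2_eq_square algebra_simps)
      ultimately show "(?s y - g y)\<^sup>2 \<le> 2 * (?s y - u k y)\<^sup>2 + 2 * (u k y - g y)\<^sup>2"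
        by linarith
    qed (use i in auto)
    also have "\<dots> = 2 * (\<integral>y. (?s y - u k y)\<^sup>2 \<partial>?P) + 2 * (\<integral>y. (u k y - g y)\<^sup>2 \<partial>?P)"
      using i by simp
    also have "\<dots> < e"
      using k gs by simp
    finally show ?thesis using gs by blast
  qed
  then show ?thesis
    using sg by (simp add: sum_product_closure_def)
qed

lemma sum_product_closure_base:
  "sum_product_form M n gs \<Longrightarrow> sum_product n gs \<in> sum_product_closure M n"
  by (auto simp: sum_product_closure_def square_integrable_sum_product intro!: exI[of _ gs])

lemma sum_product_closure_lincomb:
  assumes f: "f \<in> sum_product_closure M n" and g: "g \<in> sum_product_closure M n" and n: "n > 0"
  shows "(\<lambda>y. f y + c * g y) \<in> sum_product_closure M n"
proof -
  let ?P = "PiM {..<n} (\<lambda>_. M)"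
  have sq: "square_integrable ?P f" "square_integrable ?P g"
    using f g by (auto simp: sum_product_closure_def)
  have "\<exists>gs. sum_product_form M n gs \<and> (\<integral>y. (sum_product n gs y - (f y + c * g y))\<^sup>2 \<partial>?P) < e"
    if "e > 0" for e
  proof -
    from f that obtain fs where fs: "sum_product_form M n fs"
      "(\<integral>y. (sum_product n fs y - f y)\<^sup>2 \<partial>?P) < e / 4"
      unfolding sum_product_closure_def by (auto dest: spec[of _ "e / 4"])
    \<comment> \<open>The tolerance is chosen so that multiplication by c^2 leaves at most e/4;
      adding 1 keeps the denominator positive when c = 0.\<close>
    from g that obtain gs where gs: "sum_product_form M n gs"
      "(\<integral>y. (sum_product n gs y - g y)\<^sup>2 \<partial>?P) < e / (4 * (c\<^sup>2 + 1))"
      unfolding sum_product_closure_def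
      by (auto dest!: spec[of _ "e / (4 * (c\<^sup>2 + 1))"] simp: add_nonneg_pos)
    \<comment> \<open>The scalar is absorbed into the factor with index 0, which exists because n >
      0. For n = 0 every product is 1 and scalars could not be absorbed.\<close>
    define hs where "hs = fs @ map (\<lambda>g. g(0 := \<lambda>y. g 0 y * c)) gs"
    have hs: "sum_product_form M n hs"
      using fs gs by (auto simp: hs_def sum_product_form_def intro!: admissible_factor_mult)
    have "(\<Prod>i<n. (g(0 := \<lambda>y. g 0 y * c)) i (y i)) = c * (\<Prod>i<n. g i (y i))" for g and y :: "nat \<Rightarrow> 'a"
    proof -
      have "{..<n} = insert 0 {1..<n}" using n by auto
      then show ?thesis by simp
    qed
    then have hs_eq: "sum_product n hs y = sum_product n fs y + c * sum_product n gs y" for y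
      by (simp add: hs_def sum_product_def o_def sum_list_const_mult)
    have s: "square_integrable ?P (\<lambda>y. sum_product n fs y - f y)"
        "square_integrable ?P (\<lambda>y. sum_product n gs y - g y)"
        "square_integrable ?P (\<lambda>y. sum_product n hs y - (f y + c * g y))"
      by (intro square_integrable_diff square_integrable_add square_integrable_cmult
          square_integrable_sum_product fs gs hs sq)+
    have "(\<integral>y. (sum_product n hs y - (f y + c * g y))\<^sup>2 \<partial>?P) \<le>
        (\<integral>y. 2 * (sum_product n fs y - f y)\<^sup>2 + 2 * c\<^sup>2 * (sum_product n gs y - g y)\<^sup>2 \<partial>?P)"
    proof (rule integral_mono)
      fix y
      let ?a = "sum_product n fs y - f y" and ?b = "c * (sum_product n gs y - g y)"
      have "(?a + ?b)\<^sup>2 \<le> 2 * ?a\<^sup>2 + 2 * ?b\<^sup>2"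
        using sum_squares_bound[of ?a ?b] by (simp add: power2_sum)
      moreover have "sum_product n hs y - (f y + c * g y) = ?a + ?b"
        by (simp add: hs_eq algebra_simps)
      ultimately show "(sum_product n hs y - (f y + c * g y))\<^sup>2 \<le> 2 * ?a\<^sup>2 + 2 * c\<^sup>2 * (sum_product n gs y - g y)\<^sup>2"
        by (simp only: power_mult_distrib mult.assoc)
    qed (use s in \<open>auto simp: square_integrable_def\<close>)
    also have "\<dots> = 2 * (\<integral>y. (sum_product n fs y - f y)\<^sup>2 \<partial>?P) +
        2 * (c\<^sup>2 * (\<integral>y. (sum_product n gs y - g y)\<^sup>2 \<partial>?P))"
      using s by (simp add: square_integrable_def)
    also have "c\<^sup>2 * (\<integral>y. (sum_product n gs y - g y)\<^sup>2 \<partial>?P) \<le> c\<^sup>2 * (e / (4 * (c\<^sup>2 + 1)))"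
      using gs by (intro mult_left_mono) auto
    also have "c\<^sup>2 * (e / (4 * (c\<^sup>2 + 1))) \<le> e / 4"
    proof -
      have "c\<^sup>2 / (c\<^sup>2 + 1) \<le> 1" by (simp add: add_nonneg_pos)
      then have "c\<^sup>2 / (c\<^sup>2 + 1) * (e / 4) \<le> 1 * (e / 4)" using that by (intro mult_right_mono) auto
      then show ?thesis by (simp add: field_simps)
    qed
    also have "2 * (\<integral>y. (sum_product n fs y - f y)\<^sup>2 \<partial>?P) + 2 * (e / 4) < e"
      using fs by simp
    finally show ?thesis using hs by auto
  qed
  moreover have "square_integrable ?P (\<lambda>y. f y + c * g y)"
    by (intro square_integrable_add square_integrable_cmult sq)
  ultimately show ?thesis by (simp add: sum_product_closure_def)
qed

lemma sum_product_closure_sum: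
  assumes "\<And>i. i \<in> A \<Longrightarrow> f i \<in> sum_product_closure M n" "n > 0"
  shows "(\<lambda>y. \<Sum>i\<in>A. f i y) \<in> sum_product_closure M n"
proof -
  have 0: "(\<lambda>y. 0) \<in> sum_product_closure M n"
    using sum_product_closure_base[of n "[]"] by (simp add: sum_product_form_def sum_product_def[abs_def])
  show ?thesis
    using assms(1)
    by (induction A rule: infinite_finite_induct)
       (auto simp: 0 intro: sum_product_closure_lincomb[where c = 1, OF _ _ assms(2), simplified])
qed

text \<open>Dynkin system argument over measurable rectangles. Intersecting with a box of finite
  measure gives one square integrable bound for all sets, so that complements become differences and
  disjoint unions dominated limits.\<close>

lemma sum_product_closure_indicator_box:
  assumes n: "n > 0" and A: "A \<in> sets M" "emeasure M A < \<infinity>"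
    and E: "E \<in> sets (PiM {..<n} (\<lambda>_. M))"
  shows "indicator (E \<inter> (\<Pi>\<^sub>E i\<in>{..<n}. A)) \<in> sum_product_closure M n"
proof -
  interpret product_sigma_finite "\<lambda>_. M" by (rule product_sigma_finite_const)
  let ?P = "PiM {..<n} (\<lambda>_. M)" and ?B = "\<Pi>\<^sub>E i\<in>{..<n}. A"
  let ?\<Omega> = "\<Pi>\<^sub>E i\<in>{..<n}. space M" and ?G = "prod_algebra {..<n} (\<lambda>_. M)"
  have B[measurable]: "?B \<in> sets ?P"
    using A by (intro sets_PiM_I_finite) auto
  have eB: "emeasure ?P ?B < \<infinity>"
    using A by (subst emeasure_PiM) (auto simp: power_less_top_ennreal)
  have sB: "square_integrable ?P (indicator ?B)"
    using eB by (auto simp: square_integrable_def power2_eq_square simp flip: indicator_inter_arith)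
  have box: "indicator ((\<Pi>\<^sub>E i\<in>{..<n}. X i) \<inter> ?B) \<in> sum_product_closure M n"
    if X: "\<And>i. i < n \<Longrightarrow> X i \<in> sets M" for X
  proof (rule sum_product_closure_limit)
    let ?gs = "[\<lambda>i. indicator (X i \<inter> A)]"
    have "sum_product_form M n ?gs"
      using A X unfolding sum_product_form_def
      by (auto intro!: admissible_factor_indicator le_less_trans[OF emeasure_mono[of "X _ \<inter> A" A]])
    then show "sum_product n ?gs \<in> sum_product_closure M n"
      by (rule sum_product_closure_base)
    show "indicator ((\<Pi>\<^sub>E i\<in>{..<n}. X i) \<inter> ?B) \<in> borel_measurable ?P"
      using X by (intro borel_measurable_indicator sets.Int B sets_PiM_I_finite) auto
    fix y assume "y \<in> space ?P"
    then have eq: "sum_product n ?gs y = indicator ((\<Pi>\<^sub>E i\<in>{..<n}. X i) \<inter> ?B) y"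
      by (auto simp: sum_product_def indicator_def space_PiM PiE_iff)
    then show "(\<lambda>k. sum_product n ?gs y) \<longlonglongrightarrow> indicator ((\<Pi>\<^sub>E i\<in>{..<n}. X i) \<inter> ?B) y"
      by simp
    show "\<bar>sum_product n ?gs y\<bar> \<le> indicator ?B y"
      by (simp add: eq indicator_def)
  qed (rule sB)
  have E': "E \<in> sigma_sets ?\<Omega> ?G"
    using E by (simp add: sets_PiM)
  have Om: "indicator (?\<Omega> \<inter> ?B) \<in> sum_product_closure M n"
    by (rule box) simp
  have "\<Omega> = space ?P" if "\<Omega> = ?\<Omega>" for \<Omega> using that by (simp add: space_PiM)
  show ?thesis
    using Int_stable_prod_algebra prod_algebra_sets_into_space E'
  proof (induction E rule: sigma_sets_induct_disjoint)
    case (basic E)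
    then show ?case by (auto simp: prod_algebra_eq_finite intro!: box)
  next
    case empty
    show ?case
      using sum_product_closure_sum[of "{}" _ n, OF _ n] by (simp add: indicator_def[abs_def])
  next
    case (compl E)
    have "indicator ((?\<Omega> - E) \<inter> ?B) = (\<lambda>y. indicator (?\<Omega> \<inter> ?B) y + (-1) * indicator (E \<inter> ?B) y :: real)"
      using compl(1)[THEN sigma_sets_into_sp[OF prod_algebra_sets_into_space]]
      by (auto simp: indicator_def fun_eq_iff)
    then show ?case
      using sum_product_closure_lincomb[OF Om compl(2) n, of "-1"] by simp
  next
    case (union E)
    have E[measurable]: "E i \<in> sets ?P" for i
      using union(2) unfolding sets_PiM by blast
    show ?case
    proof (rule sum_product_closure_limit)
      show "(\<lambda>y. \<Sum>i<k. indicator (E i \<inter> ?B) y) \<in> sum_product_closure M n" for k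
        by (intro sum_product_closure_sum union n)
      show "indicator ((\<Union>i. E i) \<inter> ?B) \<in> borel_measurable ?P"
        by measurable
      fix y
      have sums: "(\<lambda>i. indicator (E i \<inter> ?B) y :: real) sums indicator ((\<Union>i. E i) \<inter> ?B) y"
      proof (cases "y \<in> (\<Union>i. E i) \<inter> ?B")
        case True
        then obtain j where "y \<in> E j" by blast
        then have "(indicator (E i \<inter> ?B) y :: real) = (if i = j then 1 else 0)" for i
          using union(1) True by (auto simp: disjoint_family_on_def indicator_def)
        then show ?thesis
          using True sums_single[of j "\<lambda>_. 1 :: real"] by (simp add: indicator_def)
      next
        case False
        then have "(indicator (E i \<inter> ?B) y :: real) = 0" for i
          by (auto simp: indicator_def)
        moreover have "(indicator ((\<Union>i. E i) \<inter> ?B) y :: real) = 0"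
          using False by (simp add: indicator_def)
        ultimately show ?thesis by (simp only: sums_zero)
      qed
      show "(\<lambda>k. \<Sum>i<k. indicator (E i \<inter> ?B) y :: real) \<longlonglongrightarrow> indicator ((\<Union>i. E i) \<inter> ?B) y"
        using sums unfolding sums_def .
      show "\<bar>\<Sum>i<k. indicator (E i \<inter> ?B) y :: real\<bar> \<le> indicator ?B y" for k
      proof -
        have "(\<Sum>i<k. indicator (E i \<inter> ?B) y :: real) \<le> indicator ((\<Union>i. E i) \<inter> ?B) y"
          using sum_le_suminf[OF sums_summable[OF sums], of "{..<k}"] sums_unique[OF sums] by simp
        also have "\<dots> \<le> indicator ?B y" by (simp add: indicator_def)
        finally show ?thesis by (simp add: sum_nonneg)
      qed
    qed (rule sB)
  qed
qed

text \<open>The set is exhausted by its parts in the growing boxes over \<open>A k\<close>, which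
  are dominated by its own indicator. A point lies in almost all boxes because it has only finitely
  many coordinates.\<close>

lemma sum_product_closure_indicator:
  assumes n: "n > 0" and E: "E \<in> sets (PiM {..<n} (\<lambda>_. M))" "emeasure (PiM {..<n} (\<lambda>_. M)) E < \<infinity>"
  shows "indicator E \<in> sum_product_closure M n"
proof -
  interpret product_sigma_finite "\<lambda>_. M" by (rule product_sigma_finite_const)
  let ?P = "PiM {..<n} (\<lambda>_. M)"
  obtain A :: "nat \<Rightarrow> 'a set" where A: "range A \<subseteq> sets M" "(\<Union>i. A i) = space M"
    "\<And>i. emeasure M (A i) \<noteq> \<infinity>" "incseq A"
    using sigma_finite_incseq by metis
  show ?thesis
  proof (rule sum_product_closure_limit)
    show "indicator (E \<inter> (\<Pi>\<^sub>E i\<in>{..<n}. A k)) \<in> sum_product_closure M n" for k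
      using A by (intro sum_product_closure_indicator_box n E(1)) (auto simp: less_top)
    show "indicator E \<in> borel_measurable ?P"
      using E by simp
    show "square_integrable ?P (indicator E)"
      using E by (auto simp: square_integrable_def power2_eq_square simp flip: indicator_inter_arith)
    fix y assume y: "y \<in> space ?P"
    show "\<bar>indicator (E \<inter> (\<Pi>\<^sub>E i\<in>{..<n}. A k)) y :: real\<bar> \<le> indicator E y" for k
      by (simp add: indicator_def)
    have "\<forall>i\<in>{..<n}. \<forall>\<^sub>F k in sequentially. y i \<in> A k"
    proof
      fix i assume "i \<in> {..<n}"
      then obtain k where "y i \<in> A k"
        using y A(2) by (auto simp: space_PiM PiE_iff)
      then show "\<forall>\<^sub>F k in sequentially. y i \<in> A k"
        using A(4) by (auto simp: incseq_def eventually_sequentially)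
    qed
    then have "\<forall>\<^sub>F k in sequentially. \<forall>i\<in>{..<n}. y i \<in> A k"
      by (intro eventually_ball_finite) auto
    then have "\<forall>\<^sub>F k in sequentially. indicator (E \<inter> (\<Pi>\<^sub>E i\<in>{..<n}. A k)) y = (indicator E y :: real)"
      by eventually_elim (use y in \<open>auto simp: space_PiM PiE_iff indicator_def\<close>)
    then show "(\<lambda>k. indicator (E \<inter> (\<Pi>\<^sub>E i\<in>{..<n}. A k)) y :: real) \<longlonglongrightarrow> indicator E y"
      by (rule tendsto_eventually)
  qed
qed

text \<open>Induction over nonnegative measurable functions, with square integrability handed down:
  summands and approximations from below are dominated by the function itself.\<close>

lemma sum_product_closure_nonneg:
  assumes n: "n > 0" and g: "g \<in> borel_measurable (PiM {..<n} (\<lambda>_. M))" "\<And>y. 0 \<le> g y"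
    "square_integrable (PiM {..<n} (\<lambda>_. M)) g"
  shows "g \<in> sum_product_closure M n"
proof -
  let ?P = "PiM {..<n} (\<lambda>_. M)"
  have dom: "square_integrable ?P u"
    if "square_integrable ?P v" "u \<in> borel_measurable ?P" "\<And>y. y \<in> space ?P \<Longrightarrow> \<bar>u y\<bar> \<le> v y" for u v
    unfolding square_integrable_def
  proof (intro conjI that(2))
    show "integrable ?P (\<lambda>y. (u y)\<^sup>2)"
    proof (rule Bochner_Integration.integrable_bound[of ?P "\<lambda>y. (v y)\<^sup>2"])
      show "AE y in ?P. norm ((u y)\<^sup>2) \<le> norm ((v y)\<^sup>2)"
      proof (rule AE_I2)
        fix y assume "y \<in> space ?P"
        from power_mono[OF that(3)[OF this], of 2] show "norm ((u y)\<^sup>2) \<le> norm ((v y)\<^sup>2)" by simp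
      qed
    qed (use that in \<open>auto simp: square_integrable_def\<close>)
  qed
  show ?thesis
    using g
  proof (induction rule: borel_measurable_induct_real)
    case (set A)
    then have "integrable ?P (\<lambda>y. (indicator A y :: real)\<^sup>2)" by (simp add: square_integrable_def)
    moreover have "(indicator A y :: real)\<^sup>2 = indicator A y" for y by (simp add: indicator_def)
    ultimately have "integrable ?P (indicator A :: _ \<Rightarrow> real)" by simp
    then have "emeasure ?P A < \<infinity>"
      using set(1) by (simp add: integrable_indicator_iff)
    then show ?case by (intro sum_product_closure_indicator n set(1))
  next
    case (mult u c)
    show ?case
    \<comment> \<open>For c = 0 nothing can be inferred about u, so this case bypasses the induction
      hypothesis.\<close>
    proof (cases "c = 0")
      case True
      then show ?thesis
        using sum_product_closure_sum[of "{}" _ n, OF _ n] by simp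
    next
      case False
      have "square_integrable ?P u"
        using square_integrable_cmult[OF mult.prems, of "1 / c"] False by simp
      then show ?thesis
        using sum_product_closure_lincomb[OF sum_product_closure_sum[of "{}" _ n, OF _ n] mult.IH n, of _ c]
        by simp
    qed
  next
    case (add u v)
    have "square_integrable ?P u" "square_integrable ?P v"
      using add by (auto intro: dom[OF add.prems])
    then show ?case
      using sum_product_closure_lincomb[OF add.IH(2,1) n, of 1] by (simp add: add.commute)
  next
    case (seq U)
    have le: "U i y \<le> g y" if "y \<in> space ?P" for i y
      using seq(3) seq(4)[OF that]
      by (intro incseq_le[of "\<lambda>i. U i y"]) (auto simp: incseq_def le_fun_def)
    show ?case
    proof (rule sum_product_closure_limit)
      show "U i \<in> sum_product_closure M n" for i
        using le seq by (intro seq dom[OF seq.prems]) auto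
      show "g \<in> borel_measurable ?P" using seq.prems by (simp add: square_integrable_def)
    qed (use seq le in auto)
  qed
qed

text \<open>Positive and negative part are treated together: \<open>part\<close> with s = 1 and with
  s = -1.\<close>

lemma sum_product_dense:
  assumes n: "n > 0" and g: "square_integrable (PiM {..<n} (\<lambda>_. M)) g"
  obtains gs where "\<And>k. sum_product_form M n (gs k)"
    "tendsto_L2 (PiM {..<n} (\<lambda>_. M)) (\<lambda>k. sum_product n (gs k)) g"
proof -
  let ?P = "PiM {..<n} (\<lambda>_. M)"
  have part: "(\<lambda>y. max 0 (s * g y)) \<in> sum_product_closure M n" if "s\<^sup>2 = 1" for s
  proof (rule sum_product_closure_nonneg[OF n])
    have "(\<lambda>y. (max 0 (s * g y))\<^sup>2) = (\<lambda>y. if 0 \<le> s * g y then (g y)\<^sup>2 else 0)"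
      using that by (auto simp: max_def power_mult_distrib)
    have "integrable ?P (\<lambda>y. (max 0 (s * g y))\<^sup>2)"
    proof (rule Bochner_Integration.integrable_bound[of ?P "\<lambda>y. (g y)\<^sup>2"])
      have "(max 0 (s * g y))\<^sup>2 \<le> (g y)\<^sup>2" for y
        using that by (auto simp: max_def power_mult_distrib)
      then show "AE y in ?P. norm ((max 0 (s * g y))\<^sup>2) \<le> norm ((g y)\<^sup>2)"
        by simp
    qed (use g in \<open>auto simp: square_integrable_def\<close>)
    then show "square_integrable ?P (\<lambda>y. max 0 (s * g y))"
      using g by (auto simp: square_integrable_def)
  qed (use g in \<open>auto simp: square_integrable_def\<close>)
  have "(\<lambda>y. max 0 (1 * g y) + (-1) * max 0 ((-1) * g y)) \<in> sum_product_closure M n"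
    by (intro sum_product_closure_lincomb part n) auto
  moreover have "max 0 (1 * g y) + (-1) * max 0 ((-1) * g y) = g y" for y
    by (simp add: max_def)
  ultimately have "g \<in> sum_product_closure M n" by simp
  then have "\<forall>k. \<exists>gs. sum_product_form M n gs \<and> (\<integral>y. (sum_product n gs y - g y)\<^sup>2 \<partial>?P) < inverse (real (Suc k))"
    by (simp add: sum_product_closure_def)
  then obtain gs where gs: "\<And>k. sum_product_form M n (gs k)"
    "\<And>k. (\<integral>y. (sum_product n (gs k) y - g y)\<^sup>2 \<partial>?P) < inverse (real (Suc k))"
    by metis
  have "(\<lambda>k. \<integral>y. (sum_product n (gs k) y - g y)\<^sup>2 \<partial>?P) \<longlonglongrightarrow> 0"
    by (rule tendsto_sandwich[OF _ _ tendsto_const LIMSEQ_inverse_real_of_nat])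
       (auto intro!: always_eventually less_imp_le[OF gs(2)] simp del: of_nat_Suc)
  then show thesis
    using that[of gs] gs(1) g by (auto simp: tendsto_L2_def square_integrable_sum_product)
qed

end

section \<open>The space of counting measures\<close>

lemma counting_measuresD:
  assumes "\<mu> \<in> counting_measures lam"
  shows "sets \<mu> = sets lam" "space \<mu> = space lam" "sigma_finite_measure \<mu>"
    "\<And>B. B \<in> sets lam \<Longrightarrow> emeasure \<mu> B \<in> insert \<infinity> (range of_nat)"
  using assms by (auto simp: counting_measures_def dest: sets_eq_imp_space_eq)

lemma measurable_emeasure_counting_space [measurable]:
  "B \<in> sets lam \<Longrightarrow> (\<lambda>\<mu>. emeasure \<mu> B) \<in> borel_measurable (counting_space lam)"
  by (auto intro!: measurable_Sup1 measurable_vimage_algebra1 simp: counting_space_def)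

lemma measurable_counting_spaceI:
  assumes "\<And>a. a \<in> space A \<Longrightarrow> f a \<in> counting_measures lam"
    and "\<And>B. B \<in> sets lam \<Longrightarrow> (\<lambda>a. emeasure (f a) B) \<in> borel_measurable A"
  shows "f \<in> A \<rightarrow>\<^sub>M counting_space lam"
  using assms by (auto intro!: measurable_Sup2 measurable_vimage_algebra2 simp: counting_space_def)

lemma sets_add_dirac [simp]: "sets (add_dirac \<mu> y) = sets \<mu>"
  by (simp add: add_dirac_def sets.space_closed sets.sigma_sets_eq)

lemma sets_remove_dirac [simp]: "sets (remove_dirac \<mu> y) = sets \<mu>"
  by (simp add: remove_dirac_def sets.space_closed sets.sigma_sets_eq)

lemma add_dirac_counting_measures:
  assumes mu: "\<mu> \<in> counting_measures lam"
  shows "add_dirac \<mu> y \<in> counting_measures lam"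
proof -
  interpret sigma_finite_measure \<mu> using mu by (simp add: counting_measuresD)
  obtain A where A: "countable A" "A \<subseteq> sets \<mu>" "\<Union>A = space \<mu>" "\<forall>a\<in>A. emeasure \<mu> a \<noteq> \<infinity>"
    using sigma_finite_countable by blast
  have "sigma_finite_measure (add_dirac \<mu> y)"
  proof
    show "\<exists>A. countable A \<and> A \<subseteq> sets (add_dirac \<mu> y) \<and> \<Union>A = space (add_dirac \<mu> y) \<and>
        (\<forall>a\<in>A. emeasure (add_dirac \<mu> y) a \<noteq> \<infinity>)"
      using A by (intro exI[of _ A])
        (auto simp: sets_eq_imp_space_eq[OF sets_add_dirac] emeasure_add_dirac subset_eq split: split_indicator)
  qed
  moreover have "emeasure (add_dirac \<mu> y) B \<in> insert \<infinity> (range of_nat)" if B: "B \<in> sets lam" for B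
  proof -
    consider "emeasure \<mu> B = \<infinity>" | n where "emeasure \<mu> B = of_nat n"
      using counting_measuresD(4)[OF mu B] by auto
    then show ?thesis
    proof cases
      case 1
      then show ?thesis using B counting_measuresD(1)[OF mu] by (simp add: emeasure_add_dirac)
    next
      case 2
      then have "emeasure (add_dirac \<mu> y) B = of_nat (n + (if y \<in> B then 1 else 0))"
        using B counting_measuresD(1)[OF mu] by (simp add: emeasure_add_dirac)
      then show ?thesis by blast
    qed
  qed
  ultimately show ?thesis
    using counting_measuresD(1)[OF mu] by (simp add: counting_measures_def)
qed

lemma measurable_add_dirac:
  assumes [measurable]: "f \<in> A \<rightarrow>\<^sub>M counting_space lam" "g \<in> A \<rightarrow>\<^sub>M lam"
  shows "(\<lambda>a. add_dirac (f a) (g a)) \<in> A \<rightarrow>\<^sub>M counting_space lam"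
proof (rule measurable_counting_spaceI)
  fix a assume "a \<in> space A"
  then show "add_dirac (f a) (g a) \<in> counting_measures lam"
    using measurable_space[OF assms(1)] by (simp add: space_counting_space add_dirac_counting_measures)
next
  fix B assume B[measurable]: "B \<in> sets lam"
  have "(\<lambda>a. emeasure (f a) B) \<in> borel_measurable A"
    by (rule measurable_compose[OF assms(1) measurable_emeasure_counting_space[OF B]])
  then have "(\<lambda>a. emeasure (f a) B + indicator B (g a)) \<in> borel_measurable A"
    by measurable
  moreover have "emeasure (add_dirac (f a) (g a)) B = emeasure (f a) B + indicator B (g a)" if "a \<in> space A" for a
    using measurable_space[OF assms(1) that] B
    by (intro emeasure_add_dirac) (simp add: space_counting_space counting_measuresD)
  ultimately show "(\<lambda>a. emeasure (add_dirac (f a) (g a)) B) \<in> borel_measurable A"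
    by (simp cong: measurable_cong)
qed

section \<open>Cylinder events and the generation of the \<sigma>-field\<close>

definition cylinder :: "'y measure \<Rightarrow> ('y set \<times> nat) set \<Rightarrow> 'y measure set" where
  "cylinder lam S = {\<mu> \<in> counting_measures lam. \<forall>(C, k)\<in>S. emeasure \<mu> C = of_nat k}"

text \<open>Only finite counts in sets of finite intensity are prescribed, because these are the
  events that the test functions can detect. They nevertheless generate the whole \<sigma>-field,
  see \<open>sets_counting_space\<close>.\<close>

definition cylinders :: "'y measure \<Rightarrow> 'y measure set set" where
  "cylinders lam = cylinder lam ` {S. finite S \<and> (\<forall>(C, k)\<in>S. C \<in> sets lam \<and> emeasure lam C < \<infinity>)}"

lemma Int_stable_cylinders: "Int_stable (cylinders lam)"
proof (rule Int_stableI)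
  fix a b assume "a \<in> cylinders lam" "b \<in> cylinders lam"
  then obtain S T where "a = cylinder lam S" "b = cylinder lam T"
    "finite S" "\<forall>(C, k)\<in>S. C \<in> sets lam \<and> emeasure lam C < \<infinity>"
    "finite T" "\<forall>(C, k)\<in>T. C \<in> sets lam \<and> emeasure lam C < \<infinity>"
    by (auto simp: cylinders_def)
  moreover have "cylinder lam S \<inter> cylinder lam T = cylinder lam (S \<union> T)"
    by (auto simp: cylinder_def)
  ultimately show "a \<inter> b \<in> cylinders lam"
    by (auto simp: cylinders_def intro!: image_eqI[of _ _ "S \<union> T"])
qed

lemma space_in_cylinders: "counting_measures lam \<in> cylinders lam"
  unfolding cylinders_def by (rule image_eqI[of _ _ "{}"]) (auto simp: cylinder_def)

lemma cylinders_subset: "cylinders lam \<subseteq> Pow (counting_measures lam)"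
  by (auto simp: cylinders_def cylinder_def)

lemma cylinder_sets:
  assumes "finite S" "\<forall>(C, k)\<in>S. C \<in> sets lam"
  shows "cylinder lam S \<in> sets (counting_space lam)"
proof -
  have "cylinder lam S = {\<mu> \<in> space (counting_space lam). \<forall>p\<in>S. emeasure \<mu> (fst p) = of_nat (snd p)}"
    by (auto simp: cylinder_def space_counting_space)
  also have "\<dots> \<in> sets (counting_space lam)"
  proof (intro sets.sets_Collect_finite_All)
    fix p assume "p \<in> S"
    then have "fst p \<in> sets lam" using assms by auto
    from measurable_sets[OF measurable_emeasure_counting_space[OF this], of "{of_nat (snd p)}"]
    show "{\<mu> \<in> space (counting_space lam). emeasure \<mu> (fst p) = of_nat (snd p)} \<in> sets (counting_space lam)"
      by (simp add: vimage_def Int_def conj_commute)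
  qed fact
  finally show ?thesis .
qed

text \<open>The identity is shown to be measurable from the \<sigma>-field generated by cylinders.
  For a set of finite intensity every finite count is a cylinder; an arbitrary set is the limit of
  its intersections with an exhausting sequence of finite intensity.\<close>

lemma sets_counting_space:
  assumes "sigma_finite_measure lam"
  shows "sets (counting_space lam) = sigma_sets (counting_measures lam) (cylinders lam)"
proof (intro antisym subsetI)
  interpret sigma_finite_measure lam by fact
  define S where "S = sigma (counting_measures lam) (cylinders lam)"
  have space_S: "space S = counting_measures lam"
    and sets_S: "sets S = sigma_sets (counting_measures lam) (cylinders lam)"
    using cylinders_subset[of lam] by (auto simp: S_def)
  have fin: "(\<lambda>\<mu>. emeasure \<mu> C) \<in> borel_measurable S" if C: "C \<in> sets lam" "emeasure lam C < \<infinity>" for C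
  proof -
    have cyl: "{\<mu> \<in> space S. emeasure \<mu> C = of_nat k} \<in> sets S" for k :: nat
    proof -
      have "{\<mu> \<in> space S. emeasure \<mu> C = of_nat k} = cylinder lam {(C, k)}"
        by (auto simp: space_S cylinder_def)
      moreover have "cylinder lam {(C, k)} \<in> cylinders lam"
        unfolding cylinders_def using C by (intro imageI) auto
      ultimately show ?thesis
        unfolding sets_S by auto
    qed
    have "{\<mu> \<in> space S. emeasure \<mu> C = a} \<in> sets S" if "a \<in> insert \<infinity> (range of_nat)" for a
    proof (cases "a = \<infinity>")
      case True
      \<comment> \<open>Counts are natural numbers or infinite, so an infinite count is the failure
        of all finite ones.\<close>
      have "{\<mu> \<in> space S. emeasure \<mu> C = a} = space S - (\<Union>k. {\<mu> \<in> space S. emeasure \<mu> C = of_nat k})"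
        using counting_measuresD(4)[OF _ C(1)] True by (fastforce simp: space_S)
      also have "\<dots> \<in> sets S"
        using cyl by auto
      finally show ?thesis .
    qed (use that cyl in auto)
    then have "(\<lambda>\<mu>. emeasure \<mu> C) \<in> S \<rightarrow>\<^sub>M count_space (insert \<infinity> (range of_nat))"
      using counting_measuresD(4)[OF _ C(1)]
      by (subst measurable_count_space_eq_countable)
         (auto simp: vimage_def Int_def conj_commute space_S)
    then show ?thesis
      by (rule measurable_compose) simp
  qed
  obtain A :: "nat \<Rightarrow> 'a set" where A: "range A \<subseteq> sets lam" "(\<Union>i. A i) = space lam"
    "\<And>i. emeasure lam (A i) \<noteq> \<infinity>" "incseq A"
    using sigma_finite_incseq by metis
  have "(\<lambda>\<mu>. \<mu>) \<in> S \<rightarrow>\<^sub>M counting_space lam"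
  proof (rule measurable_counting_spaceI)
    fix B assume B: "B \<in> sets lam"
    have "emeasure \<mu> B = (SUP j. emeasure \<mu> (B \<inter> A j))" if "\<mu> \<in> space S" for \<mu>
    proof -
      have "(SUP j. emeasure \<mu> (B \<inter> A j)) = emeasure \<mu> (\<Union>j. B \<inter> A j)"
      proof (rule SUP_emeasure_incseq)
        show "incseq (\<lambda>j. B \<inter> A j)"
          using A(4) unfolding incseq_def by blast
      qed (use A B that in \<open>auto simp: space_S counting_measuresD\<close>)
      also have "(\<Union>j. B \<inter> A j) = B"
        using A(2) sets.sets_into_space[OF B] by auto
      finally show ?thesis by simp
    qed
    moreover have "(\<lambda>\<mu>. SUP j. emeasure \<mu> (B \<inter> A j)) \<in> borel_measurable S"
      using A B by (intro borel_measurable_SUP fin)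
        (auto simp: less_top intro!: le_less_trans[OF emeasure_mono[of "B \<inter> A _" "A _"]])
    ultimately show "(\<lambda>\<mu>. emeasure \<mu> B) \<in> borel_measurable S"
      by (simp cong: measurable_cong)
  qed (simp add: space_S)
  fix E assume E: "E \<in> sets (counting_space lam)"
  from measurable_sets[OF \<open>(\<lambda>\<mu>. \<mu>) \<in> S \<rightarrow>\<^sub>M counting_space lam\<close> E]
  show "E \<in> sigma_sets (counting_measures lam) (cylinders lam)"
    using sets.sets_into_space[OF E] by (simp add: sets_S space_S space_counting_space Int_absorb2)
next
  fix E assume E: "E \<in> sigma_sets (counting_measures lam) (cylinders lam)"
  have "cylinders lam \<subseteq> sets (counting_space lam)"
    by (auto simp: cylinders_def intro!: cylinder_sets)
  from sets.sigma_sets_subset[OF this] E show "E \<in> sets (counting_space lam)"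
    by (auto simp: space_counting_space)
qed

section \<open>Sums over the points of a Poisson process\<close>

locale poisson_points = prob_space M + lam: sigma_finite_measure lam
  for M :: "'w measure" and lam :: "'y measure" +
  fixes \<eta> :: "'w \<Rightarrow> 'y measure" and X :: "nat \<Rightarrow> 'w \<Rightarrow> 'y"
  assumes poisson: "poisson_process M lam \<eta>" and points: "point_representation M lam \<eta> X"
begin

abbreviation "N \<equiv> counting_space lam"

definition I :: "'w \<Rightarrow> nat set" where "I \<omega> = point_indices (\<eta> \<omega>)"

definition reduced :: "'w \<Rightarrow> nat \<Rightarrow> 'y measure" where
  "reduced \<omega> i = remove_dirac (\<eta> \<omega>) (X i \<omega>)"

text \<open>The left side of the Mecke equation: each point of \<open>\<eta>\<close> is paired with
  the configuration that remains when it is removed.\<close>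

definition psum :: "('y measure \<times> 'y \<Rightarrow> ennreal) \<Rightarrow> 'w \<Rightarrow> ennreal" where
  "psum f \<omega> = (\<integral>\<^sup>+i. f (reduced \<omega> i, X i \<omega>) \<partial>count_space (I \<omega>))"

lemma eta_measurable [measurable]: "\<eta> \<in> M \<rightarrow>\<^sub>M N"
  using poisson by (simp add: poisson_process_def)

lemma eta_counting: "\<omega> \<in> space M \<Longrightarrow> \<eta> \<omega> \<in> counting_measures lam"
  using measurable_space[OF eta_measurable] by (simp add: space_counting_space)

lemmas sets_eta = counting_measuresD(1)[OF eta_counting]
  and space_eta = counting_measuresD(2)[OF eta_counting]

lemma mem_I_iff: "\<omega> \<in> space M \<Longrightarrow> i \<in> I \<omega> \<longleftrightarrow> of_nat i < emeasure (\<eta> \<omega>) (space lam)"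
  by (simp add: I_def point_indices_def space_eta)

text \<open>Measurability of \<open>X i\<close> is granted only on a nonempty state space; on an
  empty one the total mass is 0, so no index occurs.\<close>

lemma X_in_space: "\<omega> \<in> space M \<Longrightarrow> i \<in> I \<omega> \<Longrightarrow> X i \<omega> \<in> space lam"
proof (cases "space lam = {}")
  case False
  assume "\<omega> \<in> space M"
  with False show ?thesis
    using points by (auto simp: point_representation_def dest: measurable_space)
qed (simp add: mem_I_iff)

lemma emeasure_eta:
  assumes "\<omega> \<in> space M" "B \<in> sets lam"
  shows "emeasure (\<eta> \<omega>) B = emeasure (count_space UNIV) {i \<in> I \<omega>. X i \<omega> \<in> B}"
proof -
  have "emeasure (\<eta> \<omega>) B = (\<Sum>i. indicator {i \<in> I \<omega>. X i \<omega> \<in> B} i)"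
  proof -
    have "emeasure (\<eta> \<omega>) B = (\<Sum>i. if i \<in> point_indices (\<eta> \<omega>) then indicator B (X i \<omega>) else 0)"
      using assms points by (simp add: point_representation_def)
    moreover have "(\<lambda>i. if i \<in> point_indices (\<eta> \<omega>) then indicator B (X i \<omega>) else 0) =
        (\<lambda>i. indicator {i \<in> I \<omega>. X i \<omega> \<in> B} i :: ennreal)"
      by (auto simp: fun_eq_iff I_def indicator_def)
    ultimately show ?thesis by simp
  qed
  also have "\<dots> = (\<integral>\<^sup>+i. indicator {i \<in> I \<omega>. X i \<omega> \<in> B} i \<partial>count_space UNIV)"
    by (rule nn_integral_count_space_nat[symmetric])
  finally show ?thesis by simp
qed

lemma emeasure_reduced:
  assumes "\<omega> \<in> space M" "i \<in> I \<omega>" "A \<in> sets lam"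
  shows "emeasure (reduced \<omega> i) A = emeasure (\<eta> \<omega>) A - indicator A (X i \<omega>)"
  unfolding reduced_def
  using assms points X_in_space[OF assms(1)]
  by (intro emeasure_remove_dirac[where x = "\<lambda>i. X i \<omega>"])
     (auto simp: point_representation_def I_def sets_eta space_eta)

text \<open>Subtraction of extended reals is truncated, so adding the point back is justified by the
  fact that it is counted in \<open>\<eta> \<omega>\<close>. The additive form also covers infinite
  counts without a case distinction.\<close>

lemma emeasure_reduced_add:
  assumes "\<omega> \<in> space M" "i \<in> I \<omega>" "A \<in> sets lam"
  shows "emeasure (reduced \<omega> i) A + indicator A (X i \<omega>) = emeasure (\<eta> \<omega>) A"
proof -
  have "indicator A (X i \<omega>) \<le> emeasure (\<eta> \<omega>) A"
  proof (cases "X i \<omega> \<in> A")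
    case True
    have "emeasure (count_space UNIV) {i} \<le> emeasure (\<eta> \<omega>) A"
      using assms True unfolding emeasure_eta[OF assms(1,3)] by (intro emeasure_mono) auto
    then show ?thesis using True by simp
  qed simp
  then show ?thesis
    by (simp add: emeasure_reduced[OF assms] diff_add_cancel_ennreal)
qed

lemma reduced_counting:
  assumes "\<omega> \<in> space M" "i \<in> I \<omega>"
  shows "reduced \<omega> i \<in> counting_measures lam"
proof -
  have sets: "sets (reduced \<omega> i) = sets lam"
    using assms by (simp add: reduced_def sets_eta)
  interpret sigma_finite_measure "\<eta> \<omega>"
    by (rule counting_measuresD(3)[OF eta_counting[OF assms(1)]])
  obtain A where A: "countable A" "A \<subseteq> sets (\<eta> \<omega>)" "\<Union>A = space (\<eta> \<omega>)" "\<forall>a\<in>A. emeasure (\<eta> \<omega>) a \<noteq> \<infinity>"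
    using sigma_finite_countable by blast
  have "sigma_finite_measure (reduced \<omega> i)"
  proof
    show "\<exists>A. countable A \<and> A \<subseteq> sets (reduced \<omega> i) \<and> \<Union>A = space (reduced \<omega> i) \<and>
        (\<forall>a\<in>A. emeasure (reduced \<omega> i) a \<noteq> \<infinity>)"
      using A assms sets by (intro exI[of _ A])
        (auto simp: sets_eq_imp_space_eq[OF sets] sets_eta space_eta emeasure_reduced subset_eq
          ennreal_minus_eq_top)
  qed
  moreover have "emeasure (reduced \<omega> i) B \<in> insert \<infinity> (range of_nat)" if B: "B \<in> sets lam" for B
  proof -
    consider "emeasure (\<eta> \<omega>) B = \<infinity>" | n where "emeasure (\<eta> \<omega>) B = of_nat n"
      using counting_measuresD(4)[OF eta_counting B] assms by auto
    then show ?thesis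
    proof cases
      case 1
      then show ?thesis using B assms by (simp add: emeasure_reduced split: split_indicator)
    next
      case 2
      then have "emeasure (reduced \<omega> i) B = of_nat (n - (if X i \<omega> \<in> B then 1 else 0))"
        using B assms by (cases n) (auto simp: emeasure_reduced add.commute split: split_indicator)
      then show ?thesis by blast
    qed
  qed
  ultimately show ?thesis
    using sets by (simp add: counting_measures_def)
qed

lemma add_dirac_reduced:
  assumes "\<omega> \<in> space M" "i \<in> I \<omega>"
  shows "add_dirac (reduced \<omega> i) (X i \<omega>) = \<eta> \<omega>"
  using assms counting_measuresD(1)[OF reduced_counting[OF assms]]
  by (intro measure_eqI) (auto simp: sets_eta emeasure_add_dirac emeasure_reduced_add)

text \<open>Quantities attached to the point with index i are meaningful only on the event that i
  occurs. Measurability is established on that event and then extended by 0.\<close>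

lemma measurable_at_point:
  assumes "f \<in> restrict_space M {\<omega>. i \<in> I \<omega>} \<rightarrow>\<^sub>M borel"
  shows "(\<lambda>\<omega>. if i \<in> I \<omega> then f \<omega> else (0 :: 'b :: {topological_space, zero})) \<in> borel_measurable M"
proof (subst measurable_If_restrict_space_iff)
  show "{\<omega> \<in> space M. i \<in> I \<omega>} \<in> sets M"
    by (simp add: mem_I_iff cong: conj_cong)
qed (use assms in auto)

lemma X_measurable_at_point:
  "X i \<in> restrict_space M {\<omega>. i \<in> I \<omega>} \<rightarrow>\<^sub>M lam"
proof (cases "space lam = {}")
  case True
  then have "space (restrict_space M {\<omega>. i \<in> I \<omega>}) = {}"
    using X_in_space by (auto simp: space_restrict_space)
  then show ?thesis by (simp add: measurable_def)
next
  case False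
  then show ?thesis
    using points by (auto simp: point_representation_def intro: measurable_restrict_space1)
qed

lemma reduced_measurable_at_point:
  "(\<lambda>\<omega>. reduced \<omega> i) \<in> restrict_space M {\<omega>. i \<in> I \<omega>} \<rightarrow>\<^sub>M N"
proof (rule measurable_counting_spaceI)
  let ?R = "restrict_space M {\<omega>. i \<in> I \<omega>}"
  show "reduced \<omega> i \<in> counting_measures lam" if "\<omega> \<in> space ?R" for \<omega>
    using that by (simp add: space_restrict_space reduced_counting)
  fix B assume [measurable]: "B \<in> sets lam"
  have "(\<lambda>\<omega>. emeasure (\<eta> \<omega>) B) \<in> borel_measurable ?R"
    by (intro measurable_restrict_space1) measurable
  moreover have "(\<lambda>\<omega>. indicator B (X i \<omega>) :: ennreal) \<in> borel_measurable ?R"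
    by (rule measurable_compose[OF X_measurable_at_point]) simp
  ultimately have "(\<lambda>\<omega>. emeasure (\<eta> \<omega>) B - indicator B (X i \<omega>)) \<in> borel_measurable ?R"
    by measurable
  then show "(\<lambda>\<omega>. emeasure (reduced \<omega> i) B) \<in> borel_measurable ?R"
    by (rule measurable_cong[THEN iffD1, rotated])
       (auto simp: space_restrict_space emeasure_reduced)
qed

lemma measurable_reduced_if:
  assumes "f \<in> borel_measurable (N \<Otimes>\<^sub>M lam)"
  shows "(\<lambda>\<omega>. if i \<in> I \<omega> then f (reduced \<omega> i, X i \<omega>) else (0 :: 'b :: {topological_space, zero})) \<in> borel_measurable M"
  by (rule measurable_at_point)
     (rule measurable_compose[OF measurable_Pair[OF reduced_measurable_at_point X_measurable_at_point] assms])

lemma psum_eq_suminf: "psum f \<omega> = (\<Sum>i. if i \<in> I \<omega> then f (reduced \<omega> i, X i \<omega>) else 0)"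
proof -
  have "psum f \<omega> = (\<integral>\<^sup>+i. (if i \<in> I \<omega> then f (reduced \<omega> i, X i \<omega>) else 0) \<partial>count_space UNIV)"
    unfolding psum_def by (subst nn_integral_count_space_indicator) (auto intro!: nn_integral_cong)
  then show ?thesis by (simp add: nn_integral_count_space_nat)
qed

lemma psum_measurable [measurable]:
  assumes "f \<in> borel_measurable (N \<Otimes>\<^sub>M lam)"
  shows "psum f \<in> borel_measurable M"
  unfolding psum_eq_suminf[abs_def]
  by (intro borel_measurable_suminf_order measurable_reduced_if assms)

lemma eta_law:
  assumes "B \<in> sets lam" "A \<in> sets borel"
  shows "emeasure M {\<omega> \<in> space M. emeasure (\<eta> \<omega>) B \<in> A} = emeasure (poisson_law (emeasure lam B)) A"
proof -
  have "poisson_law (emeasure lam B) = distr M borel (\<lambda>\<omega>. emeasure (\<eta> \<omega>) B)"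
    using poisson assms by (simp add: poisson_process_def)
  then show ?thesis
    using assms by (simp add: emeasure_distr vimage_def Int_def conj_commute)
qed

lemma eta_eq_prob:
  assumes "B \<in> sets lam" "emeasure lam B < \<infinity>"
  shows "prob {\<omega> \<in> space M. emeasure (\<eta> \<omega>) B = of_nat k} =
    enn2real (emeasure lam B) ^ k / fact k * exp (- enn2real (emeasure lam B))"
proof -
  let ?r = "enn2real (emeasure lam B)"
  have r: "emeasure lam B = ennreal ?r"
    using assms by simp
  have "measure (poisson_law (emeasure lam B)) {of_nat k :: ennreal} = ?r ^ k / fact k * exp (- ?r)"
  proof (cases "emeasure lam B = 0")
    \<comment> \<open>At intensity 0 the formula describes the point mass at 0, by the convention 0
      ^ 0 = 1.\<close>
    case True
    then show ?thesis
      by (auto simp: poisson_law_def measure_return indicator_def)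
  next
    case False
    then have "?r > 0" using assms by (simp add: enn2real_positive_iff zero_less_iff_neq_zero)
    have "measure (poisson_law (emeasure lam B)) {of_nat k :: ennreal} =
        measure (measure_pmf (poisson_pmf ?r)) (of_nat -` {of_nat k :: ennreal})"
      using False assms by (auto simp: poisson_law_def measure_distr less_top)
    also have "of_nat -` {of_nat k :: ennreal} = {k}" by auto
    finally show ?thesis using \<open>?r > 0\<close> by (simp add: measure_pmf_single)
  qed
  then show ?thesis
    using eta_law[OF assms(1), of "{of_nat k}"] by (simp add: measure_def)
qed

lemma eta_finite:
  assumes "B \<in> sets lam" "emeasure lam B < \<infinity>"
  shows "AE \<omega> in M. emeasure (\<eta> \<omega>) B < \<infinity>"
proof -
  have "emeasure (poisson_law (emeasure lam B)) {\<infinity>} = 0"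
  proof (cases "emeasure lam B = 0")
    case False
    have "of_nat -` {\<infinity> :: ennreal} = {}" by auto
    then show ?thesis
      using False assms by (simp add: poisson_law_def emeasure_distr)
  qed (auto simp: poisson_law_def)
  then have "emeasure M {\<omega> \<in> space M. emeasure (\<eta> \<omega>) B = \<infinity>} = 0"
    using eta_law[OF assms(1), of "{\<infinity>}"] by simp
  then show ?thesis
    using assms by (intro AE_I'[of "{\<omega> \<in> space M. emeasure (\<eta> \<omega>) B = \<infinity>}"])
      (auto simp: less_top[symmetric] null_sets_def)
qed

section \<open>The Mecke equation\<close>

text \<open>The points \<open>X i\<close> need not be functions of \<open>\<eta>\<close>; the second condition records that the sum over
  them nevertheless is one, up to null sets.\<close>

definition mecke_class :: "('y measure \<times> 'y \<Rightarrow> ennreal) set" where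
  "mecke_class = {f \<in> borel_measurable (N \<Otimes>\<^sub>M lam).
     (\<exists>\<Phi>\<in>borel_measurable N. AE \<omega> in M. psum f \<omega> = \<Phi> (\<eta> \<omega>)) \<and>
     (\<integral>\<^sup>+\<omega>. psum f \<omega> \<partial>M) = (\<integral>\<^sup>+\<omega>. \<integral>\<^sup>+y. f (\<eta> \<omega>, y) \<partial>lam \<partial>M)}"

lemma mecke_classI:
  assumes "f \<in> borel_measurable (N \<Otimes>\<^sub>M lam)" "\<Phi> \<in> borel_measurable N"
    and "AE \<omega> in M. psum f \<omega> = \<Phi> (\<eta> \<omega>)"
    and "(\<integral>\<^sup>+\<omega>. psum f \<omega> \<partial>M) = (\<integral>\<^sup>+\<omega>. \<integral>\<^sup>+y. f (\<eta> \<omega>, y) \<partial>lam \<partial>M)"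
  shows "f \<in> mecke_class"
  using assms by (auto simp: mecke_class_def)

lemma mecke_classD:
  assumes "f \<in> mecke_class"
  shows "f \<in> borel_measurable (N \<Otimes>\<^sub>M lam)"
    and "(\<integral>\<^sup>+\<omega>. psum f \<omega> \<partial>M) = (\<integral>\<^sup>+\<omega>. \<integral>\<^sup>+y. f (\<eta> \<omega>, y) \<partial>lam \<partial>M)"
    and "\<exists>\<Phi>\<in>borel_measurable N. AE \<omega> in M. psum f \<omega> = \<Phi> (\<eta> \<omega>)"
  using assms by (auto simp: mecke_class_def)

lemma section_measurable:
  assumes [measurable]: "f \<in> borel_measurable (N \<Otimes>\<^sub>M lam)" and \<mu>: "\<mu> \<in> counting_measures lam"
  shows "(\<lambda>y. f (\<mu>, y)) \<in> borel_measurable lam"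
  using measurable_Pair2[OF assms(1), of \<mu>] \<mu> by (simp add: space_counting_space)

lemma eta_section_measurable:
  assumes [measurable]: "f \<in> borel_measurable (N \<Otimes>\<^sub>M lam)"
  shows "(\<lambda>(\<omega>, y). f (\<eta> \<omega>, y)) \<in> borel_measurable (M \<Otimes>\<^sub>M lam)"
  by measurable

lemma eta_inner_measurable:
  fixes f :: "'y measure \<times> 'y \<Rightarrow> ennreal"
  assumes [measurable]: "f \<in> borel_measurable (N \<Otimes>\<^sub>M lam)"
  shows "(\<lambda>\<omega>. \<integral>\<^sup>+y. f (\<eta> \<omega>, y) \<partial>lam) \<in> borel_measurable M"
  by measurable

lemma psum_cong:
  assumes "\<And>i. i \<in> I \<omega> \<Longrightarrow> f (reduced \<omega> i, X i \<omega>) = g (reduced \<omega> i, X i \<omega>)"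
  shows "psum f \<omega> = psum g \<omega>"
  unfolding psum_def using assms by (intro nn_integral_cong) auto

text \<open>Membership in the class depends on a function only through its values at pairs (\<eta>,
  y) and at the reduced pairs, so agreement is asked for at these two places.\<close>

lemma mecke_cong:
  assumes f: "f \<in> mecke_class" and g: "g \<in> borel_measurable (N \<Otimes>\<^sub>M lam)"
    and eq: "AE \<omega> in M. \<forall>y\<in>space lam. f (\<eta> \<omega>, y) = g (\<eta> \<omega>, y)"
      "AE \<omega> in M. \<forall>i\<in>I \<omega>. f (reduced \<omega> i, X i \<omega>) = g (reduced \<omega> i, X i \<omega>)"
  shows "g \<in> mecke_class"
proof -
  from mecke_classD(3)[OF f] obtain \<Phi> where \<Phi>: "\<Phi> \<in> borel_measurable N" "AE \<omega> in M. psum f \<omega> = \<Phi> (\<eta> \<omega>)"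
    by blast
  have psum: "AE \<omega> in M. psum g \<omega> = psum f \<omega>"
    using eq(2) by eventually_elim (rule psum_cong, simp)
  have "AE \<omega> in M. psum g \<omega> = \<Phi> (\<eta> \<omega>)"
    using psum \<Phi>(2) by eventually_elim simp
  moreover have "(\<integral>\<^sup>+\<omega>. psum g \<omega> \<partial>M) = (\<integral>\<^sup>+\<omega>. psum f \<omega> \<partial>M)"
    by (rule nn_integral_cong_AE[OF psum])
  moreover have "AE \<omega> in M. (\<integral>\<^sup>+y. f (\<eta> \<omega>, y) \<partial>lam) = (\<integral>\<^sup>+y. g (\<eta> \<omega>, y) \<partial>lam)"
    using eq(1) by eventually_elim (rule nn_integral_cong, simp)
  then have "(\<integral>\<^sup>+\<omega>. \<integral>\<^sup>+y. f (\<eta> \<omega>, y) \<partial>lam \<partial>M) = (\<integral>\<^sup>+\<omega>. \<integral>\<^sup>+y. g (\<eta> \<omega>, y) \<partial>lam \<partial>M)"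
    by (rule nn_integral_cong_AE)
  ultimately show ?thesis
    using g \<Phi>(1) mecke_classD(2)[OF f] by (auto simp: mecke_class_def)
qed

lemma mecke_cong':
  assumes "f \<in> mecke_class" "g \<in> borel_measurable (N \<Otimes>\<^sub>M lam)"
    and eq: "\<And>p. p \<in> space (N \<Otimes>\<^sub>M lam) \<Longrightarrow> f p = g p"
  shows "g \<in> mecke_class"
  by (rule mecke_cong[OF assms(1,2)])
     (auto intro!: AE_I2 eq simp: space_pair_measure space_counting_space eta_counting reduced_counting X_in_space)

lemma mecke_cmult:
  assumes f: "f \<in> mecke_class"
  shows "(\<lambda>p. c * f p) \<in> mecke_class"
proof -
  note [measurable] = mecke_classD(1)[OF f]
  from mecke_classD(3)[OF f] obtain \<Phi> where \<Phi>: "\<Phi> \<in> borel_measurable N" "AE \<omega> in M. psum f \<omega> = \<Phi> (\<eta> \<omega>)"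
    by blast
  have psum: "psum (\<lambda>p. c * f p) \<omega> = c * psum f \<omega>" for \<omega>
    by (simp add: psum_def nn_integral_cmult)
  have "AE \<omega> in M. psum (\<lambda>p. c * f p) \<omega> = c * \<Phi> (\<eta> \<omega>)"
    using \<Phi>(2) by eventually_elim (simp add: psum)
  moreover have "(\<lambda>\<mu>. c * \<Phi> \<mu>) \<in> borel_measurable N"
    using \<Phi>(1) by measurable
  moreover have "(\<integral>\<^sup>+\<omega>. \<integral>\<^sup>+y. c * f (\<eta> \<omega>, y) \<partial>lam \<partial>M) = (\<integral>\<^sup>+\<omega>. c * \<integral>\<^sup>+y. f (\<eta> \<omega>, y) \<partial>lam \<partial>M)"
    by (intro nn_integral_cong nn_integral_cmult section_measurable mecke_classD(1)[OF f] eta_counting)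
  moreover have "\<dots> = c * (\<integral>\<^sup>+\<omega>. \<integral>\<^sup>+y. f (\<eta> \<omega>, y) \<partial>lam \<partial>M)"
    by (intro nn_integral_cmult eta_inner_measurable mecke_classD(1)[OF f])
  moreover have "(\<integral>\<^sup>+\<omega>. c * psum f \<omega> \<partial>M) = c * (\<integral>\<^sup>+\<omega>. psum f \<omega> \<partial>M)"
    by (intro nn_integral_cmult) measurable
  ultimately show ?thesis
    using mecke_classD(2)[OF f] by (auto simp: mecke_class_def ext[OF psum])
qed

lemma mecke_suminf:
  assumes f: "\<And>n::nat. f n \<in> mecke_class"
  shows "(\<lambda>p. \<Sum>n. f n p) \<in> mecke_class"
proof -
  note [measurable] = mecke_classD(1)[OF f]
  have "\<forall>n. \<exists>\<Phi>\<in>borel_measurable N. AE \<omega> in M. psum (f n) \<omega> = \<Phi> (\<eta> \<omega>)"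
    using mecke_classD(3)[OF f] by blast
  then obtain \<Phi> where \<Phi>: "\<And>n. \<Phi> n \<in> borel_measurable N" "\<And>n. AE \<omega> in M. psum (f n) \<omega> = \<Phi> n (\<eta> \<omega>)"
    by metis
  note [measurable] = \<Phi>(1)
  have psum: "psum (\<lambda>p. \<Sum>n. f n p) \<omega> = (\<Sum>n. psum (f n) \<omega>)" for \<omega>
    unfolding psum_def by (rule nn_integral_suminf) simp
  have "AE \<omega> in M. \<forall>n. psum (f n) \<omega> = \<Phi> n (\<eta> \<omega>)"
    using \<Phi>(2) by (simp add: AE_all_countable)
  then have "AE \<omega> in M. psum (\<lambda>p. \<Sum>n. f n p) \<omega> = (\<Sum>n. \<Phi> n (\<eta> \<omega>))"
    by eventually_elim (simp add: psum)
  moreover have "(\<lambda>\<mu>. \<Sum>n. \<Phi> n \<mu>) \<in> borel_measurable N"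
    by measurable
  moreover have "(\<integral>\<^sup>+\<omega>. \<integral>\<^sup>+y. (\<Sum>n. f n (\<eta> \<omega>, y)) \<partial>lam \<partial>M) = (\<integral>\<^sup>+\<omega>. (\<Sum>n. \<integral>\<^sup>+y. f n (\<eta> \<omega>, y) \<partial>lam) \<partial>M)"
    by (intro nn_integral_cong nn_integral_suminf section_measurable mecke_classD(1)[OF f] eta_counting)
  moreover have "\<dots> = (\<Sum>n. \<integral>\<^sup>+\<omega>. \<integral>\<^sup>+y. f n (\<eta> \<omega>, y) \<partial>lam \<partial>M)"
    by (intro nn_integral_suminf eta_inner_measurable mecke_classD(1)[OF f])
  moreover have "(\<integral>\<^sup>+\<omega>. (\<Sum>n. psum (f n) \<omega>) \<partial>M) = (\<Sum>n. \<integral>\<^sup>+\<omega>. psum (f n) \<omega> \<partial>M)"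
    by (intro nn_integral_suminf) measurable
  ultimately show ?thesis
    using mecke_classD(2)[OF f] by (auto simp: mecke_class_def ext[OF psum])
qed

lemma mecke_zero: "(\<lambda>_. 0) \<in> mecke_class"
  by (auto simp: mecke_class_def psum_def intro!: bexI[of _ "\<lambda>_. 0"])

lemma mecke_sum:
  assumes "finite A" "\<And>a. a \<in> A \<Longrightarrow> f a \<in> mecke_class"
  shows "(\<lambda>p. \<Sum>a\<in>A. f a p) \<in> mecke_class"
proof -
  from ex_bij_betw_nat_finite[OF assms(1)] obtain t where t: "bij_betw t {0..<card A} A" by blast
  have "(\<lambda>p. \<Sum>n. if n < card A then f (t n) p else 0) \<in> mecke_class"
  proof (rule mecke_suminf)
    fix n
    show "(\<lambda>p. if n < card A then f (t n) p else 0) \<in> mecke_class"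
      using assms(2)[of "t n"] mecke_zero bij_betw_apply[OF t, of n] by (cases "n < card A") auto
  qed
  moreover have "(\<Sum>n. if n < card A then f (t n) p else 0) = (\<Sum>a\<in>A. f a p)" for p
  proof -
    have "(\<Sum>n. if n < card A then f (t n) p else 0) = (\<Sum>n\<in>{0..<card A}. f (t n) p)"
      by (subst suminf_finite[of "{0..<card A}"]) auto
    also have "\<dots> = (\<Sum>a\<in>A. f a p)"
      by (rule sum.reindex_bij_betw[OF t])
    finally show ?thesis .
  qed
  ultimately show ?thesis by simp
qed

lemma mecke_add:
  assumes "f \<in> mecke_class" "g \<in> mecke_class"
  shows "(\<lambda>p. f p + g p) \<in> mecke_class"
  using mecke_sum[of "{True, False}" "\<lambda>b. if b then f else g"] assms by auto

lemma mecke_incseq: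
  assumes f: "\<And>n::nat. f n \<in> mecke_class" and inc: "incseq f"
  shows "(\<lambda>p. SUP n. f n p) \<in> mecke_class"
proof -
  note [measurable] = mecke_classD(1)[OF f]
  have "\<forall>n. \<exists>\<Phi>\<in>borel_measurable N. AE \<omega> in M. psum (f n) \<omega> = \<Phi> (\<eta> \<omega>)"
    using mecke_classD(3)[OF f] by blast
  then obtain \<Phi> where \<Phi>: "\<And>n. \<Phi> n \<in> borel_measurable N" "\<And>n. AE \<omega> in M. psum (f n) \<omega> = \<Phi> n (\<eta> \<omega>)"
    by metis
  note [measurable] = \<Phi>(1)
  have le: "f n p \<le> f m p" if "n \<le> m" for n m p
    using incseqD[OF inc that] by (rule le_funD)
  have psum: "psum (\<lambda>p. SUP n. f n p) \<omega> = (SUP n. psum (f n) \<omega>)" for \<omega>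
    unfolding psum_def by (rule nn_integral_monotone_convergence_SUP) (auto simp: incseq_def le_fun_def le)
  have "AE \<omega> in M. \<forall>n. psum (f n) \<omega> = \<Phi> n (\<eta> \<omega>)"
    using \<Phi>(2) by (simp add: AE_all_countable)
  then have "AE \<omega> in M. psum (\<lambda>p. SUP n. f n p) \<omega> = (SUP n. \<Phi> n (\<eta> \<omega>))"
    by eventually_elim (simp add: psum)
  moreover have "(\<lambda>\<mu>. SUP n. \<Phi> n \<mu>) \<in> borel_measurable N"
    by measurable
  moreover have "(\<integral>\<^sup>+\<omega>. \<integral>\<^sup>+y. (SUP n. f n (\<eta> \<omega>, y)) \<partial>lam \<partial>M) = (\<integral>\<^sup>+\<omega>. (SUP n. \<integral>\<^sup>+y. f n (\<eta> \<omega>, y) \<partial>lam) \<partial>M)"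
    by (intro nn_integral_cong nn_integral_monotone_convergence_SUP section_measurable mecke_classD(1)[OF f] eta_counting)
       (auto simp: incseq_def le_fun_def le)
  moreover have "\<dots> = (SUP n. \<integral>\<^sup>+\<omega>. \<integral>\<^sup>+y. f n (\<eta> \<omega>, y) \<partial>lam \<partial>M)"
    by (intro nn_integral_monotone_convergence_SUP eta_inner_measurable mecke_classD(1)[OF f])
       (auto simp: incseq_def le_fun_def intro!: nn_integral_mono le)
  moreover have "(\<integral>\<^sup>+\<omega>. (SUP n. psum (f n) \<omega>) \<partial>M) = (SUP n. \<integral>\<^sup>+\<omega>. psum (f n) \<omega> \<partial>M)"
    by (intro nn_integral_monotone_convergence_SUP psum_measurable)
       (auto simp: incseq_def le_fun_def psum_def intro!: nn_integral_mono le)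
  ultimately show ?thesis
    using mecke_classD(2)[OF f] by (auto simp: mecke_class_def ext[OF psum])
qed

text \<open>Serves the complement step of the Dynkin argument. The equation for the difference is
  obtained by cancelling f, which is legitimate because the sums over g, and hence over f, have
  finite expectation.\<close>

lemma mecke_diff:
  assumes f: "f \<in> mecke_class" and g: "g \<in> mecke_class" and h: "h \<in> borel_measurable (N \<Otimes>\<^sub>M lam)"
    and eq: "\<And>p. p \<in> space (N \<Otimes>\<^sub>M lam) \<Longrightarrow> f p + h p = g p"
    and fin: "(\<integral>\<^sup>+\<omega>. psum g \<omega> \<partial>M) < \<infinity>"
  shows "h \<in> mecke_class"
proof -
  note [measurable] = mecke_classD(1)[OF f] mecke_classD(1)[OF g] h
  from mecke_classD(3)[OF f] obtain \<Phi> where \<Phi>[measurable]: "\<Phi> \<in> borel_measurable N" and f\<Phi>: "AE \<omega> in M. psum f \<omega> = \<Phi> (\<eta> \<omega>)"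
    by blast
  from mecke_classD(3)[OF g] obtain \<Psi> where \<Psi>[measurable]: "\<Psi> \<in> borel_measurable N" and g\<Psi>: "AE \<omega> in M. psum g \<omega> = \<Psi> (\<eta> \<omega>)"
    by blast
  have psum: "psum f \<omega> + psum h \<omega> = psum g \<omega>" if "\<omega> \<in> space M" for \<omega>
  proof -
    have "psum f \<omega> + psum h \<omega> = psum (\<lambda>p. f p + h p) \<omega>"
      by (simp add: psum_def nn_integral_add)
    also have "\<dots> = psum g \<omega>"
      using that by (intro psum_cong eq) (auto simp: space_pair_measure space_counting_space reduced_counting X_in_space)
    finally show ?thesis .
  qed
  have "AE \<omega> in M. psum g \<omega> \<noteq> \<infinity>"
    using fin by (intro nn_integral_PInf_AE) auto
  then have "AE \<omega> in M. psum h \<omega> = \<Psi> (\<eta> \<omega>) - \<Phi> (\<eta> \<omega>)"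
    using f\<Phi> g\<Psi> AE_space
  proof eventually_elim
    case (elim \<omega>)
    from psum[OF elim(4)] elim show ?case
      by (metis ennreal_add_diff_cancel_left ennreal_add_eq_top infinity_ennreal_def)
  qed
  moreover have "(\<lambda>\<mu>. \<Psi> \<mu> - \<Phi> \<mu>) \<in> borel_measurable N"
    by measurable
  moreover have "(\<integral>\<^sup>+\<omega>. psum h \<omega> \<partial>M) = (\<integral>\<^sup>+\<omega>. \<integral>\<^sup>+y. h (\<eta> \<omega>, y) \<partial>lam \<partial>M)"
  proof -
    have 1: "(\<integral>\<^sup>+\<omega>. psum f \<omega> \<partial>M) + (\<integral>\<^sup>+\<omega>. psum h \<omega> \<partial>M) = (\<integral>\<^sup>+\<omega>. psum g \<omega> \<partial>M)"
      by (subst nn_integral_add[symmetric]) (auto intro!: nn_integral_cong psum)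
    have "(\<integral>\<^sup>+\<omega>. \<integral>\<^sup>+y. f (\<eta> \<omega>, y) \<partial>lam \<partial>M) + (\<integral>\<^sup>+\<omega>. \<integral>\<^sup>+y. h (\<eta> \<omega>, y) \<partial>lam \<partial>M) =
        (\<integral>\<^sup>+\<omega>. (\<integral>\<^sup>+y. f (\<eta> \<omega>, y) \<partial>lam) + (\<integral>\<^sup>+y. h (\<eta> \<omega>, y) \<partial>lam) \<partial>M)"
      by (intro nn_integral_add[symmetric] eta_inner_measurable h mecke_classD(1)[OF f])
    also have "\<dots> = (\<integral>\<^sup>+\<omega>. \<integral>\<^sup>+y. g (\<eta> \<omega>, y) \<partial>lam \<partial>M)"
    proof (rule nn_integral_cong)
      fix \<omega> assume \<omega>: "\<omega> \<in> space M"
      have "(\<integral>\<^sup>+y. f (\<eta> \<omega>, y) \<partial>lam) + (\<integral>\<^sup>+y. h (\<eta> \<omega>, y) \<partial>lam) = (\<integral>\<^sup>+y. f (\<eta> \<omega>, y) + h (\<eta> \<omega>, y) \<partial>lam)"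
        by (intro nn_integral_add[symmetric] section_measurable h mecke_classD(1)[OF f] eta_counting \<omega>)
      also have "\<dots> = (\<integral>\<^sup>+y. g (\<eta> \<omega>, y) \<partial>lam)"
        using \<omega> by (intro nn_integral_cong eq) (auto simp: space_pair_measure space_counting_space eta_counting)
      finally show "(\<integral>\<^sup>+y. f (\<eta> \<omega>, y) \<partial>lam) + (\<integral>\<^sup>+y. h (\<eta> \<omega>, y) \<partial>lam) = (\<integral>\<^sup>+y. g (\<eta> \<omega>, y) \<partial>lam)" .
    qed
    finally have 2: "(\<integral>\<^sup>+\<omega>. psum f \<omega> \<partial>M) + (\<integral>\<^sup>+\<omega>. \<integral>\<^sup>+y. h (\<eta> \<omega>, y) \<partial>lam \<partial>M) = (\<integral>\<^sup>+\<omega>. psum g \<omega> \<partial>M)"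
      by (simp add: mecke_classD(2)[OF f] mecke_classD(2)[OF g])
    have "(\<integral>\<^sup>+\<omega>. psum f \<omega> \<partial>M) \<noteq> \<infinity>"
      using fin 1 by (metis ennreal_add_eq_top infinity_ennreal_def less_irrefl)
    with 1 2 show ?thesis
      by (metis ennreal_add_left_cancel)
  qed
  ultimately show ?thesis
    using h by (auto simp: mecke_class_def)
qed

text \<open>The Mecke equation in its elementary form. For disjoint sets, removing a point of
  \<open>A T\<close> leaves counts k exactly when \<open>\<eta>\<close> has counts k with the entry
  at T raised by one; there are k(T) + 1 such points. The two expectations then agree because
  Poisson weights satisfy (k + 1) p(k + 1) = r p(k).\<close>

lemma mecke_atom:
  fixes A :: "nat \<Rightarrow> 'y set" and m T :: nat
  assumes A: "\<And>j. j < m \<Longrightarrow> A j \<in> sets lam" "\<And>j. j < m \<Longrightarrow> emeasure lam (A j) < \<infinity>"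
    and dis: "disjoint_family_on A {..<m}" and T: "T < m"
  shows "(\<lambda>(\<mu>, y). indicator (cylinder lam ((\<lambda>j. (A j, k j)) ` {..<m})) \<mu> * indicator (A T) y) \<in> mecke_class"
    (is "?f \<in> _")
proof -
  define C where "C k = cylinder lam ((\<lambda>j. (A j, k j)) ` {..<m})" for k
  define k' where "k' = k(T := Suc (k T))"
  have C[measurable]: "C k \<in> sets N" for k
    unfolding C_def using A by (intro cylinder_sets finite_imageI) auto
  have [measurable]: "A T \<in> sets lam" using A T by simp
  have mem_C: "\<mu> \<in> C k \<longleftrightarrow> (\<forall>j<m. emeasure \<mu> (A j) = of_nat (k j))" if "\<mu> \<in> counting_measures lam" for \<mu> k
    using that by (auto simp: C_def cylinder_def)
  have f_meas: "?f \<in> borel_measurable (N \<Otimes>\<^sub>M lam)"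
    unfolding C_def[symmetric] by measurable
  have psum: "psum ?f \<omega> = of_nat (Suc (k T)) * indicator (C k') (\<eta> \<omega>)" if \<omega>: "\<omega> \<in> space M" for \<omega>
  proof -
    have "psum ?f \<omega> = (\<integral>\<^sup>+i. indicator (C k') (\<eta> \<omega>) * indicator {i \<in> I \<omega>. X i \<omega> \<in> A T} i \<partial>count_space (I \<omega>))"
      unfolding psum_def
    proof (rule nn_integral_cong)
      fix i assume "i \<in> space (count_space (I \<omega>))"
      then have i: "i \<in> I \<omega>" by simp
      show "?f (reduced \<omega> i, X i \<omega>) = indicator (C k') (\<eta> \<omega>) * indicator {i \<in> I \<omega>. X i \<omega> \<in> A T} i"
      proof (cases "X i \<omega> \<in> A T")
        case True
        have "emeasure (reduced \<omega> i) (A j) = of_nat (k j) \<longleftrightarrow> emeasure (\<eta> \<omega>) (A j) = of_nat (k' j)" if j: "j < m" for j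
        proof (cases "j = T")
          case True
          have "emeasure (reduced \<omega> i) (A T) + 1 = emeasure (\<eta> \<omega>) (A T)"
            using emeasure_reduced_add[OF \<omega> i, of "A T"] \<open>X i \<omega> \<in> A T\<close> by simp
          moreover have "a = of_nat (k T) \<longleftrightarrow> a + 1 = of_nat (Suc (k T))" for a :: ennreal
            using ennreal_add_left_cancel[of 1 a "of_nat (k T)"] by (simp add: add.commute)
          ultimately show ?thesis unfolding True k'_def fun_upd_same by metis
        next
          case False
          then have "X i \<omega> \<notin> A j"
            using dis T j \<open>X i \<omega> \<in> A T\<close> by (auto simp: disjoint_family_on_def)
          then show ?thesis
            using emeasure_reduced_add[OF \<omega> i, of "A j"] A j False by (simp add: k'_def)
        qed
        then have "reduced \<omega> i \<in> C k \<longleftrightarrow> \<eta> \<omega> \<in> C k'"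
          using reduced_counting[OF \<omega> i] eta_counting[OF \<omega>] by (auto simp: mem_C)
        then show ?thesis
          using True i by (simp add: C_def[symmetric] indicator_def)
      qed (auto simp: indicator_def)
    qed
    also have "\<dots> = indicator (C k') (\<eta> \<omega>) * emeasure (count_space (I \<omega>)) {i \<in> I \<omega>. X i \<omega> \<in> A T}"
      by (simp add: nn_integral_cmult)
    also have "emeasure (count_space (I \<omega>)) {i \<in> I \<omega>. X i \<omega> \<in> A T} = emeasure (\<eta> \<omega>) (A T)"
      unfolding emeasure_eta[OF \<omega> \<open>A T \<in> sets lam\<close>]
      by (cases "finite {i \<in> I \<omega>. X i \<omega> \<in> A T}") auto
    also have "indicator (C k') (\<eta> \<omega>) * emeasure (\<eta> \<omega>) (A T) = of_nat (Suc (k T)) * indicator (C k') (\<eta> \<omega>)"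
      using T eta_counting[OF \<omega>] by (auto simp: mem_C indicator_def k'_def)
    finally show ?thesis .
  qed
  have prob_C: "emeasure M {\<omega> \<in> space M. \<eta> \<omega> \<in> C k} = ennreal (\<Prod>j<m. enn2real (emeasure lam (A j)) ^ k j / fact (k j) * exp (- enn2real (emeasure lam (A j))))" for k
  proof -
    have "indep_vars (\<lambda>_. borel) (\<lambda>j \<omega>. emeasure (\<eta> \<omega>) (A j)) {..<m}"
      using poisson A dis by (simp add: poisson_process_def)
    \<comment> \<open>The index set must be nonempty, which T < m guarantees.\<close>
    from indep_varsD_finite[OF this, of "\<lambda>j. {of_nat (k j)}"] T
    have "prob (\<Inter>j<m. (\<lambda>\<omega>. emeasure (\<eta> \<omega>) (A j)) -` {of_nat (k j)} \<inter> space M) =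
        (\<Prod>j<m. prob ((\<lambda>\<omega>. emeasure (\<eta> \<omega>) (A j)) -` {of_nat (k j)} \<inter> space M))"
      by auto
    moreover have "(\<lambda>\<omega>. emeasure (\<eta> \<omega>) (A j)) -` {of_nat (k j)} \<inter> space M = {\<omega> \<in> space M. emeasure (\<eta> \<omega>) (A j) = of_nat (k j)}" for j
      by auto
    moreover have "(\<Inter>j<m. {\<omega> \<in> space M. emeasure (\<eta> \<omega>) (A j) = of_nat (k j)}) = {\<omega> \<in> space M. \<eta> \<omega> \<in> C k}"
      using T by (auto simp: mem_C eta_counting)
    ultimately show ?thesis
      using A by (simp add: eta_eq_prob emeasure_eq_measure)
  qed
  have meas_C[measurable]: "{\<omega> \<in> space M. \<eta> \<omega> \<in> C k} \<in> sets M" for k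
    by measurable
  have "(\<integral>\<^sup>+\<omega>. psum ?f \<omega> \<partial>M) = (\<integral>\<^sup>+\<omega>. of_nat (Suc (k T)) * indicator {\<omega> \<in> space M. \<eta> \<omega> \<in> C k'} \<omega> \<partial>M)"
    by (intro nn_integral_cong) (simp only: psum, simp split: split_indicator)
  also have "\<dots> = of_nat (Suc (k T)) * emeasure M {\<omega> \<in> space M. \<eta> \<omega> \<in> C k'}"
    by (subst nn_integral_cmult_indicator) auto
  also have "\<dots> = emeasure lam (A T) * emeasure M {\<omega> \<in> space M. \<eta> \<omega> \<in> C k}"
  proof -
    define r where "r j = enn2real (emeasure lam (A j))" for j
    define p where "p j n = r j ^ n / fact n * exp (- r j)" for j n
    have p: "p j n \<ge> 0" for j n by (simp add: p_def r_def)
    have split: "(\<Prod>j<m. p j (k j)) = p T (k T) * (\<Prod>j\<in>{..<m} - {T}. p j (k j))" for k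
      using T by (simp add: prod.remove)
    have "(\<Prod>j\<in>{..<m} - {T}. p j (k' j)) = (\<Prod>j\<in>{..<m} - {T}. p j (k j))"
      by (intro prod.cong) (auto simp: k'_def)
    moreover have "real (Suc (k T)) * p T (Suc (k T)) = r T * p T (k T)"
      by (simp add: p_def field_simps del: of_nat_Suc)
    moreover have "k' T = Suc (k T)" by (simp add: k'_def)
    ultimately have "real (Suc (k T)) * (\<Prod>j<m. p j (k' j)) = r T * (\<Prod>j<m. p j (k j))"
      by (simp only: split mult.assoc[symmetric])
    then have "ennreal (real (Suc (k T)) * (\<Prod>j<m. p j (k' j))) = ennreal (r T * (\<Prod>j<m. p j (k j)))"
      by simp
    moreover have "ennreal (r T) = emeasure lam (A T)"
      using A T by (simp add: r_def)
    moreover have "emeasure M {\<omega> \<in> space M. \<eta> \<omega> \<in> C k} = ennreal (\<Prod>j<m. p j (k j))" for k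
      by (simp add: prob_C p_def r_def)
    moreover have "r T \<ge> 0" by (simp add: r_def)
    ultimately show ?thesis
      by (simp add: ennreal_mult prod_nonneg p ennreal_of_nat_eq_real_of_nat del: of_nat_Suc)
  qed
  also have "\<dots> = (\<integral>\<^sup>+\<omega>. emeasure lam (A T) * indicator {\<omega> \<in> space M. \<eta> \<omega> \<in> C k} \<omega> \<partial>M)"
    by (subst nn_integral_cmult_indicator) auto
  also have "\<dots> = (\<integral>\<^sup>+\<omega>. \<integral>\<^sup>+y. ?f (\<eta> \<omega>, y) \<partial>lam \<partial>M)"
    by (intro nn_integral_cong) (simp add: C_def[symmetric] nn_integral_cmult split: split_indicator)
  finally have int: "(\<integral>\<^sup>+\<omega>. psum ?f \<omega> \<partial>M) = (\<integral>\<^sup>+\<omega>. \<integral>\<^sup>+y. ?f (\<eta> \<omega>, y) \<partial>lam \<partial>M)" .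
  show ?thesis
  proof (rule mecke_classI[OF f_meas _ _ int])
    show "(\<lambda>\<mu>. of_nat (Suc (k T)) * indicator (C k') \<mu> :: ennreal) \<in> borel_measurable N"
      by measurable
    show "AE \<omega> in M. psum ?f \<omega> = of_nat (Suc (k T)) * indicator (C k') (\<eta> \<omega>)"
      using psum by (intro AE_I2)
  qed
qed

text \<open>The sets in a cylinder may overlap, so they are cut into the atoms of the finite algebra
  that they generate together with B. The cylinder then splits, outside infinite counts, into
  countably many events prescribing the counts of all atoms, and B into some of the atoms;
  \<open>mecke_atom\<close> applies to each pair.\<close>

lemma mecke_cylinder:
  assumes S: "finite S" "\<forall>(C, k)\<in>S. C \<in> sets lam \<and> emeasure lam C < \<infinity>"
    and B: "B \<in> sets lam" "emeasure lam B < \<infinity>"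
  shows "(\<lambda>(\<mu>, y). indicator (cylinder lam S) \<mu> * indicator B y) \<in> mecke_class"
proof -
  define D where "D = insert B (fst ` S)"
  have D: "finite D" "\<And>C. C \<in> D \<Longrightarrow> C \<in> sets lam" "\<And>C. C \<in> D \<Longrightarrow> emeasure lam C < \<infinity>"
    using S B by (auto simp: D_def)
  \<comment> \<open>An atom is named by the sets of D that contain it. The empty name is left out:
    it stands for the complement of all sets, whose intensity may be infinite.\<close>
  have "finite (Pow D - {{}})" using D by simp
  then obtain t where t: "bij_betw t {0..<card (Pow D - {{}})} (Pow D - {{}})"
    using ex_bij_betw_nat_finite by blast
  define m where "m = card (Pow D - {{}})"
  have t: "bij_betw t {..<m} (Pow D - {{}})"
    using t by (simp add: m_def lessThan_atLeast0)
  define A where "A j = {y \<in> space lam. \<forall>C\<in>D. y \<in> C \<longleftrightarrow> C \<in> t j}" for j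
  define J where "J C = {j. j < m \<and> C \<in> t j}" for C
  have finJ: "finite (J C)" for C by (simp add: J_def)
  have A_sets: "A j \<in> sets lam" for j
    unfolding A_def
  proof (intro sets.sets_Collect_finite_All D(1))
    fix C assume "C \<in> D"
    then have [measurable]: "C \<in> sets lam" by (rule D)
    show "{y \<in> space lam. (y \<in> C) = (C \<in> t j)} \<in> sets lam"
      by measurable
  qed
  have A_fin: "emeasure lam (A j) < \<infinity>" if "j < m" for j
  proof -
    have "t j \<in> Pow D - {{}}" using t that by (auto dest: bij_betwE)
    then obtain C where "C \<in> D" "C \<in> t j" by auto
    then have "A j \<subseteq> C" by (auto simp: A_def)
    from emeasure_mono[OF this D(2)[OF \<open>C \<in> D\<close>]] D(3)[OF \<open>C \<in> D\<close>] show ?thesis by (rule le_less_trans)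
  qed
  have dis: "disjoint_family_on A {..<m}"
  proof (unfold disjoint_family_on_def, intro ballI impI)
    fix i j assume ij: "i \<in> {..<m}" "j \<in> {..<m}" "i \<noteq> j"
    then have "t i \<noteq> t j" "t i \<subseteq> D" "t j \<subseteq> D"
      using t by (auto simp: bij_betw_def inj_on_def)
    then show "A i \<inter> A j = {}"
      by (auto simp: A_def)
  qed
  have dis_J: "disjoint_family_on A (J C)" for C
    using dis by (rule disjoint_family_on_mono[rotated]) (auto simp: J_def)
  have UN: "C = (\<Union>j\<in>J C. A j)" if C: "C \<in> D" for C
  proof (intro set_eqI iffI)
    fix y assume y: "y \<in> C"
    then have "{C' \<in> D. y \<in> C'} \<in> Pow D - {{}}" using C by auto
    then obtain j where "j < m" "t j = {C' \<in> D. y \<in> C'}"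
      using t unfolding bij_betw_def by (metis (no_types, lifting) imageE lessThan_iff)
    then show "y \<in> (\<Union>j\<in>J C. A j)"
      using y C sets.sets_into_space[OF D(2)[OF C]] by (auto simp: J_def A_def intro!: exI[of _ j])
  qed (use C in \<open>auto simp: A_def J_def\<close>)
  have emeasure_D: "emeasure \<mu> C = (\<Sum>j\<in>J C. emeasure \<mu> (A j))" if "\<mu> \<in> counting_measures lam" "C \<in> D" for \<mu> C
    by (subst UN[OF that(2)], rule sum_emeasure[symmetric])
       (use finJ dis_J A_sets counting_measuresD(1)[OF that(1)] in auto)
  have ind_D: "indicator C y = (\<Sum>j\<in>J C. indicator (A j) y :: ennreal)" if "C \<in> D" for C y
    by (subst UN[OF that], rule indicator_UN_disjoint) (auto simp: finJ dis_J)
  define l where "l n = (from_nat n :: nat list)" for n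
  \<comment> \<open>Vectors of counts are enumerated by codes of lists. The condition
    \<open>to_nat (l n) = n\<close> discards numbers that are not codes, so that every vector is
    counted once; the sums express the prescribed counts through those of the atoms.\<close>
  define good where "good n \<longleftrightarrow> to_nat (l n) = n \<and> length (l n) = m \<and>
      (\<forall>(C, c)\<in>S. (\<Sum>j\<in>J C. l n ! j) = c)" for n
  define cyl where "cyl n = cylinder lam ((\<lambda>j. (A j, l n ! j)) ` {..<m})" for n
  define g where "g p = (\<Sum>n. \<Sum>T\<in>J B. if good n then (case p of (\<mu>, y) \<Rightarrow> indicator (cyl n) \<mu> * indicator (A T) y) else (0::ennreal))" for p
  have g: "g \<in> mecke_class"
    unfolding g_def
  proof (intro mecke_suminf mecke_sum finJ)
    fix n T assume "T \<in> J B"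
    then have "(\<lambda>(\<mu>, y). indicator (cyl n) \<mu> * indicator (A T) y) \<in> mecke_class"
      unfolding cyl_def by (intro mecke_atom A_sets A_fin dis) (auto simp: J_def)
    then show "(\<lambda>p. if good n then (case p of (\<mu>, y) \<Rightarrow> indicator (cyl n) \<mu> * indicator (A T) y) else (0::ennreal)) \<in> mecke_class"
      using mecke_zero by (cases "good n") auto
  qed
  have B_D: "B \<in> D" by (simp add: D_def)
  \<comment> \<open>For finite counts exactly one code describes \<open>\<mu>\<close>, so the series
    collapses to one term. Measures with an infinite count on some atom are excluded here and form a
    null event later.\<close>
  have eq: "g (\<mu>, y) = indicator (cylinder lam S) \<mu> * indicator B y"
    if \<mu>: "\<mu> \<in> counting_measures lam" and fin: "\<And>j. j < m \<Longrightarrow> emeasure \<mu> (A j) < \<infinity>" for \<mu> y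
  proof -
    have "\<exists>c. emeasure \<mu> (A j) = of_nat c" if "j < m" for j
      using counting_measuresD(4)[OF \<mu> A_sets, of j] fin[OF that] by auto
    then obtain c where c: "\<And>j. j < m \<Longrightarrow> emeasure \<mu> (A j) = of_nat (c j)" by metis
    define n0 where "n0 = to_nat (map c [0..<m])"
    have l0: "l n0 = map c [0..<m]" by (simp add: l_def n0_def)
    have cyl0: "\<mu> \<in> cyl n0" using c \<mu> by (auto simp: cyl_def cylinder_def l0)
    have uniq: "n = n0" if "good n" "\<mu> \<in> cyl n" for n
    proof -
      have "l n = map c [0..<m]"
      proof (rule nth_equalityI)
        show "length (l n) = length (map c [0..<m])" using that by (simp add: good_def)
        fix j assume "j < length (l n)"
        then have "j < m" using that by (simp add: good_def)
        then have "of_nat (l n ! j) = (of_nat (c j) :: ennreal)"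
          using that(2) c[of j] by (auto simp: cyl_def cylinder_def)
        then show "l n ! j = map c [0..<m] ! j" using \<open>j < m\<close> by simp
      qed
      then show ?thesis using that by (simp add: n0_def good_def)
    qed
    have good0: "good n0 \<longleftrightarrow> \<mu> \<in> cylinder lam S"
    proof -
      have "(\<Sum>j\<in>J C. l n0 ! j) = k \<longleftrightarrow> emeasure \<mu> C = of_nat k" if "(C, k) \<in> S" for C k
      proof -
        have "C \<in> D" using that by (force simp: D_def)
        then have "emeasure \<mu> C = (\<Sum>j\<in>J C. of_nat (c j))"
          using emeasure_D[OF \<mu>] c by (simp add: J_def)
        also have "\<dots> = of_nat (\<Sum>j\<in>J C. l n0 ! j)"
          by (simp add: l0 J_def)
        finally show ?thesis by (simp only: of_nat_eq_iff)
      qed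
      moreover have "to_nat (l n0) = n0" "length (l n0) = m" by (simp_all only: l0) (simp_all add: n0_def)
      ultimately show ?thesis using \<mu> by (fastforce simp: good_def cylinder_def)
    qed
    have "g (\<mu>, y) = (\<Sum>n. if good n then indicator (cyl n) \<mu> * indicator B y else 0)"
      unfolding g_def by (intro suminf_cong) (auto simp: ind_D[OF B_D] sum_distrib_left)
    also have "\<dots> = (\<Sum>n\<in>{n0}. if good n then indicator (cyl n) \<mu> * indicator B y else 0)"
      using uniq by (intro suminf_finite) (auto simp: indicator_def)
    also have "\<dots> = indicator (cylinder lam S) \<mu> * indicator B y"
      using good0 cyl0 by (simp add: indicator_def)
    finally show ?thesis .
  qed
  have AE_fin: "AE \<omega> in M. \<forall>j\<in>{..<m}. emeasure (\<eta> \<omega>) (A j) < \<infinity>"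
    by (intro AE_finite_allI eta_finite A_sets A_fin) auto
  have [measurable]: "B \<in> sets lam" "cylinder lam S \<in> sets N"
    using S B by (auto intro!: cylinder_sets)
  show ?thesis
  proof (rule mecke_cong[OF g])
    show "(\<lambda>(\<mu>, y). indicator (cylinder lam S) \<mu> * indicator B y :: ennreal) \<in> borel_measurable (N \<Otimes>\<^sub>M lam)"
      by measurable
    show "AE \<omega> in M. \<forall>y\<in>space lam. g (\<eta> \<omega>, y) = (case (\<eta> \<omega>, y) of (\<mu>, y) \<Rightarrow> indicator (cylinder lam S) \<mu> * indicator B y)"
      using AE_fin AE_space by eventually_elim (simp add: eq eta_counting)
    show "AE \<omega> in M. \<forall>i\<in>I \<omega>. g (reduced \<omega> i, X i \<omega>) =
        (case (reduced \<omega> i, X i \<omega>) of (\<mu>, y) \<Rightarrow> indicator (cylinder lam S) \<mu> * indicator B y)"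
      using AE_fin AE_space
    proof eventually_elim
      case (elim \<omega>)
      show ?case
      proof
        fix i assume i: "i \<in> I \<omega>"
        have "emeasure (reduced \<omega> i) (A j) < \<infinity>" if "j < m" for j
          using elim that i A_sets by (auto simp: emeasure_reduced diff_less_top_ennreal)
        then show "g (reduced \<omega> i, X i \<omega>) =
            (case (reduced \<omega> i, X i \<omega>) of (\<mu>, y) \<Rightarrow> indicator (cylinder lam S) \<mu> * indicator B y)"
          using i elim by (simp add: eq reduced_counting)
      qed
    qed
  qed
qed

text \<open>Dynkin argument from the products of cylinders and measurable sets, which are stable
  under intersection. The restriction to A of finite intensity keeps the expected sums finite, as
  \<open>mecke_diff\<close> demands.\<close>

lemma mecke_indicator:
  assumes A: "A \<in> sets lam" "emeasure lam A < \<infinity>" and E: "E \<in> sets (N \<Otimes>\<^sub>M lam)"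
  shows "indicator (E \<inter> (space N \<times> A)) \<in> mecke_class"
proof -
  let ?G = "{a \<times> b |a b. a \<in> cylinders lam \<and> b \<in> sets lam}" and ?\<Omega> = "space N \<times> space lam"
  have sets_eq: "sets (N \<Otimes>\<^sub>M lam) = sigma_sets ?\<Omega> ?G"
  proof -
    have G: "?G \<subseteq> Pow ?\<Omega>"
      using cylinders_subset[of lam] sets.space_closed[of lam] by (fastforce simp: space_counting_space)
    have "sets (N \<Otimes>\<^sub>M lam) = sets (sigma ?\<Omega> ?G)"
      using space_in_cylinders[of lam] cylinders_subset[of lam] sets_counting_space[OF lam.sigma_finite_measure_axioms]
      by (intro sets_pair_eq[where Ca = "{space N}" and Cb = "{space lam}"])
         (auto simp: space_counting_space sets.space_closed sets.sigma_sets_eq)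
    then show ?thesis using G by simp
  qed
  have box: "indicator (?\<Omega> \<inter> (space N \<times> A)) \<in> mecke_class"
  proof (rule mecke_cong'[OF mecke_cylinder[of "{}", OF _ _ A]])
    fix p assume "p \<in> space (N \<Otimes>\<^sub>M lam)"
    then show "(case p of (\<mu>, y) \<Rightarrow> indicator (cylinder lam {}) \<mu> * indicator A y) = (indicator (?\<Omega> \<inter> (space N \<times> A)) p :: ennreal)"
      by (auto simp: space_pair_measure space_counting_space cylinder_def indicator_def)
  qed (use A in \<open>auto intro!: borel_measurable_indicator sets.Int sets.top pair_measureI simp flip: space_pair_measure\<close>)
  have box_fin: "(\<integral>\<^sup>+\<omega>. psum (indicator (?\<Omega> \<inter> (space N \<times> A))) \<omega> \<partial>M) < \<infinity>"
  proof -
    have "(\<integral>\<^sup>+\<omega>. psum (indicator (?\<Omega> \<inter> (space N \<times> A))) \<omega> \<partial>M) = (\<integral>\<^sup>+\<omega>. \<integral>\<^sup>+y. indicator A y \<partial>lam \<partial>M)"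
      unfolding mecke_classD(2)[OF box]
      by (intro nn_integral_cong) (auto simp: indicator_def space_counting_space eta_counting)
    also have "\<dots> = emeasure lam A" using A by (simp add: emeasure_space_1)
    finally show ?thesis using A by simp
  qed
  have G_stable: "Int_stable ?G"
  proof (rule Int_stableI)
    fix a b assume "a \<in> ?G" "b \<in> ?G"
    then obtain a1 a2 b1 b2 where *: "a = a1 \<times> a2" "b = b1 \<times> b2" "a1 \<in> cylinders lam" "b1 \<in> cylinders lam"
      "a2 \<in> sets lam" "b2 \<in> sets lam" by blast
    then have "a1 \<inter> b1 \<in> cylinders lam" "a2 \<inter> b2 \<in> sets lam" "a \<inter> b = (a1 \<inter> b1) \<times> (a2 \<inter> b2)"
      using Int_stable_cylinders[of lam] by (auto simp: Int_stable_def)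
    then show "a \<inter> b \<in> ?G" by blast
  qed
  have G_Pow: "?G \<subseteq> Pow ?\<Omega>"
    using cylinders_subset[of lam] sets.space_closed[of lam] by (fastforce simp: space_counting_space)
  have in_sets: "indicator (E \<inter> (space N \<times> A)) \<in> borel_measurable (N \<Otimes>\<^sub>M lam)" if "E \<in> sigma_sets ?\<Omega> ?G" for E
    using that A unfolding sets_eq[symmetric] by (intro borel_measurable_indicator sets.Int pair_measureI) auto
  have "E \<in> sigma_sets ?\<Omega> ?G" using E by (simp add: sets_eq)
  with G_stable G_Pow show ?thesis
  proof (induction E rule: sigma_sets_induct_disjoint)
    case (basic E)
    then obtain S b where S: "E = cylinder lam S \<times> b" "finite S" "\<forall>(C, k)\<in>S. C \<in> sets lam \<and> emeasure lam C < \<infinity>" "b \<in> sets lam"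
      by (auto simp: cylinders_def)
    have "emeasure lam (b \<inter> A) < \<infinity>"
      using A S by (intro le_less_trans[OF emeasure_mono[of "b \<inter> A" A]]) auto
    then show ?case
      by (intro mecke_cong'[OF mecke_cylinder[of S "b \<inter> A", OF S(2,3)]] in_sets sigma_sets.Basic basic)
         (use A S in \<open>auto simp: indicator_def space_pair_measure\<close>)
  next
    case empty
    show ?case using mecke_zero by (simp add: indicator_def[abs_def])
  next
    case (compl E)
    show ?case
    proof (rule mecke_diff[OF compl(2) box _ _ box_fin])
      show "indicator ((?\<Omega> - E) \<inter> (space N \<times> A)) \<in> borel_measurable (N \<Otimes>\<^sub>M lam)"
        by (intro in_sets sigma_sets.Compl compl)
    qed (auto simp: indicator_def space_pair_measure)
  next
    case (union E)
    have dis: "disjoint_family (\<lambda>i. E i \<inter> (space N \<times> A))"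
      using union(1) by (auto simp: disjoint_family_on_def)
    have "(\<lambda>p. \<Sum>i. indicator (E i \<inter> (space N \<times> A)) p) \<in> mecke_class"
      by (intro mecke_suminf union)
    then show ?case
      by (simp add: suminf_indicator[OF dis] Int_UN_distrib2 flip: UN_extend_simps)
  qed
qed

text \<open>The restriction to a window of finite intensity is removed by monotone limits; the rest
  is the standard induction over nonnegative functions.\<close>

theorem mecke:
  assumes "f \<in> borel_measurable (N \<Otimes>\<^sub>M lam)"
  shows "f \<in> mecke_class"
  using assms
proof (induction rule: borel_measurable_induct)
  case (cong f g)
  then show ?case by (intro mecke_cong'[of g f]) auto
next
  case (set E)
  obtain A :: "nat \<Rightarrow> 'y set" where A: "range A \<subseteq> sets lam" "(\<Union>i. A i) = space lam"
    "\<And>i. emeasure lam (A i) \<noteq> \<infinity>" "incseq A"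
    using lam.sigma_finite_incseq by metis
  have inc: "E \<inter> space N \<times> A n \<subseteq> E \<inter> space N \<times> A k" if "n \<le> k" for n k
    using incseqD[OF A(4) that] by auto
  have "(\<lambda>p. SUP n. indicator (E \<inter> (space N \<times> A n)) p) \<in> mecke_class"
  proof (rule mecke_incseq)
    show "indicator (E \<inter> (space N \<times> A n)) \<in> mecke_class" for n
      using A set by (intro mecke_indicator) (auto simp: less_top)
    show "incseq (\<lambda>n. indicator (E \<inter> (space N \<times> A n)) :: _ \<Rightarrow> ennreal)"
      using inc by (auto simp: incseq_def le_fun_def indicator_def)
  qed
  then show ?case
  proof (rule mecke_cong')
    fix p assume p: "p \<in> space (N \<Otimes>\<^sub>M lam)"
    then obtain n where n: "p \<in> space N \<times> A n"
      using A(2) by (auto simp: space_pair_measure)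
    show "(SUP n. indicator (E \<inter> (space N \<times> A n)) p) = (indicator E p :: ennreal)"
    proof (rule antisym)
      show "(SUP n. indicator (E \<inter> (space N \<times> A n)) p) \<le> (indicator E p :: ennreal)"
        by (intro SUP_least) (auto simp: indicator_def)
      show "(indicator E p :: ennreal) \<le> (SUP n. indicator (E \<inter> (space N \<times> A n)) p)"
        using n by (intro SUP_upper2[of n]) (auto simp: indicator_def)
    qed
  qed (use set in auto)
next
  case (mult u c)
  then show ?case by (intro mecke_cmult)
next
  case (add u v)
  then show ?case by (intro mecke_add)
next
  case (seq U)
  then show ?case using mecke_incseq[of U] by (simp add: SUP_apply[abs_def])
qed

section \<open>The Mecke equation for real integrands\<close>

definition rsum :: "('y measure \<times> 'y \<Rightarrow> real) \<Rightarrow> 'w \<Rightarrow> real" where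
  "rsum f \<omega> = (\<integral>i. f (reduced \<omega> i, X i \<omega>) \<partial>count_space (I \<omega>))"

text \<open>The measure \<open>count_space (I \<omega>)\<close> varies with \<omega>. Padding with
  zeros replaces it by counting measure on all naturals, for which measurability of parameter
  integrals applies.\<close>

lemma rsum_measurable:
  assumes f: "f \<in> borel_measurable (N \<Otimes>\<^sub>M lam)"
  shows "rsum f \<in> borel_measurable M"
proof -
  interpret C: sigma_finite_measure "count_space (UNIV :: nat set)"
    by (rule sigma_finite_measure_count_space)
  have eq: "rsum f \<omega> = (\<integral>i. (if i \<in> I \<omega> then f (reduced \<omega> i, X i \<omega>) else 0) \<partial>count_space UNIV)" for \<omega>
  proof -
    have "count_space (I \<omega>) = restrict_space (count_space UNIV) (I \<omega>)"
      by (simp add: restrict_count_space)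
    then have "rsum f \<omega> = (\<integral>i. indicator (I \<omega>) i *\<^sub>R f (reduced \<omega> i, X i \<omega>) \<partial>count_space UNIV)"
      unfolding rsum_def by (simp add: integral_restrict_space)
    also have "\<dots> = (\<integral>i. (if i \<in> I \<omega> then f (reduced \<omega> i, X i \<omega>) else 0) \<partial>count_space UNIV)"
      by (intro Bochner_Integration.integral_cong) auto
    finally show ?thesis .
  qed
  have "(\<lambda>(i, \<omega>). if i \<in> I \<omega> then f (reduced \<omega> i, X i \<omega>) else 0) \<in> borel_measurable (count_space UNIV \<Otimes>\<^sub>M M)"
    by (rule measurable_pair_measure_countable1) (auto intro: measurable_reduced_if f)
  from measurable_compose[OF measurable_pair_swap' this]
  have "(\<lambda>(\<omega>, i). if i \<in> I \<omega> then f (reduced \<omega> i, X i \<omega>) else 0) \<in> borel_measurable (M \<Otimes>\<^sub>M count_space UNIV)"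
    by (simp add: case_prod_unfold cong: if_cong)
  then have "(\<lambda>\<omega>. \<integral>i. (if i \<in> I \<omega> then f (reduced \<omega> i, X i \<omega>) else 0) \<partial>count_space UNIV) \<in> borel_measurable M"
    by (intro C.borel_measurable_lebesgue_integral) simp
  then show ?thesis
    by (simp add: eq[abs_def])
qed

lemma mecke_real:
  assumes f[measurable]: "f \<in> borel_measurable (N \<Otimes>\<^sub>M lam)"
    and int: "integrable (M \<Otimes>\<^sub>M lam) (\<lambda>(\<omega>, y). f (\<eta> \<omega>, y))"
  shows "integrable M (rsum f)"
    and "(\<integral>\<omega>. rsum f \<omega> \<partial>M) = (\<integral>(\<omega>, y). f (\<eta> \<omega>, y) \<partial>(M \<Otimes>\<^sub>M lam))"
    and "\<exists>\<Theta>\<in>borel_measurable N. AE \<omega> in M. rsum f \<omega> = \<Theta> (\<eta> \<omega>)"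
proof -
  interpret P: pair_sigma_finite M lam ..
  \<comment> \<open>Since \<open>ennreal\<close> sends negative numbers to 0, s = 1 gives the
    positive part of f and s = -1 the negative part.\<close>
  define F where "F s p = ennreal (s * f p)" for s p
  have F[measurable]: "F s \<in> borel_measurable (N \<Otimes>\<^sub>M lam)" for s
    unfolding F_def[abs_def] by measurable
  have F_int: "(\<integral>\<^sup>+\<omega>. psum (F s) \<omega> \<partial>M) = (\<integral>\<^sup>+p. ennreal (s * (case p of (\<omega>, y) \<Rightarrow> f (\<eta> \<omega>, y))) \<partial>(M \<Otimes>\<^sub>M lam))" for s
  proof -
    have "(\<integral>\<^sup>+\<omega>. psum (F s) \<omega> \<partial>M) = (\<integral>\<^sup>+\<omega>. \<integral>\<^sup>+y. F s (\<eta> \<omega>, y) \<partial>lam \<partial>M)"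
      by (rule mecke_classD(2)[OF mecke[OF F]])
    also have "\<dots> = (\<integral>\<^sup>+p. (case p of (\<omega>, y) \<Rightarrow> F s (\<eta> \<omega>, y)) \<partial>(M \<Otimes>\<^sub>M lam))"
      by (subst lam.nn_integral_fst[symmetric]) (auto intro: eta_section_measurable[OF F])
    also have "\<dots> = (\<integral>\<^sup>+p. ennreal (s * (case p of (\<omega>, y) \<Rightarrow> f (\<eta> \<omega>, y))) \<partial>(M \<Otimes>\<^sub>M lam))"
      by (intro nn_integral_cong) (auto simp: F_def split: prod.split)
    finally show ?thesis .
  qed
  have fin: "(\<integral>\<^sup>+\<omega>. psum (F s) \<omega> \<partial>M) < \<infinity>" if "\<bar>s\<bar> = 1" for s
  proof -
    have "(\<integral>\<^sup>+\<omega>. psum (F s) \<omega> \<partial>M) \<le> (\<integral>\<^sup>+p. ennreal (norm (case p of (\<omega>, y) \<Rightarrow> f (\<eta> \<omega>, y))) \<partial>(M \<Otimes>\<^sub>M lam))"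
    proof -
      have "s * z \<le> \<bar>z\<bar>" for z using that by (auto simp: abs_if split: if_splits)
      then show ?thesis
        unfolding F_int by (intro nn_integral_mono ennreal_leI) simp
    qed
    also have "\<dots> < \<infinity>"
      using int by (simp add: integrable_iff_bounded)
    finally show ?thesis .
  qed
  have AE_fin: "AE \<omega> in M. psum (F s) \<omega> < \<infinity>" if "\<bar>s\<bar> = 1" for s
  proof -
    have "AE \<omega> in M. psum (F s) \<omega> \<noteq> \<infinity>"
      using fin[OF that] by (intro nn_integral_PInf_AE) auto
    then show ?thesis by eventually_elim (simp add: less_top)
  qed
  have eq: "AE \<omega> in M. rsum f \<omega> = enn2real (psum (F 1) \<omega>) - enn2real (psum (F (-1)) \<omega>)"
    using AE_fin[of 1, simplified] AE_fin[of "-1", simplified]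
  proof eventually_elim
    case (elim \<omega>)
    have "(\<integral>\<^sup>+i. ennreal (norm (f (reduced \<omega> i, X i \<omega>))) \<partial>count_space (I \<omega>)) = psum (F 1) \<omega> + psum (F (-1)) \<omega>"
      unfolding psum_def by (subst nn_integral_add[symmetric])
        (auto simp: F_def abs_if ennreal_neg intro!: nn_integral_cong)
    then have "integrable (count_space (I \<omega>)) (\<lambda>i. f (reduced \<omega> i, X i \<omega>))"
      using elim by (simp add: integrable_iff_bounded)
    then show ?case
      unfolding rsum_def psum_def by (subst real_lebesgue_integral_def) (auto simp: F_def)
  qed
  have ps: "integrable M (\<lambda>\<omega>. enn2real (psum (F s) \<omega>))"
    "(\<integral>\<omega>. enn2real (psum (F s) \<omega>) \<partial>M) = enn2real (\<integral>\<^sup>+\<omega>. psum (F s) \<omega> \<partial>M)" if "\<bar>s\<bar> = 1" for s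
  proof -
    have "(\<integral>\<^sup>+\<omega>. ennreal (enn2real (psum (F s) \<omega>)) \<partial>M) = (\<integral>\<^sup>+\<omega>. psum (F s) \<omega> \<partial>M)"
      using AE_fin[OF that] by (intro nn_integral_cong_AE) (auto elim!: eventually_mono)
    then show "integrable M (\<lambda>\<omega>. enn2real (psum (F s) \<omega>))"
      "(\<integral>\<omega>. enn2real (psum (F s) \<omega>) \<partial>M) = enn2real (\<integral>\<^sup>+\<omega>. psum (F s) \<omega> \<partial>M)"
      using fin[OF that] by (auto simp: integrable_iff_bounded integral_eq_nn_integral)
  qed
  note [measurable] = rsum_measurable[OF f]
  show "integrable M (rsum f)"
    using ps(1)[of 1] ps(1)[of "-1"] by (subst integrable_cong_AE[OF _ _ eq]) auto
  have "(\<integral>\<omega>. rsum f \<omega> \<partial>M) = enn2real (\<integral>\<^sup>+\<omega>. psum (F 1) \<omega> \<partial>M) - enn2real (\<integral>\<^sup>+\<omega>. psum (F (-1)) \<omega> \<partial>M)"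
    using ps[of 1] ps[of "-1"] by (subst integral_cong_AE[OF _ _ eq]) auto
  also have "\<dots> = (\<integral>(\<omega>, y). f (\<eta> \<omega>, y) \<partial>(M \<Otimes>\<^sub>M lam))"
    unfolding F_int by (subst real_lebesgue_integral_def[OF int]) simp
  finally show "(\<integral>\<omega>. rsum f \<omega> \<partial>M) = (\<integral>(\<omega>, y). f (\<eta> \<omega>, y) \<partial>(M \<Otimes>\<^sub>M lam))" .
  from mecke_classD(3)[OF mecke[OF F]] obtain \<Phi> where \<Phi>:
    "\<And>s. \<Phi> s \<in> borel_measurable N" "\<And>s. AE \<omega> in M. psum (F s) \<omega> = \<Phi> s (\<eta> \<omega>)"
    by metis
  note [measurable] = \<Phi>(1)
  show "\<exists>\<Theta>\<in>borel_measurable N. AE \<omega> in M. rsum f \<omega> = \<Theta> (\<eta> \<omega>)"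
  proof (rule bexI)
    show "AE \<omega> in M. rsum f \<omega> = (\<lambda>\<mu>. enn2real (\<Phi> 1 \<mu>) - enn2real (\<Phi> (-1) \<mu>)) (\<eta> \<omega>)"
      using eq \<Phi>(2)[of 1] \<Phi>(2)[of "-1"] by eventually_elim simp
  qed measurable
qed

end

section \<open>Wiener-Ito polynomials of a finite configuration\<close>

text \<open>The integral of a tensor product against the factorial measure of a finite
  configuration. Labels from an arbitrary set A, instead of an initial segment, let inductions
  delete any label.\<close>

definition inj_sum :: "nat set \<Rightarrow> (nat \<Rightarrow> 'y \<Rightarrow> real) \<Rightarrow> nat set \<Rightarrow> (nat \<Rightarrow> 'y) \<Rightarrow> real" where
  "inj_sum A g K x = (\<Sum>i\<in>{i \<in> A \<rightarrow>\<^sub>E K. inj_on i A}. \<Prod>a\<in>A. g a (x (i a)))"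

text \<open>The numbers \<open>l a\<close> play the role of the integrals of the \<open>g a\<close>.\<close>

definition wi :: "nat set \<Rightarrow> (nat \<Rightarrow> real) \<Rightarrow> (nat \<Rightarrow> 'y \<Rightarrow> real) \<Rightarrow> nat set \<Rightarrow> (nat \<Rightarrow> 'y) \<Rightarrow> real" where
  "wi A l g K x = (\<Sum>J\<in>Pow A. inj_sum J g K x * (\<Prod>a\<in>A - J. - l a))"

lemma inj_sum_cong:
  assumes "\<And>a i. a \<in> A \<Longrightarrow> i \<in> K \<Longrightarrow> g a (x i) = g' a (x' i)"
  shows "inj_sum A g K x = inj_sum A g' K x'"
  unfolding inj_sum_def using assms by (intro sum.cong prod.cong) (auto simp: PiE_iff)

lemma wi_cong:
  assumes "\<And>a i. a \<in> A \<Longrightarrow> i \<in> K \<Longrightarrow> g a (x i) = g' a (x' i)" "\<And>a. a \<in> A \<Longrightarrow> l a = l' a"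
  shows "wi A l g K x = wi A l' g' K x'"
  unfolding wi_def using assms
  by (intro sum.cong arg_cong2[where f = "(*)"] inj_sum_cong prod.cong) auto

text \<open>An injective tuple either avoids the new point p or uses it at exactly one label k, and
  then its remaining labels form an injective tuple in K.\<close>

lemma inj_sum_insert:
  assumes A: "finite A" and K: "finite K" and p: "p \<notin> K"
  shows "inj_sum A g (insert p K) x = inj_sum A g K x + (\<Sum>k\<in>A. g k (x p) * inj_sum (A - {k}) g K x)"
proof -
  define S where "S A K = {i \<in> A \<rightarrow>\<^sub>E K. inj_on i A}" for A K :: "nat set"
  have fin: "finite (S A K)" if "finite A" "finite K" for A K
    using finite_PiE[of A "\<lambda>_. K"] that by (auto simp: S_def)
  have split: "S A (insert p K) = S A K \<union> {i \<in> S A (insert p K). p \<in> i ` A}"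
    by (auto simp: S_def PiE_iff)
  have bij: "bij_betw (\<lambda>(k, i). i(k := p)) (SIGMA k:A. S (A - {k}) K) {i \<in> S A (insert p K). p \<in> i ` A}"
  \<comment> \<open>The inverse finds the label that carries p and resets the tuple there to
    \<open>undefined\<close>, because tuples are extensional.\<close>
  proof (rule bij_betwI[where g = "\<lambda>i. (inv_into A i p, i(inv_into A i p := undefined))"])
    show "(\<lambda>(k, i). i(k := p)) \<in> (SIGMA k:A. S (A - {k}) K) \<rightarrow> {i \<in> S A (insert p K). p \<in> i ` A}"
    proof safe
      fix k i assume k: "k \<in> A" and i: "i \<in> S (A - {k}) K"
      have "i b \<noteq> p" if "b \<in> A" "b \<noteq> k" for b
        using i p that by (auto simp: S_def PiE_iff)
      with i k show "i(k := p) \<in> S A (insert p K)"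
        by (auto simp: S_def PiE_iff inj_on_def extensional_def)
      show "p \<in> i(k := p) ` A" using k by auto
    qed
    show "(\<lambda>i. (inv_into A i p, i(inv_into A i p := undefined))) \<in>
        {i \<in> S A (insert p K). p \<in> i ` A} \<rightarrow> (SIGMA k:A. S (A - {k}) K)"
    proof
      fix i assume "i \<in> {i \<in> S A (insert p K). p \<in> i ` A}"
      then obtain k where k: "k \<in> A" "i k = p" and i: "i \<in> S A (insert p K)" by auto
      have inv: "inv_into A i p = k"
        using k i by (auto simp: S_def inv_into_f_eq)
      have "i b \<noteq> p" if "b \<in> A" "b \<noteq> k" for b
        using i k that by (auto simp: S_def inj_on_def)
      then show "(inv_into A i p, i(inv_into A i p := undefined)) \<in> (SIGMA k:A. S (A - {k}) K)"
        unfolding inv using i k by (auto simp: S_def PiE_iff inj_on_def extensional_def)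
    qed
    show "(inv_into A ((\<lambda>(k, i). i(k := p)) z) p, ((\<lambda>(k, i). i(k := p)) z)(inv_into A ((\<lambda>(k, i). i(k := p)) z) p := undefined)) = z"
      if z: "z \<in> (SIGMA k:A. S (A - {k}) K)" for z
    proof -
      obtain k i where ki: "z = (k, i)" "k \<in> A" "i \<in> S (A - {k}) K" using z by auto
      have ne: "i b \<noteq> p" if "b \<in> A" "b \<noteq> k" for b
        using ki p that by (auto simp: S_def PiE_iff)
      have "inj_on (i(k := p)) A"
        using ki ne by (auto simp: S_def inj_on_def)
      then have "inv_into A (i(k := p)) p = k"
        using ki by (intro inv_into_f_eq) auto
      then show ?thesis
        using ki by (auto simp: S_def fun_eq_iff PiE_iff extensional_def)
    qed
    show "(\<lambda>(k, i). i(k := p)) (inv_into A i p, i(inv_into A i p := undefined)) = i"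
      if "i \<in> {i \<in> S A (insert p K). p \<in> i ` A}" for i
      using that by (auto simp: fun_eq_iff f_inv_into_f)
  qed
  have "inj_sum A g (insert p K) x = (\<Sum>i\<in>S A K. \<Prod>a\<in>A. g a (x (i a))) +
      (\<Sum>i\<in>{i \<in> S A (insert p K). p \<in> i ` A}. \<Prod>a\<in>A. g a (x (i a)))"
    unfolding inj_sum_def S_def[symmetric]
  proof (subst split, rule sum.union_disjoint)
    show "finite (S A K)" "finite {i \<in> S A (insert p K). p \<in> i ` A}"
      using fin[of A K] fin[of A "insert p K"] A K by simp_all
    show "S A K \<inter> {i \<in> S A (insert p K). p \<in> i ` A} = {}"
      using p by (auto simp: S_def PiE_iff)
  qed
  also have "(\<Sum>i\<in>{i \<in> S A (insert p K). p \<in> i ` A}. \<Prod>a\<in>A. g a (x (i a))) =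
      (\<Sum>(k, i)\<in>(SIGMA k:A. S (A - {k}) K). \<Prod>a\<in>A. g a (x ((i(k := p)) a)))"
    by (subst sum.reindex_bij_betw[OF bij, symmetric]) (simp add: case_prod_unfold)
  also have "\<dots> = (\<Sum>k\<in>A. \<Sum>i\<in>S (A - {k}) K. \<Prod>a\<in>A. g a (x ((i(k := p)) a)))"
    using A K fin by (subst sum.Sigma) auto
  also have "\<dots> = (\<Sum>k\<in>A. g k (x p) * inj_sum (A - {k}) g K x)"
    unfolding inj_sum_def S_def[symmetric] sum_distrib_left
  proof (intro sum.cong refl)
    fix k i assume k: "k \<in> A"
    have "(\<Prod>a\<in>A. g a (x ((i(k := p)) a))) = g k (x p) * (\<Prod>a\<in>A - {k}. g a (x ((i(k := p)) a)))"
      using A k by (subst prod.remove[of A k]) auto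
    also have "(\<Prod>a\<in>A - {k}. g a (x ((i(k := p)) a))) = (\<Prod>a\<in>A - {k}. g a (x (i a)))"
      by (intro prod.cong) auto
    finally show "(\<Prod>a\<in>A. g a (x ((i(k := p)) a))) = g k (x p) * (\<Prod>a\<in>A - {k}. g a (x (i a)))" .
  qed
  finally show ?thesis
    by (simp add: inj_sum_def S_def)
qed

text \<open>The difference operator lowers the order of a multiple integral by one. Apply
  \<open>inj_sum_insert\<close> to every J and exchange the pair J, k \<in> J for the pair k, J -
  {k}; the factors from A - J are the same in both descriptions.\<close>

lemma wi_insert:
  assumes A: "finite A" and K: "finite K" and p: "p \<notin> K"
  shows "wi A l g (insert p K) x = wi A l g K x + (\<Sum>k\<in>A. g k (x p) * wi (A - {k}) l g K x)"
proof -
  have "wi A l g (insert p K) x = wi A l g K x +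
      (\<Sum>J\<in>Pow A. \<Sum>k\<in>J. g k (x p) * inj_sum (J - {k}) g K x * (\<Prod>a\<in>A - J. - l a))"
    unfolding wi_def using A K p
    by (subst sum.distrib[symmetric], intro sum.cong refl, subst inj_sum_insert)
       (auto intro: finite_subset simp: sum_distrib_left algebra_simps)
  also have "(\<Sum>J\<in>Pow A. \<Sum>k\<in>J. g k (x p) * inj_sum (J - {k}) g K x * (\<Prod>a\<in>A - J. - l a)) =
      (\<Sum>(J, k)\<in>(SIGMA J:Pow A. J). g k (x p) * inj_sum (J - {k}) g K x * (\<Prod>a\<in>A - J. - l a))"
    using A by (intro sum.Sigma) (auto intro: finite_subset)
  also have "\<dots> = (\<Sum>(k, J)\<in>(SIGMA k:A. Pow (A - {k})). g k (x p) * inj_sum J g K x * (\<Prod>a\<in>A - {k} - J. - l a))"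
    by (rule sum.reindex_bij_witness[where i = "\<lambda>(k, J). (insert k J, k)" and j = "\<lambda>(J, k). (k, J - {k})"])
       (auto intro!: arg_cong2[where f = "(*)"] prod.cong)
  also have "\<dots> = (\<Sum>k\<in>A. \<Sum>J\<in>Pow (A - {k}). g k (x p) * inj_sum J g K x * (\<Prod>a\<in>A - {k} - J. - l a))"
    using A by (intro sum.Sigma[symmetric]) auto
  also have "\<dots> = (\<Sum>k\<in>A. g k (x p) * wi (A - {k}) l g K x)"
    by (simp add: wi_def sum_distrib_left mult.assoc)
  finally show ?thesis .
qed

lemma wi_empty_config:
  assumes "finite A"
  shows "wi A l g {} x = (\<Prod>a\<in>A. - l a)"
proof -
  have "inj_sum J g {} x = (if J = {} then 1 else 0)" for J
    by (auto simp: inj_sum_def)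
  then have "wi A l g {} x = (\<Sum>J\<in>Pow A. if J = {} then (\<Prod>a\<in>A. - l a) else 0)"
    unfolding wi_def by (intro sum.cong) auto
  also have "\<dots> = (\<Prod>a\<in>A. - l a)"
    using assms by (subst sum.delta) auto
  finally show ?thesis .
qed

lemma wi_empty_index [simp]: "wi {} l g K x = 1"
  by (simp add: wi_def inj_sum_def)

text \<open>The converse mechanism: the compensated sum over points, with the point removed from the
  configuration, raises the order by one. This is the pathwise operator applied to
  \<open>g a\<close> times a polynomial. The induction adds one point at a time and compares the
  increments given by \<open>wi_insert\<close>.\<close>

lemma wi_raise:
  assumes "finite K" "finite A" "a \<notin> A"
  shows "wi (insert a A) l g K x = (\<Sum>i\<in>K. g a (x i) * wi A l g (K - {i}) x) - l a * wi A l g K x"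
  using assms
proof (induction K arbitrary: A rule: finite_induct)
  case empty
  then show ?case by (simp add: wi_empty_config)
next
  case (insert p K)
  have "wi (insert a A) l g (insert p K) x = wi (insert a A) l g K x + (g a (x p) * wi A l g K x +
      (\<Sum>k\<in>A. g k (x p) * wi (insert a (A - {k})) l g K x))"
  proof -
    have "insert a A - {k} = insert a (A - {k})" if "k \<in> A" for k
      using that insert.prems by auto
    then show ?thesis
      using insert by (simp add: wi_insert)
  qed
  also have "(\<Sum>k\<in>A. g k (x p) * wi (insert a (A - {k})) l g K x) =
      (\<Sum>k\<in>A. g k (x p) * ((\<Sum>i\<in>K. g a (x i) * wi (A - {k}) l g (K - {i}) x) - l a * wi (A - {k}) l g K x))"
    using insert by (intro sum.cong) auto
  also have "\<dots> = (\<Sum>i\<in>K. g a (x i) * (\<Sum>k\<in>A. g k (x p) * wi (A - {k}) l g (K - {i}) x)) -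
      l a * (\<Sum>k\<in>A. g k (x p) * wi (A - {k}) l g K x)"
    by (simp add: right_diff_distrib sum_subtractf sum_distrib_left mult.left_commute)
       (rule sum.swap)
  also have "wi (insert a A) l g K x = (\<Sum>i\<in>K. g a (x i) * wi A l g (K - {i}) x) - l a * wi A l g K x"
    using insert by blast
  finally have lhs: "wi (insert a A) l g (insert p K) x =
      (\<Sum>i\<in>K. g a (x i) * wi A l g (K - {i}) x) - l a * wi A l g K x + (g a (x p) * wi A l g K x +
      ((\<Sum>i\<in>K. g a (x i) * (\<Sum>k\<in>A. g k (x p) * wi (A - {k}) l g (K - {i}) x)) -
      l a * (\<Sum>k\<in>A. g k (x p) * wi (A - {k}) l g K x)))" .
  have "(\<Sum>i\<in>insert p K. g a (x i) * wi A l g (insert p K - {i}) x) =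
      g a (x p) * wi A l g K x + (\<Sum>i\<in>K. g a (x i) * wi A l g (insert p (K - {i})) x)"
  proof -
    have "insert p K - {i} = insert p (K - {i})" if "i \<in> K" for i
      using that insert by auto
    then show ?thesis using insert by simp
  qed
  also have "(\<Sum>i\<in>K. g a (x i) * wi A l g (insert p (K - {i})) x) =
      (\<Sum>i\<in>K. g a (x i) * wi A l g (K - {i}) x) +
      (\<Sum>i\<in>K. g a (x i) * (\<Sum>k\<in>A. g k (x p) * wi (A - {k}) l g (K - {i}) x))"
    using insert by (simp add: wi_insert distrib_left sum.distrib)
  finally show ?case
    using lhs insert by (simp add: wi_insert algebra_simps)
qed

text \<open>A recursion in which no point is removed, so that it can be read as a statement about
  the measure alone. The linear statistic of \<open>g a\<close> times the polynomial also counts the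
  cases in which a shares its point with another label k; these are subtracted with merged factor
  \<open>g k y * g a y\<close>. Setting \<open>l k\<close> to 0 forces the merged label onto a
  point.\<close>

lemma wi_newton:
  assumes K: "finite K" and A: "finite A" "a \<notin> A"
  shows "wi (insert a A) l g K x = ((\<Sum>i\<in>K. g a (x i)) - l a) * wi A l g K x -
    (\<Sum>k\<in>A. wi A (l(k := 0)) (g(k := \<lambda>y. g k y * g a y)) K x)"
proof -
  have 1: "wi A (l(k := 0)) (g(k := \<lambda>y. g k y * g a y)) K x =
      (\<Sum>i\<in>K. g k (x i) * g a (x i) * wi (A - {k}) l g (K - {i}) x)" if k: "k \<in> A" for k
  proof -
    have "wi (insert k (A - {k})) (l(k := 0)) (g(k := \<lambda>y. g k y * g a y)) K x =
        (\<Sum>i\<in>K. g k (x i) * g a (x i) * wi (A - {k}) (l(k := 0)) (g(k := \<lambda>y. g k y * g a y)) (K - {i}) x)"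
      using K A by (subst wi_raise) auto
    also have "\<dots> = (\<Sum>i\<in>K. g k (x i) * g a (x i) * wi (A - {k}) l g (K - {i}) x)"
      by (intro sum.cong refl arg_cong2[where f = "(*)"] wi_cong) auto
    finally show ?thesis using k by (simp add: insert_absorb)
  qed
  have 2: "wi A l g K x = wi A l g (K - {i}) x + (\<Sum>k\<in>A. g k (x i) * wi (A - {k}) l g (K - {i}) x)"
    if "i \<in> K" for i
    using wi_insert[OF A(1), of "K - {i}" i l g x] K that by (simp add: insert_absorb)
  have "(\<Sum>i\<in>K. g a (x i)) * wi A l g K x = (\<Sum>i\<in>K. g a (x i) * wi A l g (K - {i}) x) +
      (\<Sum>i\<in>K. \<Sum>k\<in>A. g k (x i) * g a (x i) * wi (A - {k}) l g (K - {i}) x)"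
    unfolding sum_distrib_right sum.distrib[symmetric]
    by (intro sum.cong refl) (subst 2, assumption, simp add: algebra_simps sum_distrib_left)
  also have "(\<Sum>i\<in>K. \<Sum>k\<in>A. g k (x i) * g a (x i) * wi (A - {k}) l g (K - {i}) x) =
      (\<Sum>k\<in>A. wi A (l(k := 0)) (g(k := \<lambda>y. g k y * g a y)) K x)"
    by (subst sum.swap) (simp add: 1)
  finally show ?thesis
    using wi_raise[OF K A, of l g x] by (simp add: algebra_simps)
qed

text \<open>By \<open>wi_insert\<close> each point multiplies the bound by at most 1 +
  \<open>card A\<close>. Growth that is geometric in the number of points is what exponential
  moments can absorb.\<close>

lemma wi_bound:
  assumes "finite K" "finite A"
    and "\<And>a i. a \<in> A \<Longrightarrow> i \<in> K \<Longrightarrow> \<bar>g a (x i)\<bar> \<le> L" "\<And>a. a \<in> A \<Longrightarrow> \<bar>l a\<bar> \<le> L"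
  shows "\<bar>wi A l g K x\<bar> \<le> L ^ card A * (1 + real (card A)) ^ card K"
  using assms
proof (induction K arbitrary: A rule: finite_induct)
  case empty
  have "\<bar>\<Prod>a\<in>A. - l a\<bar> \<le> (\<Prod>a\<in>A. L)"
    unfolding abs_prod using empty by (intro prod_mono) auto
  then show ?case using empty by (simp add: wi_empty_config)
next
  case (insert p K)
  let ?n = "card A"
  have "\<bar>wi A l g (insert p K) x\<bar> \<le> \<bar>wi A l g K x\<bar> + (\<Sum>k\<in>A. \<bar>g k (x p)\<bar> * \<bar>wi (A - {k}) l g K x\<bar>)"
    using sum_abs[of "\<lambda>k. g k (x p) * wi (A - {k}) l g K x" A] insert
    by (subst wi_insert) (auto simp: abs_mult intro: order_trans[OF abs_triangle_ineq])
  also have "\<dots> \<le> L ^ ?n * (1 + real ?n) ^ card K + (\<Sum>k\<in>A. L * (L ^ (?n - 1) * (1 + real ?n) ^ card K))"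
  proof (intro add_mono sum_mono mult_mono)
    fix k assume k: "k \<in> A"
    then have L: "L \<ge> 0" using insert.prems(3)[of k] by simp
    have "\<bar>wi (A - {k}) l g K x\<bar> \<le> L ^ card (A - {k}) * (1 + real (card (A - {k}))) ^ card K"
      using insert by auto
    also have "\<dots> \<le> L ^ card (A - {k}) * (1 + real ?n) ^ card K"
      using L insert.prems k by (intro mult_left_mono power_mono) (auto simp: card_Diff_singleton)
    finally show "\<bar>wi (A - {k}) l g K x\<bar> \<le> L ^ (?n - 1) * (1 + real ?n) ^ card K"
      using k by (simp add: card_Diff_singleton)
    show "0 \<le> L" by fact
  qed (use insert in auto)
  also have "(\<Sum>k\<in>A. L * (L ^ (?n - 1) * (1 + real ?n) ^ card K)) = real ?n * L ^ ?n * (1 + real ?n) ^ card K"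
    by (cases ?n) (auto simp: algebra_simps)
  also have "L ^ ?n * (1 + real ?n) ^ card K + real ?n * L ^ ?n * (1 + real ?n) ^ card K =
      L ^ ?n * (1 + real ?n) ^ card (insert p K)"
    using insert by (simp add: algebra_simps)
  finally show ?case .
qed

text \<open>The generating function of the polynomials with equal factors is
  \<open>z \<mapsto> exp (- z l) \<Prod>i. (1 + z w (x i))\<close>.\<close>

lemma wi_exponential:
  assumes "finite K"
  shows "\<exists>c. (\<forall>A. finite A \<longrightarrow> wi A (\<lambda>_. l) (\<lambda>_. w) K x = fact (card A) * c (card A)) \<and>
    c sums (exp (- l) * (\<Prod>i\<in>K. 1 + w (x i))) \<and>
    (\<forall>n. (\<Sum>m<n. \<bar>c m\<bar>) \<le> exp \<bar>l\<bar> * (\<Prod>i\<in>K. 1 + \<bar>w (x i)\<bar>))"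
  using assms
proof (induction K rule: finite_induct)
  case empty
  define c where "c n = (- l) ^ n / fact n" for n
  have "c sums exp (- l)"
    using exp_converges[of "- l"] by (simp add: c_def[abs_def] divide_inverse mult.commute)
  moreover have "(\<Sum>m<n. \<bar>c m\<bar>) \<le> exp \<bar>l\<bar>" for n
  proof -
    have eq: "\<bar>c m\<bar> = \<bar>l\<bar> ^ m /\<^sub>R fact m" for m
      by (simp add: c_def abs_mult power_abs divide_inverse mult.commute)
    have "(\<lambda>m. \<bar>c m\<bar>) sums exp \<bar>l\<bar>"
      unfolding eq by (rule exp_converges)
    then show ?thesis
      using sum_le_suminf[of "\<lambda>m. \<bar>c m\<bar>" "{..<n}"] by (auto simp: sums_iff)
  qed
  ultimately show ?case
    by (intro exI[of _ c]) (auto simp: wi_empty_config c_def[abs_def])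
next
  case (insert p K)
  then obtain c where c: "\<And>A. finite A \<Longrightarrow> wi A (\<lambda>_. l) (\<lambda>_. w) K x = fact (card A) * c (card A)"
    "c sums (exp (- l) * (\<Prod>i\<in>K. 1 + w (x i)))"
    "\<And>n. (\<Sum>m<n. \<bar>c m\<bar>) \<le> exp \<bar>l\<bar> * (\<Prod>i\<in>K. 1 + \<bar>w (x i)\<bar>)" by blast
  \<comment> \<open>The coefficients after multiplying the generating function by 1 + z w(x p). The
    bound on absolute partial sums is carried along as a dominating function for later.\<close>
  define d where "d n = c n + (case n of 0 \<Rightarrow> 0 | Suc m \<Rightarrow> w (x p) * c m)" for n
  have "wi A (\<lambda>_. l) (\<lambda>_. w) (insert p K) x = fact (card A) * d (card A)" if A: "finite A" for A
  proof (cases "A = {}")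
    case True
    then show ?thesis using c(1)[of "{}"] by (simp add: d_def)
  next
    case False
    then obtain n where n: "card A = Suc n"
      using A by (metis card_eq_0_iff not0_implies_Suc)
    have "wi A (\<lambda>_. l) (\<lambda>_. w) (insert p K) x = fact (card A) * c (card A) + (\<Sum>k\<in>A. w (x p) * (fact n * c n))"
      using insert A n by (simp add: wi_insert c(1) card_Diff_singleton)
    then show ?thesis
      by (simp add: n d_def algebra_simps)
  qed
  moreover have "d sums (exp (- l) * (\<Prod>i\<in>insert p K. 1 + w (x i)))"
  proof -
    have "(\<lambda>n. case n of 0 \<Rightarrow> 0 | Suc m \<Rightarrow> w (x p) * c m) sums (w (x p) * (exp (- l) * (\<Prod>i\<in>K. 1 + w (x i))))"
      using sums_mult[OF c(2), of "w (x p)"]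
        sums_Suc_iff[of "\<lambda>n. case n of 0 \<Rightarrow> 0 | Suc m \<Rightarrow> w (x p) * c m" "w (x p) * (exp (- l) * (\<Prod>i\<in>K. 1 + w (x i)))"]
      by simp
    from sums_add[OF c(2) this] show ?thesis
      using insert by (simp add: d_def[abs_def] algebra_simps)
  qed
  moreover have "(\<Sum>m<n. \<bar>d m\<bar>) \<le> exp \<bar>l\<bar> * (\<Prod>i\<in>insert p K. 1 + \<bar>w (x i)\<bar>)" for n
  proof -
    have "(\<Sum>m<n. \<bar>d m\<bar>) \<le> (\<Sum>m<n. \<bar>c m\<bar>) + (\<Sum>m<n. (case m of 0 \<Rightarrow> 0 | Suc m \<Rightarrow> \<bar>w (x p)\<bar> * \<bar>c m\<bar>))"
      unfolding sum.distrib[symmetric]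
      by (intro sum_mono) (auto simp: d_def split: nat.split simp flip: abs_mult intro: abs_triangle_ineq)
    also have "(\<Sum>m<n. (case m of 0 \<Rightarrow> 0 | Suc m \<Rightarrow> \<bar>w (x p)\<bar> * \<bar>c m\<bar>)) \<le> \<bar>w (x p)\<bar> * (\<Sum>m<n. \<bar>c m\<bar>)"
    proof (cases n)
      case (Suc k)
      have "(\<Sum>m<Suc k. (case m of 0 \<Rightarrow> 0 | Suc m \<Rightarrow> \<bar>w (x p)\<bar> * \<bar>c m\<bar>)) = \<bar>w (x p)\<bar> * (\<Sum>m<k. \<bar>c m\<bar>)"
        by (subst sum.lessThan_Suc_shift) (simp add: sum_distrib_left)
      also have "\<dots> \<le> \<bar>w (x p)\<bar> * (\<Sum>m<Suc k. \<bar>c m\<bar>)"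
        by (intro mult_left_mono) auto
      finally show ?thesis using Suc by simp
    qed simp
    also have "(\<Sum>m<n. \<bar>c m\<bar>) + \<bar>w (x p)\<bar> * (\<Sum>m<n. \<bar>c m\<bar>) = (1 + \<bar>w (x p)\<bar>) * (\<Sum>m<n. \<bar>c m\<bar>)"
      by (simp add: algebra_simps)
    also have "\<dots> \<le> (1 + \<bar>w (x p)\<bar>) * (exp \<bar>l\<bar> * (\<Prod>i\<in>K. 1 + \<bar>w (x i)\<bar>))"
      by (intro mult_left_mono c(3)) auto
    finally show ?thesis
      using insert by (simp add: algebra_simps)
  qed
  ultimately show ?case by blast
qed

section \<open>Wiener-Ito polynomials as functionals of the process\<close>

lemma measurable_nn_integral_counting_space:
  assumes "g \<in> borel_measurable lam"
  shows "(\<lambda>\<mu>. \<integral>\<^sup>+y. g y \<partial>\<mu>) \<in> borel_measurable (counting_space lam)"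
  using assms
proof (induction rule: borel_measurable_induct)
  case (cong f g)
  have "(\<integral>\<^sup>+y. f y \<partial>\<mu>) = (\<integral>\<^sup>+y. g y \<partial>\<mu>)" if "\<mu> \<in> space (counting_space lam)" for \<mu>
    using that cong by (intro nn_integral_cong) (auto simp: space_counting_space dest: counting_measuresD(2))
  then show ?case using cong by (simp cong: measurable_cong)
next
  case (set A)
  have "(\<integral>\<^sup>+y. indicator A y \<partial>\<mu>) = emeasure \<mu> A" if "\<mu> \<in> space (counting_space lam)" for \<mu>
    using that set by (intro nn_integral_indicator) (auto simp: space_counting_space dest: counting_measuresD(1))
  then show ?case using set by (simp cong: measurable_cong)
next
  case (mult u c)
  have "(\<integral>\<^sup>+y. c * u y \<partial>\<mu>) = c * (\<integral>\<^sup>+y. u y \<partial>\<mu>)" if "\<mu> \<in> space (counting_space lam)" for \<mu>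
    using that mult
    by (intro nn_integral_cmult) (auto simp: space_counting_space dest: counting_measuresD(1) cong: measurable_cong_sets)
  then show ?case using mult by (simp cong: measurable_cong)
next
  case (add u v)
  have "(\<integral>\<^sup>+y. v y + u y \<partial>\<mu>) = (\<integral>\<^sup>+y. v y \<partial>\<mu>) + (\<integral>\<^sup>+y. u y \<partial>\<mu>)" if "\<mu> \<in> space (counting_space lam)" for \<mu>
    using that add
    by (intro nn_integral_add) (auto simp: space_counting_space dest: counting_measuresD(1) cong: measurable_cong_sets)
  then show ?case using add by (simp cong: measurable_cong)
next
  case (seq U)
  have "(\<integral>\<^sup>+y. (SUP i. U i) y \<partial>\<mu>) = (SUP i. \<integral>\<^sup>+y. U i y \<partial>\<mu>)" if "\<mu> \<in> space (counting_space lam)" for \<mu>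
    using that seq unfolding SUP_apply
    by (intro nn_integral_monotone_convergence_SUP)
       (auto simp: space_counting_space dest: counting_measuresD(1) cong: measurable_cong_sets)
  then show ?case using seq by (simp cong: measurable_cong)
qed

text \<open>On \<open>B\<close>, the measure \<open>\<mu>\<close> is the finite configuration \<open>\<Sum>i\<in>K. \<delta>\<^bsub>x i\<^esub>\<close>.\<close>

definition locally_points :: "'y measure \<Rightarrow> 'y set \<Rightarrow> 'y measure \<Rightarrow> nat set \<Rightarrow> (nat \<Rightarrow> 'y) \<Rightarrow> bool" where
  "locally_points lam B \<mu> K x \<longleftrightarrow> \<mu> \<in> counting_measures lam \<and> finite K \<and> x ` K \<subseteq> B \<and>
     (\<forall>A\<in>sets lam. emeasure \<mu> (A \<inter> B) = of_nat (card {i \<in> K. x i \<in> A}))"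

text \<open>Only the restriction of \<open>\<mu>\<close> to B is known. As a density it is the image
  of counting measure on K under x, and an integrand supported by B does not notice the
  restriction.\<close>

lemma locally_points_nn_integral:
  assumes rep: "locally_points lam B \<mu> K x" and B: "B \<in> sets lam"
    and g[measurable]: "g \<in> borel_measurable lam" and supp: "\<And>y. y \<in> space lam - B \<Longrightarrow> g y = 0"
  shows "(\<integral>\<^sup>+y. g y \<partial>\<mu>) = (\<Sum>i\<in>K. g (x i))"
proof -
  have \<mu>: "sets \<mu> = sets lam" "space \<mu> = space lam" and K: "finite K" "x ` K \<subseteq> B"
    using rep counting_measuresD(1,2)[of \<mu> lam] by (auto simp: locally_points_def)
  have x: "x i \<in> space lam" if "i \<in> K" for i
    using K that sets.sets_into_space[OF B] by auto
  have x_meas: "x \<in> count_space K \<rightarrow>\<^sub>M lam" using x by auto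
  have "density \<mu> (indicator B) = distr (count_space K) lam x"
  proof (rule measure_eqI)
    fix A assume "A \<in> sets (density \<mu> (indicator B))"
    then have A: "A \<in> sets lam" by (simp add: \<mu>)
    have "emeasure (density \<mu> (indicator B)) A = emeasure \<mu> (B \<inter> A)"
      using A B \<mu> by (subst emeasure_density) (auto simp: indicator_inter_arith[symmetric])
    also have "\<dots> = of_nat (card {i \<in> K. x i \<in> A})"
      using rep A by (simp add: locally_points_def Int_commute)
    also have "{i \<in> K. x i \<in> A} = x -` A \<inter> K" by auto
    also have "of_nat (card (x -` A \<inter> K)) = emeasure (distr (count_space K) lam x) A"
      using A K by (subst emeasure_distr[OF x_meas]) auto
    finally show "emeasure (density \<mu> (indicator B)) A = emeasure (distr (count_space K) lam x) A" .
  qed (simp add: \<mu>)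
  moreover have "(\<integral>\<^sup>+y. g y \<partial>density \<mu> (indicator B)) = (\<integral>\<^sup>+y. g y \<partial>\<mu>)"
    using B g supp \<mu> by (subst nn_integral_density)
      (auto intro!: nn_integral_cong simp: indicator_def cong: measurable_cong_sets)
  moreover have "(\<integral>\<^sup>+y. g y \<partial>distr (count_space K) lam x) = (\<Sum>i\<in>K. g (x i))"
    using K by (subst nn_integral_distr[OF x_meas]) (auto simp: nn_integral_count_space_finite)
  ultimately show ?thesis by simp
qed

text \<open>The polynomial is written in terms of points, yet a single measurable function of the
  measure produces it for every representation. \<open>wi_newton\<close> builds it from linear
  statistics; the induction ranges over all g and l because the recursion changes both.\<close>

lemma wi_functional_exists:
  assumes A: "finite A" and B: "B \<in> sets lam"
    and g: "\<And>a. a \<in> A \<Longrightarrow> g a \<in> borel_measurable lam" "\<And>a y. a \<in> A \<Longrightarrow> y \<in> space lam - B \<Longrightarrow> g a y = 0"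
  shows "\<exists>\<Phi>\<in>borel_measurable (counting_space lam). \<forall>\<mu> K x. locally_points lam B \<mu> K x \<longrightarrow> \<Phi> \<mu> = wi A l g K x"
  using A g
proof (induction A arbitrary: g l rule: finite_induct)
  case empty
  then show ?case by (intro bexI[of _ "\<lambda>_. 1"]) auto
next
  case (insert a A)
  have ga[measurable]: "g a \<in> borel_measurable lam" by (simp add: insert)
  \<comment> \<open>The linear statistic, as a difference of two nonnegative integrals, since those
    are known to depend measurably on \<open>\<mu>\<close>.\<close>
  define \<Psi> where "\<Psi> \<mu> = enn2real (\<integral>\<^sup>+y. ennreal (g a y) \<partial>\<mu>) - enn2real (\<integral>\<^sup>+y. ennreal (- g a y) \<partial>\<mu>)" for \<mu>
  have \<Psi>[measurable]: "\<Psi> \<in> borel_measurable (counting_space lam)"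
    unfolding \<Psi>_def by (intro borel_measurable_diff measurable_compose[OF measurable_nn_integral_counting_space]) measurable
  have \<Psi>_eq: "\<Psi> \<mu> = (\<Sum>i\<in>K. g a (x i))" if rep: "locally_points lam B \<mu> K x" for \<mu> K x
  proof -
    have "(\<integral>\<^sup>+y. ennreal (g a y) \<partial>\<mu>) = (\<Sum>i\<in>K. ennreal (g a (x i)))"
      "(\<integral>\<^sup>+y. ennreal (- g a y) \<partial>\<mu>) = (\<Sum>i\<in>K. ennreal (- g a (x i)))"
      using insert.prems by (intro locally_points_nn_integral[OF rep B]; simp)+
    moreover have "(\<Sum>i\<in>K. ennreal (s i)) = ennreal (\<Sum>i\<in>K. max 0 (s i))" for s :: "nat \<Rightarrow> real"
    proof -
      have "(\<Sum>i\<in>K. ennreal (s i)) = (\<Sum>i\<in>K. ennreal (max 0 (s i)))"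
        by (intro sum.cong) (auto simp: max_def ennreal_neg)
      also have "\<dots> = ennreal (\<Sum>i\<in>K. max 0 (s i))"
        by (rule sum_ennreal) simp
      finally show ?thesis .
    qed
    ultimately have "\<Psi> \<mu> = (\<Sum>i\<in>K. max 0 (g a (x i))) - (\<Sum>i\<in>K. max 0 (- g a (x i)))"
      by (simp add: \<Psi>_def sum_nonneg)
    also have "\<dots> = (\<Sum>i\<in>K. g a (x i))"
      unfolding sum_subtractf[symmetric] by (intro sum.cong) auto
    finally show ?thesis .
  qed
  obtain \<Phi> where \<Phi>[measurable]: "\<Phi> \<in> borel_measurable (counting_space lam)"
    and \<Phi>_eq: "\<And>\<mu> K x. locally_points lam B \<mu> K x \<Longrightarrow> \<Phi> \<mu> = wi A l g K x"
    using insert.IH[of g l] insert.prems by (metis insertCI)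
  have "\<forall>k. \<exists>\<Phi>\<in>borel_measurable (counting_space lam). k \<in> A \<longrightarrow> (\<forall>\<mu> K x. locally_points lam B \<mu> K x \<longrightarrow>
      \<Phi> \<mu> = wi A (l(k := 0)) (g(k := \<lambda>y. g k y * g a y)) K x)"
  proof
    fix k
    show "\<exists>\<Phi>\<in>borel_measurable (counting_space lam). k \<in> A \<longrightarrow> (\<forall>\<mu> K x. locally_points lam B \<mu> K x \<longrightarrow>
        \<Phi> \<mu> = wi A (l(k := 0)) (g(k := \<lambda>y. g k y * g a y)) K x)"
    proof (cases "k \<in> A")
      case True
      have gk[measurable]: "g k \<in> borel_measurable lam" using True insert.prems by simp
      have "\<exists>\<Phi>\<in>borel_measurable (counting_space lam). \<forall>\<mu> K x. locally_points lam B \<mu> K x \<longrightarrow>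
          \<Phi> \<mu> = wi A (l(k := 0)) (g(k := \<lambda>y. g k y * g a y)) K x"
        by (rule insert.IH) (use insert.prems in auto)
      then show ?thesis by blast
    next
      case False
      have "(\<lambda>_. 0 :: real) \<in> borel_measurable (counting_space lam)" by simp
      then show ?thesis using False by blast
    qed
  qed
  then obtain \<Xi> where \<Xi>[measurable]: "\<And>k. \<Xi> k \<in> borel_measurable (counting_space lam)"
    and \<Xi>_eq: "\<And>k \<mu> K x. k \<in> A \<Longrightarrow> locally_points lam B \<mu> K x \<Longrightarrow>
      \<Xi> k \<mu> = wi A (l(k := 0)) (g(k := \<lambda>y. g k y * g a y)) K x"
    by metis
  show ?case
  proof (intro bexI allI impI)
    show "(\<lambda>\<mu>. (\<Psi> \<mu> - l a) * \<Phi> \<mu> - (\<Sum>k\<in>A. \<Xi> k \<mu>)) \<in> borel_measurable (counting_space lam)"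
      by measurable
    fix \<mu> K x assume rep: "locally_points lam B \<mu> K x"
    then have "finite K" by (simp add: locally_points_def)
    from wi_newton[OF this insert(1,2), of l g x] show "(\<Psi> \<mu> - l a) * \<Phi> \<mu> - (\<Sum>k\<in>A. \<Xi> k \<mu>) = wi (insert a A) l g K x"
      by (simp add: \<Psi>_eq[OF rep] \<Phi>_eq[OF rep] \<Xi>_eq[OF _ rep])
  qed
qed

locale poisson_window = poisson_points M lam \<eta> X
  for M :: "'w measure" and lam :: "'y measure" and \<eta> :: "'w \<Rightarrow> 'y measure" and X :: "nat \<Rightarrow> 'w \<Rightarrow> 'y" +
  fixes B :: "'y set"
  assumes B_sets [measurable]: "B \<in> sets lam" and B_finite: "emeasure lam B < \<infinity>"
begin

text \<open>Bounded factors with support in the window; one constant L for all factors of a product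
  gives bounds by powers of L.\<close>

definition nice :: "real \<Rightarrow> ('y \<Rightarrow> real) \<Rightarrow> bool" where
  "nice L g \<longleftrightarrow> g \<in> borel_measurable lam \<and> 0 \<le> L \<and> (\<forall>y\<in>space lam. \<bar>g y\<bar> \<le> L * indicator B y)"

text \<open>The multiple integral of a product as a function of the measure. It is pinned down only
  on measures that are finite configurations inside B, which \<open>\<eta>\<close> is almost
  surely.\<close>

definition Phi :: "nat set \<Rightarrow> (nat \<Rightarrow> 'y \<Rightarrow> real) \<Rightarrow> 'y measure \<Rightarrow> real" where
  "Phi A g = (SOME \<Phi>. \<Phi> \<in> borel_measurable N \<and>
     (\<forall>\<mu> K x. locally_points lam B \<mu> K x \<longrightarrow> \<Phi> \<mu> = wi A (\<lambda>a. \<integral>y. g a y \<partial>lam) g K x))"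

definition pts :: "'w \<Rightarrow> nat set" where "pts \<omega> = {i \<in> I \<omega>. X i \<omega> \<in> B}"

text \<open>A natural number, so that it can serve as an exponent. An infinite count becomes 0,
  which \<open>\<eta>\<close> meets only on a null event.\<close>

definition num :: "'y measure \<Rightarrow> nat" where "num \<mu> = nat \<lfloor>enn2real (emeasure \<mu> B)\<rfloor>"

lemma nice_measurable [measurable_dest]: "nice L g \<Longrightarrow> g \<in> borel_measurable lam"
  by (simp add: nice_def)

lemma nice_zero: "nice L g \<Longrightarrow> y \<in> space lam - B \<Longrightarrow> g y = 0"
  by (auto simp: nice_def dest!: bspec)

lemma nice_bound: "nice L g \<Longrightarrow> y \<in> space lam \<Longrightarrow> \<bar>g y\<bar> \<le> L * indicator B y"
  by (simp add: nice_def)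

lemma nice_integrable:
  assumes "nice L g"
  shows "integrable lam g"
proof (rule Bochner_Integration.integrable_bound)
  show "integrable lam (\<lambda>y. L * indicator B y :: real)"
    using B_finite by auto
qed (use assms in \<open>auto simp: nice_def intro!: AE_I2\<close>)

lemma Phi:
  assumes "finite A" "\<And>a. a \<in> A \<Longrightarrow> nice L (g a)"
  shows Phi_measurable: "Phi A g \<in> borel_measurable N"
    and Phi_eq: "\<And>\<mu> K x. locally_points lam B \<mu> K x \<Longrightarrow> Phi A g \<mu> = wi A (\<lambda>a. \<integral>y. g a y \<partial>lam) g K x"
proof -
  have "\<exists>\<Phi>. \<Phi> \<in> borel_measurable N \<and>
     (\<forall>\<mu> K x. locally_points lam B \<mu> K x \<longrightarrow> \<Phi> \<mu> = wi A (\<lambda>a. \<integral>y. g a y \<partial>lam) g K x)"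
    using wi_functional_exists[OF assms(1) B_sets, of g] assms(2) nice_zero by (blast dest: nice_measurable)
  from someI_ex[OF this] show "Phi A g \<in> borel_measurable N"
    "\<And>\<mu> K x. locally_points lam B \<mu> K x \<Longrightarrow> Phi A g \<mu> = wi A (\<lambda>a. \<integral>y. g a y \<partial>lam) g K x"
    by (auto simp: Phi_def)
qed

lemma eta_B_finite: "AE \<omega> in M. emeasure (\<eta> \<omega>) B < \<infinity>"
  by (rule eta_finite[OF B_sets B_finite])

lemma pts_finite:
  assumes "\<omega> \<in> space M" "emeasure (\<eta> \<omega>) B < \<infinity>"
  shows "finite (pts \<omega>)" "emeasure (\<eta> \<omega>) B = of_nat (card (pts \<omega>))"
proof -
  have *: "emeasure (\<eta> \<omega>) B = emeasure (count_space UNIV) (pts \<omega>)"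
    using emeasure_eta[OF assms(1) B_sets] by (simp add: pts_def)
  with assms show fin: "finite (pts \<omega>)" by (cases "finite (pts \<omega>)") auto
  with * show "emeasure (\<eta> \<omega>) B = of_nat (card (pts \<omega>))" by simp
qed

lemma locally_points_eta:
  assumes \<omega>: "\<omega> \<in> space M" and fin: "emeasure (\<eta> \<omega>) B < \<infinity>"
  shows "locally_points lam B (\<eta> \<omega>) (pts \<omega>) (\<lambda>i. X i \<omega>)"
  unfolding locally_points_def
proof (intro conjI ballI)
  fix A assume A: "A \<in> sets lam"
  have "emeasure (\<eta> \<omega>) (A \<inter> B) = emeasure (count_space UNIV) {i \<in> I \<omega>. X i \<omega> \<in> A \<inter> B}"
    using A \<omega> by (intro emeasure_eta) auto
  also have "{i \<in> I \<omega>. X i \<omega> \<in> A \<inter> B} = {i \<in> pts \<omega>. X i \<omega> \<in> A}" by (auto simp: pts_def)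
  finally show "emeasure (\<eta> \<omega>) (A \<inter> B) = of_nat (card {i \<in> pts \<omega>. X i \<omega> \<in> A})"
    using pts_finite[OF assms] by simp
qed (use pts_finite[OF assms] in \<open>auto simp: pts_def eta_counting \<omega>\<close>)

lemma locally_points_reduced:
  assumes \<omega>: "\<omega> \<in> space M" and fin: "emeasure (\<eta> \<omega>) B < \<infinity>" and i: "i \<in> pts \<omega>"
  shows "locally_points lam B (reduced \<omega> i) (pts \<omega> - {i}) (\<lambda>i. X i \<omega>)"
  unfolding locally_points_def
proof (intro conjI ballI)
  have iI: "i \<in> I \<omega>" "X i \<omega> \<in> B" using i by (auto simp: pts_def)
  show "reduced \<omega> i \<in> counting_measures lam" by (rule reduced_counting[OF \<omega> iI(1)])
  fix A assume A: "A \<in> sets lam"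
  have "emeasure (reduced \<omega> i) (A \<inter> B) = of_nat (card {j \<in> pts \<omega>. X j \<omega> \<in> A}) - indicator A (X i \<omega>)"
    using locally_points_eta[OF \<omega> fin] A iI
    by (subst emeasure_reduced[OF \<omega> iI(1)]) (auto simp: locally_points_def indicator_def)
  also have "\<dots> = of_nat (card {j \<in> pts \<omega> - {i}. X j \<omega> \<in> A})"
  proof (cases "X i \<omega> \<in> A")
    case True
    have "{j \<in> pts \<omega>. X j \<omega> \<in> A} = insert i {j \<in> pts \<omega> - {i}. X j \<omega> \<in> A}" using True i by auto
    then have "card {j \<in> pts \<omega>. X j \<omega> \<in> A} = Suc (card {j \<in> pts \<omega> - {i}. X j \<omega> \<in> A})"
      using pts_finite[OF \<omega> fin] by simp
    then show ?thesis using True by (simp add: add.commute)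
  next
    case False
    then have "{j \<in> pts \<omega>. X j \<omega> \<in> A} = {j \<in> pts \<omega> - {i}. X j \<omega> \<in> A}" by auto
    then show ?thesis using False by simp
  qed
  finally show "emeasure (reduced \<omega> i) (A \<inter> B) = of_nat (card {j \<in> pts \<omega> - {i}. X j \<omega> \<in> A})" .
qed (use pts_finite[OF \<omega> fin] in \<open>auto simp: pts_def\<close>)

lemma locally_points_num: "locally_points lam B \<mu> K x \<Longrightarrow> num \<mu> = card K"
proof -
  assume rep: "locally_points lam B \<mu> K x"
  then have "emeasure \<mu> (B \<inter> B) = of_nat (card {i \<in> K. x i \<in> B})"
    using B_sets unfolding locally_points_def by blast
  moreover have "{i \<in> K. x i \<in> B} = K" using rep by (auto simp: locally_points_def)
  ultimately show ?thesis by (simp add: num_def)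
qed

lemma locally_points_add_dirac:
  assumes rep: "locally_points lam B \<mu> K x" and y: "y \<in> B" and k: "k \<notin> K"
  shows "locally_points lam B (add_dirac \<mu> y) (insert k K) (x(k := y))"
  unfolding locally_points_def
proof (intro conjI ballI)
  have \<mu>: "\<mu> \<in> counting_measures lam" "finite K" using rep by (auto simp: locally_points_def)
  show "add_dirac \<mu> y \<in> counting_measures lam" by (rule add_dirac_counting_measures[OF \<mu>(1)])
  fix A assume A: "A \<in> sets lam"
  have "emeasure (add_dirac \<mu> y) (A \<inter> B) = of_nat (card {i \<in> K. x i \<in> A}) + indicator A y"
    using A y rep counting_measuresD(1)[OF \<mu>(1)]
    by (subst emeasure_add_dirac) (auto simp: locally_points_def indicator_def)
  moreover have "{i \<in> insert k K. (x(k := y)) i \<in> A} = (if y \<in> A then insert k {i \<in> K. x i \<in> A} else {i \<in> K. x i \<in> A})"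
    using k by auto
  ultimately show "emeasure (add_dirac \<mu> y) (A \<inter> B) = of_nat (card {i \<in> insert k K. (x(k := y)) i \<in> A})"
    using k \<mu>(2) by (simp add: add.commute)
qed (use rep y k in \<open>auto simp: locally_points_def\<close>)

lemma locally_points_add_dirac_outside:
  assumes rep: "locally_points lam B \<mu> K x" and y: "y \<notin> B"
  shows "locally_points lam B (add_dirac \<mu> y) K x"
proof -
  have \<mu>: "\<mu> \<in> counting_measures lam" using rep by (auto simp: locally_points_def)
  then have "emeasure (add_dirac \<mu> y) (A \<inter> B) = emeasure \<mu> (A \<inter> B)" if "A \<in> sets lam" for A
    using that y counting_measuresD(1)[OF \<mu>] by (subst emeasure_add_dirac) auto
  then show ?thesis
    using rep add_dirac_counting_measures[OF \<mu>] by (auto simp: locally_points_def)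
qed

text \<open>Transfers \<open>wi_insert\<close> to measures. A point outside B changes nothing, and
  there the factors vanish as well.\<close>

lemma Phi_add_dirac:
  assumes A: "finite A" "\<And>a. a \<in> A \<Longrightarrow> nice L (g a)"
    and rep: "locally_points lam B \<mu> K x" and y: "y \<in> space lam"
  shows "Phi A g (add_dirac \<mu> y) = Phi A g \<mu> + (\<Sum>k\<in>A. g k y * Phi (A - {k}) g \<mu>)"
proof (cases "y \<in> B")
  case True
  have K: "finite K" using rep by (simp add: locally_points_def)
  then obtain k where k: "k \<notin> K" using ex_new_if_finite[OF infinite_UNIV_nat] by blast
  let ?l = "\<lambda>a. \<integral>y. g a y \<partial>lam"
  have cong: "wi A' ?l g K (x(k := y)) = wi A' ?l g K x" for A'
    using k by (intro wi_cong) auto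
  have "Phi A g (add_dirac \<mu> y) = wi A ?l g (insert k K) (x(k := y))"
    by (rule Phi_eq[OF A locally_points_add_dirac[OF rep True k]])
  also have "\<dots> = wi A ?l g K x + (\<Sum>j\<in>A. g j y * wi (A - {j}) ?l g K x)"
    by (simp add: wi_insert[OF A(1) K k] cong)
  also have "\<dots> = Phi A g \<mu> + (\<Sum>k\<in>A. g k y * Phi (A - {k}) g \<mu>)"
    using A by (intro arg_cong2[where f = "(+)"] sum.cong arg_cong2[where f = "(*)"] refl Phi_eq[OF _ _ rep, symmetric]) auto
  finally show ?thesis .
next
  case False
  have "g k y = 0" if "k \<in> A" for k using nice_zero[OF A(2)[OF that]] y False by simp
  then show ?thesis
    using Phi_eq[OF A rep] Phi_eq[OF A locally_points_add_dirac_outside[OF rep False]] by simp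
qed

lemma Phi_bound:
  assumes A: "finite A" "\<And>a. a \<in> A \<Longrightarrow> nice L (g a)"
  shows "\<exists>C c. 0 \<le> C \<and> (\<forall>\<mu> K x. locally_points lam B \<mu> K x \<longrightarrow> \<bar>Phi A g \<mu>\<bar> \<le> C * real c ^ num \<mu>)"
proof -
  \<comment> \<open>\<open>wi_bound\<close> asks for one bound on the factors and on their
    integrals; inserting 0 keeps the maximum defined for empty A.\<close>
  define L' where "L' = max L (Max (insert 0 ((\<lambda>a. \<bar>\<integral>y. g a y \<partial>lam\<bar>) ` A)))"
  have L': "0 \<le> L'" unfolding L'_def using A(1) by (simp add: le_max_iff_disj)
  show ?thesis
  proof (intro exI[of _ "L' ^ card A"] exI[of _ "1 + card A"] conjI allI impI)
    fix \<mu> K x assume rep: "locally_points lam B \<mu> K x"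
    have "\<bar>wi A (\<lambda>a. \<integral>y. g a y \<partial>lam) g K x\<bar> \<le> L' ^ card A * (1 + real (card A)) ^ card K"
    proof (rule wi_bound)
      fix a i assume "a \<in> A" "i \<in> K"
      then have "\<bar>g a (x i)\<bar> \<le> L * indicator B (x i)" "x i \<in> B"
        using rep sets.sets_into_space[OF B_sets] by (auto simp: locally_points_def intro!: nice_bound[OF A(2)])
      then show "\<bar>g a (x i)\<bar> \<le> L'" by (simp add: L'_def)
    next
      fix a assume "a \<in> A"
      then have "\<bar>\<integral>y. g a y \<partial>lam\<bar> \<le> Max (insert 0 ((\<lambda>a. \<bar>\<integral>y. g a y \<partial>lam\<bar>) ` A))"
        using A(1) by (intro Max_ge) auto
      then show "\<bar>\<integral>y. g a y \<partial>lam\<bar> \<le> L'" by (simp add: L'_def)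
    qed (use rep A in \<open>auto simp: locally_points_def\<close>)
    then show "\<bar>Phi A g \<mu>\<bar> \<le> L' ^ card A * real (1 + card A) ^ num \<mu>"
      by (simp add: Phi_eq[OF A rep] locally_points_num[OF rep])
  qed (use L' in simp)
qed

lemma num_measurable [measurable]: "num \<in> N \<rightarrow>\<^sub>M count_space UNIV"
  unfolding num_def by measurable

text \<open>Against the Poisson weights the powers of c sum to exp(c r) exp(-r), where r is the
  intensity of B.\<close>

lemma exponential_moment: "(\<integral>\<^sup>+\<omega>. ennreal (real c ^ num (\<eta> \<omega>)) \<partial>M) < \<infinity>"
proof -
  let ?r = "enn2real (emeasure lam B)"
  let ?E = "\<lambda>k. {\<omega> \<in> space M. emeasure (\<eta> \<omega>) B = of_nat k}"
  have E[measurable]: "?E k \<in> sets M" for k by measurable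
  have "(\<integral>\<^sup>+\<omega>. ennreal (real c ^ num (\<eta> \<omega>)) \<partial>M) = (\<integral>\<^sup>+\<omega>. (\<Sum>k. ennreal (real c ^ k) * indicator (?E k) \<omega>) \<partial>M)"
  proof (rule nn_integral_cong_AE)
    show "AE \<omega> in M. ennreal (real c ^ num (\<eta> \<omega>)) = (\<Sum>k. ennreal (real c ^ k) * indicator (?E k) \<omega>)"
      using eta_B_finite AE_space
    proof eventually_elim
      case (elim \<omega>)
      note K = pts_finite[OF elim(2,1)]
      have "(\<Sum>k. ennreal (real c ^ k) * indicator (?E k) \<omega>) = (\<Sum>k\<in>{card (pts \<omega>)}. ennreal (real c ^ k) * indicator (?E k) \<omega>)"
        using elim K by (intro suminf_finite) (auto simp: indicator_def)
      then show ?case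
        using elim K by (simp add: num_def)
    qed
  qed
  also have "\<dots> = (\<Sum>k. ennreal (real c ^ k) * emeasure M (?E k))"
    by (subst nn_integral_suminf) (auto simp: nn_integral_cmult_indicator)
  also have "\<dots> = (\<Sum>k. ennreal ((real c * ?r) ^ k /\<^sub>R fact k * exp (- ?r)))"
    by (intro suminf_cong)
       (simp add: emeasure_eq_measure eta_eq_prob[OF B_sets B_finite] ennreal_mult[symmetric] power_mult_distrib
          divide_inverse mult_ac)
  also have "\<dots> < \<infinity>"
  proof -
    have "(\<lambda>k. (real c * ?r) ^ k /\<^sub>R fact k * exp (- ?r)) sums (exp (real c * ?r) * exp (- ?r))"
      by (intro sums_mult2 exp_converges)
    then show ?thesis
      by (subst suminf_ennreal2) (auto simp: sums_iff)
  qed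
  finally show ?thesis .
qed

section \<open>Duality between Wiener-Ito polynomials and difference operators\<close>

text \<open>This class of functionals, unlike \<open>L\<^sup>2\<close>, is preserved under difference operators (at almost
  every point) and under multiplication by Wiener-Ito polynomials.\<close>

definition weighted :: "('y measure \<Rightarrow> real) \<Rightarrow> bool" where
  "weighted F \<longleftrightarrow> F \<in> borel_measurable N \<and>
     (\<forall>c::nat. (\<integral>\<^sup>+\<omega>. ennreal (real c ^ num (\<eta> \<omega>) * \<bar>F (\<eta> \<omega>)\<bar>) \<partial>M) < \<infinity>)"

lemma weighted_measurable [measurable_dest]: "weighted F \<Longrightarrow> F \<in> borel_measurable N"
  by (simp add: weighted_def)

text \<open>A factor that grows like \<open>d ^ num\<close> is absorbed by replacing the weight c by
  c d; this is why \<open>weighted\<close> demands all weights at once.\<close>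

lemma weighted_mult:
  assumes F: "weighted F" and G[measurable]: "G \<in> borel_measurable N"
    and C: "0 \<le> C" and bound: "AE \<omega> in M. \<bar>G (\<eta> \<omega>)\<bar> \<le> C * real d ^ num (\<eta> \<omega>)"
  shows "weighted (\<lambda>\<mu>. G \<mu> * F \<mu>)"
  unfolding weighted_def
proof (intro conjI allI)
  note [measurable] = weighted_measurable[OF F]
  show "(\<lambda>\<mu>. G \<mu> * F \<mu>) \<in> borel_measurable N" by measurable
  fix c :: nat
  have "(\<integral>\<^sup>+\<omega>. ennreal (real c ^ num (\<eta> \<omega>) * \<bar>G (\<eta> \<omega>) * F (\<eta> \<omega>)\<bar>) \<partial>M) \<le>
      (\<integral>\<^sup>+\<omega>. ennreal C * ennreal (real (c * d) ^ num (\<eta> \<omega>) * \<bar>F (\<eta> \<omega>)\<bar>) \<partial>M)"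
  proof (rule nn_integral_mono_AE)
    show "AE \<omega> in M. ennreal (real c ^ num (\<eta> \<omega>) * \<bar>G (\<eta> \<omega>) * F (\<eta> \<omega>)\<bar>) \<le>
        ennreal C * ennreal (real (c * d) ^ num (\<eta> \<omega>) * \<bar>F (\<eta> \<omega>)\<bar>)"
      using bound
    proof eventually_elim
      case (elim \<omega>)
      have "real c ^ num (\<eta> \<omega>) * (\<bar>G (\<eta> \<omega>)\<bar> * \<bar>F (\<eta> \<omega>)\<bar>) \<le>
          real c ^ num (\<eta> \<omega>) * ((C * real d ^ num (\<eta> \<omega>)) * \<bar>F (\<eta> \<omega>)\<bar>)"
        using elim by (intro mult_left_mono mult_right_mono) auto
      then show ?case
        using C by (simp add: ennreal_mult[symmetric] abs_mult power_mult_distrib mult_ac ennreal_leI)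
    qed
  qed
  also have "\<dots> = ennreal C * (\<integral>\<^sup>+\<omega>. ennreal (real (c * d) ^ num (\<eta> \<omega>) * \<bar>F (\<eta> \<omega>)\<bar>) \<partial>M)"
    by (intro nn_integral_cmult) measurable
  also have "\<dots> < \<infinity>"
    using F[unfolded weighted_def, THEN conjunct2, rule_format, of "c * d"]
    by (simp add: ennreal_mult_less_top del: of_nat_mult)
  finally show "(\<integral>\<^sup>+\<omega>. ennreal (real c ^ num (\<eta> \<omega>) * \<bar>G (\<eta> \<omega>) * F (\<eta> \<omega>)\<bar>) \<partial>M) < \<infinity>" .
qed

lemma weighted_const: "weighted (\<lambda>_. a)"
proof -
  have "weighted (\<lambda>_. 1)"
    using exponential_moment by (simp add: weighted_def)
  from weighted_mult[OF this, of "\<lambda>_. a" "\<bar>a\<bar>" 1] show ?thesis by simp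
qed

text \<open>The entrance from L2 to the weighted class: c^n \<bar>z\<bar> \<le> c^(2n) + z^2, where
  the first term is an exponential moment.\<close>

lemma weighted_square_bound:
  assumes F[measurable]: "F \<in> borel_measurable N"
  shows "(\<integral>\<^sup>+\<omega>. ennreal (real c ^ num (\<eta> \<omega>) * \<bar>F (\<eta> \<omega>)\<bar>) \<partial>M) \<le>
    (\<integral>\<^sup>+\<omega>. ennreal (real (c * c) ^ num (\<eta> \<omega>)) \<partial>M) + (\<integral>\<^sup>+\<omega>. ennreal ((F (\<eta> \<omega>))\<^sup>2) \<partial>M)"
proof -
  have "real c ^ n * \<bar>z\<bar> \<le> real (c * c) ^ n + z\<^sup>2" for n z
  proof -
    have "2 * (real c ^ n * \<bar>z\<bar>) \<le> (real c ^ n)\<^sup>2 + z\<^sup>2"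
      using sum_squares_bound[of "real c ^ n" "\<bar>z\<bar>"] by (simp add: mult.assoc)
    moreover have "(real c ^ n)\<^sup>2 = real (c * c) ^ n"
      by (simp add: power_mult_distrib power2_eq_square)
    moreover have "0 \<le> real c ^ n * \<bar>z\<bar>" by simp
    ultimately show ?thesis by linarith
  qed
  then show ?thesis
    by (subst nn_integral_add[symmetric])
       (auto intro!: nn_integral_mono ennreal_leI simp: ennreal_plus[symmetric] simp del: ennreal_plus of_nat_mult)
qed

lemma weighted_integrable:
  assumes "weighted F"
  shows "integrable M (\<lambda>\<omega>. F (\<eta> \<omega>))"
proof -
  note [measurable] = weighted_measurable[OF assms]
  have "(\<integral>\<^sup>+\<omega>. ennreal (real 1 ^ num (\<eta> \<omega>) * \<bar>F (\<eta> \<omega>)\<bar>) \<partial>M) < \<infinity>"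
    using assms unfolding weighted_def by blast
  then show ?thesis by (simp add: integrable_iff_bounded)
qed

lemma AE_locally_points: "AE \<omega> in M. locally_points lam B (\<eta> \<omega>) (pts \<omega>) (\<lambda>i. X i \<omega>)"
  using eta_B_finite AE_space by eventually_elim (rule locally_points_eta)

lemma Phi_AE_bound:
  assumes "finite A" "\<And>a. a \<in> A \<Longrightarrow> nice L (g a)"
  obtains C d where "0 \<le> C" "AE \<omega> in M. \<bar>Phi A g (\<eta> \<omega>)\<bar> \<le> C * real d ^ num (\<eta> \<omega>)"
proof -
  from Phi_bound[of A L g] assms obtain C d where C: "0 \<le> C"
    "\<And>\<mu> K x. locally_points lam B \<mu> K x \<Longrightarrow> \<bar>Phi A g \<mu>\<bar> \<le> C * real d ^ num \<mu>"
    by blast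
  have "AE \<omega> in M. \<bar>Phi A g (\<eta> \<omega>)\<bar> \<le> C * real d ^ num (\<eta> \<omega>)"
    using AE_locally_points by eventually_elim (rule C(2))
  with C(1) show thesis by (rule that)
qed

lemma weighted_Phi_mult:
  assumes "finite A" "\<And>a. a \<in> A \<Longrightarrow> nice L (g a)" "weighted F"
  shows "weighted (\<lambda>\<mu>. Phi A g \<mu> * F \<mu>)"
proof -
  obtain C d where "0 \<le> C" "AE \<omega> in M. \<bar>Phi A g (\<eta> \<omega>)\<bar> \<le> C * real d ^ num (\<eta> \<omega>)"
    using Phi_AE_bound[of A L g] assms by blast
  with weighted_mult[OF assms(3) Phi_measurable[of A L g]] assms show ?thesis by blast
qed

lemma weighted_Phi:
  "finite A \<Longrightarrow> (\<And>a. a \<in> A \<Longrightarrow> nice L (g a)) \<Longrightarrow> weighted (Phi A g)"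
  using weighted_Phi_mult[OF _ _ weighted_const[of 1], of A L g] by simp

lemma measurable_add_dirac_pair [measurable]:
  "(\<lambda>(\<mu>, y). add_dirac \<mu> y) \<in> N \<Otimes>\<^sub>M lam \<rightarrow>\<^sub>M N"
  unfolding case_prod_unfold by (rule measurable_add_dirac) measurable

lemma measurable_shift:
  "F \<in> N \<rightarrow>\<^sub>M borel \<Longrightarrow> (\<lambda>p. F (add_dirac (fst p) (snd p))) \<in> N \<Otimes>\<^sub>M lam \<rightarrow>\<^sub>M borel"
  using measurable_compose[OF measurable_add_dirac_pair] by (simp add: case_prod_unfold)

text \<open>By the Mecke equation, integrating the shifted functional over B amounts to summing over
  the n points in B; each contributes \<bar>F(\<eta>)\<bar> with weight c^(n - 1), because one point
  has been removed. The factor n c^(n - 1) is then hidden in a larger weight.\<close>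

lemma shift_bound:
  fixes F :: "'y measure \<Rightarrow> real"
  assumes F[measurable]: "F \<in> borel_measurable N"
  shows "(\<integral>\<^sup>+\<omega>. \<integral>\<^sup>+y. indicator B y * ennreal (real c ^ num (\<eta> \<omega>) * \<bar>F (add_dirac (\<eta> \<omega>) y)\<bar>) \<partial>lam \<partial>M) \<le>
    (\<integral>\<^sup>+\<omega>. ennreal (real (2 * (c + 1)) ^ num (\<eta> \<omega>) * \<bar>F (\<eta> \<omega>)\<bar>) \<partial>M)"
proof -
  define f where "f p = indicator B (snd p) * ennreal (real c ^ num (fst p) * \<bar>F (add_dirac (fst p) (snd p))\<bar>)" for p
  note [measurable] = measurable_shift[OF F]
  have f: "f \<in> borel_measurable (N \<Otimes>\<^sub>M lam)"
    unfolding f_def[abs_def] by measurable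
  have "(\<integral>\<^sup>+\<omega>. \<integral>\<^sup>+y. indicator B y * ennreal (real c ^ num (\<eta> \<omega>) * \<bar>F (add_dirac (\<eta> \<omega>) y)\<bar>) \<partial>lam \<partial>M) =
      (\<integral>\<^sup>+\<omega>. psum f \<omega> \<partial>M)"
    using mecke_classD(2)[OF mecke[OF f]] by (simp add: f_def)
  also have "\<dots> \<le> (\<integral>\<^sup>+\<omega>. ennreal (real (2 * (c + 1)) ^ num (\<eta> \<omega>) * \<bar>F (\<eta> \<omega>)\<bar>) \<partial>M)"
  proof (rule nn_integral_mono_AE)
    show "AE \<omega> in M. psum f \<omega> \<le> ennreal (real (2 * (c + 1)) ^ num (\<eta> \<omega>) * \<bar>F (\<eta> \<omega>)\<bar>)"
      using eta_B_finite AE_space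
    proof eventually_elim
      case (elim \<omega>)
      let ?n = "card (pts \<omega>)"
      have num: "num (\<eta> \<omega>) = ?n"
        by (rule locally_points_num[OF locally_points_eta[OF elim(2,1)]])
      have "psum f \<omega> = (\<integral>\<^sup>+i. ennreal (real c ^ (?n - 1) * \<bar>F (\<eta> \<omega>)\<bar>) * indicator (pts \<omega>) i \<partial>count_space (I \<omega>))"
        unfolding psum_def
      proof (rule nn_integral_cong)
        fix i assume "i \<in> space (count_space (I \<omega>))"
        then have i: "i \<in> I \<omega>" by simp
        show "f (reduced \<omega> i, X i \<omega>) = ennreal (real c ^ (?n - 1) * \<bar>F (\<eta> \<omega>)\<bar>) * indicator (pts \<omega>) i"
        proof (cases "i \<in> pts \<omega>")
          case True
          have "num (reduced \<omega> i) = ?n - 1"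
            using locally_points_num[OF locally_points_reduced[OF elim(2,1) True]] True
              pts_finite[OF elim(2,1)] by simp
          then show ?thesis
            using True by (simp add: f_def add_dirac_reduced[OF elim(2) i] pts_def)
        next
          case False
          then show ?thesis using i by (simp add: f_def pts_def)
        qed
      qed
      also have "\<dots> = ennreal (real c ^ (?n - 1) * \<bar>F (\<eta> \<omega>)\<bar>) * emeasure (count_space (I \<omega>)) (pts \<omega>)"
        by (intro nn_integral_cmult_indicator) (auto simp: pts_def)
      also have "emeasure (count_space (I \<omega>)) (pts \<omega>) = of_nat ?n"
        using pts_finite[OF elim(2,1)] by (subst emeasure_count_space_finite) (auto simp: pts_def)
      also have "ennreal (real c ^ (?n - 1) * \<bar>F (\<eta> \<omega>)\<bar>) * of_nat ?n = ennreal (real ?n * real c ^ (?n - 1) * \<bar>F (\<eta> \<omega>)\<bar>)"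
        by (simp add: ennreal_of_nat_eq_real_of_nat ennreal_mult[symmetric] mult_ac)
      also have "\<dots> \<le> ennreal (real (2 * (c + 1)) ^ num (\<eta> \<omega>) * \<bar>F (\<eta> \<omega>)\<bar>)"
      proof (intro ennreal_leI mult_right_mono)
        \<comment> \<open>The factor 2 pays for n \<le> 2^n; c + 1 replaces c because powers
          increase with the exponent only for bases at least 1, and c may be 0.\<close>
        have "real ?n * real c ^ (?n - 1) \<le> 2 ^ ?n * real (c + 1) ^ ?n"
        proof (rule mult_mono)
          show "real ?n \<le> 2 ^ ?n" by (rule less_imp_le[OF of_nat_less_two_power])
          have "real c ^ (?n - 1) \<le> real (c + 1) ^ (?n - 1)" by (intro power_mono) auto
          also have "\<dots> \<le> real (c + 1) ^ ?n" by (intro power_increasing) auto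
          finally show "real c ^ (?n - 1) \<le> real (c + 1) ^ ?n" .
        qed auto
        also have "\<dots> = real (2 * (c + 1)) ^ ?n"
          unfolding power_mult_distrib[symmetric] by simp
        finally show "real ?n * real c ^ (?n - 1) \<le> real (2 * (c + 1)) ^ num (\<eta> \<omega>)"
          by (simp add: num)
      qed simp
      finally show ?case .
    qed
  qed
  finally show ?thesis .
qed

lemma integrable_pairI:
  fixes f :: "'w \<times> 'y \<Rightarrow> real"
  assumes f: "f \<in> borel_measurable (M \<Otimes>\<^sub>M lam)"
    and fin: "(\<integral>\<^sup>+\<omega>. \<integral>\<^sup>+y. ennreal \<bar>f (\<omega>, y)\<bar> \<partial>lam \<partial>M) < \<infinity>"
  shows "integrable (M \<Otimes>\<^sub>M lam) f"
proof (rule integrableI_bounded[OF f])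
  have "(\<integral>\<^sup>+p. ennreal (norm (f p)) \<partial>(M \<Otimes>\<^sub>M lam)) = (\<integral>\<^sup>+\<omega>. \<integral>\<^sup>+y. ennreal \<bar>f (\<omega>, y)\<bar> \<partial>lam \<partial>M)"
    using f by (subst lam.nn_integral_fst[symmetric]) auto
  with fin show "(\<integral>\<^sup>+p. ennreal (norm (f p)) \<partial>(M \<Otimes>\<^sub>M lam)) < \<infinity>" by simp
qed

text \<open>Integration by parts for one factor. In the Mecke equation for \<open>h1\<close> the
  shift restores \<open>\<eta>\<close> inside F while the polynomial is evaluated at the reduced
  configuration, so \<open>wi_raise\<close> identifies the sum over points as the polynomial of next
  higher order plus the compensator, whose expectation is the integral of \<open>h2\<close>.\<close>

lemma Phi_duality:
  assumes A: "finite A" "a \<notin> A" and g: "\<And>b. b \<in> insert a A \<Longrightarrow> nice L (g b)" and F: "weighted F"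
  shows Phi_duality_integrable:
      "integrable (M \<Otimes>\<^sub>M lam) (\<lambda>(\<omega>, y). g a y * (Phi A g (\<eta> \<omega>) * diff_op y F (\<eta> \<omega>)))"
    and Phi_duality_eq: "(\<integral>\<omega>. Phi (insert a A) g (\<eta> \<omega>) * F (\<eta> \<omega>) \<partial>M) =
      (\<integral>y. g a y * (\<integral>\<omega>. Phi A g (\<eta> \<omega>) * diff_op y F (\<eta> \<omega>) \<partial>M) \<partial>lam)"
proof -
  interpret P: pair_sigma_finite M lam ..
  have gA: "\<And>b. b \<in> A \<Longrightarrow> nice L (g b)" and ga: "nice L (g a)" using g by auto
  have L: "0 \<le> L" using ga by (simp add: nice_def)
  note [measurable] = weighted_measurable[OF F] nice_measurable[OF ga] Phi_measurable[OF A(1) gA, simplified]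
    measurable_shift[OF weighted_measurable[OF F]]
  obtain C d where C: "0 \<le> C" and bound: "AE \<omega> in M. \<bar>Phi A g (\<eta> \<omega>)\<bar> \<le> C * real d ^ num (\<eta> \<omega>)"
    using Phi_AE_bound[of A L g] A(1) gA by blast
  define h1 where "h1 p = g a (snd p) * (Phi A g (fst p) * F (add_dirac (fst p) (snd p)))" for p
  define h2 where "h2 p = g a (snd p) * (Phi A g (fst p) * F (fst p))" for p
  have [measurable]: "h1 \<in> borel_measurable (N \<Otimes>\<^sub>M lam)" "h2 \<in> borel_measurable (N \<Otimes>\<^sub>M lam)"
    unfolding h1_def[abs_def] h2_def[abs_def] by measurable
  have le: "ennreal \<bar>g a y * (Phi A g (\<eta> \<omega>) * z)\<bar> \<le>
      ennreal (L * C) * (indicator B y * ennreal (real d ^ num (\<eta> \<omega>) * \<bar>z\<bar>))"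
    if "\<bar>Phi A g (\<eta> \<omega>)\<bar> \<le> C * real d ^ num (\<eta> \<omega>)" "y \<in> space lam" for y z \<omega>
  proof -
    have "\<bar>g a y * (Phi A g (\<eta> \<omega>) * z)\<bar> \<le> (L * indicator B y) * ((C * real d ^ num (\<eta> \<omega>)) * \<bar>z\<bar>)"
      unfolding abs_mult using nice_bound[OF ga that(2)] that(1) L C
      by (intro mult_mono) auto
    then show ?thesis
      using L C by (auto simp: indicator_def ennreal_mult[symmetric] mult_ac ennreal_leI)
  qed
  have int1: "integrable (M \<Otimes>\<^sub>M lam) (\<lambda>(\<omega>, y). h1 (\<eta> \<omega>, y))"
  proof (rule integrable_pairI)
    have "(\<integral>\<^sup>+\<omega>. \<integral>\<^sup>+y. ennreal \<bar>h1 (\<eta> \<omega>, y)\<bar> \<partial>lam \<partial>M) \<le>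
        (\<integral>\<^sup>+\<omega>. \<integral>\<^sup>+y. ennreal (L * C) * (indicator B y * ennreal (real d ^ num (\<eta> \<omega>) * \<bar>F (add_dirac (\<eta> \<omega>) y)\<bar>)) \<partial>lam \<partial>M)"
      using bound by (intro nn_integral_mono_AE) (auto simp: h1_def elim!: eventually_mono intro!: nn_integral_mono le)
    also have "\<dots> = ennreal (L * C) * (\<integral>\<^sup>+\<omega>. \<integral>\<^sup>+y. indicator B y * ennreal (real d ^ num (\<eta> \<omega>) * \<bar>F (add_dirac (\<eta> \<omega>) y)\<bar>) \<partial>lam \<partial>M)"
    proof -
      have [measurable]: "(\<lambda>p. F (add_dirac (\<eta> (fst p)) (snd p))) \<in> borel_measurable (M \<Otimes>\<^sub>M lam)"
        by (rule measurable_compose[OF measurable_add_dirac weighted_measurable[OF F]]) measurable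
      have "(\<lambda>\<omega>. \<integral>\<^sup>+y. indicator B y * ennreal (real d ^ num (\<eta> \<omega>) * \<bar>F (add_dirac (\<eta> \<omega>) y)\<bar>) \<partial>lam) \<in> borel_measurable M"
        by (intro lam.borel_measurable_nn_integral) (simp add: case_prod_unfold)
      moreover have "(\<lambda>y. F (add_dirac (\<eta> \<omega>) y)) \<in> borel_measurable lam" if "\<omega> \<in> space M" for \<omega>
        using measurable_Pair2[OF \<open>(\<lambda>p. F (add_dirac (\<eta> (fst p)) (snd p))) \<in> borel_measurable (M \<Otimes>\<^sub>M lam)\<close> that] by simp
      ultimately show ?thesis
        by (subst nn_integral_cmult[symmetric]) (auto intro!: nn_integral_cong nn_integral_cmult)
    qed
    also have "\<dots> \<le> ennreal (L * C) * (\<integral>\<^sup>+\<omega>. ennreal (real (2 * (d + 1)) ^ num (\<eta> \<omega>) * \<bar>F (\<eta> \<omega>)\<bar>) \<partial>M)"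
      by (intro mult_left_mono shift_bound) auto
    also have "\<dots> < \<infinity>"
      using F[unfolded weighted_def, THEN conjunct2, rule_format, of "2 * (d + 1)"]
      by (simp add: ennreal_mult_less_top del: of_nat_mult of_nat_add)
    finally show "(\<integral>\<^sup>+\<omega>. \<integral>\<^sup>+y. ennreal \<bar>case (\<omega>, y) of (\<omega>, y) \<Rightarrow> h1 (\<eta> \<omega>, y)\<bar> \<partial>lam \<partial>M) < \<infinity>" by simp
  qed measurable
  have int2: "integrable (M \<Otimes>\<^sub>M lam) (\<lambda>(\<omega>, y). h2 (\<eta> \<omega>, y))"
  proof -
    have "(\<lambda>\<omega>. \<integral>\<^sup>+y. ennreal \<bar>h2 (\<eta> \<omega>, y)\<bar> \<partial>lam) =
        (\<lambda>\<omega>. (\<integral>\<^sup>+y. ennreal \<bar>g a y\<bar> \<partial>lam) * ennreal \<bar>Phi A g (\<eta> \<omega>) * F (\<eta> \<omega>)\<bar>)"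
      by (simp add: h2_def abs_mult ennreal_mult nn_integral_multc fun_eq_iff)
    then have "(\<integral>\<^sup>+\<omega>. \<integral>\<^sup>+y. ennreal \<bar>h2 (\<eta> \<omega>, y)\<bar> \<partial>lam \<partial>M) =
        (\<integral>\<^sup>+y. ennreal \<bar>g a y\<bar> \<partial>lam) * (\<integral>\<^sup>+\<omega>. ennreal \<bar>Phi A g (\<eta> \<omega>) * F (\<eta> \<omega>)\<bar> \<partial>M)"
      by (simp only:) (intro nn_integral_cmult, measurable)
    also have "\<dots> < \<infinity>"
      using nice_integrable[OF ga] weighted_integrable[OF weighted_Phi_mult[OF A(1) gA F]]
      by (simp add: integrable_iff_bounded ennreal_mult_less_top)
    finally have fin: "(\<integral>\<^sup>+\<omega>. \<integral>\<^sup>+y. ennreal \<bar>h2 (\<eta> \<omega>, y)\<bar> \<partial>lam \<partial>M) < \<infinity>" .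
    show ?thesis
    proof (rule integrable_pairI)
      show "(\<integral>\<^sup>+\<omega>. \<integral>\<^sup>+y. ennreal \<bar>case (\<omega>, y) of (\<omega>, y) \<Rightarrow> h2 (\<eta> \<omega>, y)\<bar> \<partial>lam \<partial>M) < \<infinity>"
        using fin by simp
    qed measurable
  qed
  have eq12: "(\<lambda>(\<omega>, y). g a y * (Phi A g (\<eta> \<omega>) * diff_op y F (\<eta> \<omega>))) = (\<lambda>(\<omega>, y). h1 (\<eta> \<omega>, y) - h2 (\<eta> \<omega>, y))"
    by (auto simp: h1_def h2_def diff_op_def fun_eq_iff algebra_simps)
  show int12: "integrable (M \<Otimes>\<^sub>M lam) (\<lambda>(\<omega>, y). g a y * (Phi A g (\<eta> \<omega>) * diff_op y F (\<eta> \<omega>)))"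
    unfolding eq12 using Bochner_Integration.integrable_diff[OF int1 int2] by (simp add: case_prod_unfold)
  let ?l = "\<integral>y. g a y \<partial>lam"
  have rsum: "AE \<omega> in M. rsum h1 \<omega> = Phi (insert a A) g (\<eta> \<omega>) * F (\<eta> \<omega>) + ?l * (Phi A g (\<eta> \<omega>) * F (\<eta> \<omega>))"
    using eta_B_finite AE_space
  proof eventually_elim
    case (elim \<omega>)
    note rep = locally_points_eta[OF elim(2,1)] and fin = pts_finite[OF elim(2,1)]
    let ?x = "\<lambda>i. X i \<omega>" and ?ll = "\<lambda>a. \<integral>y. g a y \<partial>lam"
    have point_term: "h1 (reduced \<omega> i, X i \<omega>) = (if i \<in> pts \<omega> then g a (X i \<omega>) * wi A ?ll g (pts \<omega> - {i}) ?x * F (\<eta> \<omega>) else 0)"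
      if i: "i \<in> I \<omega>" for i
    proof (cases "i \<in> pts \<omega>")
      case True
      then show ?thesis
        using Phi_eq[OF A(1) gA locally_points_reduced[OF elim(2,1) True]] i elim
        by (simp add: h1_def add_dirac_reduced)
    next
      case False
      then have "g a (X i \<omega>) = 0"
        using i X_in_space[OF elim(2) i] by (intro nice_zero[OF ga]) (auto simp: pts_def)
      then show ?thesis using False by (simp add: h1_def)
    qed
    have sub: "{i. i \<in> I \<omega> \<and> h1 (reduced \<omega> i, X i \<omega>) \<noteq> 0} \<subseteq> pts \<omega>"
      using point_term by (auto split: if_splits)
    have "rsum h1 \<omega> = (\<Sum>i | i \<in> I \<omega> \<and> h1 (reduced \<omega> i, X i \<omega>) \<noteq> 0. h1 (reduced \<omega> i, X i \<omega>))"
      unfolding rsum_def using finite_subset[OF sub fin(1)] by (intro lebesgue_integral_count_space_finite_support) auto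
    also have "\<dots> = (\<Sum>i\<in>pts \<omega>. h1 (reduced \<omega> i, X i \<omega>))"
      using sub fin by (intro sum.mono_neutral_left) (auto simp: pts_def)
    also have "\<dots> = (\<Sum>i\<in>pts \<omega>. g a (X i \<omega>) * wi A ?ll g (pts \<omega> - {i}) ?x) * F (\<eta> \<omega>)"
      unfolding sum_distrib_right by (intro sum.cong refl, subst point_term) (auto simp: pts_def)
    also have "(\<Sum>i\<in>pts \<omega>. g a (X i \<omega>) * wi A ?ll g (pts \<omega> - {i}) ?x) =
        wi (insert a A) ?ll g (pts \<omega>) ?x + ?l * wi A ?ll g (pts \<omega>) ?x"
      using wi_raise[OF fin(1) A, of ?ll g ?x] by simp
    also have "wi (insert a A) ?ll g (pts \<omega>) ?x = Phi (insert a A) g (\<eta> \<omega>)"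
      using Phi_eq[OF _ g rep, of "insert a A"] A by simp
    also have "wi A ?ll g (pts \<omega>) ?x = Phi A g (\<eta> \<omega>)"
      using Phi_eq[OF A(1) gA rep] by simp
    finally show ?case by (simp add: algebra_simps)
  qed
  have gi: "\<And>b. b \<in> insert a A \<Longrightarrow> nice L (g b)" by (rule g)
  have intPF: "integrable M (\<lambda>\<omega>. Phi (insert a A) g (\<eta> \<omega>) * F (\<eta> \<omega>))" "integrable M (\<lambda>\<omega>. Phi A g (\<eta> \<omega>) * F (\<eta> \<omega>))"
    using A gi gA by (auto intro!: weighted_integrable weighted_Phi_mult[where L = L] F)
  have "(\<integral>\<omega>. rsum h1 \<omega> \<partial>M) = (\<integral>\<omega>. Phi (insert a A) g (\<eta> \<omega>) * F (\<eta> \<omega>) + ?l * (Phi A g (\<eta> \<omega>) * F (\<eta> \<omega>)) \<partial>M)"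
    by (intro integral_cong_AE rsum borel_measurable_integrable rsum_measurable)
       (use intPF mecke_real(1)[OF _ int1] in auto)
  then have "(\<integral>\<omega>. Phi (insert a A) g (\<eta> \<omega>) * F (\<eta> \<omega>) \<partial>M) =
      (\<integral>(\<omega>, y). h1 (\<eta> \<omega>, y) \<partial>(M \<Otimes>\<^sub>M lam)) - ?l * (\<integral>\<omega>. Phi A g (\<eta> \<omega>) * F (\<eta> \<omega>) \<partial>M)"
    using intPF mecke_real(2)[OF _ int1] by simp
  also have "?l * (\<integral>\<omega>. Phi A g (\<eta> \<omega>) * F (\<eta> \<omega>) \<partial>M) = (\<integral>(\<omega>, y). h2 (\<eta> \<omega>, y) \<partial>(M \<Otimes>\<^sub>M lam))"
    by (subst P.integral_fst'[OF int2, symmetric]) (simp add: h2_def mult.commute)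
  also have "(\<integral>(\<omega>, y). h1 (\<eta> \<omega>, y) \<partial>(M \<Otimes>\<^sub>M lam)) - (\<integral>(\<omega>, y). h2 (\<eta> \<omega>, y) \<partial>(M \<Otimes>\<^sub>M lam)) =
      (\<integral>(\<omega>, y). g a y * (Phi A g (\<eta> \<omega>) * diff_op y F (\<eta> \<omega>)) \<partial>(M \<Otimes>\<^sub>M lam))"
    unfolding eq12 using Bochner_Integration.integral_diff[OF int1 int2] by (simp add: case_prod_unfold)
  also have "\<dots> = (\<integral>y. (\<integral>\<omega>. g a y * (Phi A g (\<eta> \<omega>) * diff_op y F (\<eta> \<omega>)) \<partial>M) \<partial>lam)"
    by (rule P.integral_snd[OF int12, symmetric])
  finally show "(\<integral>\<omega>. Phi (insert a A) g (\<eta> \<omega>) * F (\<eta> \<omega>) \<partial>M) =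
      (\<integral>y. g a y * (\<integral>\<omega>. Phi A g (\<eta> \<omega>) * diff_op y F (\<eta> \<omega>) \<partial>M) \<partial>lam)"
    by simp
qed

end

section \<open>Sums over bijections\<close>

definition bijections :: "nat set \<Rightarrow> nat set \<Rightarrow> (nat \<Rightarrow> nat) set" where
  "bijections A A' = {\<pi> \<in> A \<rightarrow>\<^sub>E A'. bij_betw \<pi> A A'}"

lemma finite_bijections: "finite A \<Longrightarrow> finite A' \<Longrightarrow> finite (bijections A A')"
  using finite_PiE[of A "\<lambda>_. A'"] by (simp add: bijections_def)

text \<open>Expansion of a permanent along the row a: k is the image of a, and the remaining labels
  are matched with A' - {k}.\<close>

lemma sum_bijections_insert:
  fixes c :: "nat \<Rightarrow> nat \<Rightarrow> real"
  assumes A: "finite A" "a \<notin> A" and A': "finite A'"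
  shows "(\<Sum>\<pi>\<in>bijections (insert a A) A'. \<Prod>b\<in>insert a A. c b (\<pi> b)) =
    (\<Sum>k\<in>A'. c a k * (\<Sum>\<pi>\<in>bijections A (A' - {k}). \<Prod>b\<in>A. c b (\<pi> b)))"
proof -
  have bij: "bij_betw (\<lambda>(k, \<pi>). \<pi>(a := k)) (SIGMA k:A'. bijections A (A' - {k})) (bijections (insert a A) A')"
  proof (rule bij_betwI[where g = "\<lambda>\<pi>. (\<pi> a, \<pi>(a := undefined))"])
    show "(\<lambda>(k, \<pi>). \<pi>(a := k)) \<in> (SIGMA k:A'. bijections A (A' - {k})) \<rightarrow> bijections (insert a A) A'"
    proof safe
      fix k \<pi> assume k: "k \<in> A'" and \<pi>: "\<pi> \<in> bijections A (A' - {k})"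
      have inj: "inj_on \<pi> A" and im: "\<pi> ` A = A' - {k}" and ext: "\<pi> \<in> extensional A"
        using \<pi> by (auto simp: bijections_def bij_betw_def PiE_iff)
      have "(\<pi>(a := k)) ` A = \<pi> ` A" using A by auto
      then have "(\<pi>(a := k)) ` insert a A = A'" using im k by auto
      moreover have "inj_on (\<pi>(a := k)) (insert a A)"
        using inj im A by (auto simp: inj_on_def)
      ultimately have "bij_betw (\<pi>(a := k)) (insert a A) A'" by (simp add: bij_betw_def)
      moreover have "\<pi>(a := k) \<in> insert a A \<rightarrow>\<^sub>E A'"
      proof -
        have "\<pi> b \<in> A'" if "b \<in> A" for b using im that by blast
        then show ?thesis using ext k by (auto simp: PiE_iff extensional_def)
      qed
      ultimately show "\<pi>(a := k) \<in> bijections (insert a A) A'"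
        by (simp add: bijections_def)
    qed
    show "(\<lambda>\<pi>. (\<pi> a, \<pi>(a := undefined))) \<in> bijections (insert a A) A' \<rightarrow> (SIGMA k:A'. bijections A (A' - {k}))"
    proof
      fix \<pi> assume \<pi>: "\<pi> \<in> bijections (insert a A) A'"
      then have inj: "inj_on \<pi> (insert a A)" and im: "\<pi> ` insert a A = A'" and ext: "\<pi> \<in> extensional (insert a A)"
        by (auto simp: bijections_def bij_betw_def PiE_iff)
      have im': "(\<pi>(a := undefined)) ` A = A' - {\<pi> a}"
      proof -
        have "(\<pi>(a := undefined)) ` A = \<pi> ` A" using A by auto
        also have "\<pi> ` A = A' - {\<pi> a}" using inj im A by (auto simp: inj_on_def)
        finally show ?thesis .
      qed
      moreover have "inj_on (\<pi>(a := undefined)) A"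
        using inj A by (auto simp: inj_on_def)
      ultimately have "bij_betw (\<pi>(a := undefined)) A (A' - {\<pi> a})" by (simp add: bij_betw_def)
      moreover have "\<pi>(a := undefined) \<in> A \<rightarrow>\<^sub>E (A' - {\<pi> a})"
      proof -
        have "(\<pi>(a := undefined)) b \<in> A' - {\<pi> a}" if "b \<in> A" for b using im' that by blast
        then show ?thesis using ext A by (auto simp: PiE_iff extensional_def)
      qed
      ultimately show "(\<pi> a, \<pi>(a := undefined)) \<in> (SIGMA k:A'. bijections A (A' - {k}))"
        using im by (auto simp: bijections_def)
    qed
  qed (use A in \<open>auto simp: bijections_def PiE_iff extensional_def fun_eq_iff\<close>)
  have "(\<Sum>\<pi>\<in>bijections (insert a A) A'. \<Prod>b\<in>insert a A. c b (\<pi> b)) =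
      (\<Sum>(k, \<pi>)\<in>(SIGMA k:A'. bijections A (A' - {k})). \<Prod>b\<in>insert a A. c b ((\<pi>(a := k)) b))"
    by (subst sum.reindex_bij_betw[OF bij, symmetric]) (simp add: case_prod_unfold)
  also have "\<dots> = (\<Sum>k\<in>A'. \<Sum>\<pi>\<in>bijections A (A' - {k}). \<Prod>b\<in>insert a A. c b ((\<pi>(a := k)) b))"
    using A A' by (subst sum.Sigma) (auto intro: finite_bijections)
  also have "\<dots> = (\<Sum>k\<in>A'. c a k * (\<Sum>\<pi>\<in>bijections A (A' - {k}). \<Prod>b\<in>A. c b (\<pi> b)))"
    unfolding sum_distrib_left
  proof (intro sum.cong refl)
    fix k \<pi>
    have "(\<Prod>b\<in>A. c b ((\<pi>(a := k)) b)) = (\<Prod>b\<in>A. c b (\<pi> b))"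
      using A by (intro prod.cong) auto
    then show "(\<Prod>b\<in>insert a A. c b ((\<pi>(a := k)) b)) = c a k * (\<Prod>b\<in>A. c b (\<pi> b))"
      using A by simp
  qed
  finally show ?thesis .
qed

section \<open>Expectations, isometry and exponential functionals\<close>

context poisson_window
begin

lemma nice_le:
  assumes "nice L g" "y \<in> space lam"
  shows "\<bar>g y\<bar> \<le> L"
proof -
  have "L * indicator B y \<le> L * 1"
    using assms by (intro mult_left_mono) (auto simp: nice_def indicator_def)
  with nice_bound[OF assms] show ?thesis by simp
qed

lemma Phi_empty: "AE \<omega> in M. Phi {} g (\<eta> \<omega>) = 1"
  using AE_locally_points by eventually_elim (subst Phi_eq[of "{}" 0], auto)

text \<open>Each use of the duality moves one factor onto G as a difference operator, which only
  multiplies G by w(y). The exceptional event is required to be common to all y, so that the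
  replacement is possible for each y.\<close>

lemma expectation_Phi_eigen:
  assumes A: "finite A" "\<And>a. a \<in> A \<Longrightarrow> nice L (g a)" and G: "weighted G"
    and w: "AE \<omega> in M. \<forall>y\<in>space lam. diff_op y G (\<eta> \<omega>) = w y * G (\<eta> \<omega>)"
  shows "(\<integral>\<omega>. Phi A g (\<eta> \<omega>) * G (\<eta> \<omega>) \<partial>M) = (\<Prod>a\<in>A. \<integral>y. g a y * w y \<partial>lam) * (\<integral>\<omega>. G (\<eta> \<omega>) \<partial>M)"
  using A
proof (induction A rule: finite_induct)
  case empty
  have "weighted (\<lambda>\<mu>. Phi {} g \<mu> * G \<mu>)" by (rule weighted_Phi_mult[where L = L]) (auto simp: G)
  then have "(\<integral>\<omega>. Phi {} g (\<eta> \<omega>) * G (\<eta> \<omega>) \<partial>M) = (\<integral>\<omega>. G (\<eta> \<omega>) \<partial>M)"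
    using Phi_empty[of g] weighted_integrable[OF G]
    by (intro integral_cong_AE) (auto dest: weighted_integrable elim!: eventually_mono)
  then show ?case by simp
next
  case (insert a A)
  have nice: "\<And>b. b \<in> insert a A \<Longrightarrow> nice L (g b)" by (rule insert.prems)
  have W: "weighted (\<lambda>\<mu>. Phi A g \<mu> * G \<mu>)" using insert by (intro weighted_Phi_mult[where L = L] G) auto
  have "(\<integral>\<omega>. Phi (insert a A) g (\<eta> \<omega>) * G (\<eta> \<omega>) \<partial>M) =
      (\<integral>y. g a y * (\<integral>\<omega>. Phi A g (\<eta> \<omega>) * diff_op y G (\<eta> \<omega>) \<partial>M) \<partial>lam)"
    by (rule Phi_duality_eq[OF insert(1,2) nice G])
  also have "\<dots> = (\<integral>y. (g a y * w y) * (\<integral>\<omega>. Phi A g (\<eta> \<omega>) * G (\<eta> \<omega>) \<partial>M) \<partial>lam)"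
  proof (rule Bochner_Integration.integral_cong[OF refl])
    fix y assume y: "y \<in> space lam"
    have eq: "AE \<omega> in M. w y * (Phi A g (\<eta> \<omega>) * G (\<eta> \<omega>)) = Phi A g (\<eta> \<omega>) * diff_op y G (\<eta> \<omega>)"
      using w by eventually_elim (use y in simp)
    have [measurable]: "Phi A g \<in> borel_measurable N" "G \<in> borel_measurable N"
      using insert G by (auto intro!: Phi_measurable[where L = L])
    have "(\<lambda>\<omega>. add_dirac (\<eta> \<omega>) y) \<in> M \<rightarrow>\<^sub>M N"
      using y by (intro measurable_add_dirac) measurable
    from measurable_compose[OF this weighted_measurable[OF G]]
    have [measurable]: "(\<lambda>\<omega>. diff_op y G (\<eta> \<omega>)) \<in> borel_measurable M"
      unfolding diff_op_def by measurable
    have "(\<integral>\<omega>. Phi A g (\<eta> \<omega>) * diff_op y G (\<eta> \<omega>) \<partial>M) = (\<integral>\<omega>. w y * (Phi A g (\<eta> \<omega>) * G (\<eta> \<omega>)) \<partial>M)"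
      using eq by (intro integral_cong_AE) (measurable, auto elim!: eventually_mono)
    then show "g a y * (\<integral>\<omega>. Phi A g (\<eta> \<omega>) * diff_op y G (\<eta> \<omega>) \<partial>M) =
        (g a y * w y) * (\<integral>\<omega>. Phi A g (\<eta> \<omega>) * G (\<eta> \<omega>) \<partial>M)" by simp
  qed
  also have "\<dots> = (\<integral>y. g a y * w y \<partial>lam) * (\<integral>\<omega>. Phi A g (\<eta> \<omega>) * G (\<eta> \<omega>) \<partial>M)"
    by simp
  finally show ?case using insert by simp
qed

text \<open>The constant functional is an eigenfunction with w = 0, and a nonempty product of zeros
  vanishes.\<close>

lemma expectation_Phi:
  assumes "finite A" "A \<noteq> {}" "\<And>a. a \<in> A \<Longrightarrow> nice L (g a)"
  shows "(\<integral>\<omega>. Phi A g (\<eta> \<omega>) \<partial>M) = 0"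
proof -
  have "(\<integral>\<omega>. Phi A g (\<eta> \<omega>) * 1 \<partial>M) = (\<Prod>a\<in>A. \<integral>y. g a y * 0 \<partial>lam) * (\<integral>\<omega>. 1 \<partial>M)"
    using assms by (intro expectation_Phi_eigen[where L = L] weighted_const) (auto simp: diff_op_def)
  then show ?thesis using assms by (simp add: card_gt_0_iff)
qed

lemma diff_op_Phi:
  assumes "finite A" "\<And>a. a \<in> A \<Longrightarrow> nice L (g a)"
  shows "AE \<omega> in M. \<forall>y\<in>space lam. diff_op y (Phi A g) (\<eta> \<omega>) = (\<Sum>k\<in>A. g k y * Phi (A - {k}) g (\<eta> \<omega>))"
  using AE_locally_points
  by eventually_elim (auto simp: diff_op_def Phi_add_dirac[OF assms])

text \<open>The isometry before symmetrization: a permanent of scalar products. The duality moves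
  \<open>g a\<close> to the other polynomial, where the difference operator deletes a label k of A';
  this is the expansion of the permanent along a. Different orders admit no bijection, which yields
  orthogonality.\<close>

lemma Phi_isometry:
  assumes A: "finite A" "\<And>a. a \<in> A \<Longrightarrow> nice L (g a)"
    and A': "finite A'" "\<And>a. a \<in> A' \<Longrightarrow> nice L (g' a)"
  shows "(\<integral>\<omega>. Phi A g (\<eta> \<omega>) * Phi A' g' (\<eta> \<omega>) \<partial>M) =
    (\<Sum>\<pi>\<in>bijections A A'. \<Prod>a\<in>A. \<integral>y. g a y * g' (\<pi> a) y \<partial>lam)"
  using A A'
proof (induction A arbitrary: A' rule: finite_induct)
  case empty
  have "(\<integral>\<omega>. Phi {} g (\<eta> \<omega>) * Phi A' g' (\<eta> \<omega>) \<partial>M) = (\<integral>\<omega>. Phi A' g' (\<eta> \<omega>) \<partial>M)"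
    using Phi_empty[of g] weighted_integrable[OF weighted_Phi[of A' L g']] empty
      weighted_integrable[OF weighted_Phi_mult[of "{}" L g, OF _ _ weighted_Phi[of A' L g']]]
    by (intro integral_cong_AE) (auto elim!: eventually_mono)
  moreover have "(\<integral>\<omega>. Phi {} g' (\<eta> \<omega>) \<partial>M) = (\<integral>\<omega>. 1 \<partial>M)"
    using Phi_empty[of g'] weighted_integrable[OF weighted_Phi[of "{}" L g']]
    by (intro integral_cong_AE) (auto elim!: eventually_mono)
  moreover have "bijections {} A' = (if A' = {} then {\<lambda>_. undefined} else {})"
    by (auto simp: bijections_def bij_betw_def)
  ultimately show ?case
    using expectation_Phi[of A' L g'] empty by (auto simp: prob_space)
next
  case (insert a A)
  have nice: "\<And>b. b \<in> insert a A \<Longrightarrow> nice L (g b)" by (rule insert.prems(1))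
  have W: "weighted (Phi A' g')" by (rule weighted_Phi) (use insert in auto)
  have Wk: "weighted (\<lambda>\<mu>. Phi A g \<mu> * Phi (A' - {k}) g' \<mu>)" for k
    by (intro weighted_Phi_mult[where L = L] weighted_Phi[where L = L]) (use insert in auto)
  let ?c = "\<lambda>a k. \<integral>y. g a y * g' k y \<partial>lam"
  have int_c: "integrable lam (\<lambda>y. g a y * g' k y)" if k: "k \<in> A'" for k
  proof (rule Bochner_Integration.integrable_bound)
    have ga: "nice L (g a)" and gk: "nice L (g' k)" using insert.prems k by auto
    show "integrable lam (\<lambda>y. L * g a y)"
      using nice_integrable[OF ga] by simp
    show "(\<lambda>y. g a y * g' k y) \<in> borel_measurable lam"
      using ga gk by (auto dest!: nice_measurable)
    have "\<bar>g' k y\<bar> \<le> L" if "y \<in> space lam" for y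
      by (rule nice_le[OF gk that])
    then show "AE y in lam. norm (g a y * g' k y) \<le> norm (L * g a y)"
      using ga by (intro AE_I2) (auto simp: abs_mult nice_def mult.commute[of L] intro!: mult_left_mono)
  qed
  have "(\<integral>\<omega>. Phi (insert a A) g (\<eta> \<omega>) * Phi A' g' (\<eta> \<omega>) \<partial>M) =
      (\<integral>y. g a y * (\<integral>\<omega>. Phi A g (\<eta> \<omega>) * diff_op y (Phi A' g') (\<eta> \<omega>) \<partial>M) \<partial>lam)"
    by (rule Phi_duality_eq[OF insert(1,2) nice W])
  also have "\<dots> = (\<integral>y. (\<Sum>k\<in>A'. (g a y * g' k y) * (\<integral>\<omega>. Phi A g (\<eta> \<omega>) * Phi (A' - {k}) g' (\<eta> \<omega>) \<partial>M)) \<partial>lam)"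
  proof (rule Bochner_Integration.integral_cong[OF refl])
    fix y assume y: "y \<in> space lam"
    have eq: "AE \<omega> in M. (\<Sum>k\<in>A'. g' k y * (Phi A g (\<eta> \<omega>) * Phi (A' - {k}) g' (\<eta> \<omega>))) =
        Phi A g (\<eta> \<omega>) * diff_op y (Phi A' g') (\<eta> \<omega>)"
    proof -
      have "AE \<omega> in M. \<forall>y\<in>space lam. diff_op y (Phi A' g') (\<eta> \<omega>) = (\<Sum>k\<in>A'. g' k y * Phi (A' - {k}) g' (\<eta> \<omega>))"
        by (rule diff_op_Phi[where L = L]) (use insert.prems in auto)
      then show ?thesis
        by eventually_elim (use y in \<open>simp add: sum_distrib_left mult_ac\<close>)
    qed
    have [measurable]: "Phi A g \<in> borel_measurable N" "Phi A' g' \<in> borel_measurable N"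
      "\<And>k. Phi (A' - {k}) g' \<in> borel_measurable N"
      using insert by (auto intro!: Phi_measurable[where L = L])
    have "(\<lambda>\<omega>. add_dirac (\<eta> \<omega>) y) \<in> M \<rightarrow>\<^sub>M N"
      using y by (intro measurable_add_dirac) measurable
    from measurable_compose[OF this weighted_measurable[OF W]]
    have [measurable]: "(\<lambda>\<omega>. diff_op y (Phi A' g') (\<eta> \<omega>)) \<in> borel_measurable M"
      unfolding diff_op_def by measurable
    have "(\<integral>\<omega>. Phi A g (\<eta> \<omega>) * diff_op y (Phi A' g') (\<eta> \<omega>) \<partial>M) =
        (\<integral>\<omega>. (\<Sum>k\<in>A'. g' k y * (Phi A g (\<eta> \<omega>) * Phi (A' - {k}) g' (\<eta> \<omega>))) \<partial>M)"
      using eq by (intro integral_cong_AE) (measurable, auto elim!: eventually_mono)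
    also have "\<dots> = (\<Sum>k\<in>A'. g' k y * (\<integral>\<omega>. Phi A g (\<eta> \<omega>) * Phi (A' - {k}) g' (\<eta> \<omega>) \<partial>M))"
      using weighted_integrable[OF Wk] by (subst Bochner_Integration.integral_sum) auto
    finally show "g a y * (\<integral>\<omega>. Phi A g (\<eta> \<omega>) * diff_op y (Phi A' g') (\<eta> \<omega>) \<partial>M) =
        (\<Sum>k\<in>A'. (g a y * g' k y) * (\<integral>\<omega>. Phi A g (\<eta> \<omega>) * Phi (A' - {k}) g' (\<eta> \<omega>) \<partial>M))"
      by (simp add: sum_distrib_left mult.assoc)
  qed
  also have "\<dots> = (\<Sum>k\<in>A'. ?c a k * (\<integral>\<omega>. Phi A g (\<eta> \<omega>) * Phi (A' - {k}) g' (\<eta> \<omega>) \<partial>M))"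
    using int_c by (subst Bochner_Integration.integral_sum) auto
  also have "\<dots> = (\<Sum>k\<in>A'. ?c a k * (\<Sum>\<pi>\<in>bijections A (A' - {k}). \<Prod>a\<in>A. ?c a (\<pi> a)))"
    using insert by (intro sum.cong refl arg_cong2[where f = "(*)"] insert.IH) auto
  also have "\<dots> = (\<Sum>\<pi>\<in>bijections (insert a A) A'. \<Prod>a\<in>insert a A. ?c a (\<pi> a))"
    by (rule sum_bijections_insert[symmetric]) (use insert in auto)
  finally show ?case .
qed

text \<open>With equal factors only the number of labels matters, by \<open>wi_exponential\<close>.
  This is applied where labels form an arbitrary finite set of coordinates.\<close>

lemma Phi_constant_card:
  assumes w: "nice L w" and "finite A"
  shows "AE \<omega> in M. Phi A (\<lambda>_. w) (\<eta> \<omega>) = Phi {..<card A} (\<lambda>_. w) (\<eta> \<omega>)"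
  using AE_locally_points
proof eventually_elim
  case (elim \<omega>)
  then have "finite (pts \<omega>)" by (simp add: locally_points_def)
  from wi_exponential[OF this, of "\<integral>y. w y \<partial>lam" w "\<lambda>i. X i \<omega>"] show ?case
    using Phi_eq[OF _ w elim, of A] Phi_eq[OF _ w elim, of "{..<card A}"] assms(2) by auto
qed

text \<open>The expectation of the generating function in \<open>wi_exponential\<close>, multiplied
  by F. Dominated convergence applies because the partial sums are bounded by a constant times a
  power \<open>d ^ num\<close>, a weight that F tolerates.\<close>

lemma Phi_exponential_sums:
  assumes w: "nice L w" and F: "weighted F" and G: "G \<in> borel_measurable N"
    and G_eq: "AE \<omega> in M. G (\<eta> \<omega>) = (\<Prod>i\<in>pts \<omega>. 1 + w (X i \<omega>))"
  shows "(\<lambda>n. (\<integral>\<omega>. Phi {..<n} (\<lambda>_. w) (\<eta> \<omega>) * F (\<eta> \<omega>) \<partial>M) / fact n) sums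
    (exp (- (\<integral>y. w y \<partial>lam)) * (\<integral>\<omega>. G (\<eta> \<omega>) * F (\<eta> \<omega>) \<partial>M))"
proof -
  let ?l = "\<integral>y. w y \<partial>lam" and ?P = "\<lambda>n. Phi {..<n} (\<lambda>_. w)"
  \<comment> \<open>Every point contributes a factor of at most 1 + L, and weights are powers of
    naturals.\<close>
  obtain d :: nat where d: "1 + L \<le> real d" using real_arch_simple by blast
  have P[measurable]: "?P n \<in> borel_measurable N" for n
    by (rule Phi_measurable[where L = L]) (auto simp: w)
  note [measurable] = weighted_measurable[OF F] G
  have ae: "AE \<omega> in M. (\<lambda>n. ?P n (\<eta> \<omega>) / fact n) sums (exp (- ?l) * G (\<eta> \<omega>)) \<and>
      (\<forall>m. \<bar>\<Sum>n<m. ?P n (\<eta> \<omega>) / fact n\<bar> \<le> exp \<bar>?l\<bar> * real d ^ num (\<eta> \<omega>))"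
    using AE_locally_points G_eq AE_space
  proof eventually_elim
    case (elim \<omega>)
    have fin: "finite (pts \<omega>)" using elim by (simp add: locally_points_def)
    from wi_exponential[OF this, of ?l w "\<lambda>i. X i \<omega>"] obtain c where
      c: "\<And>A. finite A \<Longrightarrow> wi A (\<lambda>_. ?l) (\<lambda>_. w) (pts \<omega>) (\<lambda>i. X i \<omega>) = fact (card A) * c (card A)"
        "c sums (exp (- ?l) * (\<Prod>i\<in>pts \<omega>. 1 + w (X i \<omega>)))"
        "\<And>n. (\<Sum>m<n. \<bar>c m\<bar>) \<le> exp \<bar>?l\<bar> * (\<Prod>i\<in>pts \<omega>. 1 + \<bar>w (X i \<omega>)\<bar>)"
      by blast
    have P_c: "?P n (\<eta> \<omega>) / fact n = c n" for n
      using Phi_eq[OF _ w elim(1), of "{..<n}"] c(1)[of "{..<n}"] by simp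
    have "(\<Prod>i\<in>pts \<omega>. 1 + \<bar>w (X i \<omega>)\<bar>) \<le> (\<Prod>i\<in>pts \<omega>. real d)"
    proof (intro prod_mono conjI)
      fix i assume "i \<in> pts \<omega>"
      then have "X i \<omega> \<in> space lam" using X_in_space[OF elim(3)] by (simp add: pts_def)
      then have "\<bar>w (X i \<omega>)\<bar> \<le> L"
        by (rule nice_le[OF w])
      then show "1 + \<bar>w (X i \<omega>)\<bar> \<le> real d" using d by simp
    qed simp
    then have "(\<Prod>i\<in>pts \<omega>. 1 + \<bar>w (X i \<omega>)\<bar>) \<le> real d ^ num (\<eta> \<omega>)"
      using locally_points_num[OF elim(1)] by simp
    then have "exp \<bar>?l\<bar> * (\<Prod>i\<in>pts \<omega>. 1 + \<bar>w (X i \<omega>)\<bar>) \<le> exp \<bar>?l\<bar> * real d ^ num (\<eta> \<omega>)"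
      by simp
    then have "\<bar>\<Sum>n<m. c n\<bar> \<le> exp \<bar>?l\<bar> * real d ^ num (\<eta> \<omega>)" for m
      using sum_abs[of c "{..<m}"] c(3)[of m] by linarith
    then show ?case unfolding P_c using c(2) elim(2) by simp
  qed
  have int_term: "integrable M (\<lambda>\<omega>. ?P n (\<eta> \<omega>) * F (\<eta> \<omega>))" for n
    by (intro weighted_integrable weighted_Phi_mult[where L = L] F) (auto simp: w)
  have Wd: "weighted (\<lambda>\<mu>. real d ^ num \<mu> * F \<mu>)"
    by (rule weighted_mult[OF F, of _ 1 d]) auto
  have "(\<lambda>m. \<integral>\<omega>. (\<Sum>n<m. ?P n (\<eta> \<omega>) / fact n) * F (\<eta> \<omega>) \<partial>M) \<longlonglongrightarrow> (\<integral>\<omega>. exp (- ?l) * G (\<eta> \<omega>) * F (\<eta> \<omega>) \<partial>M)"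
  proof (rule integral_dominated_convergence)
    show "integrable M (\<lambda>\<omega>. exp \<bar>?l\<bar> * \<bar>real d ^ num (\<eta> \<omega>) * F (\<eta> \<omega>)\<bar>)"
      using weighted_integrable[OF Wd] by auto
    show "AE \<omega> in M. (\<lambda>m. (\<Sum>n<m. ?P n (\<eta> \<omega>) / fact n) * F (\<eta> \<omega>)) \<longlonglongrightarrow> exp (- ?l) * G (\<eta> \<omega>) * F (\<eta> \<omega>)"
      using ae by eventually_elim (auto simp: sums_def intro!: tendsto_mult)
    show "AE \<omega> in M. norm ((\<Sum>n<m. ?P n (\<eta> \<omega>) / fact n) * F (\<eta> \<omega>)) \<le> exp \<bar>?l\<bar> * \<bar>real d ^ num (\<eta> \<omega>) * F (\<eta> \<omega>)\<bar>" for m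
      using ae
    proof eventually_elim
      case (elim \<omega>)
      then have "\<bar>\<Sum>n<m. ?P n (\<eta> \<omega>) / fact n\<bar> * \<bar>F (\<eta> \<omega>)\<bar> \<le> (exp \<bar>?l\<bar> * real d ^ num (\<eta> \<omega>)) * \<bar>F (\<eta> \<omega>)\<bar>"
        by (intro mult_right_mono) auto
      then show ?case by (simp add: abs_mult mult.assoc)
    qed
  qed measurable
  moreover have "(\<integral>\<omega>. (\<Sum>n<m. ?P n (\<eta> \<omega>) / fact n) * F (\<eta> \<omega>) \<partial>M) = (\<Sum>n<m. (\<integral>\<omega>. ?P n (\<eta> \<omega>) * F (\<eta> \<omega>) \<partial>M) / fact n)" for m
    using int_term by (simp add: sum_distrib_right)
  ultimately show ?thesis
    by (simp add: sums_def mult.assoc)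
qed

text \<open>Take F = 1 in the series: only order 0 has nonzero expectation. This identifies the
  factor exp(- \<integral>w) as the inverse of E[G], which puts \<open>exponential_expansion\<close>
  into the normalization of the chaos expansion.\<close>

lemma expectation_exponential:
  assumes w: "nice L w" and G: "G \<in> borel_measurable N"
    and G_eq: "AE \<omega> in M. G (\<eta> \<omega>) = (\<Prod>i\<in>pts \<omega>. 1 + w (X i \<omega>))"
  shows "exp (- (\<integral>y. w y \<partial>lam)) * (\<integral>\<omega>. G (\<eta> \<omega>) \<partial>M) = 1"
proof -
  have E: "(\<integral>\<omega>. Phi {..<n} (\<lambda>_. w) (\<eta> \<omega>) \<partial>M) = (if n = 0 then 1 else 0)" for n
  proof (cases "n = 0")
    case True
    have "(\<integral>\<omega>. Phi {} (\<lambda>_. w) (\<eta> \<omega>) \<partial>M) = (\<integral>\<omega>. 1 \<partial>M)"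
      using Phi_empty[of "\<lambda>_. w"] weighted_integrable[OF weighted_Phi[of "{}" L "\<lambda>_. w"]]
      by (intro integral_cong_AE) (auto elim!: eventually_mono)
    then show ?thesis using True by (simp add: prob_space)
  next
    case False
    then have "{..<n} \<noteq> {}" by auto
    then show ?thesis using expectation_Phi[of "{..<n}" L "\<lambda>_. w"] w False by simp
  qed
  have "(\<lambda>n. (if n = 0 then 1 else 0 :: real) / fact n) sums (exp (- (\<integral>y. w y \<partial>lam)) * (\<integral>\<omega>. G (\<eta> \<omega>) \<partial>M))"
    using Phi_exponential_sums[OF w weighted_const[of 1] G G_eq] by (simp add: E)
  moreover have "(\<lambda>n. (if n = 0 then 1 else 0 :: real) / fact n) sums 1"
    using sums_single[of 0 "\<lambda>_. 1 :: real"] by (simp add: if_distrib[of "\<lambda>x. x / _"] cong: if_cong)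
  ultimately show ?thesis by (rule sums_unique2)
qed

lemma exponential_expansion:
  assumes w: "nice L w" and F: "weighted F" and G: "G \<in> borel_measurable N"
    and G_eq: "AE \<omega> in M. G (\<eta> \<omega>) = (\<Prod>i\<in>pts \<omega>. 1 + w (X i \<omega>))"
  shows "(\<lambda>n. (\<integral>\<omega>. G (\<eta> \<omega>) \<partial>M) * ((\<integral>\<omega>. Phi {..<n} (\<lambda>_. w) (\<eta> \<omega>) * F (\<eta> \<omega>) \<partial>M) / fact n)) sums
    (\<integral>\<omega>. G (\<eta> \<omega>) * F (\<eta> \<omega>) \<partial>M)"
proof -
  have "(\<integral>\<omega>. G (\<eta> \<omega>) \<partial>M) * (exp (- (\<integral>y. w y \<partial>lam)) * (\<integral>\<omega>. G (\<eta> \<omega>) * F (\<eta> \<omega>) \<partial>M)) = (\<integral>\<omega>. G (\<eta> \<omega>) * F (\<eta> \<omega>) \<partial>M)"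
    using expectation_exponential[OF w G G_eq] by (metis mult.assoc mult.commute mult_1)
  with sums_mult[OF Phi_exponential_sums[OF assms], of "\<integral>\<omega>. G (\<eta> \<omega>) \<partial>M"] show ?thesis
    by simp
qed

end

section \<open>Multiple Wiener-Ito integrals\<close>

lemma card_bijections:
  "finite A \<Longrightarrow> finite A' \<Longrightarrow> card A = card A' \<Longrightarrow> card (bijections A A') = fact (card A)"
proof (induction A arbitrary: A' rule: finite_induct)
  case empty
  then have "bijections {} A' = {\<lambda>_. undefined}" by (auto simp: bijections_def bij_betw_def)
  then show ?case by simp
next
  case (insert a A)
  have "real (card (bijections (insert a A) A')) = (\<Sum>k\<in>A'. real (card (bijections A (A' - {k}))))"
    using sum_bijections_insert[OF insert(1,2) insert.prems(1), of "\<lambda>_ _. 1"] by simp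
  also have "\<dots> = (\<Sum>k\<in>A'. fact (card A))"
    using insert by (intro sum.cong refl) (simp add: insert.IH card_Diff_singleton)
  also have "\<dots> = real (fact (card (insert a A)))"
    using insert by (simp add: insert.prems(2)[symmetric] algebra_simps)
  finally show ?case by linarith
qed

lemma bijections_empty:
  "finite A \<Longrightarrow> card A \<noteq> card A' \<Longrightarrow> bijections A A' = {}"
  by (auto simp: bijections_def dest: bij_betw_same_card)

context poisson_points
begin

lemma factorial_integral_eq:
  fixes g :: "nat \<Rightarrow> 'y \<Rightarrow> real"
  assumes \<omega>: "\<omega> \<in> space M" and J: "finite J" and g: "\<And>j. j \<in> J \<Longrightarrow> g j \<in> borel_measurable lam"
  shows "(\<integral>x. (\<Prod>j\<in>J. g j (x j)) \<partial>factorial_measure lam (point_indices (\<eta> \<omega>)) (\<lambda>i. X i \<omega>) J) =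
    (\<integral>i. (\<Prod>j\<in>J. g j (X (i j) \<omega>)) \<partial>count_space {i \<in> J \<rightarrow>\<^sub>E I \<omega>. inj_on i J})"
proof -
  have "(\<lambda>x. \<Prod>j\<in>J. g j (x j)) \<in> borel_measurable (PiM J (\<lambda>_. lam))"
  proof (rule borel_measurable_prod)
    fix j assume j: "j \<in> J"
    show "(\<lambda>x. g j (x j)) \<in> borel_measurable (PiM J (\<lambda>_. lam))"
      by (rule measurable_compose[OF measurable_component_singleton[OF j, of "\<lambda>_. lam"] g[OF j]])
  qed
  moreover have "(\<lambda>i. \<lambda>j\<in>J. X (i j) \<omega>) \<in> count_space {i \<in> J \<rightarrow>\<^sub>E I \<omega>. inj_on i J} \<rightarrow>\<^sub>M PiM J (\<lambda>_. lam)"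
    using X_in_space[OF \<omega>] by (auto simp: space_PiM PiE_iff)
  ultimately show ?thesis
    unfolding factorial_measure_def I_def[symmetric] by (subst integral_distr) auto
qed

text \<open>The set of admissible index tuples depends on \<omega>. Passing to all injective tuples
  of naturals, with a zero factor whenever an index does not occur, gives a fixed countable
  domain.\<close>

lemma factorial_integral_measurable:
  fixes g :: "nat \<Rightarrow> 'y \<Rightarrow> real"
  assumes J: "finite J" and g: "\<And>j. j \<in> J \<Longrightarrow> g j \<in> borel_measurable lam"
  shows "(\<lambda>\<omega>. \<integral>x. (\<Prod>j\<in>J. g j (x j)) \<partial>factorial_measure lam (point_indices (\<eta> \<omega>)) (\<lambda>i. X i \<omega>) J) \<in> borel_measurable M"
proof -
  let ?T = "{i \<in> J \<rightarrow>\<^sub>E (UNIV :: nat set). inj_on i J}"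
  have T: "countable ?T"
    by (rule countable_subset[OF _ countable_PiE[OF J, of "\<lambda>_. UNIV"]]) auto
  interpret C: sigma_finite_measure "count_space ?T"
    by (rule sigma_finite_measure_count_space_countable[OF T])
  define f where "f \<omega> i = (\<Prod>j\<in>J. if i j \<in> I \<omega> then g j (X (i j) \<omega>) else 0)" for \<omega> i
  have factor: "(\<lambda>\<omega>. if k \<in> I \<omega> then g j (X k \<omega>) else 0) \<in> borel_measurable M" if "j \<in> J" for j k
    by (rule measurable_at_point, rule measurable_compose[OF X_measurable_at_point g[OF that]])
  have "(\<lambda>\<omega>. f \<omega> i) \<in> borel_measurable M" for i
    unfolding f_def by (intro borel_measurable_prod factor)
  then have "(\<lambda>(i, \<omega>). f \<omega> i) \<in> borel_measurable (count_space ?T \<Otimes>\<^sub>M M)"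
    by (intro measurable_pair_measure_countable1[OF T]) simp
  from measurable_compose[OF measurable_pair_swap' this]
  have "(\<lambda>\<omega>. \<integral>i. f \<omega> i \<partial>count_space ?T) \<in> borel_measurable M"
    by (intro C.borel_measurable_lebesgue_integral) (simp add: case_prod_unfold)
  moreover have "(\<integral>x. (\<Prod>j\<in>J. g j (x j)) \<partial>factorial_measure lam (point_indices (\<eta> \<omega>)) (\<lambda>i. X i \<omega>) J) =
      (\<integral>i. f \<omega> i \<partial>count_space ?T)" if \<omega>: "\<omega> \<in> space M" for \<omega>
  proof -
    have "{i \<in> J \<rightarrow>\<^sub>E I \<omega>. inj_on i J} \<subseteq> ?T" by (auto simp: PiE_iff)
    then have "count_space {i \<in> J \<rightarrow>\<^sub>E I \<omega>. inj_on i J} = restrict_space (count_space ?T) {i \<in> J \<rightarrow>\<^sub>E I \<omega>. inj_on i J}"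
      by (simp add: restrict_count_space Int_absorb2)
    then have "(\<integral>i. (\<Prod>j\<in>J. g j (X (i j) \<omega>)) \<partial>count_space {i \<in> J \<rightarrow>\<^sub>E I \<omega>. inj_on i J}) =
        (\<integral>i. indicator {i \<in> J \<rightarrow>\<^sub>E I \<omega>. inj_on i J} i *\<^sub>R (\<Prod>j\<in>J. g j (X (i j) \<omega>)) \<partial>count_space ?T)"
      by (simp add: integral_restrict_space)
    also have "\<dots> = (\<integral>i. f \<omega> i \<partial>count_space ?T)"
    proof (rule Bochner_Integration.integral_cong[OF refl])
      fix i assume "i \<in> space (count_space ?T)"
      then have i: "i \<in> J \<rightarrow>\<^sub>E UNIV" "inj_on i J" by auto
      show "indicator {i \<in> J \<rightarrow>\<^sub>E I \<omega>. inj_on i J} i *\<^sub>R (\<Prod>j\<in>J. g j (X (i j) \<omega>)) = f \<omega> i"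
      proof (cases "\<forall>j\<in>J. i j \<in> I \<omega>")
        case True
        then have "i \<in> J \<rightarrow>\<^sub>E I \<omega>" using i by (auto simp: PiE_iff)
        then show ?thesis using True i by (simp add: f_def)
      next
        case False
        then have "f \<omega> i = 0" using J by (auto simp: f_def)
        moreover have "i \<notin> J \<rightarrow>\<^sub>E I \<omega>" using False by (auto simp: PiE_iff)
        ultimately show ?thesis by simp
      qed
    qed
    finally show ?thesis
      by (simp add: factorial_integral_eq[OF \<omega> J g])
  qed
  ultimately show ?thesis
    by (simp cong: measurable_cong)
qed

lemma wiener_ito_product_measurable:
  assumes "\<And>i. i < n \<Longrightarrow> admissible_factor lam (g i)"
  shows "wiener_ito_product lam \<eta> X n g \<in> borel_measurable M"
  unfolding wiener_ito_product_def[abs_def]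
  by (intro borel_measurable_sum borel_measurable_times borel_measurable_const factorial_integral_measurable)
     (use assms in \<open>auto simp: admissible_factor_def intro: finite_subset\<close>)

lemma wiener_ito_sum_product_measurable:
  assumes "sum_product_form lam n gs"
  shows "wiener_ito_sum_product lam \<eta> X n gs \<in> borel_measurable M"
proof -
  have "wiener_ito_product lam \<eta> X n (gs ! k) \<in> borel_measurable M" if "k < length gs" for k
    using assms that by (intro wiener_ito_product_measurable) (auto simp: sum_product_form_def)
  then have "(\<lambda>\<omega>. \<Sum>k<length gs. wiener_ito_product lam \<eta> X n (gs ! k) \<omega>) \<in> borel_measurable M"
    by (intro borel_measurable_sum) auto
  then show ?thesis
    by (simp add: wiener_ito_sum_product_def[abs_def] sum_list_sum_nth atLeast0LessThan)
qed

text \<open>Results on polynomials are relative to one window and one bound; finitely many factors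
  fit into a common one. The set D allows a prescribed set to be included.\<close>

lemma window_exists:
  assumes "finite \<F>" "\<And>f. f \<in> \<F> \<Longrightarrow> admissible_factor lam f" and D: "D \<in> sets lam" "emeasure lam D < \<infinity>"
  shows "\<exists>B L. B \<in> sets lam \<and> emeasure lam B < \<infinity> \<and> D \<subseteq> B \<and> 0 \<le> L \<and>
    (\<forall>f\<in>\<F>. f \<in> borel_measurable lam \<and> (\<forall>y\<in>space lam. \<bar>f y\<bar> \<le> L * indicator B y))"
  using assms(1,2)
proof (induction \<F> rule: finite_induct)
  case empty
  show ?case using D by (intro exI[of _ D] exI[of _ 0]) auto
next
  case (insert f \<F>)
  then obtain B L where BL: "B \<in> sets lam" "emeasure lam B < \<infinity>" "D \<subseteq> B" "0 \<le> L"
    "\<forall>f\<in>\<F>. f \<in> borel_measurable lam \<and> (\<forall>y\<in>space lam. \<bar>f y\<bar> \<le> L * indicator B y)"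
    by auto
  obtain c C where C: "c \<ge> 0" "C \<in> sets lam" "emeasure lam C < \<infinity>"
    "\<And>y. y \<in> space lam \<Longrightarrow> \<bar>f y\<bar> \<le> c * indicator C y"
    using admissible_factor_bound[of lam f] insert.prems by auto
  have bound: "\<bar>f' y\<bar> \<le> max L c * indicator (B \<union> C) y" if f': "f' \<in> insert f \<F>" and y: "y \<in> space lam" for f' y
  proof -
    have mono: "a * indicator A y \<le> max L c * indicator (B \<union> C) y" if "A \<subseteq> B \<union> C" "0 \<le> a" "a \<le> max L c" for a A
      using that by (auto simp: indicator_def)
    have "L * indicator B y \<le> max L c * indicator (B \<union> C) y" "c * indicator C y \<le> max L c * indicator (B \<union> C) y"
      by (rule mono; use BL C in simp)+
    moreover have "\<bar>f' y\<bar> \<le> L * indicator B y \<or> \<bar>f' y\<bar> \<le> c * indicator C y"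
      using f' y BL(5) C(4) by auto
    ultimately show ?thesis by linarith
  qed
  have "emeasure lam (B \<union> C) < \<infinity>"
    using BL C emeasure_subadditive[of B lam C] by (auto simp: less_top[symmetric] ennreal_add_eq_top top_unique)
  moreover have "f \<in> borel_measurable lam"
    using insert.prems by (simp add: admissible_factor_def)
  ultimately show ?case
    using BL C bound by (intro exI[of _ "B \<union> C"] exI[of _ "max L c"]) auto
qed

end

context poisson_window
begin

text \<open>The factorial measure involves all points of the process, possibly infinitely many, but
  a tuple with a point outside B contributes 0. What remains is a finite sum over the points in the
  window, and the signs go into the factors - l.\<close>

lemma wiener_ito_product_eq_Phi:
  assumes g: "\<And>i. i < n \<Longrightarrow> nice L (g i)"
  shows "AE \<omega> in M. wiener_ito_product lam \<eta> X n g \<omega> = Phi {..<n} g (\<eta> \<omega>)"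
  using AE_locally_points AE_space
proof eventually_elim
  case (elim \<omega>)
  interpret P: product_sigma_finite "\<lambda>_::nat. lam" by (rule lam.product_sigma_finite_const)
  let ?l = "\<lambda>a. \<integral>y. g a y \<partial>lam"
  have fin: "finite (pts \<omega>)" using elim by (simp add: locally_points_def)
  have "(-1) ^ (n - card J) *
        (\<integral>x. (\<Prod>j\<in>J. g j (x j)) \<partial>factorial_measure lam (point_indices (\<eta> \<omega>)) (\<lambda>i. X i \<omega>) J) *
        (\<integral>x. (\<Prod>j\<in>{..<n} - J. g j (x j)) \<partial>PiM ({..<n} - J) (\<lambda>_. lam)) =
      inj_sum J g (pts \<omega>) (\<lambda>i. X i \<omega>) * (\<Prod>a\<in>{..<n} - J. - ?l a)" if "J \<in> Pow {..<n}" for J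
  proof -
    have J: "finite J" "\<And>j. j \<in> J \<Longrightarrow> nice L (g j)" using that g by (auto intro: finite_subset)
    let ?T = "{i \<in> J \<rightarrow>\<^sub>E I \<omega>. inj_on i J}" and ?S = "{i \<in> J \<rightarrow>\<^sub>E pts \<omega>. inj_on i J}"
    let ?f = "\<lambda>i. \<Prod>j\<in>J. g j (X (i j) \<omega>)"
    have finS: "finite ?S" using finite_PiE[OF J(1), of "\<lambda>_. pts \<omega>"] fin by simp
    have ST: "?S \<subseteq> ?T" by (auto simp: PiE_iff pts_def)
    have zero: "?f i = 0" if "i \<in> ?T - ?S" for i
    proof -
      from that obtain j where j: "j \<in> J" "i j \<in> I \<omega>" "i j \<notin> pts \<omega>" by (auto simp: PiE_iff)
      then have "g j (X (i j) \<omega>) = 0"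
        using X_in_space[OF elim(2) j(2)] by (intro nice_zero[OF J(2)]) (auto simp: pts_def)
      then show ?thesis using J(1) j(1) by auto
    qed
    then have sub: "{i. i \<in> ?T \<and> ?f i \<noteq> 0} \<subseteq> ?S" by blast
    have "(\<integral>x. (\<Prod>j\<in>J. g j (x j)) \<partial>factorial_measure lam (point_indices (\<eta> \<omega>)) (\<lambda>i. X i \<omega>) J) =
        (\<integral>i. ?f i \<partial>count_space ?T)"
      by (rule factorial_integral_eq[OF elim(2) J(1)]) (use J in \<open>auto dest: nice_measurable\<close>)
    also have "\<dots> = (\<Sum>i | i \<in> ?T \<and> ?f i \<noteq> 0. ?f i)"
      using finite_subset[OF sub finS] by (intro lebesgue_integral_count_space_finite_support) auto
    also have "\<dots> = (\<Sum>i\<in>?S. ?f i)"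
      by (rule sum.mono_neutral_left[OF finS sub]) (use ST in auto)
    also have "\<dots> = inj_sum J g (pts \<omega>) (\<lambda>i. X i \<omega>)"
      by (simp add: inj_sum_def)
    finally have 1: "(\<integral>x. (\<Prod>j\<in>J. g j (x j)) \<partial>factorial_measure lam (point_indices (\<eta> \<omega>)) (\<lambda>i. X i \<omega>) J) =
        inj_sum J g (pts \<omega>) (\<lambda>i. X i \<omega>)" .
    have 2: "(\<integral>x. (\<Prod>j\<in>{..<n} - J. g j (x j)) \<partial>PiM ({..<n} - J) (\<lambda>_. lam)) = (\<Prod>a\<in>{..<n} - J. ?l a)"
      using g by (intro P.product_integral_prod) (auto intro: nice_integrable)
    have "card ({..<n} - J) = n - card J"
      using that J(1) by (simp add: card_Diff_subset)
    then show ?thesis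
      unfolding 1 2 by (simp add: prod_uminus)
  qed
  then have "wiener_ito_product lam \<eta> X n g \<omega> = wi {..<n} ?l g (pts \<omega>) (\<lambda>i. X i \<omega>)"
    unfolding wiener_ito_product_def wi_def by (intro sum.cong refl)
  then show ?case
    using Phi_eq[of "{..<n}" L g, OF _ _ elim(1)] g by simp
qed

lemma nice_mult_integrable:
  assumes f: "nice L f" and g: "nice L g"
  shows "integrable lam (\<lambda>y. f y * g y)"
proof (rule Bochner_Integration.integrable_bound)
  show "integrable lam (\<lambda>y. L * f y)"
    using nice_integrable[OF f] by simp
  show "(\<lambda>y. f y * g y) \<in> borel_measurable lam"
    using f g by (auto dest!: nice_measurable)
  show "AE y in lam. norm (f y * g y) \<le> norm (L * f y)"
    using f nice_le[OF g] by (intro AE_I2) (auto simp: abs_mult nice_def mult.commute[of L] intro!: mult_left_mono)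
qed

text \<open>The isometry gives a sum over permutations \<pi> of the scalar products of the kernel
  with its rearrangement by \<pi>. Both have the same norm, so each scalar product is at most the
  squared norm, and there are n! permutations. This yields continuity without symmetrizing the
  kernel.\<close>

lemma Phi_second_moment:
  assumes Q: "finite Q" and g: "\<And>k i. k \<in> Q \<Longrightarrow> i < n \<Longrightarrow> nice L (g k i)"
  shows "(\<integral>\<omega>. (\<Sum>k\<in>Q. \<alpha> k * Phi {..<n} (g k) (\<eta> \<omega>))\<^sup>2 \<partial>M) \<le>
    fact n * (\<integral>y. (\<Sum>k\<in>Q. \<alpha> k * (\<Prod>i<n. g k i (y i)))\<^sup>2 \<partial>PiM {..<n} (\<lambda>_. lam))"
proof -
  interpret P: product_sigma_finite "\<lambda>_::nat. lam" by (rule lam.product_sigma_finite_const)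
  let ?P = "PiM {..<n} (\<lambda>_. lam)" and ?B = "bijections {..<n} {..<n}"
  define s where "s \<pi> y = (\<Sum>k\<in>Q. \<alpha> k * (\<Prod>i<n. g k (\<pi> i) (y i)))" for \<pi> y
  have \<pi>: "\<pi> i < n" if "\<pi> \<in> ?B" "i < n" for \<pi> i
    using that by (auto simp: bijections_def PiE_iff)
  have int_prod: "integrable ?P (\<lambda>y. (\<Prod>i<n. g k (\<rho> i) (y i)) * (\<Prod>i<n. g l (\<pi> i) (y i)))"
      "(\<integral>y. (\<Prod>i<n. g k (\<rho> i) (y i)) * (\<Prod>i<n. g l (\<pi> i) (y i)) \<partial>?P) =
        (\<Prod>i<n. \<integral>z. g k (\<rho> i) z * g l (\<pi> i) z \<partial>lam)"
    if "k \<in> Q" "l \<in> Q" "\<And>i. i < n \<Longrightarrow> \<rho> i < n" "\<And>i. i < n \<Longrightarrow> \<pi> i < n" for k l \<rho> \<pi>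
  proof -
    have i: "integrable lam (\<lambda>z. g k (\<rho> i) z * g l (\<pi> i) z)" if "i \<in> {..<n}" for i
      using that \<open>k \<in> Q\<close> \<open>l \<in> Q\<close> \<open>\<And>i. i < n \<Longrightarrow> \<rho> i < n\<close> \<open>\<And>i. i < n \<Longrightarrow> \<pi> i < n\<close>
      by (intro nice_mult_integrable[where L = L] g) auto
    show "integrable ?P (\<lambda>y. (\<Prod>i<n. g k (\<rho> i) (y i)) * (\<Prod>i<n. g l (\<pi> i) (y i)))"
      "(\<integral>y. (\<Prod>i<n. g k (\<rho> i) (y i)) * (\<Prod>i<n. g l (\<pi> i) (y i)) \<partial>?P) =
        (\<Prod>i<n. \<integral>z. g k (\<rho> i) z * g l (\<pi> i) z \<partial>lam)"
      using P.product_integrable_prod[OF finite_lessThan i] P.product_integral_prod[OF finite_lessThan i]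
      by (simp_all add: prod.distrib)
  qed
  define c where "c \<pi> k l = (\<Prod>i<n. \<integral>z. g k i z * g l (\<pi> i) z \<partial>lam)" for \<pi> k l
  have expand: "(\<Sum>k\<in>Q. \<alpha> k * a k) * (\<Sum>k\<in>Q. \<alpha> k * b k) = (\<Sum>k\<in>Q. \<Sum>l\<in>Q. \<alpha> k * \<alpha> l * (a k * b l))" for a b :: "_ \<Rightarrow> real"
    by (simp add: sum_product mult_ac)
  have s_mult: "integrable ?P (\<lambda>y. s (\<lambda>i. i) y * s \<pi> y)"
      "(\<integral>y. s (\<lambda>i. i) y * s \<pi> y \<partial>?P) = (\<Sum>k\<in>Q. \<Sum>l\<in>Q. \<alpha> k * \<alpha> l * c \<pi> k l)"
    if "\<And>i. i < n \<Longrightarrow> \<pi> i < n" for \<pi>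
    unfolding s_def expand c_def using int_prod[of _ _ "\<lambda>i. i"] that by (auto simp: Bochner_Integration.integral_sum)
  have s_sq: "integrable ?P (\<lambda>y. (s \<pi> y)\<^sup>2)" "(\<integral>y. (s \<pi> y)\<^sup>2 \<partial>?P) = (\<integral>y. (s (\<lambda>i. i) y)\<^sup>2 \<partial>?P)" if p: "\<pi> \<in> ?B" for \<pi>
  proof -
    have bij: "bij_betw \<pi> {..<n} {..<n}" using p by (simp add: bijections_def)
    have eq: "(\<Prod>i<n. \<integral>z. g k (\<pi> i) z * g l (\<pi> i) z \<partial>lam) = (\<Prod>i<n. \<integral>z. g k i z * g l i z \<partial>lam)" for k l
      by (rule prod.reindex_bij_betw[OF bij])
    show "integrable ?P (\<lambda>y. (s \<pi> y)\<^sup>2)"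
      unfolding s_def power2_eq_square expand using int_prod \<pi>[OF p] by auto
    have "(\<integral>y. (s \<pi> y)\<^sup>2 \<partial>?P) = (\<Sum>k\<in>Q. \<Sum>l\<in>Q. \<alpha> k * \<alpha> l * (\<Prod>i<n. \<integral>z. g k (\<pi> i) z * g l (\<pi> i) z \<partial>lam))"
      unfolding s_def power2_eq_square expand using int_prod \<pi>[OF p] by (auto simp: Bochner_Integration.integral_sum)
    also have "\<dots> = (\<integral>y. (s (\<lambda>i. i) y)\<^sup>2 \<partial>?P)"
      using s_mult(2)[of "\<lambda>i. i"] by (simp add: eq c_def power2_eq_square)
    finally show "(\<integral>y. (s \<pi> y)\<^sup>2 \<partial>?P) = (\<integral>y. (s (\<lambda>i. i) y)\<^sup>2 \<partial>?P)" .
  qed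
  have int_PP: "integrable M (\<lambda>\<omega>. Phi {..<n} (g k) (\<eta> \<omega>) * Phi {..<n} (g l) (\<eta> \<omega>))" if "k \<in> Q" "l \<in> Q" for k l
    using that g by (intro weighted_integrable weighted_Phi_mult[where L = L] weighted_Phi[where L = L]) auto
  have "(\<integral>\<omega>. (\<Sum>k\<in>Q. \<alpha> k * Phi {..<n} (g k) (\<eta> \<omega>))\<^sup>2 \<partial>M) =
      (\<Sum>k\<in>Q. \<Sum>l\<in>Q. \<alpha> k * \<alpha> l * (\<integral>\<omega>. Phi {..<n} (g k) (\<eta> \<omega>) * Phi {..<n} (g l) (\<eta> \<omega>) \<partial>M))"
    unfolding power2_eq_square expand using int_PP by (simp add: Bochner_Integration.integral_sum)
  also have "\<dots> = (\<Sum>k\<in>Q. \<Sum>l\<in>Q. \<alpha> k * \<alpha> l * (\<Sum>\<pi>\<in>?B. c \<pi> k l))"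
    unfolding c_def using g
    by (intro sum.cong refl arg_cong2[where f = "(*)"] Phi_isometry[where L = L]) auto
  also have "\<dots> = (\<Sum>\<pi>\<in>?B. \<Sum>k\<in>Q. \<Sum>l\<in>Q. \<alpha> k * \<alpha> l * c \<pi> k l)"
    unfolding sum_distrib_left by (simp only: sum.swap[of _ Q ?B])
  also have "\<dots> = (\<Sum>\<pi>\<in>?B. \<integral>y. s (\<lambda>i. i) y * s \<pi> y \<partial>?P)"
  proof (rule sum.cong[OF refl])
    fix \<pi> assume p: "\<pi> \<in> ?B"
    show "(\<Sum>k\<in>Q. \<Sum>l\<in>Q. \<alpha> k * \<alpha> l * c \<pi> k l) = (\<integral>y. s (\<lambda>i. i) y * s \<pi> y \<partial>?P)"
      using s_mult(2)[of \<pi>] \<pi>[OF p] by simp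
  qed
  also have "\<dots> \<le> (\<Sum>\<pi>\<in>?B. \<integral>y. (s (\<lambda>i. i) y)\<^sup>2 \<partial>?P)"
  proof (rule sum_mono)
    fix \<pi> assume p: "\<pi> \<in> ?B"
    have sq: "integrable ?P (\<lambda>y. (s (\<lambda>i. i) y)\<^sup>2)"
      using s_mult(1)[of "\<lambda>i. i"] by (simp add: power2_eq_square)
    have "(\<integral>y. s (\<lambda>i. i) y * s \<pi> y \<partial>?P) \<le> (\<integral>y. ((s (\<lambda>i. i) y)\<^sup>2 + (s \<pi> y)\<^sup>2) / 2 \<partial>?P)"
    proof (rule integral_mono)
      fix y show "s (\<lambda>i. i) y * s \<pi> y \<le> ((s (\<lambda>i. i) y)\<^sup>2 + (s \<pi> y)\<^sup>2) / 2"
        using sum_squares_bound[of "s (\<lambda>i. i) y" "s \<pi> y"] by simp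
    qed (use s_mult(1)[of \<pi>] \<pi>[OF p] sq s_sq(1)[OF p] in auto)
    also have "\<dots> = (\<integral>y. (s (\<lambda>i. i) y)\<^sup>2 \<partial>?P)"
      using sq s_sq[OF p] by simp
    finally show "(\<integral>y. s (\<lambda>i. i) y * s \<pi> y \<partial>?P) \<le> (\<integral>y. (s (\<lambda>i. i) y)\<^sup>2 \<partial>?P)" .
  qed
  also have "\<dots> = fact n * (\<integral>y. (s (\<lambda>i. i) y)\<^sup>2 \<partial>?P)"
    by (simp add: card_bijections)
  finally show ?thesis by (simp add: s_def)
qed

end

section \<open>Test functions\<close>

definition count_in :: "'y set \<Rightarrow> 'y measure \<Rightarrow> nat" where
  "count_in C \<mu> = nat \<lfloor>enn2real (emeasure \<mu> C)\<rfloor>"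

definition testfun :: "('y set \<times> real) list \<Rightarrow> 'y measure \<Rightarrow> real" where
  "testfun ps \<mu> = (\<Prod>(C, s)\<leftarrow>ps. s ^ count_in C \<mu>)"

text \<open>The eigenvalue of the difference operator: adding a point at y multiplies
  \<open>testfun\<close> by the product, and subtracting the old value takes off 1.\<close>

definition testweight :: "('y set \<times> real) list \<Rightarrow> 'y \<Rightarrow> real" where
  "testweight ps y = (\<Prod>(C, s)\<leftarrow>ps. if y \<in> C then s else 1) - 1"

definition testlist :: "'y measure \<Rightarrow> ('y set \<times> real) list \<Rightarrow> bool" where
  "testlist lam ps \<longleftrightarrow> (\<forall>(C, s)\<in>set ps. C \<in> sets lam \<and> emeasure lam C < \<infinity> \<and> \<bar>s\<bar> \<le> 1)"

lemma count_in_measurable [measurable]: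
  "C \<in> sets lam \<Longrightarrow> count_in C \<in> counting_space lam \<rightarrow>\<^sub>M count_space UNIV"
  unfolding count_in_def[abs_def] by measurable

lemma testfun_Cons: "testfun ((C, s) # ps) \<mu> = s ^ count_in C \<mu> * testfun ps \<mu>"
  by (simp add: testfun_def)

lemma testlist_Cons:
  "testlist lam ((C, s) # ps) \<longleftrightarrow> C \<in> sets lam \<and> emeasure lam C < \<infinity> \<and> \<bar>s\<bar> \<le> 1 \<and> testlist lam ps"
  by (simp add: testlist_def)

lemma testfun_measurable: "testlist lam ps \<Longrightarrow> testfun ps \<in> borel_measurable (counting_space lam)"
proof (induction ps)
  case Nil
  then show ?case by (simp add: testfun_def[abs_def])
next
  case (Cons p ps)
  obtain C s where p: "p = (C, s)" by force
  have [measurable]: "C \<in> sets lam" "testfun ps \<in> borel_measurable (counting_space lam)"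
    using Cons by (auto simp: p testlist_Cons)
  have "(\<lambda>\<mu>. s ^ count_in C \<mu> * testfun ps \<mu>) \<in> borel_measurable (counting_space lam)"
    by measurable
  then show ?case by (simp add: p testfun_Cons[abs_def])
qed

lemma testfun_bound: "testlist lam ps \<Longrightarrow> \<bar>testfun ps \<mu>\<bar> \<le> 1"
proof (induction ps)
  case (Cons p ps)
  then show ?case
    by (cases p) (auto simp: testfun_Cons testlist_Cons abs_mult power_abs intro!: mult_le_one power_le_one)
qed (simp add: testfun_def)

lemma testweight_bound: "testlist lam ps \<Longrightarrow> \<bar>testweight ps y\<bar> \<le> 2 * indicator (\<Union>(fst ` set ps)) y"
proof (cases "y \<in> \<Union>(fst ` set ps)")
  case True
  assume "testlist lam ps"
  then have "\<bar>\<Prod>(C, s)\<leftarrow>ps. if y \<in> C then s else 1\<bar> \<le> 1"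
    by (induction ps) (auto simp: testlist_Cons abs_mult intro!: mult_le_one)
  then show ?thesis using True unfolding testweight_def by simp
next
  case False
  then have "(\<Prod>(C, s)\<leftarrow>ps. if y \<in> C then s else 1) = 1"
    by (induction ps) auto
  then show ?thesis by (simp add: testweight_def)
qed

lemma testweight_measurable: "testlist lam ps \<Longrightarrow> testweight ps \<in> borel_measurable lam"
proof -
  assume "testlist lam ps"
  then have "(\<lambda>y. \<Prod>(C, s)\<leftarrow>ps. if y \<in> C then s else 1) \<in> borel_measurable lam"
  proof (induction ps)
    case (Cons p ps)
    obtain C s where p: "p = (C, s)" by force
    have [measurable]: "C \<in> sets lam" "(\<lambda>y. \<Prod>(C, s)\<leftarrow>ps. if y \<in> C then s else 1) \<in> borel_measurable lam"
      using Cons by (auto simp: p testlist_Cons)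
    have "(\<lambda>y. (if y \<in> C then s else 1) * (\<Prod>(C, s)\<leftarrow>ps. if y \<in> C then s else 1)) \<in> borel_measurable lam"
      by measurable
    then show ?case by (simp add: p)
  qed simp
  then show "testweight ps \<in> borel_measurable lam"
    unfolding testweight_def[abs_def] by measurable
qed

lemma testlist_support:
  assumes "testlist lam ps"
  shows "\<Union>(fst ` set ps) \<in> sets lam" "emeasure lam (\<Union>(fst ` set ps)) < \<infinity>"
proof -
  have "\<Union>(fst ` set ps) \<in> sets lam \<and> emeasure lam (\<Union>(fst ` set ps)) < \<infinity>"
    using assms
  proof (induction ps)
    case (Cons p ps)
    then show ?case
      using emeasure_subadditive[of "fst p" lam "\<Union>(fst ` set ps)"]
      by (cases p) (auto simp: testlist_Cons less_top[symmetric] ennreal_add_eq_top top_unique)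
  qed simp
  then show "\<Union>(fst ` set ps) \<in> sets lam" "emeasure lam (\<Union>(fst ` set ps)) < \<infinity>" by auto
qed

lemma testweight_admissible: "testlist lam ps \<Longrightarrow> admissible_factor lam (testweight ps)"
proof -
  assume ps: "testlist lam ps"
  have "\<bar>testweight ps y\<bar> \<le> 2" for y
    by (rule order_trans[OF testweight_bound[OF ps]]) (simp add: indicator_def)
  moreover have "testweight ps y = 0" if "y \<notin> \<Union>(fst ` set ps)" for y
    using testweight_bound[OF ps, of y] that by (auto simp: indicator_def)
  ultimately show ?thesis
    unfolding admissible_factor_def using testweight_measurable[OF ps] testlist_support[OF ps] by blast
qed

context poisson_points
begin

text \<open>Infinite counts must be excluded, since \<open>count_in\<close> sends them to 0 and
  would miss the added point. Only the finitely many sets in ps matter, so one null event serves all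
  y.\<close>

lemma testfun_diff_op:
  assumes "testlist lam ps"
  shows "AE \<omega> in M. \<forall>y\<in>space lam. diff_op y (testfun ps) (\<eta> \<omega>) = testweight ps y * testfun ps (\<eta> \<omega>)"
proof -
  have "AE \<omega> in M. \<forall>p\<in>set ps. emeasure (\<eta> \<omega>) (fst p) < \<infinity>"
    using assms by (intro AE_finite_allI eta_finite) (auto simp: testlist_def)
  then show ?thesis
    using AE_space
  proof eventually_elim
    case (elim \<omega>)
    show ?case
    proof
      fix y
      have count: "count_in C (add_dirac (\<eta> \<omega>) y) = count_in C (\<eta> \<omega>) + (if y \<in> C then 1 else 0)"
        if C: "C \<in> sets lam" "emeasure (\<eta> \<omega>) C < \<infinity>" for C
      proof -
        obtain k where "emeasure (\<eta> \<omega>) C = of_nat k"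
          using counting_measuresD(4)[OF eta_counting[OF elim(2)] C(1)] C(2) by auto
        moreover from this have "emeasure (add_dirac (\<eta> \<omega>) y) C = of_nat (k + (if y \<in> C then 1 else 0))"
          using C sets_eta[OF elim(2)] by (simp add: emeasure_add_dirac)
        moreover have "count_in C \<mu> = j" if "emeasure \<mu> C = of_nat j" for \<mu> j
          using that by (simp add: count_in_def)
        ultimately show ?thesis by metis
      qed
      have "testfun ps (add_dirac (\<eta> \<omega>) y) = (testweight ps y + 1) * testfun ps (\<eta> \<omega>)"
        using assms elim(1)
      proof (induction ps)
        case (Cons p ps)
        then show ?case
          by (cases p) (auto simp: testfun_Cons testlist_Cons testweight_def count)
      qed (simp add: testfun_def testweight_def)
      then show "diff_op y (testfun ps) (\<eta> \<omega>) = testweight ps y * testfun ps (\<eta> \<omega>)"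
        by (simp add: diff_op_def algebra_simps)
    qed
  qed
qed

end

context poisson_window
begin

lemma testweight_nice:
  assumes "testlist lam ps" "\<Union>(fst ` set ps) \<subseteq> B"
  shows "nice 2 (testweight ps)"
  unfolding nice_def
proof (intro conjI ballI testweight_measurable[OF assms(1)])
  fix y
  have "(2 :: real) * indicator (\<Union>(fst ` set ps)) y \<le> 2 * indicator B y"
    using assms(2) by (auto simp: indicator_def)
  with testweight_bound[OF assms(1), of y] show "\<bar>testweight ps y\<bar> \<le> 2 * indicator B y" by linarith
qed simp

text \<open>The power of s with exponent the count of C is a product over the points of the window,
  with factor s in C and 1 elsewhere. In this form G is the exponential functional with weight
  \<open>testweight ps\<close>.\<close>

lemma testfun_eq_prod:
  assumes ps: "testlist lam ps" "\<Union>(fst ` set ps) \<subseteq> B"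
  shows "AE \<omega> in M. testfun ps (\<eta> \<omega>) = (\<Prod>i\<in>pts \<omega>. 1 + testweight ps (X i \<omega>))"
  using AE_locally_points
proof eventually_elim
  case (elim \<omega>)
  then have fin: "finite (pts \<omega>)" by (simp add: locally_points_def)
  show ?case
    using ps
  proof (induction ps)
    case (Cons p ps)
    obtain C s where p: "p = (C, s)" by force
    have C: "C \<in> sets lam" "C \<inter> B = C" using Cons.prems by (auto simp: p testlist_Cons)
    have "emeasure (\<eta> \<omega>) (C \<inter> B) = of_nat (card {i \<in> pts \<omega>. X i \<omega> \<in> C})"
      using elim C(1) unfolding locally_points_def by blast
    then have "count_in C (\<eta> \<omega>) = card {i \<in> pts \<omega>. X i \<omega> \<in> C}"
      by (simp add: C(2) count_in_def)
    moreover have "(\<Prod>i\<in>pts \<omega>. if X i \<omega> \<in> C then s else 1) = s ^ card {i \<in> pts \<omega>. X i \<omega> \<in> C}"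
      using fin by (simp add: prod.If_cases Int_def)
    ultimately show ?case
      using Cons by (simp add: p testfun_Cons testlist_Cons testweight_def prod.distrib)
  qed (simp add: testfun_def testweight_def)
qed

lemma testfun_weighted:
  assumes "testlist lam ps"
  shows "weighted (testfun ps)"
proof -
  have "weighted (\<lambda>\<mu>. testfun ps \<mu> * 1)"
    using testfun_bound[OF assms]
    by (intro weighted_mult[OF weighted_const, of _ 1 1] testfun_measurable assms) auto
  then show ?thesis by simp
qed

end

section \<open>The extension of the multiple integral to square integrable functions\<close>

context poisson_points
begin

abbreviation "WI \<equiv> wiener_ito_sum_product lam \<eta> X"

text \<open>Two lists share a window because norm bounds and orthogonality compare two multiple
  integrals.\<close>

lemma window_for_lists:
  assumes D: "D \<in> sets lam" "emeasure lam D < \<infinity>"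
    and gs: "sum_product_form lam n gs" "sum_product_form lam m gs'"
  obtains B L where "poisson_window M lam \<eta> X B" "D \<subseteq> B"
    "\<And>g i. g \<in> set gs \<Longrightarrow> i < n \<Longrightarrow> poisson_window.nice lam B L (g i)"
    "\<And>g i. g \<in> set gs' \<Longrightarrow> i < m \<Longrightarrow> poisson_window.nice lam B L (g i)"
proof -
  let ?F = "(\<Union>g\<in>set gs. g ` {..<n}) \<union> (\<Union>g\<in>set gs'. g ` {..<m})"
  have fin: "finite ?F" by simp
  have adm: "admissible_factor lam f" if "f \<in> ?F" for f
    using that gs by (auto simp: sum_product_form_def)
  have "\<exists>B L. B \<in> sets lam \<and> emeasure lam B < \<infinity> \<and> D \<subseteq> B \<and> 0 \<le> L \<and>
      (\<forall>f\<in>?F. f \<in> borel_measurable lam \<and> (\<forall>y\<in>space lam. \<bar>f y\<bar> \<le> L * indicator B y))"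
    by (rule window_exists[OF fin _ D]) (fact adm)
  then obtain B L where B: "B \<in> sets lam" "emeasure lam B < \<infinity>" "D \<subseteq> B" "0 \<le> L"
    "\<forall>f\<in>?F. f \<in> borel_measurable lam \<and> (\<forall>y\<in>space lam. \<bar>f y\<bar> \<le> L * indicator B y)"
    by (elim exE conjE) (rule that)
  interpret W: poisson_window M lam \<eta> X B by unfold_locales (use B in auto)
  show thesis
  proof (rule that[of B L])
    show "poisson_window M lam \<eta> X B" by (rule W.poisson_window_axioms)
    show "D \<subseteq> B" by (rule B(3))
    show "W.nice L (g i)" if "g \<in> set gs" "i < n" for g i
      unfolding W.nice_def using that B(4) bspec[OF B(5), of "g i"] by auto
    show "W.nice L (g i)" if "g \<in> set gs'" "i < m" for g i
      unfolding W.nice_def using that B(4) bspec[OF B(5), of "g i"] by auto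
  qed
qed

text \<open>The integral is defined through the points X but is almost surely a function of the
  process, by way of \<open>Phi\<close>.\<close>

lemma WI_eq_functional:
  assumes "sum_product_form lam n gs"
  shows "\<exists>\<Phi>\<in>borel_measurable N. (AE \<omega> in M. WI n gs \<omega> = \<Phi> (\<eta> \<omega>)) \<and> square_integrable M (\<lambda>\<omega>. \<Phi> (\<eta> \<omega>))"
proof -
  obtain B L where B: "poisson_window M lam \<eta> X B" and
    nice: "\<And>g i. g \<in> set gs \<Longrightarrow> i < n \<Longrightarrow> poisson_window.nice lam B L (g i)"
    using window_for_lists[of "{}" n gs n gs] assms by auto
  interpret W: poisson_window M lam \<eta> X B by (rule B)
  let ?\<Phi> = "\<lambda>\<mu>. \<Sum>k<length gs. W.Phi {..<n} (gs ! k) \<mu>"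
  have n: "W.nice L ((gs ! k) i)" if "k < length gs" "i < n" for k i
    using that by (intro nice) auto
  have "AE \<omega> in M. \<forall>k\<in>{..<length gs}. wiener_ito_product lam \<eta> X n (gs ! k) \<omega> = W.Phi {..<n} (gs ! k) (\<eta> \<omega>)"
    by (intro AE_finite_allI W.wiener_ito_product_eq_Phi[where L = L] n) auto
  then have AE_eq: "AE \<omega> in M. WI n gs \<omega> = ?\<Phi> (\<eta> \<omega>)"
    by eventually_elim (simp add: wiener_ito_sum_product_def sum_list_sum_nth atLeast0LessThan)
  have P[measurable]: "W.Phi {..<n} (gs ! k) \<in> borel_measurable N" if "k < length gs" for k
    by (intro W.Phi_measurable[where L = L] n that) auto
  then have meas: "?\<Phi> \<in> borel_measurable N" by (intro borel_measurable_sum) auto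
  have "square_integrable M (\<lambda>\<omega>. W.Phi {..<n} (gs ! k) (\<eta> \<omega>))" if "k < length gs" for k
    unfolding square_integrable_def power2_eq_square
    using measurable_compose[OF eta_measurable P[OF that]]
    by (intro conjI W.weighted_integrable W.weighted_Phi_mult[where L = L] W.weighted_Phi[where L = L] n that) auto
  then have "square_integrable M (\<lambda>\<omega>. ?\<Phi> (\<eta> \<omega>))" by (intro square_integrable_sum) auto
  with AE_eq show ?thesis by (intro bexI[OF _ meas] conjI)
qed

lemma square_integrable_cong_AE:
  assumes "square_integrable M' f" "g \<in> borel_measurable M'" "AE x in M'. g x = f x"
  shows "square_integrable M' g"
proof -
  have "AE x in M'. (g x)\<^sup>2 = (f x)\<^sup>2" using assms(3) by eventually_elim simp
  then show ?thesis
    using assms integrable_cong_AE[of "\<lambda>x. (g x)\<^sup>2" M' "\<lambda>x. (f x)\<^sup>2"]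
    by (auto simp: square_integrable_def)
qed

lemma WI_square_integrable:
  assumes "sum_product_form lam n gs"
  shows "square_integrable M (WI n gs)"
proof -
  obtain \<Phi> where "AE \<omega> in M. WI n gs \<omega> = \<Phi> (\<eta> \<omega>)" "square_integrable M (\<lambda>\<omega>. \<Phi> (\<eta> \<omega>))"
    using WI_eq_functional[OF assms] by blast
  then show ?thesis
    using square_integrable_cong_AE wiener_ito_sum_product_measurable[OF assms] by blast
qed

text \<open>The continuity estimate behind the extension to L2. It compares the functions and not
  the lists, so two lists for the same function have almost surely equal integrals.\<close>

lemma WI_diff_bound:
  assumes gs: "sum_product_form lam n gs" "sum_product_form lam n gs'"
  shows "(\<integral>\<omega>. (WI n gs \<omega> - WI n gs' \<omega>)\<^sup>2 \<partial>M) \<le>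
    fact n * (\<integral>y. (sum_product n gs y - sum_product n gs' y)\<^sup>2 \<partial>PiM {..<n} (\<lambda>_. lam))"
proof -
  obtain B L where B: "poisson_window M lam \<eta> X B" and
    nice: "\<And>g i. g \<in> set gs \<Longrightarrow> i < n \<Longrightarrow> poisson_window.nice lam B L (g i)"
      "\<And>g i. g \<in> set gs' \<Longrightarrow> i < n \<Longrightarrow> poisson_window.nice lam B L (g i)"
    using window_for_lists[of "{}" n gs n gs'] assms by auto
  interpret W: poisson_window M lam \<eta> X B by (rule B)
  \<comment> \<open>A difference of sums becomes one sum with coefficients 1 and -1, as
    \<open>Phi_second_moment\<close> expects.\<close>
  define zs where "zs = map (Pair (1::real)) gs @ map (Pair (-1)) gs'"
  have split: "(\<Sum>k<length zs. fst (zs ! k) * f (snd (zs ! k))) = (\<Sum>g\<leftarrow>gs. f g) - (\<Sum>g\<leftarrow>gs'. f g)" for f :: "_ \<Rightarrow> real"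
  proof -
    have "(\<Sum>k<length zs. fst (zs ! k) * f (snd (zs ! k))) = (\<Sum>z\<leftarrow>zs. fst z * f (snd z))"
      by (simp add: sum_list_sum_nth atLeast0LessThan)
    also have "\<dots> = (\<Sum>g\<leftarrow>gs. f g) - (\<Sum>g\<leftarrow>gs'. f g)"
      by (simp add: zs_def o_def uminus_sum_list_map)
    finally show ?thesis .
  qed
  have n: "W.nice L (snd (zs ! k) i)" if "k < length zs" "i < n" for k i
  proof -
    have "zs ! k \<in> set zs" using that by simp
    then have "snd (zs ! k) \<in> set gs \<union> set gs'" by (auto simp: zs_def)
    then show ?thesis using nice that by auto
  qed
  have "AE \<omega> in M. \<forall>k\<in>{..<length zs}. wiener_ito_product lam \<eta> X n (snd (zs ! k)) \<omega> = W.Phi {..<n} (snd (zs ! k)) (\<eta> \<omega>)"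
    by (intro AE_finite_allI W.wiener_ito_product_eq_Phi[where L = L] n) auto
  then have "AE \<omega> in M. (WI n gs \<omega> - WI n gs' \<omega>)\<^sup>2 = (\<Sum>k<length zs. fst (zs ! k) * W.Phi {..<n} (snd (zs ! k)) (\<eta> \<omega>))\<^sup>2"
  proof eventually_elim
    case (elim \<omega>)
    have "WI n gs \<omega> - WI n gs' \<omega> = (\<Sum>k<length zs. fst (zs ! k) * wiener_ito_product lam \<eta> X n (snd (zs ! k)) \<omega>)"
      unfolding wiener_ito_sum_product_def by (rule split[symmetric])
    then show ?case using elim by simp
  qed
  then have "(\<integral>\<omega>. (WI n gs \<omega> - WI n gs' \<omega>)\<^sup>2 \<partial>M) =
      (\<integral>\<omega>. (\<Sum>k<length zs. fst (zs ! k) * W.Phi {..<n} (snd (zs ! k)) (\<eta> \<omega>))\<^sup>2 \<partial>M)"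
  proof (rule integral_cong_AE[rotated 2])
    show "(\<lambda>\<omega>. (WI n gs \<omega> - WI n gs' \<omega>)\<^sup>2) \<in> borel_measurable M"
      using wiener_ito_sum_product_measurable[OF gs(1)] wiener_ito_sum_product_measurable[OF gs(2)] by measurable
    have "W.Phi {..<n} (snd (zs ! k)) \<in> borel_measurable N" if "k < length zs" for k
      by (intro W.Phi_measurable[where L = L] n that) auto
    from measurable_compose[OF eta_measurable this]
    show "(\<lambda>\<omega>. (\<Sum>k<length zs. fst (zs ! k) * W.Phi {..<n} (snd (zs ! k)) (\<eta> \<omega>))\<^sup>2) \<in> borel_measurable M"
      by (intro borel_measurable_power borel_measurable_sum borel_measurable_times borel_measurable_const) auto
  qed
  also have "\<dots> \<le> fact n * (\<integral>y. (\<Sum>k<length zs. fst (zs ! k) * (\<Prod>i<n. snd (zs ! k) i (y i)))\<^sup>2 \<partial>PiM {..<n} (\<lambda>_. lam))"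
    by (rule W.Phi_second_moment[where L = L]) (auto intro: n)
  also have "\<dots> = fact n * (\<integral>y. (sum_product n gs y - sum_product n gs' y)\<^sup>2 \<partial>PiM {..<n} (\<lambda>_. lam))"
  proof -
    have "(\<Sum>k<length zs. fst (zs ! k) * (\<Prod>i<n. snd (zs ! k) i (y i))) = sum_product n gs y - sum_product n gs' y" for y
      unfolding sum_product_def by (rule split)
    then show ?thesis by simp
  qed
  finally show ?thesis .
qed

lemma WI_orthogonal:
  assumes gs: "sum_product_form lam n gs" "sum_product_form lam m gs'" and "n \<noteq> m"
  shows "(\<integral>\<omega>. WI n gs \<omega> * WI m gs' \<omega> \<partial>M) = 0"
proof -
  obtain B L where B: "poisson_window M lam \<eta> X B" and
    nice: "\<And>g i. g \<in> set gs \<Longrightarrow> i < n \<Longrightarrow> poisson_window.nice lam B L (g i)"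
      "\<And>g i. g \<in> set gs' \<Longrightarrow> i < m \<Longrightarrow> poisson_window.nice lam B L (g i)"
    using window_for_lists[of "{}" n gs m gs'] assms by auto
  interpret W: poisson_window M lam \<eta> X B by (rule B)
  let ?P = "\<lambda>k. W.Phi {..<n} (gs ! k)" and ?P' = "\<lambda>k. W.Phi {..<m} (gs' ! k)"
  have n: "W.nice L ((gs ! k) i)" if "k < length gs" "i < n" for k i
    using that by (intro nice(1)) auto
  have n': "W.nice L ((gs' ! k) i)" if "k < length gs'" "i < m" for k i
    using that by (intro nice(2)) auto
  have 1: "AE \<omega> in M. \<forall>k\<in>{..<length gs}. wiener_ito_product lam \<eta> X n (gs ! k) \<omega> = ?P k (\<eta> \<omega>)"
    by (intro AE_finite_allI W.wiener_ito_product_eq_Phi[where L = L] n) auto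
  have 2: "AE \<omega> in M. \<forall>k\<in>{..<length gs'}. wiener_ito_product lam \<eta> X m (gs' ! k) \<omega> = ?P' k (\<eta> \<omega>)"
    by (intro AE_finite_allI W.wiener_ito_product_eq_Phi[where L = L] n') auto
  have int: "integrable M (\<lambda>\<omega>. ?P k (\<eta> \<omega>) * ?P' l (\<eta> \<omega>))" if "k < length gs" "l < length gs'" for k l
    by (intro W.weighted_integrable W.weighted_Phi_mult[where L = L] W.weighted_Phi[where L = L] n n' that) auto
  have "AE \<omega> in M. WI n gs \<omega> * WI m gs' \<omega> = (\<Sum>k<length gs. \<Sum>l<length gs'. ?P k (\<eta> \<omega>) * ?P' l (\<eta> \<omega>))"
    using 1 2 by eventually_elim
      (simp add: wiener_ito_sum_product_def sum_list_sum_nth atLeast0LessThan sum_product)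
  then have "(\<integral>\<omega>. WI n gs \<omega> * WI m gs' \<omega> \<partial>M) = (\<integral>\<omega>. (\<Sum>k<length gs. \<Sum>l<length gs'. ?P k (\<eta> \<omega>) * ?P' l (\<eta> \<omega>)) \<partial>M)"
  proof (rule integral_cong_AE[rotated 2])
    show "(\<lambda>\<omega>. WI n gs \<omega> * WI m gs' \<omega>) \<in> borel_measurable M"
      using wiener_ito_sum_product_measurable[OF gs(1)] wiener_ito_sum_product_measurable[OF gs(2)] by measurable
    show "(\<lambda>\<omega>. \<Sum>k<length gs. \<Sum>l<length gs'. ?P k (\<eta> \<omega>) * ?P' l (\<eta> \<omega>)) \<in> borel_measurable M"
      using int by (intro borel_measurable_sum) auto
  qed
  also have "\<dots> = (\<Sum>k<length gs. \<Sum>l<length gs'. \<integral>\<omega>. ?P k (\<eta> \<omega>) * ?P' l (\<eta> \<omega>) \<partial>M)"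
    by (subst Bochner_Integration.integral_sum)
       (auto intro!: sum.cong Bochner_Integration.integrable_sum Bochner_Integration.integral_sum int)
  also have "\<dots> = 0"
  proof (intro sum.neutral ballI)
    fix k l assume kl: "k \<in> {..<length gs}" "l \<in> {..<length gs'}"
    have "bijections {..<n} {..<m} = {}" using \<open>n \<noteq> m\<close> by (intro bijections_empty) auto
    then show "(\<integral>\<omega>. ?P k (\<eta> \<omega>) * ?P' l (\<eta> \<omega>) \<partial>M) = 0"
      using kl by (subst W.Phi_isometry[where L = L]) (auto intro: n n')
  qed
  finally show ?thesis .
qed

text \<open>Duality at the level of sum-product form: \<open>testfun ps\<close> is an eigenfunction,
  so each factor is integrated against \<open>testweight ps\<close>, and the product integral
  reassembles the kernel.\<close>

lemma WI_testfun:
  assumes gs: "sum_product_form lam n gs" and ps: "testlist lam ps"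
  shows "(\<integral>\<omega>. WI n gs \<omega> * testfun ps (\<eta> \<omega>) \<partial>M) =
    (\<integral>\<omega>. testfun ps (\<eta> \<omega>) \<partial>M) * (\<integral>y. sum_product n gs y * (\<Prod>i<n. testweight ps (y i)) \<partial>PiM {..<n} (\<lambda>_. lam))"
proof -
  interpret P: product_sigma_finite "\<lambda>_::nat. lam" by (rule lam.product_sigma_finite_const)
  obtain B L where B: "poisson_window M lam \<eta> X B" and
    nice: "\<And>g i. g \<in> set gs \<Longrightarrow> i < n \<Longrightarrow> poisson_window.nice lam B L (g i)"
    using window_for_lists[of "{}" n gs n gs] assms by auto
  interpret W: poisson_window M lam \<eta> X B by (rule B)
  let ?P = "\<lambda>k. W.Phi {..<n} (gs ! k)" and ?G = "testfun ps" and ?w = "testweight ps"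
  have n: "W.nice L ((gs ! k) i)" if "k < length gs" "i < n" for k i
    using that by (intro nice(1)) auto
  have 1: "AE \<omega> in M. \<forall>k\<in>{..<length gs}. wiener_ito_product lam \<eta> X n (gs ! k) \<omega> = ?P k (\<eta> \<omega>)"
    by (intro AE_finite_allI W.wiener_ito_product_eq_Phi[where L = L] n) auto
  have int: "integrable M (\<lambda>\<omega>. ?P k (\<eta> \<omega>) * ?G (\<eta> \<omega>))" if "k < length gs" for k
    by (intro W.weighted_integrable W.weighted_Phi_mult[where L = L] W.testfun_weighted ps n that) auto
  have "AE \<omega> in M. WI n gs \<omega> * ?G (\<eta> \<omega>) = (\<Sum>k<length gs. ?P k (\<eta> \<omega>) * ?G (\<eta> \<omega>))"
    using 1 by eventually_elim
      (simp add: wiener_ito_sum_product_def sum_list_sum_nth atLeast0LessThan sum_distrib_right)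
  then have "(\<integral>\<omega>. WI n gs \<omega> * ?G (\<eta> \<omega>) \<partial>M) = (\<integral>\<omega>. (\<Sum>k<length gs. ?P k (\<eta> \<omega>) * ?G (\<eta> \<omega>)) \<partial>M)"
  proof (rule integral_cong_AE[rotated 2])
    show "(\<lambda>\<omega>. WI n gs \<omega> * ?G (\<eta> \<omega>)) \<in> borel_measurable M"
      using wiener_ito_sum_product_measurable[OF gs] measurable_compose[OF eta_measurable testfun_measurable[OF ps]]
      by measurable
    show "(\<lambda>\<omega>. \<Sum>k<length gs. ?P k (\<eta> \<omega>) * ?G (\<eta> \<omega>)) \<in> borel_measurable M"
      using int by (intro borel_measurable_sum) auto
  qed
  also have "\<dots> = (\<Sum>k<length gs. \<integral>\<omega>. ?P k (\<eta> \<omega>) * ?G (\<eta> \<omega>) \<partial>M)"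
    by (rule Bochner_Integration.integral_sum) (auto intro!: int)
  also have "\<dots> = (\<Sum>k<length gs. (\<Prod>i<n. \<integral>y. (gs ! k) i y * ?w y \<partial>lam) * (\<integral>\<omega>. ?G (\<eta> \<omega>) \<partial>M))"
    by (intro sum.cong refl W.expectation_Phi_eigen[where L = L] W.testfun_weighted testfun_diff_op ps) (auto intro: n)
  also have "\<dots> = (\<integral>\<omega>. ?G (\<eta> \<omega>) \<partial>M) * (\<Sum>k<length gs. \<Prod>i<n. \<integral>y. (gs ! k) i y * ?w y \<partial>lam)"
    by (simp add: sum_distrib_left mult.commute)
  also have "(\<Sum>k<length gs. \<Prod>i<n. \<integral>y. (gs ! k) i y * ?w y \<partial>lam) =
      (\<integral>y. sum_product n gs y * (\<Prod>i<n. ?w (y i)) \<partial>PiM {..<n} (\<lambda>_. lam))"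
  proof -
    have i: "integrable lam (\<lambda>y. (gs ! k) i y * ?w y)" if "k < length gs" "i \<in> {..<n}" for k i
      using gs that by (intro admissible_factor_mult_integrable testweight_admissible ps) (auto simp: sum_product_form_def)
    have "sum_product n gs y * (\<Prod>i<n. ?w (y i)) = (\<Sum>k<length gs. \<Prod>i<n. (gs ! k) i (y i) * ?w (y i))" for y
      by (simp add: sum_product_def sum_list_sum_nth atLeast0LessThan sum_distrib_right prod.distrib)
    then show ?thesis
      using P.product_integrable_prod[OF finite_lessThan i] P.product_integral_prod[OF finite_lessThan i]
      by (simp only:) (subst Bochner_Integration.integral_sum, auto)
  qed
  finally show ?thesis .
qed

text \<open>Shows that the choice in \<open>wiener_ito\<close> is made among existing objects. The
  sequence delivered is the one that witnesses the chosen value, which may differ from the one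
  constructed for existence.\<close>

lemma wiener_ito_approximation:
  assumes n: "n > 0" and g: "square_integrable (PiM {..<n} (\<lambda>_. lam)) g"
  obtains gs where "\<And>k. sum_product_form lam n (gs k)"
    "tendsto_L2 (PiM {..<n} (\<lambda>_. lam)) (\<lambda>k. sum_product n (gs k)) g"
    "tendsto_L2 M (\<lambda>k. WI n (gs k)) (wiener_ito M lam \<eta> X n g)"
proof -
  let ?P = "PiM {..<n} (\<lambda>_. lam)"
  obtain gs where gs: "\<And>k. sum_product_form lam n (gs k)" "tendsto_L2 ?P (\<lambda>k. sum_product n (gs k)) g"
    using lam.sum_product_dense[OF n g] by blast
  have sq: "square_integrable ?P (\<lambda>y. sum_product n (gs k) y - g y)" for k
    using gs(2) by (auto simp: tendsto_L2_def intro: square_integrable_diff)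
  have sqs: "square_integrable ?P (sum_product n (gs k))" for k
    using gs(2) by (auto simp: tendsto_L2_def)
  have "\<exists>Z. tendsto_L2 M (\<lambda>k. WI n (gs k)) Z"
  proof (rule L2_Cauchy_limit)
    show "square_integrable M (WI n (gs k))" for k by (rule WI_square_integrable[OF gs(1)])
    fix e :: real assume e: "e > 0"
    \<comment> \<open>Two kernels within squared distance d of g are within 4 d of each other, and
      \<open>WI_diff_bound\<close> multiplies by n!.\<close>
    define d where "d = e / (4 * fact n)"
    have d: "d > 0" using e by (simp add: d_def)
    have "(\<lambda>k. \<integral>y. (sum_product n (gs k) y - g y)\<^sup>2 \<partial>?P) \<longlonglongrightarrow> 0"
      using gs(2) by (simp add: tendsto_L2_def)
    from order_tendstoD(2)[OF this d] obtain k0 where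
      k0: "\<And>k. k \<ge> k0 \<Longrightarrow> (\<integral>y. (sum_product n (gs k) y - g y)\<^sup>2 \<partial>?P) < d"
      by (auto simp: eventually_sequentially)
    show "\<exists>N. \<forall>m\<ge>N. \<forall>k\<ge>N. (\<integral>\<omega>. (WI n (gs m) \<omega> - WI n (gs k) \<omega>)\<^sup>2 \<partial>M) < e"
    proof (intro exI[of _ k0] allI impI)
      fix m k assume mk: "m \<ge> k0" "k \<ge> k0"
      let ?a = "\<lambda>j y. sum_product n (gs j) y - g y"
      have i: "integrable ?P (\<lambda>y. (?a j y)\<^sup>2)" for j using sq by (simp add: square_integrable_def)
      have "(\<integral>\<omega>. (WI n (gs m) \<omega> - WI n (gs k) \<omega>)\<^sup>2 \<partial>M) \<le> fact n * (\<integral>y. (sum_product n (gs m) y - sum_product n (gs k) y)\<^sup>2 \<partial>?P)"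
        by (rule WI_diff_bound[OF gs(1) gs(1)])
      also have "(\<integral>y. (sum_product n (gs m) y - sum_product n (gs k) y)\<^sup>2 \<partial>?P) \<le> (\<integral>y. 2 * (?a m y)\<^sup>2 + 2 * (?a k y)\<^sup>2 \<partial>?P)"
      proof (rule integral_mono)
        show "integrable ?P (\<lambda>y. (sum_product n (gs m) y - sum_product n (gs k) y)\<^sup>2)"
          using square_integrable_diff[OF sqs sqs] by (simp add: square_integrable_def)
        fix y
        have "(u - v)\<^sup>2 \<le> 2 * u\<^sup>2 + 2 * v\<^sup>2" for u v :: real
          using sum_squares_bound[of u "- v"] by (simp add: power2_diff)
        from this[of "?a m y" "?a k y"]
        show "(sum_product n (gs m) y - sum_product n (gs k) y)\<^sup>2 \<le> 2 * (?a m y)\<^sup>2 + 2 * (?a k y)\<^sup>2"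
          by simp
      qed (use i in simp)
      also have "\<dots> = 2 * (\<integral>y. (?a m y)\<^sup>2 \<partial>?P) + 2 * (\<integral>y. (?a k y)\<^sup>2 \<partial>?P)"
        using i by simp
      also have "fact n * \<dots> < fact n * (4 * d)"
        using k0[OF mk(1)] k0[OF mk(2)] by (intro mult_strict_left_mono) auto
      finally show "(\<integral>\<omega>. (WI n (gs m) \<omega> - WI n (gs k) \<omega>)\<^sup>2 \<partial>M) < e"
        by (simp add: d_def mult_left_mono)
    qed
  qed
  then have "\<exists>Z. \<exists>gs. (\<forall>k. sum_product_form lam n (gs k)) \<and> tendsto_L2 ?P (\<lambda>k. sum_product n (gs k)) g \<and>
      tendsto_L2 M (\<lambda>k. WI n (gs k)) Z"
    using gs by blast
  from someI_ex[OF this] n show thesis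
    using that unfolding wiener_ito_def by auto
qed

end

text \<open>Once the coefficients below j vanish, division by s^j leaves a power series with
  constant term \<open>a j\<close> that is zero near 0 except possibly at 0; let s tend to
  0.\<close>

lemma powser_zero_coeff:
  fixes a :: "nat \<Rightarrow> real"
  assumes sums: "\<And>s. \<bar>s\<bar> < 1 \<Longrightarrow> (\<lambda>j. a j * s ^ j) sums 0"
  shows "a j = 0"
proof (induction j rule: less_induct)
  case (less j)
  have "((\<lambda>_. 0) \<longlongrightarrow> a (0 + j)) (at (0 :: real))"
  proof (rule powser_limit_0_strong[of 1 "\<lambda>i. a (i + j)"])
    fix x :: real assume x: "x \<noteq> 0" "norm x < 1"
    have "(\<lambda>i. a (i + j) * x ^ (i + j)) sums (0 - (\<Sum>i<j. a i * x ^ i))"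
      using sums[of x] x by (subst sums_iff_shift) (simp add: less)
    then have "(\<lambda>i. a (i + j) * x ^ (i + j) / x ^ j) sums (0 / x ^ j)"
      by (intro sums_divide) (simp add: less)
    then show "(\<lambda>i. a (i + j) * x ^ i) sums 0"
      using x by (simp add: power_add)
  qed simp
  then have "a j = 0"
    using tendsto_unique[of "at (0 :: real)" "\<lambda>_. 0" "a j" 0] by simp
  then show ?case .
qed

section \<open>Random variables determined by test functions\<close>

context poisson_points
begin

lemma square_integrable_integrable:
  assumes "square_integrable M f"
  shows "integrable M f"
  using square_integrable_mult[OF assms, of "\<lambda>_. 1"] by (simp add: square_integrable_def)

lemma expectation_abs_le:
  assumes "square_integrable M f"
  shows "(\<integral>\<omega>. \<bar>f \<omega>\<bar> \<partial>M) \<le> sqrt (\<integral>\<omega>. (f \<omega>)\<^sup>2 \<partial>M)"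
proof -
  have "square_integrable M (\<lambda>\<omega>. \<bar>f \<omega>\<bar>)" using assms by (auto simp: square_integrable_def)
  from integral_Cauchy_Schwarz[OF this, of "\<lambda>_. 1"]
  have "(\<integral>\<omega>. \<bar>f \<omega>\<bar> \<partial>M)\<^sup>2 \<le> (\<integral>\<omega>. (f \<omega>)\<^sup>2 \<partial>M)"
    by (simp add: square_integrable_def prob_space)
  then show ?thesis by (rule real_le_rsqrt)
qed

text \<open>The \<open>L\<^sup>1\<close>-closure of the functions of \<open>\<eta>\<close>. Orthogonality to all test functions implies
  vanishing only for such variables, and the choice of versions in \<^const>\<open>wiener_ito\<close> and
  \<^const>\<open>kabanov_skorohod\<close> prevents them from being functions of \<open>\<eta>\<close> everywhere.\<close>

definition eta_approx :: "('w \<Rightarrow> real) \<Rightarrow> bool" where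
  "eta_approx Z \<longleftrightarrow> integrable M Z \<and> (\<forall>e>0. \<exists>\<Phi>\<in>borel_measurable N.
     integrable M (\<lambda>\<omega>. \<Phi> (\<eta> \<omega>)) \<and> (\<integral>\<omega>. \<bar>Z \<omega> - \<Phi> (\<eta> \<omega>)\<bar> \<partial>M) < e)"

lemma eta_approx_exact:
  assumes Z: "integrable M Z" and \<Phi>: "\<Phi> \<in> borel_measurable N" and eq: "AE \<omega> in M. Z \<omega> = \<Phi> (\<eta> \<omega>)"
  shows "eta_approx Z"
  unfolding eta_approx_def
proof (intro conjI allI impI Z bexI[OF _ \<Phi>])
  have [measurable]: "(\<lambda>\<omega>. \<Phi> (\<eta> \<omega>)) \<in> borel_measurable M" "Z \<in> borel_measurable M"
    using measurable_compose[OF eta_measurable \<Phi>] Z by auto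
  show "integrable M (\<lambda>\<omega>. \<Phi> (\<eta> \<omega>))"
    using Z eq by (subst integrable_cong_AE[of _ _ Z]) (auto elim!: eventually_mono)
  have "(\<integral>\<omega>. \<bar>Z \<omega> - \<Phi> (\<eta> \<omega>)\<bar> \<partial>M) = (\<integral>\<omega>. 0 \<partial>M)"
    using eq by (intro integral_cong_AE) (auto elim!: eventually_mono)
  then show "(\<integral>\<omega>. \<bar>Z \<omega> - \<Phi> (\<eta> \<omega>)\<bar> \<partial>M) < e" if "e > 0" for e
    using that by simp
qed

lemma eta_approx_add_cmult:
  assumes Y: "eta_approx Y" and Z: "eta_approx Z"
  shows "eta_approx (\<lambda>\<omega>. Y \<omega> + c * Z \<omega>)"
  unfolding eta_approx_def
proof (intro conjI allI impI)
  have iY: "integrable M Y" and iZ: "integrable M Z" using Y Z by (auto simp: eta_approx_def)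
  then show "integrable M (\<lambda>\<omega>. Y \<omega> + c * Z \<omega>)" by auto
  fix e :: real assume e: "e > 0"
  obtain \<Phi> where \<Phi>: "\<Phi> \<in> borel_measurable N" "integrable M (\<lambda>\<omega>. \<Phi> (\<eta> \<omega>))" "(\<integral>\<omega>. \<bar>Y \<omega> - \<Phi> (\<eta> \<omega>)\<bar> \<partial>M) < e / 2"
    using Y e unfolding eta_approx_def by (meson half_gt_zero)
  have "e / (2 * (\<bar>c\<bar> + 1)) > 0" using e by (simp add: add_nonneg_pos)
  then obtain \<Psi> where \<Psi>: "\<Psi> \<in> borel_measurable N" "integrable M (\<lambda>\<omega>. \<Psi> (\<eta> \<omega>))"
    "(\<integral>\<omega>. \<bar>Z \<omega> - \<Psi> (\<eta> \<omega>)\<bar> \<partial>M) < e / (2 * (\<bar>c\<bar> + 1))"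
    using Z unfolding eta_approx_def by meson
  show "\<exists>\<Phi>\<in>borel_measurable N. integrable M (\<lambda>\<omega>. \<Phi> (\<eta> \<omega>)) \<and> (\<integral>\<omega>. \<bar>Y \<omega> + c * Z \<omega> - \<Phi> (\<eta> \<omega>)\<bar> \<partial>M) < e"
  proof (intro bexI[of _ "\<lambda>\<mu>. \<Phi> \<mu> + c * \<Psi> \<mu>"] conjI)
    show "integrable M (\<lambda>\<omega>. \<Phi> (\<eta> \<omega>) + c * \<Psi> (\<eta> \<omega>))" using \<Phi> \<Psi> by auto
    show "(\<lambda>\<mu>. \<Phi> \<mu> + c * \<Psi> \<mu>) \<in> borel_measurable N" using \<Phi>(1) \<Psi>(1) by measurable
    have "(\<integral>\<omega>. \<bar>Y \<omega> + c * Z \<omega> - (\<Phi> (\<eta> \<omega>) + c * \<Psi> (\<eta> \<omega>))\<bar> \<partial>M) \<le>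
        (\<integral>\<omega>. \<bar>Y \<omega> - \<Phi> (\<eta> \<omega>)\<bar> + \<bar>c\<bar> * \<bar>Z \<omega> - \<Psi> (\<eta> \<omega>)\<bar> \<partial>M)"
    proof (rule integral_mono)
      fix \<omega>
      have "Y \<omega> + c * Z \<omega> - (\<Phi> (\<eta> \<omega>) + c * \<Psi> (\<eta> \<omega>)) = (Y \<omega> - \<Phi> (\<eta> \<omega>)) + c * (Z \<omega> - \<Psi> (\<eta> \<omega>))"
        by (simp add: algebra_simps)
      then show "\<bar>Y \<omega> + c * Z \<omega> - (\<Phi> (\<eta> \<omega>) + c * \<Psi> (\<eta> \<omega>))\<bar> \<le> \<bar>Y \<omega> - \<Phi> (\<eta> \<omega>)\<bar> + \<bar>c\<bar> * \<bar>Z \<omega> - \<Psi> (\<eta> \<omega>)\<bar>"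
        by (simp add: abs_mult[symmetric] abs_triangle_ineq)
    qed (use iY iZ \<Phi> \<Psi> in auto)
    also have "\<dots> = (\<integral>\<omega>. \<bar>Y \<omega> - \<Phi> (\<eta> \<omega>)\<bar> \<partial>M) + \<bar>c\<bar> * (\<integral>\<omega>. \<bar>Z \<omega> - \<Psi> (\<eta> \<omega>)\<bar> \<partial>M)"
      using iY iZ \<Phi> \<Psi> by auto
    also have "\<dots> < e / 2 + e / 2"
    proof (rule add_less_le_mono[OF \<Phi>(3)])
      have "\<bar>c\<bar> * (\<integral>\<omega>. \<bar>Z \<omega> - \<Psi> (\<eta> \<omega>)\<bar> \<partial>M) \<le> (\<bar>c\<bar> + 1) * (e / (2 * (\<bar>c\<bar> + 1)))"
        using \<Psi>(3) e by (intro mult_mono) auto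
      also have "\<dots> = e / 2" using add_nonneg_pos[of "\<bar>c\<bar>" 1] by (simp add: field_simps)
      finally show "\<bar>c\<bar> * (\<integral>\<omega>. \<bar>Z \<omega> - \<Psi> (\<eta> \<omega>)\<bar> \<partial>M) \<le> e / 2" .
    qed
    finally show "(\<integral>\<omega>. \<bar>Y \<omega> + c * Z \<omega> - (\<Phi> (\<eta> \<omega>) + c * \<Psi> (\<eta> \<omega>))\<bar> \<partial>M) < e" by simp
  qed
qed

lemma eta_approx_sum:
  assumes "\<And>i. i \<in> A \<Longrightarrow> eta_approx (f i)"
  shows "eta_approx (\<lambda>\<omega>. \<Sum>i\<in>A. f i \<omega>)"
proof -
  have 0: "eta_approx (\<lambda>_. 0)" by (rule eta_approx_exact[of _ "\<lambda>_. 0"]) auto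
  show ?thesis
    using assms
    by (induction A rule: infinite_finite_induct) (auto simp: 0 intro: eta_approx_add_cmult[where c = 1, simplified])
qed

text \<open>On a probability space L2 convergence implies L1 convergence, so an approximation of
  some \<open>F k\<close> also approximates the limit.\<close>

lemma eta_approx_L2_limit:
  assumes F: "\<And>k. eta_approx (F k)" and lim: "tendsto_L2 M F Z"
  shows "eta_approx Z"
  unfolding eta_approx_def
proof (intro conjI allI impI)
  have sq: "square_integrable M Z" "square_integrable M (F k)" "square_integrable M (\<lambda>\<omega>. F k \<omega> - Z \<omega>)" for k
    using lim by (auto simp: tendsto_L2_def intro: square_integrable_diff)
  note int = sq[THEN square_integrable_integrable]
  show "integrable M Z" by (rule int)
  fix e :: real assume e: "e > 0"
  have "(\<lambda>k. sqrt (\<integral>\<omega>. (F k \<omega> - Z \<omega>)\<^sup>2 \<partial>M)) \<longlonglongrightarrow> sqrt 0"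
    using lim by (intro tendsto_real_sqrt) (simp add: tendsto_L2_def)
  from order_tendstoD(2)[OF this, of "e / 2"] e obtain k where k: "sqrt (\<integral>\<omega>. (F k \<omega> - Z \<omega>)\<^sup>2 \<partial>M) < e / 2"
    by (auto simp: eventually_sequentially)
  obtain \<Phi> where \<Phi>: "\<Phi> \<in> borel_measurable N" "integrable M (\<lambda>\<omega>. \<Phi> (\<eta> \<omega>))" "(\<integral>\<omega>. \<bar>F k \<omega> - \<Phi> (\<eta> \<omega>)\<bar> \<partial>M) < e / 2"
    using F[of k] e unfolding eta_approx_def by (meson half_gt_zero)
  have "(\<integral>\<omega>. \<bar>Z \<omega> - \<Phi> (\<eta> \<omega>)\<bar> \<partial>M) \<le> (\<integral>\<omega>. \<bar>F k \<omega> - Z \<omega>\<bar> + \<bar>F k \<omega> - \<Phi> (\<eta> \<omega>)\<bar> \<partial>M)"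
    using int \<Phi> by (intro integral_mono) auto
  also have "\<dots> = (\<integral>\<omega>. \<bar>F k \<omega> - Z \<omega>\<bar> \<partial>M) + (\<integral>\<omega>. \<bar>F k \<omega> - \<Phi> (\<eta> \<omega>)\<bar> \<partial>M)"
    using int \<Phi> by (intro Bochner_Integration.integral_add) auto
  also have "\<dots> < e"
    using expectation_abs_le[OF sq(3), of k] k \<Phi>(3) by linarith
  finally show "\<exists>\<Phi>\<in>borel_measurable N. integrable M (\<lambda>\<omega>. \<Phi> (\<eta> \<omega>)) \<and> (\<integral>\<omega>. \<bar>Z \<omega> - \<Phi> (\<eta> \<omega>)\<bar> \<partial>M) < e"
    using \<Phi> by blast
qed

text \<open>One event at a time is extracted. Prefixing ps with the pair (C, s) makes the
  expectation a power series in s whose coefficients are the expectations over the events that C has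
  exactly j points; it vanishes for \<bar>s\<bar> < 1. The remaining list ps stays arbitrary so that
  the induction hypothesis covers the prefixed one.\<close>

lemma moment_zero:
  assumes Z: "integrable M Z"
    and orth: "\<And>ps. testlist lam ps \<Longrightarrow> (\<integral>\<omega>. Z \<omega> * testfun ps (\<eta> \<omega>) \<partial>M) = 0"
    and "testlist lam ps" "\<forall>(C, k)\<in>set ts. C \<in> sets lam \<and> emeasure lam C < \<infinity>"
  shows "(\<integral>\<omega>. Z \<omega> * testfun ps (\<eta> \<omega>) * (\<Prod>(C, k)\<leftarrow>ts. of_bool (count_in C (\<eta> \<omega>) = k)) \<partial>M) = 0"
  using assms(3,4)
proof (induction ts arbitrary: ps)
  case Nil
  then show ?case by (simp add: orth)
next
  case (Cons t ts)
  obtain C k where t: "t = (C, k)" by force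
  have C[measurable]: "C \<in> sets lam" and finC: "emeasure lam C < \<infinity>" using Cons.prems by (auto simp: t)
  define ind where "ind ts \<omega> = (\<Prod>(C, k)\<leftarrow>ts. of_bool (count_in C (\<eta> \<omega>) = k) :: real)" for ts \<omega>
  have ind_meas: "ind ts \<in> borel_measurable M" if "\<forall>(C, k)\<in>set ts. C \<in> sets lam \<and> emeasure lam C < \<infinity>" for ts
    using that
  proof (induction ts)
    case Nil
    then show ?case by (simp add: ind_def[abs_def])
  next
    case (Cons t ts)
    obtain C k where t: "t = (C, k)" by force
    have [measurable]: "C \<in> sets lam" "ind ts \<in> borel_measurable M" using Cons by (auto simp: t)
    have "(\<lambda>\<omega>. of_bool (count_in C (\<eta> \<omega>) = k) * ind ts \<omega>) \<in> borel_measurable M" by measurable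
    then show ?case by (simp add: ind_def[abs_def] t)
  qed
  have ind_bound: "\<bar>ind ts \<omega>\<bar> \<le> 1" for ts \<omega>
    unfolding ind_def by (induction ts) (auto simp: abs_mult intro!: mult_le_one)
  define Y where "Y \<omega> = Z \<omega> * testfun ps (\<eta> \<omega>) * ind ts \<omega>" for \<omega>
  have Y: "integrable M Y"
  proof (rule Bochner_Integration.integrable_bound[OF Z])
    show "Y \<in> borel_measurable M"
      unfolding Y_def using Z ind_meas[of ts] Cons.prems measurable_compose[OF eta_measurable testfun_measurable[OF Cons.prems(1)]]
      by (intro borel_measurable_times) auto
    have "\<bar>Y \<omega>\<bar> \<le> \<bar>Z \<omega>\<bar> * 1 * 1" for \<omega>
      unfolding Y_def abs_mult using testfun_bound[OF Cons.prems(1), of "\<eta> \<omega>"] ind_bound[of ts \<omega>]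
      by (intro mult_mono) auto
    then show "AE \<omega> in M. norm (Y \<omega>) \<le> norm (Z \<omega>)" by simp
  qed
  note [measurable] = borel_measurable_integrable[OF Y]
  define a where "a j = (\<integral>\<omega>. Y \<omega> * of_bool (count_in C (\<eta> \<omega>) = j) \<partial>M)" for j
  have int_a: "integrable M (\<lambda>\<omega>. Y \<omega> * of_bool (count_in C (\<eta> \<omega>) = j))" for j
    by (rule Bochner_Integration.integrable_bound[OF Y]) auto
  have "a j = 0" for j
  proof (rule powser_zero_coeff)
    fix s :: real assume s: "\<bar>s\<bar> < 1"
    have "(\<lambda>m. \<integral>\<omega>. (\<Sum>j<m. Y \<omega> * of_bool (count_in C (\<eta> \<omega>) = j) * s ^ j) \<partial>M) \<longlonglongrightarrow> (\<integral>\<omega>. Y \<omega> * s ^ count_in C (\<eta> \<omega>) \<partial>M)"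
    proof (rule integral_dominated_convergence)
      show "integrable M (\<lambda>\<omega>. \<bar>Y \<omega>\<bar>)" using Y by simp
      have eq: "(\<Sum>j<m. Y \<omega> * of_bool (count_in C (\<eta> \<omega>) = j) * s ^ j) =
          (if count_in C (\<eta> \<omega>) < m then Y \<omega> * s ^ count_in C (\<eta> \<omega>) else 0)" for m \<omega>
      proof -
        have "(\<Sum>j<m. Y \<omega> * of_bool (count_in C (\<eta> \<omega>) = j) * s ^ j) =
            (\<Sum>j<m. if count_in C (\<eta> \<omega>) = j then Y \<omega> * s ^ j else 0)"
          by (intro sum.cong) auto
        then show ?thesis by (simp add: sum.delta')
      qed
      show "AE \<omega> in M. (\<lambda>m. \<Sum>j<m. Y \<omega> * of_bool (count_in C (\<eta> \<omega>) = j) * s ^ j) \<longlonglongrightarrow> Y \<omega> * s ^ count_in C (\<eta> \<omega>)"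
      proof (rule AE_I2)
        fix \<omega>
        have "\<forall>\<^sub>F m in sequentially. (\<Sum>j<m. Y \<omega> * of_bool (count_in C (\<eta> \<omega>) = j) * s ^ j) = Y \<omega> * s ^ count_in C (\<eta> \<omega>)"
          using eventually_gt_at_top[of "count_in C (\<eta> \<omega>)"] by eventually_elim (simp add: eq)
        then show "(\<lambda>m. \<Sum>j<m. Y \<omega> * of_bool (count_in C (\<eta> \<omega>) = j) * s ^ j) \<longlonglongrightarrow> Y \<omega> * s ^ count_in C (\<eta> \<omega>)"
          by (rule tendsto_eventually)
      qed
      have "\<bar>Y \<omega> * s ^ count_in C (\<eta> \<omega>)\<bar> \<le> \<bar>Y \<omega>\<bar>" for \<omega>
        using s by (auto simp: abs_mult power_abs intro!: mult_left_le power_le_one)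
      then show "AE \<omega> in M. norm (\<Sum>j<m. Y \<omega> * of_bool (count_in C (\<eta> \<omega>) = j) * s ^ j) \<le> \<bar>Y \<omega>\<bar>" for m
        by (simp add: eq)
    qed measurable
    moreover have "(\<integral>\<omega>. (\<Sum>j<m. Y \<omega> * of_bool (count_in C (\<eta> \<omega>) = j) * s ^ j) \<partial>M) = (\<Sum>j<m. a j * s ^ j)" for m
      using int_a by (simp add: a_def)
    moreover have "(\<integral>\<omega>. Y \<omega> * s ^ count_in C (\<eta> \<omega>) \<partial>M) = 0"
      using Cons.IH[of "(C, s) # ps"] Cons.prems s
      by (simp add: t testlist_Cons testfun_Cons Y_def ind_def mult_ac)
    ultimately show "(\<lambda>j. a j * s ^ j) sums 0"
      by (simp add: sums_def)
  qed
  from this[of k] show ?case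
    by (simp add: t a_def Y_def ind_def mult_ac)
qed

lemma cylinder_zero:
  assumes Z: "integrable M Z"
    and orth: "\<And>ps. testlist lam ps \<Longrightarrow> (\<integral>\<omega>. Z \<omega> * testfun ps (\<eta> \<omega>) \<partial>M) = 0"
    and E: "E \<in> cylinders lam"
  shows "(\<integral>\<omega>. Z \<omega> * indicator E (\<eta> \<omega>) \<partial>M) = 0"
proof -
  obtain S where S: "finite S" "\<forall>(C, k)\<in>S. C \<in> sets lam \<and> emeasure lam C < \<infinity>" "E = cylinder lam S"
    using E by (auto simp: cylinders_def)
  obtain ts where ts: "set ts = S" using finite_list[OF S(1)] by blast
  have tsv: "\<forall>(C, k)\<in>set ts. C \<in> sets lam \<and> emeasure lam C < \<infinity>" using S ts by simp
  have E_sets[measurable]: "E \<in> sets N" unfolding S(3) by (rule cylinder_sets) (use S in auto)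
  have "AE \<omega> in M. \<forall>p\<in>S. emeasure (\<eta> \<omega>) (fst p) < \<infinity>"
    using S by (intro AE_finite_allI eta_finite) auto
  then have eq: "AE \<omega> in M. indicator E (\<eta> \<omega>) = (\<Prod>(C, k)\<leftarrow>ts. of_bool (count_in C (\<eta> \<omega>) = k) :: real)"
    using AE_space
  proof eventually_elim
    case (elim \<omega>)
    \<comment> \<open>\<open>count_in\<close> agrees with the true count only when that is finite,
      which holds almost surely for the sets of a cylinder.\<close>
    have iff: "emeasure (\<eta> \<omega>) C = of_nat k \<longleftrightarrow> count_in C (\<eta> \<omega>) = k" if "(C, k) \<in> S" for C k
    proof -
      have "C \<in> sets lam" "emeasure (\<eta> \<omega>) C < \<infinity>" using S that elim by auto
      then obtain j where "emeasure (\<eta> \<omega>) C = of_nat j"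
        using counting_measuresD(4)[OF eta_counting[OF elim(2)]] by fastforce
      then show ?thesis by (simp add: count_in_def)
    qed
    have "\<eta> \<omega> \<in> E \<longleftrightarrow> (\<forall>(C, k)\<in>set ts. count_in C (\<eta> \<omega>) = k)"
      using eta_counting[OF elim(2)] iff by (auto simp: S(3) cylinder_def ts)
    moreover have "(\<Prod>(C, k)\<leftarrow>ts. of_bool (count_in C (\<eta> \<omega>) = k) :: real) = of_bool (\<forall>(C, k)\<in>set ts. count_in C (\<eta> \<omega>) = k)"
      by (induction ts) auto
    ultimately show ?case by (simp add: indicator_def)
  qed
  have "(\<integral>\<omega>. Z \<omega> * testfun [] (\<eta> \<omega>) * (\<Prod>(C, k)\<leftarrow>ts. of_bool (count_in C (\<eta> \<omega>) = k)) \<partial>M) = 0"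
    by (rule moment_zero[OF Z orth _ tsv]) (auto simp: testlist_def)
  moreover have "(\<integral>\<omega>. Z \<omega> * testfun [] (\<eta> \<omega>) * (\<Prod>(C, k)\<leftarrow>ts. of_bool (count_in C (\<eta> \<omega>) = k)) \<partial>M) =
      (\<integral>\<omega>. Z \<omega> * indicator E (\<eta> \<omega>) \<partial>M)"
  proof (rule integral_cong_AE)
    have "(\<lambda>\<omega>. \<Prod>(C, k)\<leftarrow>ts. of_bool (count_in C (\<eta> \<omega>) = k) :: real) \<in> borel_measurable M"
      using tsv
    proof (induction ts)
      case (Cons t ts)
      obtain C k where t: "t = (C, k)" by force
      have [measurable]: "C \<in> sets lam" "(\<lambda>\<omega>. \<Prod>(C, k)\<leftarrow>ts. of_bool (count_in C (\<eta> \<omega>) = k) :: real) \<in> borel_measurable M"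
        using Cons by (auto simp: t)
      have "(\<lambda>\<omega>. of_bool (count_in C (\<eta> \<omega>) = k) * (\<Prod>(C, k)\<leftarrow>ts. of_bool (count_in C (\<eta> \<omega>) = k) :: real)) \<in> borel_measurable M"
        by measurable
      then show ?case by (simp add: t)
    qed simp
    then show "(\<lambda>\<omega>. Z \<omega> * testfun [] (\<eta> \<omega>) * (\<Prod>(C, k)\<leftarrow>ts. of_bool (count_in C (\<eta> \<omega>) = k))) \<in> borel_measurable M"
      using Z by (intro borel_measurable_times) (auto simp: testfun_def)
    show "(\<lambda>\<omega>. Z \<omega> * indicator E (\<eta> \<omega>)) \<in> borel_measurable M"
      using Z by measurable
    show "AE \<omega> in M. Z \<omega> * testfun [] (\<eta> \<omega>) * (\<Prod>(C, k)\<leftarrow>ts. of_bool (count_in C (\<eta> \<omega>) = k)) = Z \<omega> * indicator E (\<eta> \<omega>)"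
      using eq by eventually_elim (simp add: testfun_def)
  qed
  ultimately show ?thesis by simp
qed

text \<open>Dynkin argument from the cylinders. The whole space is itself a cylinder, and this
  handles complements.\<close>

lemma event_zero:
  assumes Z: "integrable M Z"
    and orth: "\<And>ps. testlist lam ps \<Longrightarrow> (\<integral>\<omega>. Z \<omega> * testfun ps (\<eta> \<omega>) \<partial>M) = 0"
    and E: "E \<in> sets N"
  shows "(\<integral>\<omega>. Z \<omega> * indicator E (\<eta> \<omega>) \<partial>M) = 0"
proof -
  note sets_eq = sets_counting_space[OF lam.sigma_finite_measure_axioms]
  have int: "integrable M (\<lambda>\<omega>. Z \<omega> * indicator E (\<eta> \<omega>))" if [measurable]: "E \<in> sets N" for E
    by (rule Bochner_Integration.integrable_bound[OF Z]) (use Z in \<open>auto simp: indicator_def\<close>)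
  have cyl: "(\<integral>\<omega>. Z \<omega> * indicator E (\<eta> \<omega>) \<partial>M) = 0" if "E \<in> cylinders lam" for E
    using cylinder_zero[of Z E] Z orth that by blast
  have "E \<in> sigma_sets (counting_measures lam) (cylinders lam)" using E by (simp add: sets_eq)
  with Int_stable_cylinders cylinders_subset show ?thesis
  proof (induction E rule: sigma_sets_induct_disjoint)
    case (basic E)
    then show ?case by (rule cyl)
  next
    case empty
    show ?case by simp
  next
    case (compl E)
    have [measurable]: "E \<in> sets N" using compl by (simp add: sets_eq)
    have "(\<integral>\<omega>. Z \<omega> * indicator (counting_measures lam - E) (\<eta> \<omega>) \<partial>M) =
        (\<integral>\<omega>. Z \<omega> * indicator (counting_measures lam) (\<eta> \<omega>) - Z \<omega> * indicator E (\<eta> \<omega>) \<partial>M)"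
      by (intro Bochner_Integration.integral_cong) (auto simp: indicator_def eta_counting)
    also have "\<dots> = 0"
      using int[OF sets.top] int[of E] compl(2) cyl[OF space_in_cylinders]
      by (simp add: space_counting_space)
    finally show ?case .
  next
    case (union E)
    have E[measurable]: "E i \<in> sets N" for i using union(2) unfolding sets_eq by blast
    have [measurable]: "(\<Union>i. E i) \<in> sets N" using E by auto
    note [measurable] = borel_measurable_integrable[OF Z]
    have "(\<lambda>m. \<integral>\<omega>. (\<Sum>i<m. Z \<omega> * indicator (E i) (\<eta> \<omega>)) \<partial>M) \<longlonglongrightarrow> (\<integral>\<omega>. Z \<omega> * indicator (\<Union>i. E i) (\<eta> \<omega>) \<partial>M)"
    proof (rule integral_dominated_convergence)
      show "integrable M (\<lambda>\<omega>. \<bar>Z \<omega>\<bar>)" using Z by simp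
      have eq: "(\<Sum>i<m. Z \<omega> * indicator (E i) (\<eta> \<omega>)) = Z \<omega> * indicator (\<Union>i<m. E i) (\<eta> \<omega>)" for m \<omega>
        unfolding sum_distrib_left[symmetric]
        by (subst indicator_UN_disjoint) (use union(1) in \<open>auto intro: disjoint_family_on_mono\<close>)
      show "AE \<omega> in M. (\<lambda>m. \<Sum>i<m. Z \<omega> * indicator (E i) (\<eta> \<omega>)) \<longlonglongrightarrow> Z \<omega> * indicator (\<Union>i. E i) (\<eta> \<omega>)"
      proof (rule AE_I2)
        fix \<omega>
        have "\<forall>\<^sub>F m in sequentially. (indicator (\<Union>i<m. E i) (\<eta> \<omega>) :: real) = indicator (\<Union>i. E i) (\<eta> \<omega>)"
        proof (cases "\<eta> \<omega> \<in> (\<Union>i. E i)")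
          case True
          then obtain i where i: "\<eta> \<omega> \<in> E i" by blast
          show ?thesis
            using eventually_gt_at_top[of i] by eventually_elim (use i in \<open>auto simp: indicator_def\<close>)
        qed (auto simp: indicator_def)
        then have "\<forall>\<^sub>F m in sequentially. (\<Sum>i<m. Z \<omega> * indicator (E i) (\<eta> \<omega>)) = Z \<omega> * indicator (\<Union>i. E i) (\<eta> \<omega>)"
          by eventually_elim (simp add: eq)
        then show "(\<lambda>m. \<Sum>i<m. Z \<omega> * indicator (E i) (\<eta> \<omega>)) \<longlonglongrightarrow> Z \<omega> * indicator (\<Union>i. E i) (\<eta> \<omega>)"
          by (rule tendsto_eventually)
      qed
      show "AE \<omega> in M. norm (\<Sum>i<m. Z \<omega> * indicator (E i) (\<eta> \<omega>)) \<le> \<bar>Z \<omega>\<bar>" for m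
        unfolding eq by (auto simp: indicator_def)
    qed measurable
    moreover have "(\<integral>\<omega>. (\<Sum>i<m. Z \<omega> * indicator (E i) (\<eta> \<omega>)) \<partial>M) = 0" for m
      using int[OF E] union(3) by (subst Bochner_Integration.integral_sum) auto
    ultimately have "(\<lambda>m::nat. 0) \<longlonglongrightarrow> (\<integral>\<omega>. Z \<omega> * indicator (\<Union>i. E i) (\<eta> \<omega>) \<partial>M)" by simp
    then show ?case by (metis LIMSEQ_unique tendsto_const)
  qed
qed

text \<open>Approximate Z by \<Phi>(\<eta>) and pair with the sign of \<Phi>(\<eta>), a difference
  of indicators of events of \<open>\<eta>\<close> and hence orthogonal to Z. This bounds
  E\<bar>\<Phi>(\<eta>)\<bar> by the error of the approximation, and E\<bar>Z\<bar> by twice that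
  error.\<close>

lemma eta_approx_zero:
  assumes Z: "eta_approx Z"
    and orth: "\<And>ps. testlist lam ps \<Longrightarrow> (\<integral>\<omega>. Z \<omega> * testfun ps (\<eta> \<omega>) \<partial>M) = 0"
  shows "AE \<omega> in M. Z \<omega> = 0"
proof -
  have iZ: "integrable M Z" using Z by (simp add: eta_approx_def)
  have zero: "(\<integral>\<omega>. Z \<omega> * indicator E (\<eta> \<omega>) \<partial>M) = 0" if "E \<in> sets N" for E
    using event_zero[of Z E] iZ orth that by blast
  have small: "(\<integral>\<omega>. \<bar>Z \<omega>\<bar> \<partial>M) \<le> 2 * e" if e: "e > 0" for e
  proof -
    obtain \<Phi> where \<Phi>[measurable]: "\<Phi> \<in> borel_measurable N" and i\<Phi>: "integrable M (\<lambda>\<omega>. \<Phi> (\<eta> \<omega>))"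
      and less: "(\<integral>\<omega>. \<bar>Z \<omega> - \<Phi> (\<eta> \<omega>)\<bar> \<partial>M) < e"
      using Z e unfolding eta_approx_def by meson
    define P Q where "P = {\<mu> \<in> space N. 0 < \<Phi> \<mu>}" and "Q = {\<mu> \<in> space N. \<Phi> \<mu> < 0}"
    have PQ[measurable]: "P \<in> sets N" "Q \<in> sets N" unfolding P_def Q_def by measurable
    define sg where "sg \<omega> = indicator P (\<eta> \<omega>) - (indicator Q (\<eta> \<omega>) :: real)" for \<omega>
    have [measurable]: "sg \<in> borel_measurable M" unfolding sg_def by measurable
    have sg: "\<bar>sg \<omega>\<bar> \<le> 1" for \<omega> by (auto simp: sg_def indicator_def P_def Q_def)
    have bounded: "integrable M (\<lambda>\<omega>. f \<omega> * sg \<omega>)" if "integrable M f" for f :: "'w \<Rightarrow> real"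
      by (rule Bochner_Integration.integrable_bound[OF that])
         (use that sg in \<open>auto simp: abs_mult intro!: mult_left_le\<close>)
    have "integrable M (\<lambda>\<omega>. Z \<omega> * indicator R (\<eta> \<omega>))" if [measurable]: "R \<in> sets N" for R
      by (rule Bochner_Integration.integrable_bound[OF iZ]) (use iZ in \<open>auto simp: indicator_def\<close>)
    then have Zsg: "(\<integral>\<omega>. Z \<omega> * sg \<omega> \<partial>M) = 0"
      using zero[OF PQ(1)] zero[OF PQ(2)] PQ by (simp add: sg_def right_diff_distrib)
    have "(\<integral>\<omega>. \<bar>\<Phi> (\<eta> \<omega>)\<bar> \<partial>M) = (\<integral>\<omega>. \<Phi> (\<eta> \<omega>) * sg \<omega> \<partial>M)"
      by (intro Bochner_Integration.integral_cong)
         (auto simp: sg_def indicator_def P_def Q_def space_counting_space eta_counting)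
    also have "\<dots> = (\<integral>\<omega>. (\<Phi> (\<eta> \<omega>) - Z \<omega>) * sg \<omega> \<partial>M)"
      using bounded[OF i\<Phi>] bounded[OF iZ] by (simp add: left_diff_distrib Zsg)
    also have "\<dots> \<le> (\<integral>\<omega>. \<bar>Z \<omega> - \<Phi> (\<eta> \<omega>)\<bar> \<partial>M)"
    proof (rule integral_mono)
      fix \<omega>
      have "(\<Phi> (\<eta> \<omega>) - Z \<omega>) * sg \<omega> \<le> \<bar>\<Phi> (\<eta> \<omega>) - Z \<omega>\<bar> * \<bar>sg \<omega>\<bar>"
        by (simp add: abs_mult[symmetric])
      also have "\<dots> \<le> \<bar>\<Phi> (\<eta> \<omega>) - Z \<omega>\<bar> * 1" by (intro mult_left_mono sg) simp
      finally show "(\<Phi> (\<eta> \<omega>) - Z \<omega>) * sg \<omega> \<le> \<bar>Z \<omega> - \<Phi> (\<eta> \<omega>)\<bar>" by (simp add: abs_minus_commute)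
    qed (use bounded i\<Phi> iZ in auto)
    finally have "(\<integral>\<omega>. \<bar>\<Phi> (\<eta> \<omega>)\<bar> \<partial>M) \<le> e" using less by simp
    moreover have "(\<integral>\<omega>. \<bar>Z \<omega>\<bar> \<partial>M) \<le> (\<integral>\<omega>. \<bar>Z \<omega> - \<Phi> (\<eta> \<omega>)\<bar> + \<bar>\<Phi> (\<eta> \<omega>)\<bar> \<partial>M)"
      using iZ i\<Phi> by (intro integral_mono) auto
    moreover have "\<dots> = (\<integral>\<omega>. \<bar>Z \<omega> - \<Phi> (\<eta> \<omega>)\<bar> \<partial>M) + (\<integral>\<omega>. \<bar>\<Phi> (\<eta> \<omega>)\<bar> \<partial>M)"
      using iZ i\<Phi> by (intro Bochner_Integration.integral_add) auto
    ultimately show ?thesis using less by linarith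
  qed
  have "(\<integral>\<omega>. \<bar>Z \<omega>\<bar> \<partial>M) \<le> 0"
  proof (rule field_le_epsilon)
    fix e :: real assume "0 < e"
    then show "(\<integral>\<omega>. \<bar>Z \<omega>\<bar> \<partial>M) \<le> 0 + e" using small[of "e / 2"] by simp
  qed
  then have "(\<integral>\<omega>. \<bar>Z \<omega>\<bar> \<partial>M) = 0"
    using integral_nonneg_AE[of "\<lambda>\<omega>. \<bar>Z \<omega>\<bar>" M] by (intro antisym) auto
  then have "AE \<omega> in M. \<bar>Z \<omega>\<bar> = 0"
    using iZ by (subst (asm) integral_nonneg_eq_0_iff_AE) auto
  then show ?thesis by simp
qed

lemma testfun_square_integrable:
  assumes "testlist lam ps"
  shows "square_integrable M (\<lambda>\<omega>. testfun ps (\<eta> \<omega>))"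
  unfolding square_integrable_def
proof
  show [measurable]: "(\<lambda>\<omega>. testfun ps (\<eta> \<omega>)) \<in> borel_measurable M"
    by (rule measurable_compose[OF eta_measurable testfun_measurable[OF assms]])
  show "integrable M (\<lambda>\<omega>. (testfun ps (\<eta> \<omega>))\<^sup>2)"
  proof (rule integrable_const_bound[of _ 1])
    show "AE \<omega> in M. norm ((testfun ps (\<eta> \<omega>))\<^sup>2) \<le> 1"
      using testfun_bound[OF assms] by (intro AE_I2) (auto simp: abs_square_le_1)
  qed measurable
qed

text \<open>All four facts pass to the limit along the approximating sequence. The second moment is
  controlled by an inequality instead of the full isometry, which is enough for convergence of the
  chaos series.\<close>

lemma wiener_ito_properties:
  assumes n: "n > 0" and g: "square_integrable (PiM {..<n} (\<lambda>_. lam)) g"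
  shows wiener_ito_square_integrable: "square_integrable M (wiener_ito M lam \<eta> X n g)"
    and wiener_ito_second_moment: "(\<integral>\<omega>. (wiener_ito M lam \<eta> X n g \<omega>)\<^sup>2 \<partial>M) \<le>
      fact n * (\<integral>y. (g y)\<^sup>2 \<partial>PiM {..<n} (\<lambda>_. lam))"
    and wiener_ito_testfun: "\<And>ps. testlist lam ps \<Longrightarrow>
      (\<integral>\<omega>. wiener_ito M lam \<eta> X n g \<omega> * testfun ps (\<eta> \<omega>) \<partial>M) =
      (\<integral>\<omega>. testfun ps (\<eta> \<omega>) \<partial>M) * (\<integral>y. g y * (\<Prod>i<n. testweight ps (y i)) \<partial>PiM {..<n} (\<lambda>_. lam))"
    and wiener_ito_eta_approx: "eta_approx (wiener_ito M lam \<eta> X n g)"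
proof -
  let ?P = "PiM {..<n} (\<lambda>_. lam)" and ?Z = "wiener_ito M lam \<eta> X n g"
  obtain gs where gs: "\<And>k. sum_product_form lam n (gs k)"
    "tendsto_L2 ?P (\<lambda>k. sum_product n (gs k)) g" "tendsto_L2 M (\<lambda>k. WI n (gs k)) ?Z"
    using wiener_ito_approximation[OF n g] by blast
  show sqZ: "square_integrable M ?Z" using gs(3) by (simp add: tendsto_L2_def)
  \<comment> \<open>The empty list represents the zero kernel, so the bound on differences becomes a
    bound on norms.\<close>
  have "(\<integral>\<omega>. WI n (gs k) \<omega> * WI n (gs k) \<omega> \<partial>M) \<le> fact n * (\<integral>y. sum_product n (gs k) y * sum_product n (gs k) y \<partial>?P)" for k
    using WI_diff_bound[OF gs(1)[of k], of "[]"]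
    by (simp add: sum_product_form_def wiener_ito_sum_product_def sum_product_def power2_eq_square)
  then have "(\<integral>\<omega>. ?Z \<omega> * ?Z \<omega> \<partial>M) \<le> fact n * (\<integral>y. g y * g y \<partial>?P)"
    by (intro LIMSEQ_le[OF tendsto_L2_mult[OF gs(3,3)] tendsto_mult_left[OF tendsto_L2_mult[OF gs(2,2)]]]) auto
  then show "(\<integral>\<omega>. (?Z \<omega>)\<^sup>2 \<partial>M) \<le> fact n * (\<integral>y. (g y)\<^sup>2 \<partial>?P)"
    by (simp add: power2_eq_square)
  show "(\<integral>\<omega>. ?Z \<omega> * testfun ps (\<eta> \<omega>) \<partial>M) =
      (\<integral>\<omega>. testfun ps (\<eta> \<omega>) \<partial>M) * (\<integral>y. g y * (\<Prod>i<n. testweight ps (y i)) \<partial>?P)" if ps: "testlist lam ps" for ps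
  proof -
    have w: "square_integrable ?P (\<lambda>y. \<Prod>i<n. testweight ps (y i))"
      by (rule lam.square_integrable_product) (auto intro: testweight_admissible ps)
    have "(\<lambda>k. \<integral>\<omega>. WI n (gs k) \<omega> * testfun ps (\<eta> \<omega>) \<partial>M) \<longlonglongrightarrow> (\<integral>\<omega>. ?Z \<omega> * testfun ps (\<eta> \<omega>) \<partial>M)"
      by (rule tendsto_L2_mult[OF gs(3) tendsto_L2_const[OF testfun_square_integrable[OF ps]]])
    moreover have "(\<lambda>k. \<integral>\<omega>. WI n (gs k) \<omega> * testfun ps (\<eta> \<omega>) \<partial>M) \<longlonglongrightarrow>
        (\<integral>\<omega>. testfun ps (\<eta> \<omega>) \<partial>M) * (\<integral>y. g y * (\<Prod>i<n. testweight ps (y i)) \<partial>?P)"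
      unfolding WI_testfun[OF gs(1) ps]
      by (intro tendsto_mult_left tendsto_L2_mult[OF gs(2) tendsto_L2_const[OF w]])
    ultimately show ?thesis by (rule LIMSEQ_unique)
  qed
  have "eta_approx (WI n (gs k))" for k
  proof -
    obtain \<Phi> where "\<Phi> \<in> borel_measurable N" "AE \<omega> in M. WI n (gs k) \<omega> = \<Phi> (\<eta> \<omega>)"
      using WI_eq_functional[OF gs(1)] by blast
    then show ?thesis
      by (intro eta_approx_exact square_integrable_integrable WI_square_integrable gs(1))
  qed
  then show "eta_approx ?Z" by (rule eta_approx_L2_limit[OF _ gs(3)])
qed

lemma wiener_ito_orthogonal:
  assumes n: "n > 0" and g: "square_integrable (PiM {..<n} (\<lambda>_. lam)) g"
    and m: "m > 0" and g': "square_integrable (PiM {..<m} (\<lambda>_. lam)) g'" and "n \<noteq> m"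
  shows "(\<integral>\<omega>. wiener_ito M lam \<eta> X n g \<omega> * wiener_ito M lam \<eta> X m g' \<omega> \<partial>M) = 0"
proof -
  obtain gs where gs: "\<And>k. sum_product_form lam n (gs k)" "tendsto_L2 M (\<lambda>k. WI n (gs k)) (wiener_ito M lam \<eta> X n g)"
    using wiener_ito_approximation[OF n g] by blast
  obtain gs' where gs': "\<And>k. sum_product_form lam m (gs' k)" "tendsto_L2 M (\<lambda>k. WI m (gs' k)) (wiener_ito M lam \<eta> X m g')"
    using wiener_ito_approximation[OF m g'] by blast
  have "(\<lambda>k::nat. 0) \<longlonglongrightarrow> (\<integral>\<omega>. wiener_ito M lam \<eta> X n g \<omega> * wiener_ito M lam \<eta> X m g' \<omega> \<partial>M)"
    using tendsto_L2_mult[OF gs(2) gs'(2)] WI_orthogonal[OF gs(1) gs'(1) \<open>n \<noteq> m\<close>] by simp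
  then show ?thesis using LIMSEQ_unique[OF _ tendsto_const] by blast
qed

end

section \<open>Iterated difference operators\<close>

text \<open>The common parameter in \<Theta> lets the functional and the shift points vary together.
  This is the situation in the kernels, where one coordinate is the argument of h and the others are
  shifts.\<close>

lemma measurable_diff_ops:
  fixes F :: "'a \<Rightarrow> 'y measure \<Rightarrow> real"
  assumes F: "(\<lambda>p. F (fst p) (snd p)) \<in> borel_measurable (\<Theta> \<Otimes>\<^sub>M counting_space lam)"
    and Y: "\<And>k. k \<in> set ks \<Longrightarrow> Y k \<in> \<Theta> \<rightarrow>\<^sub>M lam"
  shows "(\<lambda>p. diff_ops (map (\<lambda>k. Y k (fst p)) ks) (F (fst p)) (snd p)) \<in> borel_measurable (\<Theta> \<Otimes>\<^sub>M counting_space lam)"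
  using Y
proof (induction ks)
  case Nil
  then show ?case using F by simp
next
  case (Cons k ks)
  let ?D = "\<lambda>p. diff_ops (map (\<lambda>k. Y k (fst p)) ks) (F (fst p)) (snd p)"
  have D: "?D \<in> borel_measurable (\<Theta> \<Otimes>\<^sub>M counting_space lam)" using Cons by auto
  have [measurable]: "Y k \<in> \<Theta> \<rightarrow>\<^sub>M lam" using Cons by simp
  have "(\<lambda>p. (fst p, add_dirac (snd p) (Y k (fst p)))) \<in> \<Theta> \<Otimes>\<^sub>M counting_space lam \<rightarrow>\<^sub>M \<Theta> \<Otimes>\<^sub>M counting_space lam"
    by (intro measurable_Pair measurable_add_dirac) measurable
  from measurable_compose[OF this D] D show ?case
    by (simp add: diff_op_def)
qed

text \<open>Fubini with the new coordinate outermost. In \<open>kernel_term\<close> that coordinate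
  is the argument of h and has to be fixed before duality is applied to the section.\<close>

lemma (in product_sigma_finite) product_integral_insert_rev:
  fixes f :: "_ \<Rightarrow> real"
  assumes I: "finite I" "i \<notin> I" and f: "integrable (PiM (insert i I) M) f"
  shows "integral\<^sup>L (PiM (insert i I) M) f = (\<integral>y. (\<integral>x. f (x(i := y)) \<partial>PiM I M) \<partial>M i)"
proof -
  have eq: "merge {i} I (x, y) = y(i := x i)" if "y \<in> space (PiM I M)" for x y
    using that I by (auto simp: merge_def fun_eq_iff space_PiM PiE_iff extensional_def)
  have "integral\<^sup>L (PiM (insert i I) M) f = integral\<^sup>L (PiM ({i} \<union> I) M) f" by simp
  also have "\<dots> = (\<integral>x. (\<integral>y. f (merge {i} I (x, y)) \<partial>PiM I M) \<partial>PiM {i} M)"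
    using I f by (intro product_integral_fold) auto
  also have "\<dots> = (\<integral>x. (\<integral>y. f (y(i := x i)) \<partial>PiM I M) \<partial>PiM {i} M)"
    by (intro Bochner_Integration.integral_cong refl) (simp add: eq)
  also have "\<dots> = (\<integral>y. (\<integral>x. f (x(i := y)) \<partial>PiM I M) \<partial>M i)"
  proof (rule product_integral_singleton)
    interpret PI: sigma_finite_measure "PiM I M" by (rule sigma_finite[OF I(1)])
    have "(\<lambda>p. (snd p)(i := fst p)) \<in> M i \<Otimes>\<^sub>M PiM I M \<rightarrow>\<^sub>M PiM (insert i I) M"
      by (intro measurable_fun_upd[where J = I]) auto
    from measurable_compose[OF this borel_measurable_integrable[OF f]]
    show "(\<lambda>y. \<integral>x. f (x(i := y)) \<partial>PiM I M) \<in> borel_measurable (M i)"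
      by (intro PI.borel_measurable_lebesgue_integral) (simp add: case_prod_unfold)
  qed
  finally show ?thesis .
qed

lemma diff_ops_map_upd:
  "k \<notin> set ks \<Longrightarrow> diff_ops (map (y(k := z)) (k # ks)) F = diff_op z (diff_ops (map y ks) F)"
proof -
  assume "k \<notin> set ks"
  then have "map (y(k := z)) ks = map y ks" by auto
  then show ?thesis by (simp only: list.map diff_ops.simps fun_upd_same)
qed

context poisson_window
begin

lemma eta_diff_ops_measurable:
  assumes F: "F \<in> borel_measurable N" and ks: "set ks \<subseteq> J"
  shows "(\<lambda>p. diff_ops (map (fst p) ks) F (\<eta> (snd p))) \<in> borel_measurable (PiM J (\<lambda>_. lam) \<Otimes>\<^sub>M M)"
proof -
  have D: "(\<lambda>p. diff_ops (map (\<lambda>k. fst p k) ks) F (snd p)) \<in> borel_measurable (PiM J (\<lambda>_. lam) \<Otimes>\<^sub>M N)"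
    by (rule measurable_diff_ops[where F = "\<lambda>_. F" and Y = "\<lambda>k y. y k"])
       (use F ks in \<open>auto intro!: measurable_component_singleton\<close>)
  have "(\<lambda>p. (fst p, \<eta> (snd p))) \<in> PiM J (\<lambda>_. lam) \<Otimes>\<^sub>M M \<rightarrow>\<^sub>M PiM J (\<lambda>_. lam) \<Otimes>\<^sub>M N"
    by measurable
  from measurable_compose[OF this D] show ?thesis by simp
qed

lemma diff_ops_section_measurable:
  assumes F: "F \<in> borel_measurable N" and y: "y \<in> space (PiM (set ks) (\<lambda>_. lam))"
  shows "diff_ops (map y ks) F \<in> borel_measurable N"
proof -
  have "(\<lambda>p. diff_ops (map (\<lambda>k. fst p k) ks) F (snd p)) \<in> borel_measurable (PiM (set ks) (\<lambda>_. lam) \<Otimes>\<^sub>M N)"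
    by (rule measurable_diff_ops[where F = "\<lambda>_. F" and Y = "\<lambda>k y. y k"])
       (use F in \<open>auto intro!: measurable_component_singleton\<close>)
  from measurable_Pair2[OF this y] show ?thesis by simp
qed

text \<open>The shifted part of the difference is covered by \<open>shift_bound\<close> and accounts
  for the 1 in the constant; the unshifted part is constant in z and accounts for the intensity of
  B.\<close>

lemma diff_op_bound:
  fixes H :: "'y measure \<Rightarrow> real"
  assumes H[measurable]: "H \<in> borel_measurable N"
  shows "(\<integral>\<^sup>+z. indicator B z * (\<integral>\<^sup>+\<omega>. ennreal (real c ^ num (\<eta> \<omega>) * \<bar>diff_op z H (\<eta> \<omega>)\<bar>) \<partial>M) \<partial>lam) \<le>
    (1 + emeasure lam B) * (\<integral>\<^sup>+\<omega>. ennreal (real (2 * (c + 1)) ^ num (\<eta> \<omega>) * \<bar>H (\<eta> \<omega>)\<bar>) \<partial>M)"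
proof -
  interpret P: pair_sigma_finite M lam ..
  let ?R = "\<integral>\<^sup>+\<omega>. ennreal (real (2 * (c + 1)) ^ num (\<eta> \<omega>) * \<bar>H (\<eta> \<omega>)\<bar>) \<partial>M"
  have [measurable]: "(\<lambda>p. H (add_dirac (\<eta> (fst p)) (snd p))) \<in> borel_measurable (M \<Otimes>\<^sub>M lam)"
    by (rule measurable_compose[OF measurable_add_dirac H]) measurable
  let ?f = "\<lambda>\<omega> z. indicator B z * ennreal (real c ^ num (\<eta> \<omega>) * \<bar>H (add_dirac (\<eta> \<omega>) z)\<bar>)"
  let ?g = "\<lambda>\<omega> z. indicator B z * ennreal (real c ^ num (\<eta> \<omega>) * \<bar>H (\<eta> \<omega>)\<bar>)"
  have mf: "(\<lambda>(\<omega>, z). ?f \<omega> z) \<in> borel_measurable (M \<Otimes>\<^sub>M lam)" "(\<lambda>(\<omega>, z). ?g \<omega> z) \<in> borel_measurable (M \<Otimes>\<^sub>M lam)"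
    unfolding case_prod_unfold by measurable
  have "(\<integral>\<^sup>+z. indicator B z * (\<integral>\<^sup>+\<omega>. ennreal (real c ^ num (\<eta> \<omega>) * \<bar>diff_op z H (\<eta> \<omega>)\<bar>) \<partial>M) \<partial>lam) \<le>
      (\<integral>\<^sup>+z. \<integral>\<^sup>+\<omega>. ?f \<omega> z + ?g \<omega> z \<partial>M \<partial>lam)"
  proof (intro nn_integral_mono)
    fix z assume z: "z \<in> space lam"
    have "indicator B z * ennreal (real c ^ num (\<eta> \<omega>) * \<bar>diff_op z H (\<eta> \<omega>)\<bar>) \<le> ?f \<omega> z + ?g \<omega> z" for \<omega>
    proof -
      have le: "real c ^ num (\<eta> \<omega>) * \<bar>diff_op z H (\<eta> \<omega>)\<bar> \<le>
          real c ^ num (\<eta> \<omega>) * \<bar>H (add_dirac (\<eta> \<omega>) z)\<bar> + real c ^ num (\<eta> \<omega>) * \<bar>H (\<eta> \<omega>)\<bar>"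
        unfolding distrib_left[symmetric] diff_op_def by (intro mult_left_mono) auto
      have "ennreal (real c ^ num (\<eta> \<omega>) * \<bar>diff_op z H (\<eta> \<omega>)\<bar>) \<le>
          ennreal (real c ^ num (\<eta> \<omega>) * \<bar>H (add_dirac (\<eta> \<omega>) z)\<bar>) + ennreal (real c ^ num (\<eta> \<omega>) * \<bar>H (\<eta> \<omega>)\<bar>)"
        using ennreal_leI[OF le] by simp
      then show ?thesis by (auto simp: indicator_def)
    qed
    then have "(\<integral>\<^sup>+\<omega>. indicator B z * ennreal (real c ^ num (\<eta> \<omega>) * \<bar>diff_op z H (\<eta> \<omega>)\<bar>) \<partial>M) \<le> (\<integral>\<^sup>+\<omega>. ?f \<omega> z + ?g \<omega> z \<partial>M)"
      by (intro nn_integral_mono)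
    moreover have "(\<lambda>\<omega>. diff_op z H (\<eta> \<omega>)) \<in> borel_measurable M"
    proof -
      have "(\<lambda>\<omega>. add_dirac (\<eta> \<omega>) z) \<in> M \<rightarrow>\<^sub>M N" using z by (intro measurable_add_dirac) measurable
      from measurable_compose[OF this H] show ?thesis unfolding diff_op_def by measurable
    qed
    then have "(\<integral>\<^sup>+\<omega>. indicator B z * ennreal (real c ^ num (\<eta> \<omega>) * \<bar>diff_op z H (\<eta> \<omega>)\<bar>) \<partial>M) =
        indicator B z * (\<integral>\<^sup>+\<omega>. ennreal (real c ^ num (\<eta> \<omega>) * \<bar>diff_op z H (\<eta> \<omega>)\<bar>) \<partial>M)"
      by (intro nn_integral_cmult) measurable
    ultimately show "indicator B z * (\<integral>\<^sup>+\<omega>. ennreal (real c ^ num (\<eta> \<omega>) * \<bar>diff_op z H (\<eta> \<omega>)\<bar>) \<partial>M) \<le>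
        (\<integral>\<^sup>+\<omega>. ?f \<omega> z + ?g \<omega> z \<partial>M)" by simp
  qed
  also have "\<dots> = (\<integral>\<^sup>+\<omega>. \<integral>\<^sup>+z. ?f \<omega> z + ?g \<omega> z \<partial>lam \<partial>M)"
    by (rule P.Fubini') (use mf in \<open>simp add: case_prod_unfold\<close>)
  also have "\<dots> = (\<integral>\<^sup>+\<omega>. (\<integral>\<^sup>+z. ?f \<omega> z \<partial>lam) + (\<integral>\<^sup>+z. ?g \<omega> z \<partial>lam) \<partial>M)"
  proof (rule nn_integral_cong)
    fix \<omega> assume \<omega>: "\<omega> \<in> space M"
    show "(\<integral>\<^sup>+z. ?f \<omega> z + ?g \<omega> z \<partial>lam) = (\<integral>\<^sup>+z. ?f \<omega> z \<partial>lam) + (\<integral>\<^sup>+z. ?g \<omega> z \<partial>lam)"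
      using measurable_Pair2[OF mf(1) \<omega>] measurable_Pair2[OF mf(2) \<omega>] by (intro nn_integral_add) simp_all
  qed
  also have "\<dots> = (\<integral>\<^sup>+\<omega>. \<integral>\<^sup>+z. ?f \<omega> z \<partial>lam \<partial>M) + (\<integral>\<^sup>+\<omega>. \<integral>\<^sup>+z. ?g \<omega> z \<partial>lam \<partial>M)"
    using mf by (intro nn_integral_add lam.borel_measurable_nn_integral) auto
  also have "(\<integral>\<^sup>+\<omega>. \<integral>\<^sup>+z. ?f \<omega> z \<partial>lam \<partial>M) \<le> ?R"
    by (rule shift_bound[OF H])
  also have "(\<integral>\<^sup>+\<omega>. \<integral>\<^sup>+z. ?g \<omega> z \<partial>lam \<partial>M) \<le> (\<integral>\<^sup>+\<omega>. emeasure lam B * ennreal (real (2 * (c + 1)) ^ num (\<eta> \<omega>) * \<bar>H (\<eta> \<omega>)\<bar>) \<partial>M)"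
  proof (intro nn_integral_mono)
    fix \<omega>
    have "(\<integral>\<^sup>+z. ?g \<omega> z \<partial>lam) = emeasure lam B * ennreal (real c ^ num (\<eta> \<omega>) * \<bar>H (\<eta> \<omega>)\<bar>)"
      by (subst nn_integral_multc) auto
    also have "\<dots> \<le> emeasure lam B * ennreal (real (2 * (c + 1)) ^ num (\<eta> \<omega>) * \<bar>H (\<eta> \<omega>)\<bar>)"
      by (intro mult_left_mono ennreal_leI mult_right_mono power_mono) auto
    finally show "(\<integral>\<^sup>+z. ?g \<omega> z \<partial>lam) \<le> emeasure lam B * ennreal (real (2 * (c + 1)) ^ num (\<eta> \<omega>) * \<bar>H (\<eta> \<omega>)\<bar>)" .
  qed
  also have "\<dots> = emeasure lam B * ?R"
    by (intro nn_integral_cmult) measurable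
  also have "?R + emeasure lam B * ?R = (1 + emeasure lam B) * ?R"
    by (simp add: distrib_right)
  finally show ?thesis by (simp add: add_mono)
qed

text \<open>Induction over the shifts, each enlarging the weight as in \<open>diff_op_bound\<close>.
  The constants are uniform in F, because later F is a section of h and the bound is integrated over
  the section parameter.\<close>

lemma iterated_diff_bound:
  fixes c :: nat and ks :: "nat list"
  assumes "distinct ks"
  shows "\<exists>C d. C < \<infinity> \<and> (\<forall>F\<in>borel_measurable N.
    (\<integral>\<^sup>+y. (\<Prod>k\<in>set ks. indicator B (y k)) *
      (\<integral>\<^sup>+\<omega>. ennreal (real c ^ num (\<eta> \<omega>) * \<bar>diff_ops (map y ks) F (\<eta> \<omega>)\<bar>) \<partial>M) \<partial>PiM (set ks) (\<lambda>_. lam)) \<le>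
    C * (\<integral>\<^sup>+\<omega>. ennreal (real d ^ num (\<eta> \<omega>) * \<bar>F (\<eta> \<omega>)\<bar>) \<partial>M))"
  using assms
proof (induction ks arbitrary: c)
  case Nil
  interpret P: product_sigma_finite "\<lambda>_::nat. lam" by (rule lam.product_sigma_finite_const)
  show ?case
    by (rule exI[of _ "1 :: ennreal"], rule exI[of _ c]) (simp add: PiM_empty nn_integral_count_space_finite)
next
  case (Cons k ks)
  interpret P: product_sigma_finite "\<lambda>_::nat. lam" by (rule lam.product_sigma_finite_const)
  let ?c = "2 * (c + 1)" and ?P = "PiM (set ks) (\<lambda>_. lam)"
  have k: "k \<notin> set ks" and dist: "distinct ks" using Cons.prems by auto
  from Cons.IH[OF dist, of ?c] obtain C d where C: "C < \<infinity>"
    "\<And>F. F \<in> borel_measurable N \<Longrightarrow>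
    (\<integral>\<^sup>+y. (\<Prod>k\<in>set ks. indicator B (y k)) *
      (\<integral>\<^sup>+\<omega>. ennreal (real ?c ^ num (\<eta> \<omega>) * \<bar>diff_ops (map y ks) F (\<eta> \<omega>)\<bar>) \<partial>M) \<partial>?P) \<le>
    C * (\<integral>\<^sup>+\<omega>. ennreal (real d ^ num (\<eta> \<omega>) * \<bar>F (\<eta> \<omega>)\<bar>) \<partial>M)"
    by blast
  show ?case
  proof (intro exI[of _ "(1 + emeasure lam B) * C"] exI[of _ d] conjI ballI)
    show "(1 + emeasure lam B) * C < \<infinity>" using C B_finite by (simp add: ennreal_mult_less_top)
    fix F :: "'y measure \<Rightarrow> real" assume F[measurable]: "F \<in> borel_measurable N"
    define f where "f y = (\<Prod>k\<in>set (k # ks). indicator B (y k)) *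
      (\<integral>\<^sup>+\<omega>. ennreal (real c ^ num (\<eta> \<omega>) * \<bar>diff_ops (map y (k # ks)) F (\<eta> \<omega>)\<bar>) \<partial>M)" for y
    have [measurable]: "(\<lambda>p. diff_ops (map (fst p) (k # ks)) F (\<eta> (snd p))) \<in> borel_measurable (PiM (insert k (set ks)) (\<lambda>_. lam) \<Otimes>\<^sub>M M)"
      by (rule eta_diff_ops_measurable[OF F]) simp
    have "(\<lambda>y. \<integral>\<^sup>+\<omega>. ennreal (real c ^ num (\<eta> \<omega>) * \<bar>diff_ops (map y (k # ks)) F (\<eta> \<omega>)\<bar>) \<partial>M) \<in> borel_measurable (PiM (insert k (set ks)) (\<lambda>_. lam))"
      by (intro borel_measurable_nn_integral) (simp only: case_prod_unfold, measurable)
    moreover have "(\<lambda>y. \<Prod>k\<in>set (k # ks). indicator B (y k) :: ennreal) \<in> borel_measurable (PiM (insert k (set ks)) (\<lambda>_. lam))"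
      by (intro borel_measurable_prod_ennreal measurable_compose[OF measurable_component_singleton borel_measurable_indicator]) auto
    ultimately have f: "f \<in> borel_measurable (PiM (insert k (set ks)) (\<lambda>_. lam))"
      unfolding f_def[abs_def] by (rule borel_measurable_times_ennreal[rotated])
    have "(\<integral>\<^sup>+y. f y \<partial>PiM (set (k # ks)) (\<lambda>_. lam)) = (\<integral>\<^sup>+x. \<integral>\<^sup>+z. f (x(k := z)) \<partial>lam \<partial>?P)"
      using P.product_nn_integral_insert[OF finite_set k f] by simp
    also have "\<dots> \<le> (\<integral>\<^sup>+x. (\<Prod>k\<in>set ks. indicator B (x k)) * ((1 + emeasure lam B) *
        (\<integral>\<^sup>+\<omega>. ennreal (real ?c ^ num (\<eta> \<omega>) * \<bar>diff_ops (map x ks) F (\<eta> \<omega>)\<bar>) \<partial>M)) \<partial>?P)"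
    proof (rule nn_integral_mono)
      fix x assume x: "x \<in> space ?P"
      have H: "diff_ops (map x ks) F \<in> borel_measurable N" by (rule diff_ops_section_measurable[OF F x])
      let ?E = "\<lambda>z. \<integral>\<^sup>+\<omega>. ennreal (real c ^ num (\<eta> \<omega>) * \<bar>diff_op z (diff_ops (map x ks) F) (\<eta> \<omega>)\<bar>) \<partial>M"
      have "(\<Prod>j\<in>set ks. indicator B ((x(k := z)) j)) = (\<Prod>j\<in>set ks. indicator B (x j) :: ennreal)" for z
        using k by (intro prod.cong) auto
      then have f_eq: "f (x(k := z)) = (\<Prod>k\<in>set ks. indicator B (x k)) * (indicator B z * ?E z)" for z
        unfolding f_def diff_ops_map_upd[OF k] using k by (simp add: mult_ac)
      have "(\<lambda>p. diff_op (snd p) (diff_ops (map x ks) F) (\<eta> (fst p))) \<in> borel_measurable (M \<Otimes>\<^sub>M lam)"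
        unfolding diff_op_def
        by (intro borel_measurable_diff measurable_compose[OF measurable_add_dirac H] measurable_compose[OF _ H]) measurable
      from measurable_compose[OF measurable_pair_swap' this]
      have [measurable]: "(\<lambda>p. diff_op (fst p) (diff_ops (map x ks) F) (\<eta> (snd p))) \<in> borel_measurable (lam \<Otimes>\<^sub>M M)"
        by (simp add: case_prod_unfold)
      have "?E \<in> borel_measurable lam"
        by (intro borel_measurable_nn_integral) (simp only: case_prod_unfold, measurable)
      then have "(\<integral>\<^sup>+z. f (x(k := z)) \<partial>lam) = (\<Prod>k\<in>set ks. indicator B (x k)) * (\<integral>\<^sup>+z. indicator B z * ?E z \<partial>lam)"
        unfolding f_eq by (intro nn_integral_cmult) measurable
      also have "\<dots> \<le> (\<Prod>k\<in>set ks. indicator B (x k)) * ((1 + emeasure lam B) *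
        (\<integral>\<^sup>+\<omega>. ennreal (real ?c ^ num (\<eta> \<omega>) * \<bar>diff_ops (map x ks) F (\<eta> \<omega>)\<bar>) \<partial>M))"
        by (intro mult_left_mono diff_op_bound[OF H]) simp
      finally show "(\<integral>\<^sup>+z. f (x(k := z)) \<partial>lam) \<le> (\<Prod>k\<in>set ks. indicator B (x k)) * ((1 + emeasure lam B) *
        (\<integral>\<^sup>+\<omega>. ennreal (real ?c ^ num (\<eta> \<omega>) * \<bar>diff_ops (map x ks) F (\<eta> \<omega>)\<bar>) \<partial>M))" .
    qed
    also have "\<dots> = (1 + emeasure lam B) * (\<integral>\<^sup>+x. (\<Prod>k\<in>set ks. indicator B (x k)) *
        (\<integral>\<^sup>+\<omega>. ennreal (real ?c ^ num (\<eta> \<omega>) * \<bar>diff_ops (map x ks) F (\<eta> \<omega>)\<bar>) \<partial>M) \<partial>?P)"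
    proof -
      have [measurable]: "(\<lambda>p. diff_ops (map (fst p) ks) F (\<eta> (snd p))) \<in> borel_measurable (?P \<Otimes>\<^sub>M M)"
        by (rule eta_diff_ops_measurable[OF F]) simp
      have "(\<lambda>y. \<integral>\<^sup>+\<omega>. ennreal (real ?c ^ num (\<eta> \<omega>) * \<bar>diff_ops (map y ks) F (\<eta> \<omega>)\<bar>) \<partial>M) \<in> borel_measurable ?P"
        by (intro borel_measurable_nn_integral) (simp only: case_prod_unfold, measurable)
      moreover have "(\<lambda>y. \<Prod>k\<in>set ks. indicator B (y k) :: ennreal) \<in> borel_measurable ?P"
        by (intro borel_measurable_prod_ennreal measurable_compose[OF measurable_component_singleton borel_measurable_indicator]) auto
      ultimately show ?thesis
        by (subst nn_integral_cmult[symmetric]) (auto intro!: nn_integral_cong borel_measurable_times_ennreal simp: mult_ac)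
    qed
    also have "\<dots> \<le> (1 + emeasure lam B) * (C * (\<integral>\<^sup>+\<omega>. ennreal (real d ^ num (\<eta> \<omega>) * \<bar>F (\<eta> \<omega>)\<bar>) \<partial>M))"
      by (intro mult_left_mono C(2) F) simp
    finally show "(\<integral>\<^sup>+y. (\<Prod>k\<in>set (k # ks). indicator B (y k)) *
      (\<integral>\<^sup>+\<omega>. ennreal (real c ^ num (\<eta> \<omega>) * \<bar>diff_ops (map y (k # ks)) F (\<eta> \<omega>)\<bar>) \<partial>M) \<partial>PiM (set (k # ks)) (\<lambda>_. lam)) \<le>
      (1 + emeasure lam B) * C * (\<integral>\<^sup>+\<omega>. ennreal (real d ^ num (\<eta> \<omega>) * \<bar>F (\<eta> \<omega>)\<bar>) \<partial>M)"
      unfolding f_def by (simp add: mult.assoc)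
  qed
qed

text \<open>Finiteness of the integrated bound gives finiteness at almost every tuple in the window.
  Weights are natural numbers, so the exceptional sets for all weights together remain null.\<close>

lemma iterated_weighted:
  fixes ks :: "nat list"
  assumes dist: "distinct ks" and F: "weighted F"
  shows "AE y in PiM (set ks) (\<lambda>_. lam). (\<forall>k\<in>set ks. y k \<in> B) \<longrightarrow> weighted (diff_ops (map y ks) F)"
proof -
  let ?P = "PiM (set ks) (\<lambda>_. lam)"
  note Fm = weighted_measurable[OF F]
  have [measurable]: "(\<lambda>p. diff_ops (map (fst p) ks) F (\<eta> (snd p))) \<in> borel_measurable (?P \<Otimes>\<^sub>M M)"
    by (rule eta_diff_ops_measurable[OF Fm]) simp
  define f where "f c y = (\<Prod>k\<in>set ks. indicator B (y k)) *
    (\<integral>\<^sup>+\<omega>. ennreal (real c ^ num (\<eta> \<omega>) * \<bar>diff_ops (map y ks) F (\<eta> \<omega>)\<bar>) \<partial>M)" for c :: nat and y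
  have "AE y in ?P. f c y \<noteq> \<infinity>" for c
  proof (rule nn_integral_PInf_AE)
    have "(\<lambda>y. \<integral>\<^sup>+\<omega>. ennreal (real c ^ num (\<eta> \<omega>) * \<bar>diff_ops (map y ks) F (\<eta> \<omega>)\<bar>) \<partial>M) \<in> borel_measurable ?P"
      by (intro borel_measurable_nn_integral) (simp only: case_prod_unfold, measurable)
    moreover have "(\<lambda>y. \<Prod>k\<in>set ks. indicator B (y k) :: ennreal) \<in> borel_measurable ?P"
      by (intro borel_measurable_prod_ennreal measurable_compose[OF measurable_component_singleton borel_measurable_indicator]) auto
    ultimately show "f c \<in> borel_measurable ?P"
      unfolding f_def[abs_def] by (rule borel_measurable_times_ennreal[rotated])
    from iterated_diff_bound[OF dist, of c] obtain C d where C: "C < \<infinity>"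
      "(\<integral>\<^sup>+y. f c y \<partial>?P) \<le> C * (\<integral>\<^sup>+\<omega>. ennreal (real d ^ num (\<eta> \<omega>) * \<bar>F (\<eta> \<omega>)\<bar>) \<partial>M)"
      unfolding f_def using Fm by blast
    have "(\<integral>\<^sup>+\<omega>. ennreal (real d ^ num (\<eta> \<omega>) * \<bar>F (\<eta> \<omega>)\<bar>) \<partial>M) < \<infinity>"
      using F by (simp add: weighted_def)
    then show "(\<integral>\<^sup>+y. f c y \<partial>?P) \<noteq> \<infinity>"
      using C by (auto simp: top_unique ennreal_mult_eq_top_iff)
  qed
  then have "AE y in ?P. \<forall>c. f c y \<noteq> \<infinity>" by (simp add: AE_all_countable)
  then show ?thesis
    using AE_space
  proof eventually_elim
    case (elim y)
    show ?case
    proof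
      assume "\<forall>k\<in>set ks. y k \<in> B"
      then have "(\<Prod>k\<in>set ks. indicator B (y k) :: ennreal) = 1" by simp
      with elim show "weighted (diff_ops (map y ks) F)"
        unfolding weighted_def f_def by (auto simp: less_top intro: diff_ops_section_measurable Fm)
    qed
  qed
qed

lemma product_nice:
  assumes "finite J" "\<And>k. k \<in> J \<Longrightarrow> nice L (g k)" and y: "y \<in> space (PiM J (\<lambda>_. lam))"
  shows "ennreal \<bar>\<Prod>k\<in>J. g k (y k)\<bar> \<le> ennreal (L ^ card J) * (\<Prod>k\<in>J. indicator B (y k))"
proof -
  have "\<bar>\<Prod>k\<in>J. g k (y k)\<bar> \<le> (\<Prod>k\<in>J. L * indicator B (y k))"
    unfolding abs_prod using y assms(2)
    by (intro prod_mono) (auto simp: space_PiM PiE_iff intro!: nice_bound)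
  also have "\<dots> = L ^ card J * (\<Prod>k\<in>J. indicator B (y k))"
    by (simp add: prod.distrib)
  finally have le: "\<bar>\<Prod>k\<in>J. g k (y k)\<bar> \<le> L ^ card J * (\<Prod>k\<in>J. indicator B (y k))" .
  show ?thesis
  proof (cases "\<forall>k\<in>J. y k \<in> B")
    case True
    then show ?thesis using le by (simp add: ennreal_leI)
  next
    case False
    then obtain k where "k \<in> J" "y k \<notin> B" by blast
    then have "(\<Prod>k\<in>J. indicator B (y k) :: real) = 0"
      by (intro prod_zero assms(1) bexI[of _ k]) auto
    then show ?thesis using le by simp
  qed
qed

lemma iterated_integrable:
  fixes ks :: "nat list"
  assumes dist: "distinct ks" and A: "finite A" and g: "\<And>k. k \<in> A \<union> set ks \<Longrightarrow> nice L (g k)" and F: "weighted F"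
  shows "integrable (PiM (set ks) (\<lambda>_. lam))
    (\<lambda>y. (\<Prod>k\<in>set ks. g k (y k)) * (\<integral>\<omega>. Phi A g (\<eta> \<omega>) * diff_ops (map y ks) F (\<eta> \<omega>) \<partial>M))"
proof -
  let ?P = "PiM (set ks) (\<lambda>_. lam)"
  note Fm = weighted_measurable[OF F]
  have gA: "\<And>k. k \<in> A \<Longrightarrow> nice L (g k)" using g by auto
  obtain C d where C: "0 \<le> C" and bound: "AE \<omega> in M. \<bar>Phi A g (\<eta> \<omega>)\<bar> \<le> C * real d ^ num (\<eta> \<omega>)"
    using Phi_AE_bound[of A L g] A gA by blast
  have [measurable]: "Phi A g \<in> borel_measurable N" by (rule Phi_measurable[OF A gA])
  have [measurable]: "(\<lambda>p. diff_ops (map (fst p) ks) F (\<eta> (snd p))) \<in> borel_measurable (?P \<Otimes>\<^sub>M M)"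
    by (rule eta_diff_ops_measurable[OF Fm]) simp
  have m1: "(\<lambda>y. \<integral>\<omega>. Phi A g (\<eta> \<omega>) * diff_ops (map y ks) F (\<eta> \<omega>) \<partial>M) \<in> borel_measurable ?P"
    by (intro borel_measurable_lebesgue_integral) (simp only: case_prod_unfold, measurable)
  have m2: "(\<lambda>y. \<Prod>k\<in>set ks. g k (y k)) \<in> borel_measurable ?P"
  proof (rule borel_measurable_prod)
    fix k assume k: "k \<in> set ks"
    show "(\<lambda>y. g k (y k)) \<in> borel_measurable ?P"
      by (rule measurable_compose[OF measurable_component_singleton[OF k, of "\<lambda>_. lam"] nice_measurable[OF g]]) (use k in auto)
  qed
  show ?thesis
  proof (rule integrableI_bounded)
    show "(\<lambda>y. (\<Prod>k\<in>set ks. g k (y k)) * (\<integral>\<omega>. Phi A g (\<eta> \<omega>) * diff_ops (map y ks) F (\<eta> \<omega>) \<partial>M)) \<in> borel_measurable ?P"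
      using m1 m2 by (rule borel_measurable_times[rotated])
    define E where "E y = (\<integral>\<^sup>+\<omega>. ennreal (real d ^ num (\<eta> \<omega>) * \<bar>diff_ops (map y ks) F (\<eta> \<omega>)\<bar>) \<partial>M)" for y
    have E[measurable]: "E \<in> borel_measurable ?P"
      unfolding E_def[abs_def] by (intro borel_measurable_nn_integral) (simp only: case_prod_unfold, measurable)
    have m3: "(\<lambda>y. \<Prod>k\<in>set ks. indicator B (y k) :: ennreal) \<in> borel_measurable ?P"
      by (intro borel_measurable_prod_ennreal measurable_compose[OF measurable_component_singleton borel_measurable_indicator]) auto
    have "(\<integral>\<^sup>+y. ennreal (norm ((\<Prod>k\<in>set ks. g k (y k)) * (\<integral>\<omega>. Phi A g (\<eta> \<omega>) * diff_ops (map y ks) F (\<eta> \<omega>) \<partial>M))) \<partial>?P) \<le>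
        (\<integral>\<^sup>+y. ennreal (L ^ length ks * C) * ((\<Prod>k\<in>set ks. indicator B (y k)) * E y) \<partial>?P)"
    proof (rule nn_integral_mono)
      fix y assume y: "y \<in> space ?P"
      have [measurable]: "diff_ops (map y ks) F \<in> borel_measurable N" by (rule diff_ops_section_measurable[OF Fm y])
      \<comment> \<open>If the integrand is not integrable, its integral is 0 by convention and the
        estimate still holds.\<close>
      have "ennreal \<bar>\<integral>\<omega>. Phi A g (\<eta> \<omega>) * diff_ops (map y ks) F (\<eta> \<omega>) \<partial>M\<bar> \<le>
          (\<integral>\<^sup>+\<omega>. ennreal \<bar>Phi A g (\<eta> \<omega>) * diff_ops (map y ks) F (\<eta> \<omega>)\<bar> \<partial>M)"
        using integral_norm_bound_ennreal[of M "\<lambda>\<omega>. Phi A g (\<eta> \<omega>) * diff_ops (map y ks) F (\<eta> \<omega>)"]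
        by (cases "integrable M (\<lambda>\<omega>. Phi A g (\<eta> \<omega>) * diff_ops (map y ks) F (\<eta> \<omega>))") (auto simp: not_integrable_integral_eq)
      also have "\<dots> \<le> (\<integral>\<^sup>+\<omega>. ennreal C * ennreal (real d ^ num (\<eta> \<omega>) * \<bar>diff_ops (map y ks) F (\<eta> \<omega>)\<bar>) \<partial>M)"
      proof (rule nn_integral_mono_AE)
        show "AE \<omega> in M. ennreal \<bar>Phi A g (\<eta> \<omega>) * diff_ops (map y ks) F (\<eta> \<omega>)\<bar> \<le>
            ennreal C * ennreal (real d ^ num (\<eta> \<omega>) * \<bar>diff_ops (map y ks) F (\<eta> \<omega>)\<bar>)"
          using bound
        proof eventually_elim
          case (elim \<omega>)
          then have "\<bar>Phi A g (\<eta> \<omega>)\<bar> * \<bar>diff_ops (map y ks) F (\<eta> \<omega>)\<bar> \<le> (C * real d ^ num (\<eta> \<omega>)) * \<bar>diff_ops (map y ks) F (\<eta> \<omega>)\<bar>"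
            by (intro mult_right_mono) auto
          then show ?case using C by (simp add: abs_mult ennreal_mult[symmetric] mult.assoc ennreal_leI)
        qed
      qed
      also have "\<dots> = ennreal C * E y"
        unfolding E_def by (intro nn_integral_cmult) measurable
      finally have 1: "ennreal \<bar>\<integral>\<omega>. Phi A g (\<eta> \<omega>) * diff_ops (map y ks) F (\<eta> \<omega>) \<partial>M\<bar> \<le> ennreal C * E y" .
      have "ennreal \<bar>\<Prod>k\<in>set ks. g k (y k)\<bar> \<le> ennreal (L ^ card (set ks)) * (\<Prod>k\<in>set ks. indicator B (y k))"
        using g by (intro product_nice y) auto
      then have 2: "ennreal \<bar>\<Prod>k\<in>set ks. g k (y k)\<bar> \<le> ennreal (L ^ length ks) * (\<Prod>k\<in>set ks. indicator B (y k))"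
        using dist by (simp add: distinct_card)
      \<comment> \<open>Nonnegativity of L comes from some factor; if there is none the power is
        1.\<close>
      have "ennreal (L ^ length ks * C) = ennreal (L ^ length ks) * ennreal C \<or> ks = []"
      proof (cases ks)
        case (Cons k ks')
        then have "0 \<le> L" using g[of k] by (simp add: nice_def)
        then show ?thesis using C by (simp add: ennreal_mult)
      qed simp
      then have "ennreal (L ^ length ks * C) = ennreal (L ^ length ks) * ennreal C" by auto
      then show "ennreal (norm ((\<Prod>k\<in>set ks. g k (y k)) * (\<integral>\<omega>. Phi A g (\<eta> \<omega>) * diff_ops (map y ks) F (\<eta> \<omega>) \<partial>M))) \<le>
          ennreal (L ^ length ks * C) * ((\<Prod>k\<in>set ks. indicator B (y k)) * E y)"
        using mult_mono[OF 2 1] by (simp add: abs_mult ennreal_mult mult_ac)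
    qed
    also have "\<dots> = ennreal (L ^ length ks * C) * (\<integral>\<^sup>+y. (\<Prod>k\<in>set ks. indicator B (y k)) * E y \<partial>?P)"
      using m3 by (intro nn_integral_cmult) measurable
    also have "\<dots> < \<infinity>"
    proof -
      from iterated_diff_bound[OF dist, of d] obtain C' d' where C': "C' < \<infinity>"
        "(\<integral>\<^sup>+y. (\<Prod>k\<in>set ks. indicator B (y k)) * E y \<partial>?P) \<le> C' * (\<integral>\<^sup>+\<omega>. ennreal (real d' ^ num (\<eta> \<omega>) * \<bar>F (\<eta> \<omega>)\<bar>) \<partial>M)"
        unfolding E_def using Fm by blast
      have "(\<integral>\<^sup>+\<omega>. ennreal (real d' ^ num (\<eta> \<omega>) * \<bar>F (\<eta> \<omega>)\<bar>) \<partial>M) < \<infinity>"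
        using F by (simp add: weighted_def)
      then have "(\<integral>\<^sup>+y. (\<Prod>k\<in>set ks. indicator B (y k)) * E y \<partial>?P) < \<infinity>"
        using C' by (intro le_less_trans[OF C'(2)]) (simp add: ennreal_mult_less_top)
      then show ?thesis by (simp add: ennreal_mult_less_top)
    qed
    finally show "(\<integral>\<^sup>+y. ennreal (norm ((\<Prod>k\<in>set ks. g k (y k)) * (\<integral>\<omega>. Phi A g (\<eta> \<omega>) * diff_ops (map y ks) F (\<eta> \<omega>) \<partial>M))) \<partial>?P) < \<infinity>" .
  qed
qed

text \<open>The head of the list is the outermost difference, so \<open>Phi_duality\<close> for the
  functional with the remaining differences moves its label into A. That functional is weighted only
  at almost all tuples inside the window; at the other tuples inside the window the identity is lost
  on a null set, and outside the window the product of factors vanishes.\<close>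

lemma iterated_duality:
  fixes ks :: "nat list"
  assumes "distinct ks" "finite A" "A \<inter> set ks = {}" "\<And>k. k \<in> A \<union> set ks \<Longrightarrow> nice L (g k)" and F: "weighted F"
  shows "(\<integral>y. (\<Prod>k\<in>set ks. g k (y k)) * (\<integral>\<omega>. Phi A g (\<eta> \<omega>) * diff_ops (map y ks) F (\<eta> \<omega>) \<partial>M) \<partial>PiM (set ks) (\<lambda>_. lam)) =
    (\<integral>\<omega>. Phi (A \<union> set ks) g (\<eta> \<omega>) * F (\<eta> \<omega>) \<partial>M)"
  using assms(1-4)
proof (induction ks arbitrary: A)
  case Nil
  then show ?case by (simp add: PiM_empty lebesgue_integral_count_space_finite)
next
  case (Cons k ks)
  interpret P: product_sigma_finite "\<lambda>_::nat. lam" by (rule lam.product_sigma_finite_const)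
  let ?P = "PiM (set ks) (\<lambda>_. lam)"
  let ?D = "\<lambda>y. diff_ops (map y ks) F"
  have k: "k \<notin> set ks" "k \<notin> A" and dist: "distinct ks" using Cons.prems by auto
  have nice: "\<And>j. j \<in> insert k A \<Longrightarrow> nice L (g j)" using Cons.prems by auto
  define f where "f y = (\<Prod>k\<in>set (k # ks). g k (y k)) * (\<integral>\<omega>. Phi A g (\<eta> \<omega>) * diff_ops (map y (k # ks)) F (\<eta> \<omega>) \<partial>M)" for y
  have int: "integrable (PiM (insert k (set ks)) (\<lambda>_. lam)) f"
    using iterated_integrable[OF Cons.prems(1,2) _ F, of L g] Cons.prems(4) unfolding f_def by simp
  have "(\<integral>y. f y \<partial>PiM (set (k # ks)) (\<lambda>_. lam)) = (\<integral>x. \<integral>z. f (x(k := z)) \<partial>lam \<partial>?P)"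
    using P.product_integral_insert[OF finite_set k(1) int] by simp
  also have "\<dots> = (\<integral>x. (\<Prod>j\<in>set ks. g j (x j)) * (\<integral>\<omega>. Phi (insert k A) g (\<eta> \<omega>) * ?D x (\<eta> \<omega>) \<partial>M) \<partial>?P)"
  proof (rule integral_cong_AE)
    have "(\<lambda>p. (fst p)(k := snd p)) \<in> ?P \<Otimes>\<^sub>M lam \<rightarrow>\<^sub>M PiM (insert k (set ks)) (\<lambda>_. lam)"
      by (intro measurable_fun_upd[where J = "set ks"]) auto
    from measurable_compose[OF this borel_measurable_integrable[OF int]]
    show "(\<lambda>x. \<integral>z. f (x(k := z)) \<partial>lam) \<in> borel_measurable ?P"
      by (intro lam.borel_measurable_lebesgue_integral) (simp add: case_prod_unfold)
    show "(\<lambda>x. (\<Prod>j\<in>set ks. g j (x j)) * (\<integral>\<omega>. Phi (insert k A) g (\<eta> \<omega>) * ?D x (\<eta> \<omega>) \<partial>M)) \<in> borel_measurable ?P"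
      using Cons.prems by (intro borel_measurable_integrable iterated_integrable[OF dist _ _ F]) auto
    show "AE x in ?P. (\<integral>z. f (x(k := z)) \<partial>lam) = (\<Prod>j\<in>set ks. g j (x j)) * (\<integral>\<omega>. Phi (insert k A) g (\<eta> \<omega>) * ?D x (\<eta> \<omega>) \<partial>M)"
      using iterated_weighted[OF dist F] AE_space
    proof eventually_elim
      case (elim x)
      have "(\<Prod>j\<in>set ks. g j ((x(k := z)) j)) = (\<Prod>j\<in>set ks. g j (x j))" for z
        using k by (intro prod.cong) auto
      then have f_eq: "f (x(k := z)) = (\<Prod>j\<in>set ks. g j (x j)) * (g k z * (\<integral>\<omega>. Phi A g (\<eta> \<omega>) * diff_op z (?D x) (\<eta> \<omega>) \<partial>M))" for z
        unfolding f_def diff_ops_map_upd[OF k(1)] using k by (simp add: mult_ac)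
      show ?case
      proof (cases "\<forall>j\<in>set ks. x j \<in> B")
        case True
        with elim have W: "weighted (?D x)" by blast
        show ?thesis
          unfolding f_eq using Phi_duality_eq[OF Cons.prems(2) k(2) nice W] by simp
      next
        case False
        then obtain j where j: "j \<in> set ks" "x j \<notin> B" by blast
        then have "g j (x j) = 0"
          using elim(2) Cons.prems(4)[of j] by (intro nice_zero[of L]) (auto simp: space_PiM PiE_iff)
        then have "(\<Prod>j\<in>set ks. g j (x j)) = 0" using j(1) by auto
        then show ?thesis by (simp add: f_eq)
      qed
    qed
  qed
  also have "\<dots> = (\<integral>\<omega>. Phi (insert k A \<union> set ks) g (\<eta> \<omega>) * F (\<eta> \<omega>) \<partial>M)"
    using Cons.prems by (intro Cons.IH) auto
  finally show ?case by (simp add: f_def)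
qed

section \<open>The kernels of the Kabanov-Skorohod integral\<close>

text \<open>\<open>weighted_square_bound\<close> for the sections of h. The exponential moment is
  integrated only over the window, and the squares are integrable by hypothesis.\<close>

lemma window_bound:
  assumes h: "(\<lambda>(\<mu>, y). h \<mu> y) \<in> borel_measurable (N \<Otimes>\<^sub>M lam)"
    and sq: "integrable (M \<Otimes>\<^sub>M lam) (\<lambda>(\<omega>, y). (h (\<eta> \<omega>) y)\<^sup>2)"
  shows "(\<integral>\<^sup>+z. indicator B z * (\<integral>\<^sup>+\<omega>. ennreal (real c ^ num (\<eta> \<omega>) * \<bar>h (\<eta> \<omega>) z\<bar>) \<partial>M) \<partial>lam) < \<infinity>"
proof -
  interpret P: pair_sigma_finite M lam ..
  have hm[measurable]: "(\<lambda>p. h (\<eta> (fst p)) (snd p)) \<in> borel_measurable (M \<Otimes>\<^sub>M lam)"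
    using eta_section_measurable[OF h] by (simp add: case_prod_unfold)
  from measurable_compose[OF measurable_pair_swap' this]
  have hm'[measurable]: "(\<lambda>p. h (\<eta> (snd p)) (fst p)) \<in> borel_measurable (lam \<Otimes>\<^sub>M M)"
    by (simp add: case_prod_unfold)
  let ?q = "\<lambda>z. \<integral>\<^sup>+\<omega>. ennreal ((h (\<eta> \<omega>) z)\<^sup>2) \<partial>M"
  let ?e = "\<integral>\<^sup>+\<omega>. ennreal (real (c * c) ^ num (\<eta> \<omega>)) \<partial>M"
  have q: "?q \<in> borel_measurable lam"
    by (intro borel_measurable_nn_integral) (simp only: case_prod_unfold, measurable)
  have "(\<integral>\<^sup>+z. indicator B z * (\<integral>\<^sup>+\<omega>. ennreal (real c ^ num (\<eta> \<omega>) * \<bar>h (\<eta> \<omega>) z\<bar>) \<partial>M) \<partial>lam) \<le>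
      (\<integral>\<^sup>+z. ?e * indicator B z + ?q z \<partial>lam)"
  proof (rule nn_integral_mono)
    fix z assume z: "z \<in> space lam"
    have "(\<lambda>\<mu>. h \<mu> z) \<in> borel_measurable N"
      using measurable_Pair1[OF h z] by simp
    from weighted_square_bound[OF this, of c]
    show "indicator B z * (\<integral>\<^sup>+\<omega>. ennreal (real c ^ num (\<eta> \<omega>) * \<bar>h (\<eta> \<omega>) z\<bar>) \<partial>M) \<le> ?e * indicator B z + ?q z"
      by (auto simp: indicator_def)
  qed
  also have "\<dots> = (\<integral>\<^sup>+z. ?e * indicator B z \<partial>lam) + (\<integral>\<^sup>+z. ?q z \<partial>lam)"
    by (intro nn_integral_add q) measurable
  also have "(\<integral>\<^sup>+z. ?e * indicator B z \<partial>lam) = ?e * emeasure lam B"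
    by (intro nn_integral_cmult_indicator) simp
  also have "(\<integral>\<^sup>+z. ?q z \<partial>lam) = (\<integral>\<^sup>+p. ennreal ((h (\<eta> (fst p)) (snd p))\<^sup>2) \<partial>(M \<Otimes>\<^sub>M lam))"
    by (subst P.nn_integral_snd[symmetric]) (simp_all add: case_prod_unfold)
  also have "?e * emeasure lam B + \<dots> < \<infinity>"
  proof -
    have "(\<integral>\<^sup>+p. ennreal ((h (\<eta> (fst p)) (snd p))\<^sup>2) \<partial>(M \<Otimes>\<^sub>M lam)) < \<infinity>"
      using sq by (simp add: integrable_iff_bounded case_prod_unfold)
    then show ?thesis
      using exponential_moment[of "c * c"] B_finite by (simp add: ennreal_mult_less_top)
  qed
  finally show ?thesis .
qed

lemma weighted_sections:
  assumes h: "(\<lambda>(\<mu>, y). h \<mu> y) \<in> borel_measurable (N \<Otimes>\<^sub>M lam)"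
    and sq: "integrable (M \<Otimes>\<^sub>M lam) (\<lambda>(\<omega>, y). (h (\<eta> \<omega>) y)\<^sup>2)"
  shows "AE z in lam. z \<in> B \<longrightarrow> weighted (\<lambda>\<mu>. h \<mu> z)"
proof -
  define f where "f c z = indicator B z * (\<integral>\<^sup>+\<omega>. ennreal (real c ^ num (\<eta> \<omega>) * \<bar>h (\<eta> \<omega>) z\<bar>) \<partial>M)" for c :: nat and z
  have "(\<lambda>p. h (\<eta> (fst p)) (snd p)) \<in> borel_measurable (M \<Otimes>\<^sub>M lam)"
    using eta_section_measurable[OF h] by (simp add: case_prod_unfold)
  from measurable_compose[OF measurable_pair_swap' this]
  have [measurable]: "(\<lambda>p. h (\<eta> (snd p)) (fst p)) \<in> borel_measurable (lam \<Otimes>\<^sub>M M)"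
    by (simp add: case_prod_unfold)
  have "AE z in lam. f c z \<noteq> \<infinity>" for c
  proof (rule nn_integral_PInf_AE)
    have "(\<lambda>z. \<integral>\<^sup>+\<omega>. ennreal (real c ^ num (\<eta> \<omega>) * \<bar>h (\<eta> \<omega>) z\<bar>) \<partial>M) \<in> borel_measurable lam"
      by (intro borel_measurable_nn_integral) (simp only: case_prod_unfold, measurable)
    then show "f c \<in> borel_measurable lam"
      unfolding f_def[abs_def] by measurable
    show "(\<integral>\<^sup>+z. f c z \<partial>lam) \<noteq> \<infinity>"
      using window_bound[OF h sq, of c] by (simp add: f_def)
  qed
  then have "AE z in lam. \<forall>c. f c z \<noteq> \<infinity>" by (simp add: AE_all_countable)
  then show ?thesis
    using AE_space
  proof eventually_elim
    case (elim z)
    have "(\<lambda>\<mu>. h \<mu> z) \<in> borel_measurable N"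
      using measurable_Pair1[OF h elim(2)] by simp
    with elim(1) show ?case by (auto simp: weighted_def f_def less_top)
  qed
qed

lemma kernel_integrand_measurable:
  assumes h: "(\<lambda>(\<mu>, y). h \<mu> y) \<in> borel_measurable (N \<Otimes>\<^sub>M lam)" and J: "i \<in> J" "set ks \<subseteq> J"
  shows "(\<lambda>y. \<integral>\<omega>. diff_ops (map y ks) (\<lambda>\<mu>. h \<mu> (y i)) (\<eta> \<omega>) \<partial>M) \<in> borel_measurable (PiM J (\<lambda>_. lam))"
proof -
  have "(\<lambda>p. (snd p, fst p i)) \<in> PiM J (\<lambda>_. lam) \<Otimes>\<^sub>M N \<rightarrow>\<^sub>M N \<Otimes>\<^sub>M lam"
    by (intro measurable_Pair measurable_snd measurable_compose[OF measurable_fst measurable_component_singleton[OF J(1)]])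
  from measurable_compose[OF this h]
  have D: "(\<lambda>p. diff_ops (map (\<lambda>k. fst p k) ks) (\<lambda>\<mu>. h \<mu> (fst p i)) (snd p)) \<in> borel_measurable (PiM J (\<lambda>_. lam) \<Otimes>\<^sub>M N)"
    by (intro measurable_diff_ops[where F = "\<lambda>y \<mu>. h \<mu> (y i)" and Y = "\<lambda>k y. y k"])
       (use J in \<open>auto intro!: measurable_component_singleton\<close>)
  have "(\<lambda>p. (fst p, \<eta> (snd p))) \<in> PiM J (\<lambda>_. lam) \<Otimes>\<^sub>M M \<rightarrow>\<^sub>M PiM J (\<lambda>_. lam) \<Otimes>\<^sub>M N"
    by measurable
  from measurable_compose[OF this D]
  have "(\<lambda>p. diff_ops (map (fst p) ks) (\<lambda>\<mu>. h \<mu> (fst p i)) (\<eta> (snd p))) \<in> borel_measurable (PiM J (\<lambda>_. lam) \<Otimes>\<^sub>M M)"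
    by simp
  then show ?thesis
    by (intro borel_measurable_lebesgue_integral) (simp only: case_prod_unfold)
qed

text \<open>One summand of the kernel: coordinate i is the argument of h, the coordinates ks carry
  the differences. For almost every fixed value z of coordinate i in B the section of h is weighted,
  and \<open>iterated_duality\<close> with A empty turns the differences into the polynomial with
  labels \<open>set ks\<close>, which depends only on their number.\<close>

lemma kernel_term:
  fixes ks :: "nat list"
  assumes h: "(\<lambda>(\<mu>, y). h \<mu> y) \<in> borel_measurable (N \<Otimes>\<^sub>M lam)"
    and sq: "integrable (M \<Otimes>\<^sub>M lam) (\<lambda>(\<omega>, y). (h (\<eta> \<omega>) y)\<^sup>2)"
    and w: "nice L w" and dist: "distinct ks" and i: "i \<notin> set ks"
  shows "integrable (PiM (insert i (set ks)) (\<lambda>_. lam)) (\<lambda>y. (\<Prod>j\<in>insert i (set ks). w (y j)) *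
      (\<integral>\<omega>. diff_ops (map y ks) (\<lambda>\<mu>. h \<mu> (y i)) (\<eta> \<omega>) \<partial>M))" (is "integrable ?P ?f")
    and "(\<integral>y. (\<Prod>j\<in>insert i (set ks). w (y j)) *
      (\<integral>\<omega>. diff_ops (map y ks) (\<lambda>\<mu>. h \<mu> (y i)) (\<eta> \<omega>) \<partial>M) \<partial>PiM (insert i (set ks)) (\<lambda>_. lam)) =
      (\<integral>z. w z * (\<integral>\<omega>. Phi {..<length ks} (\<lambda>_. w) (\<eta> \<omega>) * h (\<eta> \<omega>) z \<partial>M) \<partial>lam)"
proof -
  interpret P: product_sigma_finite "\<lambda>_::nat. lam" by (rule lam.product_sigma_finite_const)
  let ?Q = "PiM (set ks) (\<lambda>_. lam)"
  have L: "0 \<le> L" using w by (simp add: nice_def)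
  have wm[measurable]: "w \<in> borel_measurable lam" by (rule nice_measurable[OF w])
  have hz: "(\<lambda>\<mu>. h \<mu> z) \<in> borel_measurable N" if "z \<in> space lam" for z
    using measurable_Pair1[OF h that] by simp
  have fm: "?f \<in> borel_measurable ?P"
  proof (intro borel_measurable_times borel_measurable_prod kernel_integrand_measurable h)
    fix j assume "j \<in> insert i (set ks)"
    from measurable_compose[OF measurable_component_singleton[OF this, of "\<lambda>_. lam"] wm]
    show "(\<lambda>y. w (y j)) \<in> borel_measurable ?P" .
  qed auto
  have upd: "?f (x(i := z)) = w z * ((\<Prod>j\<in>set ks. w (x j)) * (\<integral>\<omega>. diff_ops (map x ks) (\<lambda>\<mu>. h \<mu> z) (\<eta> \<omega>) \<partial>M))" for x z
  proof -
    have "(\<Prod>j\<in>set ks. w ((x(i := z)) j)) = (\<Prod>j\<in>set ks. w (x j))"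
      using i by (intro prod.cong) auto
    moreover have "map (x(i := z)) ks = map x ks" using i by auto
    ultimately show ?thesis
      using i by (simp only: prod.insert[OF finite_set i] fun_upd_same mult.assoc)
  qed
  \<comment> \<open>Weight 1 suffices on the left. The weight d produced on the right is the one for
    which \<open>window_bound\<close> is invoked.\<close>
  from iterated_diff_bound[OF dist, of 1] obtain C d where C: "C < \<infinity>"
    "\<And>F. F \<in> borel_measurable N \<Longrightarrow> (\<integral>\<^sup>+y. (\<Prod>k\<in>set ks. indicator B (y k)) *
      (\<integral>\<^sup>+\<omega>. ennreal (real 1 ^ num (\<eta> \<omega>) * \<bar>diff_ops (map y ks) F (\<eta> \<omega>)\<bar>) \<partial>M) \<partial>?Q) \<le>
      C * (\<integral>\<^sup>+\<omega>. ennreal (real d ^ num (\<eta> \<omega>) * \<bar>F (\<eta> \<omega>)\<bar>) \<partial>M)"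
    by blast
  show int: "integrable ?P ?f"
  proof (rule integrableI_bounded[OF fm])
    let ?R = "\<lambda>z. \<integral>\<^sup>+\<omega>. ennreal (real d ^ num (\<eta> \<omega>) * \<bar>h (\<eta> \<omega>) z\<bar>) \<partial>M"
    have "(\<integral>\<^sup>+y. ennreal (norm (?f y)) \<partial>?P) = (\<integral>\<^sup>+z. \<integral>\<^sup>+x. ennreal (norm (?f (x(i := z)))) \<partial>?Q \<partial>lam)"
      by (rule P.product_nn_integral_insert_rev[OF finite_set i measurable_compose[OF measurable_compose[OF fm borel_measurable_norm] measurable_ennreal]])
    also have "\<dots> \<le> (\<integral>\<^sup>+z. ennreal (L * L ^ card (set ks)) * C * (indicator B z * ?R z) \<partial>lam)"
    proof (rule nn_integral_mono)
      fix z assume z: "z \<in> space lam"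
      define E where "E x = (\<integral>\<^sup>+\<omega>. ennreal (real 1 ^ num (\<eta> \<omega>) * \<bar>diff_ops (map x ks) (\<lambda>\<mu>. h \<mu> z) (\<eta> \<omega>)\<bar>) \<partial>M)" for x
      let ?a = "ennreal L * indicator B z" and ?b = "ennreal (L ^ card (set ks))"
      have [measurable]: "(\<lambda>p. diff_ops (map (fst p) ks) (\<lambda>\<mu>. h \<mu> z) (\<eta> (snd p))) \<in> borel_measurable (?Q \<Otimes>\<^sub>M M)"
        by (rule eta_diff_ops_measurable[OF hz[OF z]]) simp
      have "(\<lambda>y. \<Prod>k\<in>set ks. indicator B (y k) :: ennreal) \<in> borel_measurable ?Q"
        by (intro borel_measurable_prod_ennreal measurable_compose[OF measurable_component_singleton borel_measurable_indicator]) auto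
      moreover have "E \<in> borel_measurable ?Q"
        unfolding E_def[abs_def] by (intro borel_measurable_nn_integral) (simp only: case_prod_unfold, measurable)
      ultimately have m: "(\<lambda>x. (\<Prod>k\<in>set ks. indicator B (x k)) * E x) \<in> borel_measurable ?Q"
        by (rule borel_measurable_times_ennreal)
      have "(\<integral>\<^sup>+x. ennreal (norm (?f (x(i := z)))) \<partial>?Q) \<le> (\<integral>\<^sup>+x. ?a * ?b * ((\<Prod>k\<in>set ks. indicator B (x k)) * E x) \<partial>?Q)"
      proof (rule nn_integral_mono)
        fix x assume x: "x \<in> space ?Q"
        have [measurable]: "diff_ops (map x ks) (\<lambda>\<mu>. h \<mu> z) \<in> borel_measurable N"
          by (rule diff_ops_section_measurable[OF hz[OF z] x])
        have "ennreal \<bar>w z\<bar> \<le> ennreal (L * indicator B z)"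
          by (intro ennreal_leI nice_bound[OF w z])
        then have 1: "ennreal \<bar>w z\<bar> \<le> ?a" using L by (auto simp: indicator_def)
        have 2: "ennreal \<bar>\<Prod>k\<in>set ks. w (x k)\<bar> \<le> ?b * (\<Prod>k\<in>set ks. indicator B (x k))"
          by (rule product_nice[OF finite_set w x])
        have 3: "ennreal \<bar>\<integral>\<omega>. diff_ops (map x ks) (\<lambda>\<mu>. h \<mu> z) (\<eta> \<omega>) \<partial>M\<bar> \<le> E x"
          unfolding E_def using integral_norm_bound_ennreal[of M "\<lambda>\<omega>. diff_ops (map x ks) (\<lambda>\<mu>. h \<mu> z) (\<eta> \<omega>)"]
          by (cases "integrable M (\<lambda>\<omega>. diff_ops (map x ks) (\<lambda>\<mu>. h \<mu> z) (\<eta> \<omega>))") (auto simp: not_integrable_integral_eq)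
        have "ennreal (norm (?f (x(i := z)))) = ennreal \<bar>w z\<bar> * (ennreal \<bar>\<Prod>k\<in>set ks. w (x k)\<bar> *
            ennreal \<bar>\<integral>\<omega>. diff_ops (map x ks) (\<lambda>\<mu>. h \<mu> z) (\<eta> \<omega>) \<partial>M\<bar>)"
          unfolding upd real_norm_def abs_mult by (simp add: ennreal_mult)
        also have "\<dots> \<le> ?a * ((?b * (\<Prod>k\<in>set ks. indicator B (x k))) * E x)"
          by (intro mult_mono 1 2 3) auto
        finally show "ennreal (norm (?f (x(i := z)))) \<le> ?a * ?b * ((\<Prod>k\<in>set ks. indicator B (x k)) * E x)"
          by (simp add: mult_ac)
      qed
      also have "\<dots> = ?a * ?b * (\<integral>\<^sup>+x. (\<Prod>k\<in>set ks. indicator B (x k)) * E x \<partial>?Q)"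
        by (rule nn_integral_cmult[OF m])
      also have "\<dots> \<le> ?a * ?b * (C * ?R z)"
        using C(2)[OF hz[OF z]] unfolding E_def by (intro mult_left_mono) auto
      also have "\<dots> = ennreal (L * L ^ card (set ks)) * C * (indicator B z * ?R z)"
        using L by (simp add: ennreal_mult mult_ac)
      finally show "(\<integral>\<^sup>+x. ennreal (norm (?f (x(i := z)))) \<partial>?Q) \<le> ennreal (L * L ^ card (set ks)) * C * (indicator B z * ?R z)" .
    qed
    also have "\<dots> = ennreal (L * L ^ card (set ks)) * C * (\<integral>\<^sup>+z. indicator B z * ?R z \<partial>lam)"
    proof (rule nn_integral_cmult)
      have "(\<lambda>p. h (\<eta> (fst p)) (snd p)) \<in> borel_measurable (M \<Otimes>\<^sub>M lam)"
        using eta_section_measurable[OF h] by (simp add: case_prod_unfold)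
      from measurable_compose[OF measurable_pair_swap' this]
      have [measurable]: "(\<lambda>p. h (\<eta> (snd p)) (fst p)) \<in> borel_measurable (lam \<Otimes>\<^sub>M M)"
        by (simp add: case_prod_unfold)
      have "?R \<in> borel_measurable lam"
        by (intro borel_measurable_nn_integral) (simp only: case_prod_unfold, measurable)
      then show "(\<lambda>z. indicator B z * ?R z) \<in> borel_measurable lam" by measurable
    qed
    also have "\<dots> < \<infinity>"
      using window_bound[OF h sq, of d] C(1) by (simp add: ennreal_mult_less_top)
    finally show "(\<integral>\<^sup>+y. ennreal (norm (?f y)) \<partial>?P) < \<infinity>" .
  qed
  have "(\<integral>y. ?f y \<partial>?P) = (\<integral>z. \<integral>x. ?f (x(i := z)) \<partial>?Q \<partial>lam)"
    by (rule P.product_integral_insert_rev[OF finite_set i int])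
  also have "\<dots> = (\<integral>z. w z * (\<integral>\<omega>. Phi {..<length ks} (\<lambda>_. w) (\<eta> \<omega>) * h (\<eta> \<omega>) z \<partial>M) \<partial>lam)"
  proof (rule integral_cong_AE)
    have "(\<lambda>p. (snd p)(i := fst p)) \<in> lam \<Otimes>\<^sub>M ?Q \<rightarrow>\<^sub>M ?P"
      by (intro measurable_fun_upd[where J = "set ks"]) auto
    interpret Q: sigma_finite_measure ?Q by (rule P.sigma_finite) simp
    from measurable_compose[OF \<open>(\<lambda>p. (snd p)(i := fst p)) \<in> lam \<Otimes>\<^sub>M ?Q \<rightarrow>\<^sub>M ?P\<close> fm]
    show "(\<lambda>z. \<integral>x. ?f (x(i := z)) \<partial>?Q) \<in> borel_measurable lam"
      by (intro Q.borel_measurable_lebesgue_integral) (simp only: case_prod_unfold)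
    have [measurable]: "Phi {..<length ks} (\<lambda>_. w) \<in> borel_measurable N"
      by (rule Phi_measurable[where L = L]) (auto simp: w)
    have "(\<lambda>p. h (\<eta> (fst p)) (snd p)) \<in> borel_measurable (M \<Otimes>\<^sub>M lam)"
      using eta_section_measurable[OF h] by (simp add: case_prod_unfold)
    from measurable_compose[OF measurable_pair_swap' this]
    have [measurable]: "(\<lambda>p. h (\<eta> (snd p)) (fst p)) \<in> borel_measurable (lam \<Otimes>\<^sub>M M)"
      by (simp add: case_prod_unfold)
    have "(\<lambda>z. \<integral>\<omega>. Phi {..<length ks} (\<lambda>_. w) (\<eta> \<omega>) * h (\<eta> \<omega>) z \<partial>M) \<in> borel_measurable lam"
      by (intro borel_measurable_lebesgue_integral) (simp only: case_prod_unfold, measurable)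
    then show "(\<lambda>z. w z * (\<integral>\<omega>. Phi {..<length ks} (\<lambda>_. w) (\<eta> \<omega>) * h (\<eta> \<omega>) z \<partial>M)) \<in> borel_measurable lam"
      by measurable
    show "AE z in lam. (\<integral>x. ?f (x(i := z)) \<partial>?Q) = w z * (\<integral>\<omega>. Phi {..<length ks} (\<lambda>_. w) (\<eta> \<omega>) * h (\<eta> \<omega>) z \<partial>M)"
      using weighted_sections[OF h sq] AE_space
    proof eventually_elim
      case (elim z)
      show ?case
      proof (cases "z \<in> B")
        case False
        then have "w z = 0" using nice_zero[OF w] elim(2) by simp
        then show ?thesis unfolding upd by simp
      next
        case True
        with elim have W: "weighted (\<lambda>\<mu>. h \<mu> z)" by simp
        \<comment> \<open>The polynomial without labels is almost surely 1; inserting it brings the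
          integral into the form of \<open>iterated_duality\<close>.\<close>
        have "(\<integral>x. (\<Prod>j\<in>set ks. w (x j)) * (\<integral>\<omega>. diff_ops (map x ks) (\<lambda>\<mu>. h \<mu> z) (\<eta> \<omega>) \<partial>M) \<partial>?Q) =
            (\<integral>x. (\<Prod>j\<in>set ks. w (x j)) * (\<integral>\<omega>. Phi {} (\<lambda>_. w) (\<eta> \<omega>) * diff_ops (map x ks) (\<lambda>\<mu>. h \<mu> z) (\<eta> \<omega>) \<partial>M) \<partial>?Q)"
        proof (rule Bochner_Integration.integral_cong[OF refl])
          fix x assume x: "x \<in> space ?Q"
          have [measurable]: "diff_ops (map x ks) (\<lambda>\<mu>. h \<mu> z) \<in> borel_measurable N"
            by (rule diff_ops_section_measurable[OF hz[OF elim(2)] x])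
          have [measurable]: "Phi {} (\<lambda>_. w) \<in> borel_measurable N"
            by (rule Phi_measurable[where L = L]) auto
          have "(\<integral>\<omega>. diff_ops (map x ks) (\<lambda>\<mu>. h \<mu> z) (\<eta> \<omega>) \<partial>M) =
              (\<integral>\<omega>. Phi {} (\<lambda>_. w) (\<eta> \<omega>) * diff_ops (map x ks) (\<lambda>\<mu>. h \<mu> z) (\<eta> \<omega>) \<partial>M)"
            using Phi_empty[of "\<lambda>_. w"] by (intro integral_cong_AE) (measurable, auto elim!: eventually_mono)
          then show "(\<Prod>j\<in>set ks. w (x j)) * (\<integral>\<omega>. diff_ops (map x ks) (\<lambda>\<mu>. h \<mu> z) (\<eta> \<omega>) \<partial>M) =
              (\<Prod>j\<in>set ks. w (x j)) * (\<integral>\<omega>. Phi {} (\<lambda>_. w) (\<eta> \<omega>) * diff_ops (map x ks) (\<lambda>\<mu>. h \<mu> z) (\<eta> \<omega>) \<partial>M)"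
            by simp
        qed
        also have "\<dots> = (\<integral>\<omega>. Phi ({} \<union> set ks) (\<lambda>_. w) (\<eta> \<omega>) * h (\<eta> \<omega>) z \<partial>M)"
          by (rule iterated_duality[OF dist _ _ _ W, of "{}" L "\<lambda>_. w"]) (auto simp: w)
        also have "\<dots> = (\<integral>\<omega>. Phi {..<length ks} (\<lambda>_. w) (\<eta> \<omega>) * h (\<eta> \<omega>) z \<partial>M)"
        proof (rule integral_cong_AE)
          have "integrable M (\<lambda>\<omega>. Phi A (\<lambda>_. w) (\<eta> \<omega>) * h (\<eta> \<omega>) z)" if "finite A" for A
            by (intro weighted_integrable weighted_Phi_mult[where L = L] W) (auto simp: w that)
          then show "(\<lambda>\<omega>. Phi ({} \<union> set ks) (\<lambda>_. w) (\<eta> \<omega>) * h (\<eta> \<omega>) z) \<in> borel_measurable M"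
            "(\<lambda>\<omega>. Phi {..<length ks} (\<lambda>_. w) (\<eta> \<omega>) * h (\<eta> \<omega>) z) \<in> borel_measurable M"
            by (auto intro!: borel_measurable_integrable)
          have "AE \<omega> in M. Phi (set ks) (\<lambda>_. w) (\<eta> \<omega>) = Phi {..<length ks} (\<lambda>_. w) (\<eta> \<omega>)"
            using Phi_constant_card[OF w finite_set, of ks] dist by (simp add: distinct_card)
          then show "AE \<omega> in M. Phi ({} \<union> set ks) (\<lambda>_. w) (\<eta> \<omega>) * h (\<eta> \<omega>) z = Phi {..<length ks} (\<lambda>_. w) (\<eta> \<omega>) * h (\<eta> \<omega>) z"
            by eventually_elim simp
        qed
        finally show ?thesis unfolding upd by simp
      qed
    qed
  qed
  finally show "(\<integral>y. ?f y \<partial>?P) = (\<integral>z. w z * (\<integral>\<omega>. Phi {..<length ks} (\<lambda>_. w) (\<eta> \<omega>) * h (\<eta> \<omega>) z \<partial>M) \<partial>lam)" .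
qed

lemma window_bound':
  assumes h: "(\<lambda>(\<mu>, y). h \<mu> y) \<in> borel_measurable (N \<Otimes>\<^sub>M lam)"
    and sq: "integrable (M \<Otimes>\<^sub>M lam) (\<lambda>(\<omega>, y). (h (\<eta> \<omega>) y)\<^sup>2)"
  shows "(\<integral>\<^sup>+\<omega>. \<integral>\<^sup>+z. indicator B z * ennreal (real c ^ num (\<eta> \<omega>) * \<bar>h (\<eta> \<omega>) z\<bar>) \<partial>lam \<partial>M) < \<infinity>"
proof -
  interpret P: pair_sigma_finite M lam ..
  have [measurable]: "(\<lambda>p. h (\<eta> (fst p)) (snd p)) \<in> borel_measurable (M \<Otimes>\<^sub>M lam)"
    using eta_section_measurable[OF h] by (simp add: case_prod_unfold)
  have "(\<integral>\<^sup>+\<omega>. \<integral>\<^sup>+z. indicator B z * ennreal (real c ^ num (\<eta> \<omega>) * \<bar>h (\<eta> \<omega>) z\<bar>) \<partial>lam \<partial>M) =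
      (\<integral>\<^sup>+z. \<integral>\<^sup>+\<omega>. indicator B z * ennreal (real c ^ num (\<eta> \<omega>) * \<bar>h (\<eta> \<omega>) z\<bar>) \<partial>M \<partial>lam)"
    by (rule P.Fubini'[symmetric]) (simp only: case_prod_unfold, measurable)
  also have "\<dots> = (\<integral>\<^sup>+z. indicator B z * (\<integral>\<^sup>+\<omega>. ennreal (real c ^ num (\<eta> \<omega>) * \<bar>h (\<eta> \<omega>) z\<bar>) \<partial>M) \<partial>lam)"
    by (intro nn_integral_cong) (auto split: split_indicator)
  also have "\<dots> < \<infinity>" by (rule window_bound[OF h sq])
  finally show ?thesis .
qed

text \<open>This averaged functional plays the role of F in \<open>exponential_expansion\<close>.
  Averaging over the window keeps all weighted moments finite, by
  \<open>window_bound'\<close>.\<close>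

lemma average_weighted:
  assumes h: "(\<lambda>(\<mu>, y). h \<mu> y) \<in> borel_measurable (N \<Otimes>\<^sub>M lam)"
    and sq: "integrable (M \<Otimes>\<^sub>M lam) (\<lambda>(\<omega>, y). (h (\<eta> \<omega>) y)\<^sup>2)" and w: "nice L w"
  shows "weighted (\<lambda>\<mu>. \<integral>z. w z * h \<mu> z \<partial>lam)"
  unfolding weighted_def
proof (intro conjI allI)
  have wm[measurable]: "w \<in> borel_measurable lam" by (rule nice_measurable[OF w])
  have [measurable]: "(\<lambda>p. h (fst p) (snd p)) \<in> borel_measurable (N \<Otimes>\<^sub>M lam)"
    using h by (simp add: case_prod_unfold)
  show "(\<lambda>\<mu>. \<integral>z. w z * h \<mu> z \<partial>lam) \<in> borel_measurable N"
    by (intro lam.borel_measurable_lebesgue_integral) (simp only: case_prod_unfold, measurable)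
  have L: "0 \<le> L" using w by (simp add: nice_def)
  have m: "(\<lambda>(\<omega>, z). indicator B z * ennreal (real c ^ num (\<eta> \<omega>) * \<bar>h (\<eta> \<omega>) z\<bar>)) \<in> borel_measurable (M \<Otimes>\<^sub>M lam)" for c
  proof -
    have [measurable]: "(\<lambda>p. h (\<eta> (fst p)) (snd p)) \<in> borel_measurable (M \<Otimes>\<^sub>M lam)"
      using eta_section_measurable[OF h] by (simp add: case_prod_unfold)
    show ?thesis by (simp only: case_prod_unfold, measurable)
  qed
  fix c
  have "(\<integral>\<^sup>+\<omega>. ennreal (real c ^ num (\<eta> \<omega>) * \<bar>\<integral>z. w z * h (\<eta> \<omega>) z \<partial>lam\<bar>) \<partial>M) \<le>
      (\<integral>\<^sup>+\<omega>. ennreal L * (\<integral>\<^sup>+z. indicator B z * ennreal (real c ^ num (\<eta> \<omega>) * \<bar>h (\<eta> \<omega>) z\<bar>) \<partial>lam) \<partial>M)"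
  proof (rule nn_integral_mono)
    fix \<omega> assume \<omega>: "\<omega> \<in> space M"
    have "ennreal \<bar>\<integral>z. w z * h (\<eta> \<omega>) z \<partial>lam\<bar> \<le> (\<integral>\<^sup>+z. ennreal \<bar>w z * h (\<eta> \<omega>) z\<bar> \<partial>lam)"
      using integral_norm_bound_ennreal[of lam "\<lambda>z. w z * h (\<eta> \<omega>) z"]
      by (cases "integrable lam (\<lambda>z. w z * h (\<eta> \<omega>) z)") (auto simp: not_integrable_integral_eq)
    have hm[measurable]: "h (\<eta> \<omega>) \<in> borel_measurable lam"
      using section_measurable[OF h eta_counting[OF \<omega>]] by simp
    have "ennreal (real c ^ num (\<eta> \<omega>) * \<bar>\<integral>z. w z * h (\<eta> \<omega>) z \<partial>lam\<bar>) =
        ennreal (real c ^ num (\<eta> \<omega>)) * ennreal \<bar>\<integral>z. w z * h (\<eta> \<omega>) z \<partial>lam\<bar>"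
      by (simp add: ennreal_mult)
    also have "\<dots> \<le> ennreal (real c ^ num (\<eta> \<omega>)) * (\<integral>\<^sup>+z. ennreal \<bar>w z * h (\<eta> \<omega>) z\<bar> \<partial>lam)"
      by (intro mult_left_mono) (fact, simp)
    also have "\<dots> = (\<integral>\<^sup>+z. ennreal (real c ^ num (\<eta> \<omega>)) * ennreal \<bar>w z * h (\<eta> \<omega>) z\<bar> \<partial>lam)"
      by (rule nn_integral_cmult[symmetric]) measurable
    also have "\<dots> \<le> (\<integral>\<^sup>+z. ennreal L * (indicator B z * ennreal (real c ^ num (\<eta> \<omega>) * \<bar>h (\<eta> \<omega>) z\<bar>)) \<partial>lam)"
    proof (rule nn_integral_mono)
      fix z assume z: "z \<in> space lam"
      have "real c ^ num (\<eta> \<omega>) * (\<bar>w z\<bar> * \<bar>h (\<eta> \<omega>) z\<bar>) \<le> real c ^ num (\<eta> \<omega>) * ((L * indicator B z) * \<bar>h (\<eta> \<omega>) z\<bar>)"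
        using nice_bound[OF w z] by (intro mult_left_mono mult_right_mono) auto
      from ennreal_leI[OF this]
      have "ennreal (real c ^ num (\<eta> \<omega>)) * ennreal \<bar>w z * h (\<eta> \<omega>) z\<bar> \<le> ennreal (L * indicator B z * (real c ^ num (\<eta> \<omega>) * \<bar>h (\<eta> \<omega>) z\<bar>))"
        by (simp add: ennreal_mult[symmetric] abs_mult mult_ac)
      also have "\<dots> = ennreal L * (indicator B z * ennreal (real c ^ num (\<eta> \<omega>) * \<bar>h (\<eta> \<omega>) z\<bar>))"
        using L by (cases "z \<in> B") (simp_all add: ennreal_mult)
      finally show "ennreal (real c ^ num (\<eta> \<omega>)) * ennreal \<bar>w z * h (\<eta> \<omega>) z\<bar> \<le>
          ennreal L * (indicator B z * ennreal (real c ^ num (\<eta> \<omega>) * \<bar>h (\<eta> \<omega>) z\<bar>))" .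
    qed
    also have "\<dots> = ennreal L * (\<integral>\<^sup>+z. indicator B z * ennreal (real c ^ num (\<eta> \<omega>) * \<bar>h (\<eta> \<omega>) z\<bar>) \<partial>lam)"
      by (rule nn_integral_cmult) measurable
    finally show "ennreal (real c ^ num (\<eta> \<omega>) * \<bar>\<integral>z. w z * h (\<eta> \<omega>) z \<partial>lam\<bar>) \<le> \<dots>" .
  qed
  also have "\<dots> = ennreal L * (\<integral>\<^sup>+\<omega>. \<integral>\<^sup>+z. indicator B z * ennreal (real c ^ num (\<eta> \<omega>) * \<bar>h (\<eta> \<omega>) z\<bar>) \<partial>lam \<partial>M)"
    using m by (intro nn_integral_cmult lam.borel_measurable_nn_integral)
  also have "\<dots> < \<infinity>"
    using window_bound'[OF h sq, of c] by (simp add: ennreal_mult_less_top)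
  finally show "(\<integral>\<^sup>+\<omega>. ennreal (real c ^ num (\<eta> \<omega>) * \<bar>\<integral>z. w z * h (\<eta> \<omega>) z \<partial>lam\<bar>) \<partial>M) < \<infinity>" .
qed

lemma average_Phi:
  assumes h: "(\<lambda>(\<mu>, y). h \<mu> y) \<in> borel_measurable (N \<Otimes>\<^sub>M lam)"
    and sq: "integrable (M \<Otimes>\<^sub>M lam) (\<lambda>(\<omega>, y). (h (\<eta> \<omega>) y)\<^sup>2)"
    and w: "nice L w" and A: "finite A" "\<And>a. a \<in> A \<Longrightarrow> nice L (g a)"
  shows "(\<integral>z. w z * (\<integral>\<omega>. Phi A g (\<eta> \<omega>) * h (\<eta> \<omega>) z \<partial>M) \<partial>lam) =
    (\<integral>\<omega>. Phi A g (\<eta> \<omega>) * (\<integral>z. w z * h (\<eta> \<omega>) z \<partial>lam) \<partial>M)"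
proof -
  interpret P: pair_sigma_finite M lam ..
  have L: "0 \<le> L" using w by (simp add: nice_def)
  have wm[measurable]: "w \<in> borel_measurable lam" by (rule nice_measurable[OF w])
  have hm[measurable]: "(\<lambda>p. h (\<eta> (fst p)) (snd p)) \<in> borel_measurable (M \<Otimes>\<^sub>M lam)"
    using eta_section_measurable[OF h] by (simp add: case_prod_unfold)
  have [measurable]: "Phi A g \<in> borel_measurable N"
    by (rule Phi_measurable[where L = L]) (use A in auto)
  obtain C d where C: "0 \<le> C" "AE \<omega> in M. \<bar>Phi A g (\<eta> \<omega>)\<bar> \<le> C * real d ^ num (\<eta> \<omega>)"
    using Phi_AE_bound[of A L g] A by auto
  let ?f = "\<lambda>(\<omega>, z). w z * (Phi A g (\<eta> \<omega>) * h (\<eta> \<omega>) z)"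
  let ?i = "\<lambda>\<omega> z. indicator B z * ennreal (real d ^ num (\<eta> \<omega>) * \<bar>h (\<eta> \<omega>) z\<bar>)"
  have m: "(\<lambda>(\<omega>, z). ?i \<omega> z) \<in> borel_measurable (M \<Otimes>\<^sub>M lam)"
    by (simp only: case_prod_unfold, measurable)
  have int: "integrable (M \<Otimes>\<^sub>M lam) ?f"
  proof (rule integrable_pairI)
    show "?f \<in> borel_measurable (M \<Otimes>\<^sub>M lam)" by (simp only: case_prod_unfold, measurable)
    have "(\<integral>\<^sup>+\<omega>. \<integral>\<^sup>+z. ennreal \<bar>?f (\<omega>, z)\<bar> \<partial>lam \<partial>M) \<le> (\<integral>\<^sup>+\<omega>. ennreal (L * C) * (\<integral>\<^sup>+z. ?i \<omega> z \<partial>lam) \<partial>M)"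
    proof (rule nn_integral_mono_AE)
      show "AE \<omega> in M. (\<integral>\<^sup>+z. ennreal \<bar>?f (\<omega>, z)\<bar> \<partial>lam) \<le> ennreal (L * C) * (\<integral>\<^sup>+z. ?i \<omega> z \<partial>lam)"
        using C(2) AE_space
      proof eventually_elim
        case (elim \<omega>)
        have "(\<integral>\<^sup>+z. ennreal \<bar>?f (\<omega>, z)\<bar> \<partial>lam) \<le> (\<integral>\<^sup>+z. ennreal (L * C) * ?i \<omega> z \<partial>lam)"
        proof (rule nn_integral_mono)
          fix z assume z: "z \<in> space lam"
          have "\<bar>w z\<bar> * (\<bar>Phi A g (\<eta> \<omega>)\<bar> * \<bar>h (\<eta> \<omega>) z\<bar>) \<le> (L * indicator B z) * ((C * real d ^ num (\<eta> \<omega>)) * \<bar>h (\<eta> \<omega>) z\<bar>)"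
            using nice_bound[OF w z] elim(1) L by (intro mult_mono) auto
          from ennreal_leI[OF this]
          have "ennreal \<bar>?f (\<omega>, z)\<bar> \<le> ennreal ((L * indicator B z) * ((C * real d ^ num (\<eta> \<omega>)) * \<bar>h (\<eta> \<omega>) z\<bar>))"
            by (simp add: abs_mult)
          also have "\<dots> = ennreal (L * C) * ?i \<omega> z"
            using L C(1) by (cases "z \<in> B") (simp_all add: ennreal_mult[symmetric] mult_ac)
          finally show "ennreal \<bar>?f (\<omega>, z)\<bar> \<le> ennreal (L * C) * ?i \<omega> z" .
        qed
        also have "\<dots> = ennreal (L * C) * (\<integral>\<^sup>+z. ?i \<omega> z \<partial>lam)"
          using measurable_Pair2[OF m elim(2)] by (intro nn_integral_cmult) simp
        finally show ?case .
      qed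
    qed
    also have "\<dots> = ennreal (L * C) * (\<integral>\<^sup>+\<omega>. \<integral>\<^sup>+z. ?i \<omega> z \<partial>lam \<partial>M)"
      using m by (intro nn_integral_cmult lam.borel_measurable_nn_integral)
    also have "\<dots> < \<infinity>"
      using window_bound'[OF h sq, of d] by (simp add: ennreal_mult_less_top)
    finally show "(\<integral>\<^sup>+\<omega>. \<integral>\<^sup>+z. ennreal \<bar>?f (\<omega>, z)\<bar> \<partial>lam \<partial>M) < \<infinity>" .
  qed
  have "(\<integral>z. w z * (\<integral>\<omega>. Phi A g (\<eta> \<omega>) * h (\<eta> \<omega>) z \<partial>M) \<partial>lam) =
      (\<integral>z. \<integral>\<omega>. w z * (Phi A g (\<eta> \<omega>) * h (\<eta> \<omega>) z) \<partial>M \<partial>lam)"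
    by simp
  also have "\<dots> = (\<integral>\<omega>. \<integral>z. w z * (Phi A g (\<eta> \<omega>) * h (\<eta> \<omega>) z) \<partial>lam \<partial>M)"
    by (rule P.Fubini_integral[OF int])
  also have "\<dots> = (\<integral>\<omega>. \<integral>z. Phi A g (\<eta> \<omega>) * (w z * h (\<eta> \<omega>) z) \<partial>lam \<partial>M)"
    by (simp only: mult.left_commute)
  also have "\<dots> = (\<integral>\<omega>. Phi A g (\<eta> \<omega>) * (\<integral>z. w z * h (\<eta> \<omega>) z \<partial>lam) \<partial>M)"
    by simp
  finally show ?thesis .
qed

text \<open>The tensor power of w is symmetric, so the n + 1 summands of the kernel contribute
  equally, and (n + 1) / (n + 1)! = 1 / n!. The symmetrization in the kernel thus disappears in the
  pairing.\<close>

lemma kernel_tilde_pairing: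
  assumes h: "(\<lambda>(\<mu>, y). h \<mu> y) \<in> borel_measurable (N \<Otimes>\<^sub>M lam)"
    and sq: "integrable (M \<Otimes>\<^sub>M lam) (\<lambda>(\<omega>, y). (h (\<eta> \<omega>) y)\<^sup>2)" and w: "nice L w"
  shows "(\<integral>y. kernel_tilde M \<eta> h n y * (\<Prod>j<n + 1. w (y j)) \<partial>PiM {..<n + 1} (\<lambda>_. lam)) =
    (\<integral>\<omega>. Phi {..<n} (\<lambda>_. w) (\<eta> \<omega>) * (\<integral>z. w z * h (\<eta> \<omega>) z \<partial>lam) \<partial>M) / fact n"
proof -
  \<comment> \<open>The coordinates other than i, in the order in which \<open>kernel_tilde\<close>
    lists them.\<close>
  define K where "K i = ([0..<i] @ [i + 1..<n + 1] :: nat list)" for i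
  have K: "insert i (set (K i)) = {..<n + 1}" "i \<notin> set (K i)" "distinct (K i)" "length (K i) = n" if "i < n + 1" for i
    using that by (auto simp: K_def)
  let ?P = "PiM {..<n + 1} (\<lambda>_. lam)"
  let ?E = "\<integral>\<omega>. Phi {..<n} (\<lambda>_. w) (\<eta> \<omega>) * (\<integral>z. w z * h (\<eta> \<omega>) z \<partial>lam) \<partial>M"
  let ?t = "\<lambda>i y. (\<Prod>j<n + 1. w (y j)) * (\<integral>\<omega>. diff_ops (map y (K i)) (\<lambda>\<mu>. h \<mu> (y i)) (\<eta> \<omega>) \<partial>M)"
  have t: "integrable ?P (?t i)" "(\<integral>y. ?t i y \<partial>?P) = ?E" if i: "i < n + 1" for i
  proof -
    note k = kernel_term[OF h sq w K(3,2)[OF i], unfolded K(1,4)[OF i]]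
    show "integrable ?P (?t i)" by (rule k(1))
    show "(\<integral>y. ?t i y \<partial>?P) = ?E"
      unfolding k(2) by (rule average_Phi[OF h sq w]) (use w in auto)
  qed
  have "(\<integral>y. kernel_tilde M \<eta> h n y * (\<Prod>j<n + 1. w (y j)) \<partial>?P) = (\<integral>y. 1 / fact (n + 1) * (\<Sum>i<n + 1. ?t i y) \<partial>?P)"
    unfolding kernel_tilde_def K_def sum_distrib_left by (simp only: mult_ac sum_distrib_right sum_distrib_left)
  also have "\<dots> = 1 / fact (n + 1) * (\<integral>y. (\<Sum>i<n + 1. ?t i y) \<partial>?P)"
    by (rule integral_mult_right_zero)
  also have "(\<integral>y. (\<Sum>i<n + 1. ?t i y) \<partial>?P) = (\<Sum>i<n + 1. (\<integral>y. ?t i y \<partial>?P))"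
    by (rule Bochner_Integration.integral_sum) (use t(1) in auto)
  also have "\<dots> = (\<Sum>i<n + 1. ?E)" by (rule sum.cong[OF refl]) (use t(2) in auto)
  also have "\<dots> = real (Suc n) * ?E" by (simp only: sum_constant card_lessThan Suc_eq_plus1)
  also have "1 / fact (n + 1) * \<dots> = ?E / fact n"
    unfolding Suc_eq_plus1[symmetric] fact_Suc by (simp del: of_nat_Suc)
  finally show ?thesis .
qed

lemma kernel_tilde_measurable:
  assumes h: "(\<lambda>(\<mu>, y). h \<mu> y) \<in> borel_measurable (N \<Otimes>\<^sub>M lam)"
  shows "kernel_tilde M \<eta> h n \<in> borel_measurable (PiM {..<n + 1} (\<lambda>_. lam))"
  unfolding kernel_tilde_def[abs_def]
  by (intro borel_measurable_times borel_measurable_const borel_measurable_sum kernel_integrand_measurable[OF h]) auto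

end

section \<open>Comparison of the two integrals\<close>

context poisson_points
begin

text \<open>The union of the sets in ps serves as window, so that \<open>testweight ps\<close> is
  supported by it. The factor 1 / n! in the pairing is the one that
  \<open>exponential_expansion\<close> asks for.\<close>

lemma skorohod_expansion:
  assumes h: "(\<lambda>(\<mu>, y). h \<mu> y) \<in> borel_measurable (N \<Otimes>\<^sub>M lam)"
    and sq: "integrable (M \<Otimes>\<^sub>M lam) (\<lambda>(\<omega>, y). (h (\<eta> \<omega>) y)\<^sup>2)" and ps: "testlist lam ps"
  shows "(\<lambda>n. (\<integral>\<omega>. testfun ps (\<eta> \<omega>) \<partial>M) *
      (\<integral>y. kernel_tilde M \<eta> h n y * (\<Prod>i<n + 1. testweight ps (y i)) \<partial>PiM {..<n + 1} (\<lambda>_. lam))) sums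
    (\<integral>\<omega>. testfun ps (\<eta> \<omega>) * (\<integral>y. testweight ps y * h (\<eta> \<omega>) y \<partial>lam) \<partial>M)"
proof -
  interpret W: poisson_window M lam \<eta> X "\<Union>(fst ` set ps)"
    by unfold_locales (use testlist_support[OF ps] in auto)
  have w: "W.nice 2 (testweight ps)" by (rule W.testweight_nice[OF ps]) simp
  show ?thesis
    unfolding W.kernel_tilde_pairing[OF h sq w]
    by (rule W.exponential_expansion[OF w W.average_weighted[OF h sq w] testfun_measurable[OF ps] W.testfun_eq_prod[OF ps order_refl]])
qed

lemma pathwise_eq_rsum:
  "pathwise_skorohod lam \<eta> X h \<omega> = rsum (\<lambda>(\<mu>, y). h \<mu> y) \<omega> - (\<integral>y. h (\<eta> \<omega>) y \<partial>lam)"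
  by (simp add: pathwise_skorohod_def points_integral_def rsum_def reduced_def I_def)

text \<open>Adding a removed point back restores \<open>\<eta>\<close>, so the factor G(\<eta>) may
  be moved inside the sum over points as G of the shifted reduced configuration. The Mecke equation
  turns this into h(\<eta>, y) G(\<eta> + \<delta>_y), and the compensator leaves the difference of
  G. Since G is bounded, integrability of h suffices throughout.\<close>

lemma pathwise_skorohod_properties:
  assumes h: "(\<lambda>(\<mu>, y). h \<mu> y) \<in> borel_measurable (N \<Otimes>\<^sub>M lam)"
    and int: "integrable (M \<Otimes>\<^sub>M lam) (\<lambda>(\<omega>, y). h (\<eta> \<omega>) y)"
  shows pathwise_skorohod_eta_approx: "eta_approx (pathwise_skorohod lam \<eta> X h)"
    and pathwise_skorohod_testfun: "\<And>ps. testlist lam ps \<Longrightarrow>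
      (\<integral>\<omega>. pathwise_skorohod lam \<eta> X h \<omega> * testfun ps (\<eta> \<omega>) \<partial>M) =
      (\<integral>\<omega>. testfun ps (\<eta> \<omega>) * (\<integral>y. testweight ps y * h (\<eta> \<omega>) y \<partial>lam) \<partial>M)"
proof -
  interpret P: pair_sigma_finite M lam ..
  let ?f = "\<lambda>(\<mu>, y). h \<mu> y"
  have [measurable]: "(\<lambda>p. h (fst p) (snd p)) \<in> borel_measurable (N \<Otimes>\<^sub>M lam)"
    using h by (simp add: case_prod_unfold)
  have [measurable]: "(\<lambda>p. h (\<eta> (fst p)) (snd p)) \<in> borel_measurable (M \<Otimes>\<^sub>M lam)"
    using eta_section_measurable[OF h] by (simp add: case_prod_unfold)
  have int': "integrable (M \<Otimes>\<^sub>M lam) (\<lambda>(\<omega>, y). ?f (\<eta> \<omega>, y))" using int by simp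
  note r = mecke_real[OF h int']
  have inner: "integrable M (\<lambda>\<omega>. \<integral>y. h (\<eta> \<omega>) y \<partial>lam)"
    using P.integrable_fst[of "\<lambda>\<omega> y. h (\<eta> \<omega>) y"] int by simp
  show "eta_approx (pathwise_skorohod lam \<eta> X h)"
  proof -
    obtain \<Theta> where "\<Theta> \<in> borel_measurable N" "AE \<omega> in M. rsum ?f \<omega> = \<Theta> (\<eta> \<omega>)" using r(3) by blast
    from eta_approx_exact[OF r(1) this] have 1: "eta_approx (rsum ?f)" .
    have "(\<lambda>\<mu>. \<integral>y. h \<mu> y \<partial>lam) \<in> borel_measurable N"
      by (intro lam.borel_measurable_lebesgue_integral) (simp only: case_prod_unfold, measurable)
    from eta_approx_exact[OF inner this] have 2: "eta_approx (\<lambda>\<omega>. \<integral>y. h (\<eta> \<omega>) y \<partial>lam)" by simp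
    show ?thesis
      using eta_approx_add_cmult[OF 1 2, of "-1"] by (simp add: pathwise_eq_rsum[abs_def])
  qed
  fix ps :: "('y set \<times> real) list" assume ps: "testlist lam ps"
  let ?G = "testfun ps" and ?w = "testweight ps"
  have [measurable]: "?G \<in> borel_measurable N" by (rule testfun_measurable[OF ps])
  have [measurable]: "(\<lambda>p. add_dirac (\<eta> (fst p)) (snd p)) \<in> M \<Otimes>\<^sub>M lam \<rightarrow>\<^sub>M N"
    by (rule measurable_add_dirac) measurable
  let ?g = "\<lambda>p. ?f p * ?G (add_dirac (fst p) (snd p))"
  have gm: "?g \<in> borel_measurable (N \<Otimes>\<^sub>M lam)"
  proof -
    have [measurable]: "(\<lambda>p. add_dirac (fst p) (snd p)) \<in> N \<Otimes>\<^sub>M lam \<rightarrow>\<^sub>M N"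
      by (rule measurable_add_dirac) measurable
    show ?thesis by (simp only: case_prod_unfold, measurable)
  qed
  have bounded: "integrable (M \<Otimes>\<^sub>M lam) (\<lambda>(\<omega>, y). h (\<eta> \<omega>) y * ?G (\<nu> \<omega> y))"
    if "(\<lambda>p. ?G (\<nu> (fst p) (snd p))) \<in> borel_measurable (M \<Otimes>\<^sub>M lam)" for \<nu>
  proof (rule Bochner_Integration.integrable_bound[OF int])
    show "(\<lambda>(\<omega>, y). h (\<eta> \<omega>) y * ?G (\<nu> \<omega> y)) \<in> borel_measurable (M \<Otimes>\<^sub>M lam)"
      using that by (simp only: case_prod_unfold, measurable)
    show "AE p in M \<Otimes>\<^sub>M lam. norm (case p of (\<omega>, y) \<Rightarrow> h (\<eta> \<omega>) y * ?G (\<nu> \<omega> y)) \<le> norm (case p of (\<omega>, y) \<Rightarrow> h (\<eta> \<omega>) y)"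
    proof (rule AE_I2)
      fix p
      show "norm (case p of (\<omega>, y) \<Rightarrow> h (\<eta> \<omega>) y * ?G (\<nu> \<omega> y)) \<le> norm (case p of (\<omega>, y) \<Rightarrow> h (\<eta> \<omega>) y)"
        using testfun_bound[OF ps, of "\<nu> (fst p) (snd p)"]
        by (simp add: case_prod_unfold abs_mult mult_left_le)
    qed
  qed
  have g_int: "integrable (M \<Otimes>\<^sub>M lam) (\<lambda>(\<omega>, y). ?g (\<eta> \<omega>, y))"
    using bounded[of "\<lambda>\<omega> y. add_dirac (\<eta> \<omega>) y"] by simp
  have G_int: "integrable (M \<Otimes>\<^sub>M lam) (\<lambda>(\<omega>, y). h (\<eta> \<omega>) y * ?G (\<eta> \<omega>))"
    using bounded[of "\<lambda>\<omega> y. \<eta> \<omega>"] by simp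
  have rg: "rsum ?g \<omega> = rsum ?f \<omega> * ?G (\<eta> \<omega>)" if \<omega>: "\<omega> \<in> space M" for \<omega>
  proof -
    have "rsum ?g \<omega> = (\<integral>i. ?f (reduced \<omega> i, X i \<omega>) * ?G (\<eta> \<omega>) \<partial>count_space (I \<omega>))"
      unfolding rsum_def by (intro Bochner_Integration.integral_cong refl) (simp add: add_dirac_reduced[OF \<omega>])
    then show ?thesis unfolding rsum_def by simp
  qed
  note s = mecke_real(1,2)[OF gm g_int]
  have 1: "integrable M (\<lambda>\<omega>. rsum ?f \<omega> * ?G (\<eta> \<omega>))"
    using s(1) by (subst Bochner_Integration.integrable_cong[OF refl, of M _ "rsum ?g"]) (simp_all add: rg)
  have 2: "integrable M (\<lambda>\<omega>. (\<integral>y. h (\<eta> \<omega>) y \<partial>lam) * ?G (\<eta> \<omega>))"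
    using P.integrable_fst[of "\<lambda>\<omega> y. h (\<eta> \<omega>) y * ?G (\<eta> \<omega>)"] G_int by simp
  have "(\<integral>\<omega>. rsum ?f \<omega> * ?G (\<eta> \<omega>) \<partial>M) = (\<integral>\<omega>. rsum ?g \<omega> \<partial>M)"
    by (intro Bochner_Integration.integral_cong refl) (simp add: rg)
  also have "\<dots> = (\<integral>\<omega>. \<integral>y. h (\<eta> \<omega>) y * ?G (add_dirac (\<eta> \<omega>) y) \<partial>lam \<partial>M)"
    unfolding s(2) using P.integral_fst[of "\<lambda>\<omega> y. h (\<eta> \<omega>) y * ?G (add_dirac (\<eta> \<omega>) y)"] g_int by simp
  finally have r_eq: "(\<integral>\<omega>. rsum ?f \<omega> * ?G (\<eta> \<omega>) \<partial>M) = \<dots>" .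
  have g_fst: "integrable M (\<lambda>\<omega>. \<integral>y. h (\<eta> \<omega>) y * ?G (add_dirac (\<eta> \<omega>) y) \<partial>lam)"
    using P.integrable_fst[of "\<lambda>\<omega> y. h (\<eta> \<omega>) y * ?G (add_dirac (\<eta> \<omega>) y)"] g_int by simp
  have AE_h: "AE \<omega> in M. integrable lam (h (\<eta> \<omega>))"
    using P.AE_integrable_fst[of "\<lambda>\<omega> y. h (\<eta> \<omega>) y"] int by simp
  have AE_g: "AE \<omega> in M. integrable lam (\<lambda>y. h (\<eta> \<omega>) y * ?G (add_dirac (\<eta> \<omega>) y))"
    using P.AE_integrable_fst[of "\<lambda>\<omega> y. h (\<eta> \<omega>) y * ?G (add_dirac (\<eta> \<omega>) y)"] g_int by simp
  have [measurable]: "?w \<in> borel_measurable lam" by (rule testweight_measurable[OF ps])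
  have wh: "(\<lambda>\<omega>. \<integral>y. ?w y * h (\<eta> \<omega>) y \<partial>lam) \<in> borel_measurable M"
    by (intro lam.borel_measurable_lebesgue_integral) (simp only: case_prod_unfold, measurable)
  have "(\<integral>\<omega>. pathwise_skorohod lam \<eta> X h \<omega> * ?G (\<eta> \<omega>) \<partial>M) =
      (\<integral>\<omega>. rsum ?f \<omega> * ?G (\<eta> \<omega>) - (\<integral>y. h (\<eta> \<omega>) y \<partial>lam) * ?G (\<eta> \<omega>) \<partial>M)"
    by (simp add: pathwise_eq_rsum left_diff_distrib)
  also have "\<dots> = (\<integral>\<omega>. (\<integral>y. h (\<eta> \<omega>) y * ?G (add_dirac (\<eta> \<omega>) y) \<partial>lam) - (\<integral>y. h (\<eta> \<omega>) y \<partial>lam) * ?G (\<eta> \<omega>) \<partial>M)"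
    using 1 2 g_fst r_eq by simp
  also have "\<dots> = (\<integral>\<omega>. ?G (\<eta> \<omega>) * (\<integral>y. ?w y * h (\<eta> \<omega>) y \<partial>lam) \<partial>M)"
  proof (rule integral_cong_AE)
    show "(\<lambda>\<omega>. (\<integral>y. h (\<eta> \<omega>) y * ?G (add_dirac (\<eta> \<omega>) y) \<partial>lam) - (\<integral>y. h (\<eta> \<omega>) y \<partial>lam) * ?G (\<eta> \<omega>)) \<in> borel_measurable M"
      using 2 g_fst by (intro borel_measurable_diff borel_measurable_integrable)
    show "(\<lambda>\<omega>. ?G (\<eta> \<omega>) * (\<integral>y. ?w y * h (\<eta> \<omega>) y \<partial>lam)) \<in> borel_measurable M"
      using wh by measurable
    show "AE \<omega> in M. (\<integral>y. h (\<eta> \<omega>) y * ?G (add_dirac (\<eta> \<omega>) y) \<partial>lam) - (\<integral>y. h (\<eta> \<omega>) y \<partial>lam) * ?G (\<eta> \<omega>) =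
        ?G (\<eta> \<omega>) * (\<integral>y. ?w y * h (\<eta> \<omega>) y \<partial>lam)"
      using AE_h AE_g testfun_diff_op[OF ps]
    proof eventually_elim
      case (elim \<omega>)
      have "(\<integral>y. h (\<eta> \<omega>) y * ?G (add_dirac (\<eta> \<omega>) y) \<partial>lam) - (\<integral>y. h (\<eta> \<omega>) y \<partial>lam) * ?G (\<eta> \<omega>) =
          (\<integral>y. h (\<eta> \<omega>) y * ?G (add_dirac (\<eta> \<omega>) y) - h (\<eta> \<omega>) y * ?G (\<eta> \<omega>) \<partial>lam)"
        using elim(1,2) by simp
      also have "\<dots> = (\<integral>y. ?G (\<eta> \<omega>) * (?w y * h (\<eta> \<omega>) y) \<partial>lam)"
      proof (rule Bochner_Integration.integral_cong[OF refl])
        fix y assume "y \<in> space lam"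
        then have "?G (add_dirac (\<eta> \<omega>) y) = ?w y * ?G (\<eta> \<omega>) + ?G (\<eta> \<omega>)"
          using elim(3) by (auto simp: diff_op_def algebra_simps)
        then show "h (\<eta> \<omega>) y * ?G (add_dirac (\<eta> \<omega>) y) - h (\<eta> \<omega>) y * ?G (\<eta> \<omega>) = ?G (\<eta> \<omega>) * (?w y * h (\<eta> \<omega>) y)"
          by (simp add: algebra_simps)
      qed
      finally show ?case by simp
    qed
  qed
  finally show "(\<integral>\<omega>. pathwise_skorohod lam \<eta> X h \<omega> * ?G (\<eta> \<omega>) \<partial>M) =
      (\<integral>\<omega>. ?G (\<eta> \<omega>) * (\<integral>y. ?w y * h (\<eta> \<omega>) y \<partial>lam) \<partial>M)" .
qed

end

section \<open>Orthogonal series in L2\<close>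

lemma orthogonal_sum_second_moment:
  fixes f :: "'i \<Rightarrow> 'a \<Rightarrow> real"
  assumes A: "finite A" and f: "\<And>i. i \<in> A \<Longrightarrow> square_integrable M (f i)"
    and orth: "\<And>i j. i \<in> A \<Longrightarrow> j \<in> A \<Longrightarrow> i \<noteq> j \<Longrightarrow> (\<integral>x. f i x * f j x \<partial>M) = 0"
  shows "(\<integral>x. (\<Sum>i\<in>A. f i x)\<^sup>2 \<partial>M) = (\<Sum>i\<in>A. \<integral>x. (f i x)\<^sup>2 \<partial>M)"
proof -
  have "(\<integral>x. (\<Sum>i\<in>A. f i x)\<^sup>2 \<partial>M) = (\<integral>x. (\<Sum>i\<in>A. \<Sum>j\<in>A. f i x * f j x) \<partial>M)"
    by (simp add: power2_eq_square sum_product)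
  also have "\<dots> = (\<Sum>i\<in>A. \<Sum>j\<in>A. \<integral>x. f i x * f j x \<partial>M)"
    by (simp add: Bochner_Integration.integral_sum square_integrable_mult f)
  also have "\<dots> = (\<Sum>i\<in>A. \<Sum>j\<in>A. if j = i then \<integral>x. (f i x)\<^sup>2 \<partial>M else 0)"
    by (intro sum.cong refl) (auto simp: orth power2_eq_square)
  finally show ?thesis using A by simp
qed

text \<open>By orthogonality the squared norm of a block of terms is the sum of their squared norms,
  so the Cauchy criterion for the numerical series carries over.\<close>

lemma orthogonal_series_converges:
  fixes f :: "nat \<Rightarrow> 'a \<Rightarrow> real"
  assumes f: "\<And>i. square_integrable M (f i)"
    and orth: "\<And>i j. i \<noteq> j \<Longrightarrow> (\<integral>x. f i x * f j x \<partial>M) = 0"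
    and summable: "summable (\<lambda>i. \<integral>x. (f i x)\<^sup>2 \<partial>M)"
  shows "\<exists>Z. tendsto_L2 M (\<lambda>n x. \<Sum>i<n. f i x) Z"
proof (rule L2_Cauchy_limit)
  show "square_integrable M (\<lambda>x. \<Sum>i<n. f i x)" for n
    by (rule square_integrable_sum) (rule f)
  fix e :: real assume "e > 0"
  with summable obtain K where K: "\<And>m n. m \<ge> K \<Longrightarrow> norm (\<Sum>i\<in>{m..<n}. \<integral>x. (f i x)\<^sup>2 \<partial>M) < e"
    unfolding summable_Cauchy by blast
  have "(\<integral>x. ((\<Sum>i<m. f i x) - (\<Sum>i<n. f i x))\<^sup>2 \<partial>M) < e" if "n \<ge> K" "n \<le> m" for m n
  proof -
    have "(\<Sum>i<m. f i x) - (\<Sum>i<n. f i x) = (\<Sum>i\<in>{n..<m}. f i x)" for x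
      using sum_diff_nat_ivl[of 0 n m "\<lambda>i. f i x"] that by (simp add: atLeast0LessThan)
    then have "(\<integral>x. ((\<Sum>i<m. f i x) - (\<Sum>i<n. f i x))\<^sup>2 \<partial>M) = (\<Sum>i\<in>{n..<m}. \<integral>x. (f i x)\<^sup>2 \<partial>M)"
      by (simp add: orthogonal_sum_second_moment f orth)
    then show ?thesis using K[OF that(1), of m] by simp
  qed
  note le = this
  show "\<exists>N. \<forall>m\<ge>N. \<forall>n\<ge>N. (\<integral>x. ((\<Sum>i<m. f i x) - (\<Sum>i<n. f i x))\<^sup>2 \<partial>M) < e"
  proof (intro exI[of _ K] allI impI)
    fix m n assume "K \<le> m" "K \<le> n"
    then show "(\<integral>x. ((\<Sum>i<m. f i x) - (\<Sum>i<n. f i x))\<^sup>2 \<partial>M) < e"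
      using le[of n m] le[of m n] by (cases "n \<le> m") (auto simp: power2_commute)
  qed
qed

section \<open>Convergence of the chaos series and conclusion\<close>

context poisson_points
begin

lemma kernel_tilde_summable:
  assumes h: "(\<lambda>(\<mu>, y). h \<mu> y) \<in> borel_measurable (N \<Otimes>\<^sub>M lam)"
    and fin: "(\<Sum>n. ennreal (fact (n + 1)) *
      (\<integral>\<^sup>+y. ennreal ((kernel_tilde M \<eta> h n y)\<^sup>2) \<partial>PiM {..<n + 1} (\<lambda>_. lam))) < \<infinity>"
  shows kernel_tilde_square_integrable: "square_integrable (PiM {..<n + 1} (\<lambda>_. lam)) (kernel_tilde M \<eta> h n)"
    and "summable (\<lambda>n. fact (n + 1) * (\<integral>y. (kernel_tilde M \<eta> h n y)\<^sup>2 \<partial>PiM {..<n + 1} (\<lambda>_. lam)))"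
proof -
  \<comment> \<open>Measurability of the kernels does not involve the window, so the empty one gives
    access to it.\<close>
  interpret W: poisson_window M lam \<eta> X "{}" by unfold_locales auto
  let ?t = "\<lambda>n. ennreal (fact (n + 1)) * (\<integral>\<^sup>+y. ennreal ((kernel_tilde M \<eta> h n y)\<^sup>2) \<partial>PiM {..<n + 1} (\<lambda>_. lam))"
  have sq: "square_integrable (PiM {..<n + 1} (\<lambda>_. lam)) (kernel_tilde M \<eta> h n)" for n
  proof -
    have "?t n \<noteq> \<infinity>"
      using ennreal_suminf_lessD[OF fin, of n] by simp
    then have "(\<integral>\<^sup>+y. ennreal ((kernel_tilde M \<eta> h n y)\<^sup>2) \<partial>PiM {..<n + 1} (\<lambda>_. lam)) < \<infinity>"
      by (auto simp: ennreal_mult_eq_top_iff less_top)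
    then show ?thesis
      using W.kernel_tilde_measurable[OF h, of n] by (simp add: square_integrable_def integrable_iff_bounded)
  qed
  then show "square_integrable (PiM {..<n + 1} (\<lambda>_. lam)) (kernel_tilde M \<eta> h n)" .
  have "?t n = ennreal (fact (n + 1) * (\<integral>y. (kernel_tilde M \<eta> h n y)\<^sup>2 \<partial>PiM {..<n + 1} (\<lambda>_. lam)))" for n
    using sq[of n] by (subst nn_integral_eq_integral) (simp_all add: square_integrable_def ennreal_mult)
  with fin show "summable (\<lambda>n. fact (n + 1) * (\<integral>y. (kernel_tilde M \<eta> h n y)\<^sup>2 \<partial>PiM {..<n + 1} (\<lambda>_. lam)))"
    by (intro summable_suminf_not_top) auto
qed

text \<open>Integrals of different orders are orthogonal and their second moments are bounded by the
  terms of the summability condition. The series therefore converges, the choice in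
  \<open>kabanov_skorohod\<close> is a genuine limit, and pairing with a bounded test variable
  commutes with it.\<close>

lemma kabanov_skorohod_properties:
  assumes h: "(\<lambda>(\<mu>, y). h \<mu> y) \<in> borel_measurable (N \<Otimes>\<^sub>M lam)"
    and sq: "integrable (M \<Otimes>\<^sub>M lam) (\<lambda>(\<omega>, y). (h (\<eta> \<omega>) y)\<^sup>2)"
    and fin: "(\<Sum>n. ennreal (fact (n + 1)) *
      (\<integral>\<^sup>+y. ennreal ((kernel_tilde M \<eta> h n y)\<^sup>2) \<partial>PiM {..<n + 1} (\<lambda>_. lam))) < \<infinity>"
  shows kabanov_skorohod_eta_approx: "eta_approx (kabanov_skorohod M lam \<eta> X h)"
    and kabanov_skorohod_testfun: "\<And>ps. testlist lam ps \<Longrightarrow>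
      (\<integral>\<omega>. kabanov_skorohod M lam \<eta> X h \<omega> * testfun ps (\<eta> \<omega>) \<partial>M) =
      (\<integral>\<omega>. testfun ps (\<eta> \<omega>) * (\<integral>y. testweight ps y * h (\<eta> \<omega>) y \<partial>lam) \<partial>M)"
proof -
  define Z where "Z n = wiener_ito M lam \<eta> X (n + 1) (kernel_tilde M \<eta> h n)" for n
  let ?S = "\<lambda>k \<omega>. \<Sum>n<k. Z n \<omega>"
  note k = kernel_tilde_square_integrable[OF h fin]
  have pos: "0 < n + 1" for n :: nat by simp
  have Zsq: "square_integrable M (Z n)" for n
    unfolding Z_def by (rule wiener_ito_square_integrable[OF pos k])
  have "\<exists>Z'. tendsto_L2 M ?S Z'"
  proof (rule orthogonal_series_converges[OF Zsq])
    show "(\<integral>\<omega>. Z i \<omega> * Z j \<omega> \<partial>M) = 0" if "i \<noteq> j" for i j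
      unfolding Z_def by (rule wiener_ito_orthogonal[OF pos k pos k]) (use that in simp)
    show "summable (\<lambda>n. \<integral>\<omega>. (Z n \<omega>)\<^sup>2 \<partial>M)"
    proof (rule summable_comparison_test'[OF kernel_tilde_summable(2)[OF h fin], of 0])
      fix n
      show "norm (\<integral>\<omega>. (Z n \<omega>)\<^sup>2 \<partial>M) \<le> fact (n + 1) * (\<integral>y. (kernel_tilde M \<eta> h n y)\<^sup>2 \<partial>PiM {..<n + 1} (\<lambda>_. lam))"
        using wiener_ito_second_moment[OF pos k, of n] by (simp add: Z_def)
    qed
  qed
  then have lim: "tendsto_L2 M ?S (kabanov_skorohod M lam \<eta> X h)"
    unfolding kabanov_skorohod_def Z_def by (rule someI_ex)
  show "eta_approx (kabanov_skorohod M lam \<eta> X h)"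
  proof (rule eta_approx_L2_limit[OF _ lim])
    show "eta_approx (?S k)" for k
      by (rule eta_approx_sum) (unfold Z_def, rule wiener_ito_eta_approx[OF pos kernel_tilde_square_integrable[OF h fin]])
  qed
  fix ps :: "('y set \<times> real) list" assume ps: "testlist lam ps"
  let ?G = "testfun ps"
  have G: "square_integrable M (\<lambda>\<omega>. ?G (\<eta> \<omega>))" by (rule testfun_square_integrable[OF ps])
  have "(\<integral>\<omega>. ?S k \<omega> * ?G (\<eta> \<omega>) \<partial>M) = (\<Sum>n<k. (\<integral>\<omega>. ?G (\<eta> \<omega>) \<partial>M) *
      (\<integral>y. kernel_tilde M \<eta> h n y * (\<Prod>i<n + 1. testweight ps (y i)) \<partial>PiM {..<n + 1} (\<lambda>_. lam)))" for k
  proof -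
    have "(\<integral>\<omega>. ?S k \<omega> * ?G (\<eta> \<omega>) \<partial>M) = (\<Sum>n<k. \<integral>\<omega>. Z n \<omega> * ?G (\<eta> \<omega>) \<partial>M)"
      unfolding sum_distrib_right by (rule Bochner_Integration.integral_sum) (rule square_integrable_mult[OF Zsq G])
    also have "\<dots> = (\<Sum>n<k. (\<integral>\<omega>. ?G (\<eta> \<omega>) \<partial>M) *
        (\<integral>y. kernel_tilde M \<eta> h n y * (\<Prod>i<n + 1. testweight ps (y i)) \<partial>PiM {..<n + 1} (\<lambda>_. lam)))"
      unfolding Z_def by (intro sum.cong refl wiener_ito_testfun[OF pos kernel_tilde_square_integrable[OF h fin] ps])
    finally show ?thesis .
  qed
  with skorohod_expansion[OF h sq ps]
  have "(\<lambda>k. \<integral>\<omega>. ?S k \<omega> * ?G (\<eta> \<omega>) \<partial>M) \<longlonglongrightarrow>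
      (\<integral>\<omega>. ?G (\<eta> \<omega>) * (\<integral>y. testweight ps y * h (\<eta> \<omega>) y \<partial>lam) \<partial>M)"
    unfolding sums_def by simp
  then show "(\<integral>\<omega>. kabanov_skorohod M lam \<eta> X h \<omega> * ?G (\<eta> \<omega>) \<partial>M) =
      (\<integral>\<omega>. ?G (\<eta> \<omega>) * (\<integral>y. testweight ps y * h (\<eta> \<omega>) y \<partial>lam) \<partial>M)"
    using tendsto_L2_mult[OF lim tendsto_L2_const[OF G]] by (rule LIMSEQ_unique[rotated])
qed

text \<open>The hypotheses on h refer to the law of \<open>\<eta>\<close>, the proofs to the
  probability space; this identity carries integrability from one to the other.\<close>

lemma distr_eta_pair: "distr M N \<eta> \<Otimes>\<^sub>M lam = distr (M \<Otimes>\<^sub>M lam) (N \<Otimes>\<^sub>M lam) (\<lambda>(\<omega>, y). (\<eta> \<omega>, y))"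
proof -
  have id: "distr lam lam (\<lambda>y. y) = lam" by (rule distr_id)
  have "distr M N \<eta> \<Otimes>\<^sub>M distr lam lam (\<lambda>y. y) = distr (M \<Otimes>\<^sub>M lam) (N \<Otimes>\<^sub>M lam) (\<lambda>(\<omega>, y). (\<eta> \<omega>, y))"
    by (rule pair_measure_distr) (simp_all add: id lam.sigma_finite_measure_axioms)
  then show ?thesis by (simp add: id)
qed

lemma integrable_distr_eta_pair:
  assumes "f \<in> borel_measurable (N \<Otimes>\<^sub>M lam)"
  shows "integrable (distr M N \<eta> \<Otimes>\<^sub>M lam) f \<longleftrightarrow> integrable (M \<Otimes>\<^sub>M lam) (\<lambda>(\<omega>, y). f (\<eta> \<omega>, y) :: real)"
proof -
  have "(\<lambda>(\<omega>, y). (\<eta> \<omega>, y)) \<in> M \<Otimes>\<^sub>M lam \<rightarrow>\<^sub>M N \<Otimes>\<^sub>M lam" by measurable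
  from integrable_distr_eq[OF this assms] show ?thesis
    unfolding distr_eta_pair by (simp add: case_prod_unfold)
qed

theorem skorohod_integrals_agree:
  assumes int: "integrable (distr M N \<eta> \<Otimes>\<^sub>M lam) (\<lambda>(\<mu>, y). h \<mu> y)"
    and sq: "square_integrable (distr M N \<eta> \<Otimes>\<^sub>M lam) (\<lambda>(\<mu>, y). h \<mu> y)"
    and fin: "(\<Sum>n. ennreal (fact (n + 1)) *
      (\<integral>\<^sup>+y. ennreal ((kernel_tilde M \<eta> h n y)\<^sup>2) \<partial>PiM {..<n + 1} (\<lambda>_. lam))) < \<infinity>"
  shows "AE \<omega> in M. kabanov_skorohod M lam \<eta> X h \<omega> = pathwise_skorohod lam \<eta> X h \<omega>"
proof -
  have h: "(\<lambda>(\<mu>, y). h \<mu> y) \<in> borel_measurable (N \<Otimes>\<^sub>M lam)"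
    using borel_measurable_integrable[OF int] unfolding distr_eta_pair by simp
  have h1: "integrable (M \<Otimes>\<^sub>M lam) (\<lambda>(\<omega>, y). h (\<eta> \<omega>) y)"
    using int integrable_distr_eta_pair[OF h] by simp
  have h2: "integrable (M \<Otimes>\<^sub>M lam) (\<lambda>(\<omega>, y). (h (\<eta> \<omega>) y)\<^sup>2)"
  proof -
    have "(\<lambda>p. (case p of (\<mu>, y) \<Rightarrow> h \<mu> y)\<^sup>2) \<in> borel_measurable (N \<Otimes>\<^sub>M lam)"
      using h by measurable
    from integrable_distr_eta_pair[OF this] sq show ?thesis
      by (simp add: square_integrable_def)
  qed
  let ?K = "kabanov_skorohod M lam \<eta> X h" and ?P = "pathwise_skorohod lam \<eta> X h"
  note K = kabanov_skorohod_properties[OF h h2 fin] and P = pathwise_skorohod_properties[OF h h1]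
  have "AE \<omega> in M. ?K \<omega> + (-1) * ?P \<omega> = 0"
  proof (rule eta_approx_zero[OF eta_approx_add_cmult[OF K(1) P(1)]])
    fix ps :: "('y set \<times> real) list" assume ps: "testlist lam ps"
    have "integrable M (\<lambda>\<omega>. Z \<omega> * testfun ps (\<eta> \<omega>))" if Z: "eta_approx Z" for Z
    proof (rule Bochner_Integration.integrable_bound)
      have "integrable M Z" using Z by (simp add: eta_approx_def)
      then show "integrable M Z" "(\<lambda>\<omega>. Z \<omega> * testfun ps (\<eta> \<omega>)) \<in> borel_measurable M"
        using measurable_compose[OF eta_measurable testfun_measurable[OF ps]] by auto
      show "AE \<omega> in M. norm (Z \<omega> * testfun ps (\<eta> \<omega>)) \<le> norm (Z \<omega>)"
        using testfun_bound[OF ps] by (intro AE_I2) (simp add: abs_mult mult_left_le)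
    qed
    note this[OF K(1)] this[OF P(1)]
    then show "(\<integral>\<omega>. (?K \<omega> + (-1) * ?P \<omega>) * testfun ps (\<eta> \<omega>) \<partial>M) = 0"
      using K(2)[OF ps] P(2)[OF ps] by (simp add: left_diff_distrib)
  qed
  then show ?thesis by eventually_elim simp
qed

end

theorem theorem3p5:
  fixes M :: "'w measure" and lam :: "'y measure"
    and \<eta> :: "'w \<Rightarrow> 'y measure" and X :: "nat \<Rightarrow> 'w \<Rightarrow> 'y"
    and h :: "'y measure \<Rightarrow> 'y \<Rightarrow> real"
  assumes "prob_space M" and "sigma_finite_measure lam"
    and "poisson_process M lam \<eta>" and "point_representation M lam \<eta> X"
    and "integrable (distr M (counting_space lam) \<eta> \<Otimes>\<^sub>M lam) (\<lambda>(\<mu>, y). h \<mu> y)"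
    and "square_integrable (distr M (counting_space lam) \<eta> \<Otimes>\<^sub>M lam) (\<lambda>(\<mu>, y). h \<mu> y)"
    and "(\<Sum>n. ennreal (fact (n + 1)) *
           (\<integral>\<^sup>+y. ennreal ((kernel_tilde M \<eta> h n y)\<^sup>2) \<partial>PiM {..<n + 1} (\<lambda>_. lam))) < \<infinity>"
  shows "AE \<omega> in M. kabanov_skorohod M lam \<eta> X h \<omega> = pathwise_skorohod lam \<eta> X h \<omega>"
proof -
  interpret poisson_points M lam \<eta> X
    using assms(1-4) by (simp add: poisson_points_def poisson_points_axioms_def)
  show ?thesis by (rule skorohod_integrals_agree[OF assms(5-7)])
qed

end
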